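(* Let $K\subset\mathbb{R}^n$ be a convex body in Löwner position, and let $f,g:\mathbb{R}\to\mathbb{R}$ satisfy: $f$ is locally Lipschitz, convex, $f(x)=0$ for $x\le-1$, and $f$ is strictly increasing in $[-1,\infty)$; $g$ is locally Lipschitz, non-increasing, $g(x)=1$ for $x\le-1$, $g(x)>0$ for $x\in(-1,1)$, and $g(x)=0$ for $x\ge1$. Assume that the function $I_1$ restricted to $\mathrm{Sym}_0\times\mathbb{R}^n$ has a unique global minimum $(M_0,w_0)$. Then $\left.\frac{\partial(A_r,v_r)}{\partial r}\right|_{r=1}$ exists and is equal to $-(M_0,w_0)$. In this case, if $(\bar A_r,\bar v_r)$ is any curve in $\mathrm{Sym}_+\times\mathbb{R}^n$ of the form $$(\bar A_r,\bar v_r)=(\mathrm{Id},0)+(1-r)(M_0,w_0)+o(1-r)\qquad (r\to1^-),$$ then the measure $$\frac1{1-r}\,\frac{(f')_r(|x|_2)}{|x|_2}\,g_r\big(\|\bar A_r^{-1}(x-\bar v_r)\|_K\big)\,dx$$ on $\mathbb{R}^n$ converges weakly, as $r\to1^-$, to $F'(\langle\xi,M_0\xi+w_0\rangle)\,d\sigma(\xi)$. For example, this is true for the linear part $\bar A_r=\mathrm{Id}+(1-r)M_0$, $\bar v_r=(1-r)w_0$.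
   Context: A convex body is a compact convex subset of $\mathbb{R}^n$ with non-empty interior. $\mathbb{B}$ is the closed unit Euclidean ball and $S^{n-1}$ its boundary. A convex body $K$ is in Löwner position if $\mathbb{B}$ is the (unique) ellipsoid of minimal volume containing $K$; in that case $0$ is in the interior of $K$. $|x|_2$ is the Euclidean norm and $\|x\|_K=\inf\{\lambda>0: x\in\lambda K\}$ the gauge function of $K$. $\mathrm{Sym}$, $\mathrm{Sym}_+$ are the sets of real symmetric, resp. symmetric positive-definite, $n\times n$ matrices, $\mathrm{Sym}_0=\{A\in\mathrm{Sym}:\mathrm{tr}(A)=0\}$, and $\mathrm{SL}_n(\mathbb{R})$ is the set of matrices of determinant one. For $r\in(1/2,1)$ and a function $h$ on $\mathbb{R}$ put $h_r(s)=h\left(\frac{s-1}{1-r}\right)$; in particular $(f')_r(s)=f'\left(\frac{s-1}{1-r}\right)$, where $f'$ is the (almost everywhere defined) derivative of $f$. Define $$L_r(A,v)=\frac1{1-r}\int_{\mathbb{R}^n}f_r(|Ax+v|_2)\,g_r(\|x\|_K)\,dx$$ for real $n\times n$ matrices $A$ and $v\in\mathbb{R}^n$. For $r\in(1/2,1)$, $(A_r,v_r)$ denotes the unique minimum of the restriction of $L_r$ to $(\mathrm{Sym}_+\cap\mathrm{SL}_n(\mathbb{R}))\times\mathbb{R}^n$ (it exists and is unique under the stated properties of $f,g$), and $(A_r,v_r)\to(\mathrm{Id},0)$ as $r\to1^-$; we set $(A_1,v_1)=(\mathrm{Id},0)$, and the derivative at $r=1$ is the one-sided derivative $\lim_{r\to1^-}\frac{(A_r,v_r)-(\mathrm{Id},0)}{r-1}$.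 $\sigma$ is the $(n-1)$-dimensional Hausdorff measure restricted to $S^{n-1}\cap\partial K$. $F(x)=\int_{\mathbb{R}}f(t)\,g(t-x)\,dt$ (the convolution of $f$ with $\bar g(x)=g(-x)$), and $I_1:\mathrm{Sym}\times\mathbb{R}^n\to\mathbb{R}$ is $$I_1(M,v)=\int_{S^{n-1}\cap\partial K}F(\langle\xi,M\xi+v\rangle)\,d\sigma(\xi).$$ Weak convergence of measures on $\mathbb{R}^n$ is tested against continuous functions with compact support. *)

theory Defs
  imports "HOL-Analysis.Analysis" "HOL-Library.Landau_Symbols"
begin

definition convex_body :: "(real^'n) set \<Rightarrow> bool" where
  "convex_body K \<longleftrightarrow> compact K \<and> convex K \<and> interior K \<noteq> {}"

definition ellipsoid :: "(real^'n) set \<Rightarrow> bool" where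
  "ellipsoid E \<longleftrightarrow> (\<exists>(A::real^'n^'n) c. invertible A \<and> E = (\<lambda>x. A *v x + c) ` cball 0 1)"

(* The ellipsoid of minimal volume containing a convex body is automatically unique, so
   minimality alone is required. *)
definition loewner_position :: "(real^'n) set \<Rightarrow> bool" where
  "loewner_position K \<longleftrightarrow> K \<subseteq> cball 0 1 \<and>
     (\<forall>E. ellipsoid E \<and> K \<subseteq> E \<longrightarrow> measure lebesgue (cball 0 1 :: (real^'n) set) \<le> measure lebesgue E)"

definition body_gauge :: "(real^'n) set \<Rightarrow> real^'n \<Rightarrow> real" where
  "body_gauge K x = Inf {c. 0 < c \<and> x \<in> (*\<^sub>R) c ` K}"

definition Sym :: "(real^'n^'n) set" where
  "Sym = {A. transpose A = A}"

definition Sym_pos :: "(real^'n^'n) set" where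
  "Sym_pos = {A \<in> Sym. \<forall>x. x \<noteq> 0 \<longrightarrow> 0 < x \<bullet> (A *v x)}"

definition Sym_zero :: "(real^'n^'n) set" where
  "Sym_zero = {A \<in> Sym. trace A = 0}"

definition SL :: "(real^'n^'n) set" where
  "SL = {A. det A = 1}"

definition locally_lipschitz :: "(real \<Rightarrow> real) \<Rightarrow> bool" where
  "locally_lipschitz h \<longleftrightarrow> (\<forall>x. \<exists>u>0. \<exists>C. C-lipschitz_on (cball x u) h)"

definition unique_min_on :: "'a set \<Rightarrow> ('a \<Rightarrow> real) \<Rightarrow> 'a \<Rightarrow> bool" where
  "unique_min_on S \<phi> p \<longleftrightarrow>
     is_arg_min \<phi> (\<lambda>q. q \<in> S) p \<and> (\<forall>q. is_arg_min \<phi> (\<lambda>q. q \<in> S) q \<longrightarrow> q = p)"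

definition rescale :: "real \<Rightarrow> (real \<Rightarrow> real) \<Rightarrow> real \<Rightarrow> real" where
  "rescale r h s = h ((s - 1) / (1 - r))"

definition L_fun ::
    "(real \<Rightarrow> real) \<Rightarrow> (real \<Rightarrow> real) \<Rightarrow> (real^'n) set \<Rightarrow> real \<Rightarrow> (real^'n^'n) \<times> (real^'n) \<Rightarrow> real" where
  "L_fun f g K r = (\<lambda>(A, v). 1 / (1 - r) *
     (\<integral>x. rescale r f (norm (A *v x + v)) * rescale r g (body_gauge K x) \<partial>lborel))"

definition min_curve ::
    "(real \<Rightarrow> real) \<Rightarrow> (real \<Rightarrow> real) \<Rightarrow> (real^'n) set \<Rightarrow> real \<Rightarrow> (real^'n^'n) \<times> (real^'n)" where
  "min_curve f g K r =
     (if r = 1 then (mat 1, 0)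
      else (THE p. unique_min_on ((Sym_pos \<inter> SL) \<times> UNIV) (L_fun f g K r) p))"

(* Normalised so that in R^d the d-dimensional measure is Lebesgue measure.  The diameter of an
   unbounded set is a junk value in the library, hence the boundedness condition; the case split
   makes empty covering sets free also for d = 0, where 0 ^ 0 = 1. *)
definition hausdorff_outer :: "nat \<Rightarrow> 'a::metric_space set \<Rightarrow> ennreal" where
  "hausdorff_outer d S =
     (SUP \<delta>\<in>{0<..}.
        INF U\<in>{U :: nat \<Rightarrow> 'a set. S \<subseteq> (\<Union>i. U i) \<and> (\<forall>i. bounded (U i) \<and> diameter (U i) \<le> \<delta>)}.
          \<Sum>i. if U i = {} then 0 else ennreal (unit_ball_vol (real d) * (diameter (U i) / 2) ^ d))"

definition hausdorff_measure :: "nat \<Rightarrow> 'a::metric_space measure" where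
  "hausdorff_measure d = measure_of UNIV (sets borel) (hausdorff_outer d)"

definition contact_measure :: "(real^'n) set \<Rightarrow> (real^'n) measure" where
  "contact_measure K =
     density (hausdorff_measure (CARD('n) - 1)) (indicator (sphere 0 1 \<inter> frontier K))"

definition F_conv :: "(real \<Rightarrow> real) \<Rightarrow> (real \<Rightarrow> real) \<Rightarrow> real \<Rightarrow> real" where
  "F_conv f g x = (\<integral>t. f t * g (t - x) \<partial>lborel)"

definition I_one ::
    "(real \<Rightarrow> real) \<Rightarrow> (real \<Rightarrow> real) \<Rightarrow> (real^'n) set \<Rightarrow> (real^'n^'n) \<times> (real^'n) \<Rightarrow> real" where
  "I_one f g K = (\<lambda>(M, v).
     LINT \<xi>:sphere 0 1 \<inter> frontier K|contact_measure K. F_conv f g (\<xi> \<bullet> (M *v \<xi> + v)))"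

(* The integrability clauses exclude the default value 0 of non-integrable Bochner integrals. *)
definition weakly_converges :: "('i \<Rightarrow> (real^'n) measure) \<Rightarrow> (real^'n) measure \<Rightarrow> 'i filter \<Rightarrow> bool" where
  "weakly_converges \<mu> \<nu> G \<longleftrightarrow>
     (\<forall>\<phi> :: real^'n \<Rightarrow> real. continuous_on UNIV \<phi> \<and> compact (closure {x. \<phi> x \<noteq> 0}) \<longrightarrow>
        (\<forall>\<^sub>F r in G. integrable (\<mu> r) \<phi>) \<and> integrable \<nu> \<phi> \<and>
        ((\<lambda>r. \<integral>x. \<phi> x \<partial>\<mu> r) \<longlongrightarrow> (\<integral>x. \<phi> x \<partial>\<nu>)) G)"

(* In the next two definitions ennreal truncates nothing that matters: f and F_conv f g are
   non-decreasing and g is non-negative, so both densities are non-negative wherever f is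
   differentiable; deriv f is an arbitrary value on the remaining null set. *)
definition curve_measure ::
    "(real \<Rightarrow> real) \<Rightarrow> (real \<Rightarrow> real) \<Rightarrow> (real^'n) set \<Rightarrow> real \<Rightarrow> real^'n^'n \<Rightarrow> real^'n \<Rightarrow> (real^'n) measure"
  where
  "curve_measure f g K r A v = density lborel (\<lambda>x. ennreal
     (1 / (1 - r) * (rescale r (deriv f) (norm x) / norm x) *
        rescale r g (body_gauge K (matrix_inv A *v (x - v)))))"

definition limit_measure ::
    "(real \<Rightarrow> real) \<Rightarrow> (real \<Rightarrow> real) \<Rightarrow> (real^'n) set \<Rightarrow> real^'n^'n \<Rightarrow> real^'n \<Rightarrow> (real^'n) measure"
  where
  "limit_measure f g K M w =
     density (contact_measure K) (\<lambda>\<xi>. ennreal (deriv (F_conv f g) (\<xi> \<bullet> (M *v \<xi> + w))))"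

end

theory Submission
  imports Defs
begin

text \<open>
  Write \<open>\<rho> = 1 - r\<close> and blow up the variables around the identity, \<open>A = Id + \<rho> M\<close>, \<open>v = \<rho> w\<close>.
  In the polar coordinates \<open>x = (1 + \<rho> u) \<xi>\<close> with \<open>\<xi>\<close> on the sphere the Jacobian contributes a
  factor \<open>\<rho>\<close>, which cancels \<open>1 / (1 - r)\<close>. The argument of \<open>f\<close> tends to
  \<open>u + \<xi> \<bullet> (M \<xi> + w)\<close>. The argument of \<open>g\<close> equals \<open>u\<close> at a contact point, where the
  gauge is 1, and tends to infinity, where \<open>g\<close> vanishes, at every other point of the sphere. Dominated
  convergence therefore turns the blown-up functional into \<open>I_one\<close>, whenever the blown-up variables
  converge (\<open>shell_limit_sequence\<close>). With \<open>f'\<close> in place of \<open>f\<close> and a test function as an additional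
  factor the same limit gives the weak convergence of the measures
  (\<open>curve_measure_weakly_converges\<close>).

  For the derivative it has to be shown that the blown-up minimizers converge to \<open>(M0, w0)\<close>. The
  functional \<open>L_fun\<close> is convex in \<open>(A, v)\<close>. A positive definite matrix of determinant one has trace at
  least \<open>n\<close>, so the blown-up constraint set lies in the half space of symmetric matrices of non-negative
  trace. On this half space \<open>(M0, w0)\<close> is still the only minimum of \<open>I_one\<close>, because adding a
  positive multiple of the identity pushes all contact points outwards (\<open>min_half_space\<close>). The limit on
  a small sphere around \<open>(M0, w0)\<close> combined with convexity shows that every point of the half space outside this
  sphere is worse than a feasible curve tangent to \<open>(M0, w0)\<close> (\<open>localisation\<close>). This confines the
  minimization to a compact set, so minimizers exist and are close to \<open>(M0, w0)\<close>; they are unique since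
  the determinant of the midpoint of two distinct matrices exceeds one, which leaves room for shrinking the
  midpoint, and since two different translations are excluded by the strict convexity of the ball
  (\<open>minimizer_unique\<close>).

  The contact measure is defined by coverings, so polar coordinates have to be proved for the Hausdorff
  measure of the sphere: \<open>hausdorff_outer_sphere\<close> states that it is \<open>n\<close> times the volume of the cone over
  a set. It rests on the equality of Hausdorff and Lebesgue measure in the full dimension
  (\<open>hausdorff_outer_eq_lborel\<close>), which is the isodiametric inequality in one direction and the Vitali
  covering theorem in the other, and on charts of small caps of the sphere that are close to isometries.
\<close>

section \<open>Hausdorff measure is a Borel measure\<close>

definition diam_cost :: "nat \<Rightarrow> 'a::metric_space set \<Rightarrow> ennreal" where
  "diam_cost d U = (if U = {} then 0 else ennreal (unit_ball_vol (real d) * (diameter U / 2) ^ d))"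

definition fine_covers :: "real \<Rightarrow> 'a::metric_space set \<Rightarrow> (nat \<Rightarrow> 'a set) set" where
  "fine_covers \<delta> S = {U. S \<subseteq> (\<Union>i. U i) \<and> (\<forall>i. bounded (U i) \<and> diameter (U i) \<le> \<delta>)}"

definition hausdorff_premeasure :: "nat \<Rightarrow> real \<Rightarrow> 'a::metric_space set \<Rightarrow> ennreal" where
  "hausdorff_premeasure d \<delta> S = (INF U\<in>fine_covers \<delta> S. \<Sum>i. diam_cost d (U i))"

lemma hausdorff_outer_eq_SUP:
  "hausdorff_outer d S = (SUP \<delta>\<in>{0<..}. hausdorff_premeasure d \<delta> S)"
  by (simp add: hausdorff_outer_def hausdorff_premeasure_def fine_covers_def diam_cost_def)

lemma hausdorff_premeasure_le:
  "U \<in> fine_covers \<delta> S \<Longrightarrow> hausdorff_premeasure d \<delta> S \<le> (\<Sum>i. diam_cost d (U i))"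
  unfolding hausdorff_premeasure_def by (rule INF_lower)

lemma le_hausdorff_premeasure:
  "(\<And>U. U \<in> fine_covers \<delta> S \<Longrightarrow> x \<le> (\<Sum>i. diam_cost d (U i))) \<Longrightarrow> x \<le> hausdorff_premeasure d \<delta> S"
  unfolding hausdorff_premeasure_def by (rule INF_greatest)

lemma hausdorff_premeasure_approx:
  assumes "hausdorff_premeasure d \<delta> S < top" "0 < e"
  obtains U where "U \<in> fine_covers \<delta> S" "(\<Sum>i. diam_cost d (U i)) \<le> hausdorff_premeasure d \<delta> S + ennreal e"
  using INF_approx_ennreal[OF assms(2) hausdorff_premeasure_def[of d \<delta> S]] assms(1) that
  by (metis infinity_ennreal_def less_imp_le order_less_irrefl)

lemma hausdorff_premeasure_le_outer: "0 < \<delta> \<Longrightarrow> hausdorff_premeasure d \<delta> S \<le> hausdorff_outer d S"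
  unfolding hausdorff_outer_eq_SUP by (rule SUP_upper) simp

lemma hausdorff_outer_le:
  "(\<And>\<delta>. 0 < \<delta> \<Longrightarrow> hausdorff_premeasure d \<delta> S \<le> x) \<Longrightarrow> hausdorff_outer d S \<le> x"
  unfolding hausdorff_outer_eq_SUP by (rule SUP_least) simp

lemma fine_covers_mono: "\<delta> \<le> \<delta>' \<Longrightarrow> S' \<subseteq> S \<Longrightarrow> fine_covers \<delta> S \<subseteq> fine_covers \<delta>' S'"
  unfolding fine_covers_def by (auto intro: order_trans) 

lemma hausdorff_premeasure_mono:
  "\<delta> \<le> \<delta>' \<Longrightarrow> S' \<subseteq> S \<Longrightarrow> hausdorff_premeasure d \<delta>' S' \<le> hausdorff_premeasure d \<delta> S"
  unfolding hausdorff_premeasure_def by (intro INF_superset_mono fine_covers_mono) auto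

lemma hausdorff_outer_mono: "S \<subseteq> T \<Longrightarrow> hausdorff_outer d S \<le> hausdorff_outer d T"
  unfolding hausdorff_outer_eq_SUP by (intro SUP_mono) (use hausdorff_premeasure_mono in blast)

lemma hausdorff_outer_empty [simp]: "hausdorff_outer d {} = 0"
proof -
  have "hausdorff_premeasure d \<delta> ({} :: 'a set) \<le> 0" if "0 < \<delta>" for \<delta>
    using hausdorff_premeasure_le[of "\<lambda>_. {}" \<delta> "{}::'a set" d] that
    by (simp add: fine_covers_def diam_cost_def)
  then show ?thesis
    by (metis hausdorff_outer_le le_zero_eq)
qed

text \<open>
  Countably many almost optimal covers, with errors that form a geometric series, are merged into one
  sequence by pairing indices.
\<close>
lemma hausdorff_premeasure_UN_le:
  assumes "0 < \<delta>"
  shows "hausdorff_premeasure d \<delta> (\<Union>i. A i) \<le> (\<Sum>i. hausdorff_premeasure d \<delta> (A i))"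
proof (rule ennreal_le_epsilon)
  fix e :: real
  assume fin: "(\<Sum>i. hausdorff_premeasure d \<delta> (A i)) < top" and "0 < e"
  have finA: "hausdorff_premeasure d \<delta> (A i) < top" for i
    using fin by (meson ennreal_suminf_lessD)
  have "\<exists>U. U \<in> fine_covers \<delta> (A i) \<and>
      (\<Sum>j. diam_cost d (U j)) \<le> hausdorff_premeasure d \<delta> (A i) + ennreal (e * (1/2) ^ Suc i)" for i
    by (rule hausdorff_premeasure_approx[OF finA, of "e * (1/2) ^ Suc i"]) (use \<open>0 < e\<close> in auto)
  then obtain U where U: "\<And>i. U i \<in> fine_covers \<delta> (A i)"
    "\<And>i. (\<Sum>j. diam_cost d (U i j)) \<le> hausdorff_premeasure d \<delta> (A i) + ennreal (e * (1/2) ^ Suc i)"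
    by metis
  define V where "V k = (case prod_decode k of (i, j) \<Rightarrow> U i j)" for k
  have UV: "U i j = V (prod_encode (i, j))" for i j
    by (simp add: V_def)
  have "V \<in> fine_covers \<delta> (\<Union>i. A i)"
    unfolding fine_covers_def
  proof (intro CollectI conjI allI)
    show "(\<Union>i. A i) \<subseteq> (\<Union>k. V k)"
      using U(1) unfolding fine_covers_def UV by blast
    show "bounded (V k)" "diameter (V k) \<le> \<delta>" for k
      using U(1) unfolding fine_covers_def V_def by (auto split: prod.split)
  qed
  then have "hausdorff_premeasure d \<delta> (\<Union>i. A i) \<le> (\<Sum>k. diam_cost d (V k))"
    by (rule hausdorff_premeasure_le)
  also have "(\<Sum>k. diam_cost d (V k)) = (\<Sum>k. (\<lambda>(i, j). diam_cost d (U i j)) (prod_decode k))"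
    by (auto simp: V_def intro!: arg_cong[where f = suminf] split: prod.split)
  also have "\<dots> = (\<Sum>i. \<Sum>j. diam_cost d (U i j))"
    by (rule suminf_ennreal_2dimen) simp
  also have "\<dots> \<le> (\<Sum>i. hausdorff_premeasure d \<delta> (A i) + ennreal (e * (1/2) ^ Suc i))"
    by (intro suminf_le U(2)) auto
  also have "\<dots> = (\<Sum>i. hausdorff_premeasure d \<delta> (A i)) + (\<Sum>i. ennreal (e * (1/2) ^ Suc i))"
    by (rule suminf_add[symmetric]) auto
  also have "(\<Sum>i. ennreal (e * (1/2) ^ Suc i)) = ennreal e"
    using sums_mult[OF power_half_series, of e] \<open>0 < e\<close>
    by (intro suminf_ennreal_eq) auto
  finally show "hausdorff_premeasure d \<delta> (\<Union>i. A i) \<le> (\<Sum>i. hausdorff_premeasure d \<delta> (A i)) + ennreal e" .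
qed

lemma hausdorff_outer_UN_le: "hausdorff_outer d (\<Union>i. A i) \<le> (\<Sum>i. hausdorff_outer d (A i))"
proof (rule hausdorff_outer_le)
  fix \<delta> :: real assume "0 < \<delta>"
  show "hausdorff_premeasure d \<delta> (\<Union>i. A i) \<le> (\<Sum>i. hausdorff_outer d (A i))"
    by (rule order_trans[OF hausdorff_premeasure_UN_le[OF \<open>0 < \<delta>\<close>]])
       (intro suminf_le hausdorff_premeasure_le_outer[OF \<open>0 < \<delta>\<close>]; simp)
qed

text \<open>
  A set of diameter less than the distance of \<open>A\<close> and \<open>B\<close> meets at most one of them, so a fine cover
  of the union splits into a cover of \<open>A\<close> and a cover of \<open>B\<close>.
\<close>
lemma hausdorff_outer_separated:
  assumes "0 < \<eta>" and sep: "\<And>x y. x \<in> A \<Longrightarrow> y \<in> B \<Longrightarrow> \<eta> \<le> dist x y"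
  shows "hausdorff_outer d A + hausdorff_outer d B \<le> hausdorff_outer d (A \<union> B)"
proof -
  have *: "hausdorff_premeasure d \<delta> A + hausdorff_premeasure d \<delta> B \<le> hausdorff_premeasure d \<delta> (A \<union> B)"
    if "\<delta> < \<eta>" for \<delta>
  proof (rule le_hausdorff_premeasure)
    fix U assume U: "U \<in> fine_covers \<delta> (A \<union> B)"
    define VA VB where "VA i = (if U i \<inter> A = {} then {} else U i)"
      and "VB i = (if U i \<inter> A = {} then U i else {})" for i
    have *: "U i \<inter> B = {}" if "U i \<inter> A \<noteq> {}" for i
    proof (rule ccontr)
      assume "U i \<inter> B \<noteq> {}"
      with that obtain x y where xy: "x \<in> U i" "x \<in> A" "y \<in> U i" "y \<in> B" by blast
      then have "dist x y \<le> diameter (U i)"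
        using U by (intro diameter_bounded_bound) (auto simp: fine_covers_def)
      then show False
        using sep[OF xy(2,4)] U \<open>\<delta> < \<eta>\<close> unfolding fine_covers_def
        by (smt (verit) mem_Collect_eq)
    qed
    have d0: "0 \<le> \<delta>"
      using U diameter_ge_0[of "U 0"] unfolding fine_covers_def by (smt (verit) mem_Collect_eq)
    have "VA \<in> fine_covers \<delta> A" "VB \<in> fine_covers \<delta> B"
      using U * d0 unfolding fine_covers_def VA_def VB_def by (auto; blast)+
    then have "hausdorff_premeasure d \<delta> A + hausdorff_premeasure d \<delta> B
        \<le> (\<Sum>i. diam_cost d (VA i)) + (\<Sum>i. diam_cost d (VB i))"
      by (intro add_mono hausdorff_premeasure_le)
    also have "\<dots> = (\<Sum>i. diam_cost d (VA i) + diam_cost d (VB i))"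
      by (rule suminf_add) auto
    also have "\<dots> = (\<Sum>i. diam_cost d (U i))"
      by (rule arg_cong[where f = suminf]) (auto simp: VA_def VB_def diam_cost_def)
    finally show "hausdorff_premeasure d \<delta> A + hausdorff_premeasure d \<delta> B \<le> (\<Sum>i. diam_cost d (U i))" .
  qed
  have "hausdorff_outer d A + hausdorff_outer d B
      = (SUP \<delta>\<in>{0<..}. hausdorff_premeasure d \<delta> A + hausdorff_premeasure d \<delta> B)"
    unfolding hausdorff_outer_eq_SUP
  proof (rule SUP_add_directed_ennreal[symmetric])
    fix i j :: real assume "i \<in> {0<..}" "j \<in> {0<..}"
    then show "\<exists>k\<in>{0<..}. hausdorff_premeasure d i A + hausdorff_premeasure d j B
        \<le> hausdorff_premeasure d k A + hausdorff_premeasure d k B"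
      by (intro bexI[of _ "min i j"] add_mono hausdorff_premeasure_mono) auto
  qed
  also have "\<dots> \<le> hausdorff_outer d (A \<union> B)"
  proof (rule SUP_least)
    fix \<delta> :: real assume "\<delta> \<in> {0<..}"
    define \<delta>' where "\<delta>' = min \<delta> (\<eta> / 2)"
    have "hausdorff_premeasure d \<delta> A + hausdorff_premeasure d \<delta> B
        \<le> hausdorff_premeasure d \<delta>' A + hausdorff_premeasure d \<delta>' B"
      by (intro add_mono hausdorff_premeasure_mono) (auto simp: \<delta>'_def)
    also have "\<dots> \<le> hausdorff_premeasure d \<delta>' (A \<union> B)"
      using \<open>0 < \<eta>\<close> by (intro *) (auto simp: \<delta>'_def)
    also have "\<dots> \<le> hausdorff_outer d (A \<union> B)"
      using \<open>\<delta> \<in> {0<..}\<close> \<open>0 < \<eta>\<close> by (intro hausdorff_premeasure_le_outer) (auto simp: \<delta>'_def)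
    finally show "hausdorff_premeasure d \<delta> A + hausdorff_premeasure d \<delta> B \<le> hausdorff_outer d (A \<union> B)" .
  qed
  finally show ?thesis .
qed

lemma outer_measure_Un_le:
  fixes f :: "'a set \<Rightarrow> ennreal"
  assumes "f {} = 0" and UN: "\<And>A :: nat \<Rightarrow> 'a set. f (\<Union>i. A i) \<le> (\<Sum>i. f (A i))"
  shows "f (A \<union> B) \<le> f A + f B"
proof -
  have "f (A \<union> B) = f (\<Union>i. binaryset A B i)" by (simp only: UN_binaryset_eq)
  also have "\<dots> \<le> (\<Sum>i. f (binaryset A B i))" by (rule UN)
  also have "\<dots> = f A + f B"
    by (rule suminf_binaryset_eq) (simp add: assms(1))
  finally show ?thesis .
qed

text \<open>
  Caratheodory's criterion: an outer measure that is additive on sets at positive distance measures all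
  closed sets. The part of \<open>X\<close> outside \<open>C\<close> is exhausted by the sets \<open>A n\<close> of points at distance at
  least \<open>1 / (n + 1)\<close> from \<open>C\<close>. Among the shells \<open>D n = A (n + 1) - A n\<close> those of even index are at
  positive distance from each other, and so are those of odd index; hence the outer measures of the shells form a convergent series, and the remainder
  \<open>X - C - A n\<close> becomes negligible.
\<close>
lemma closed_in_lambda_system:
  fixes f :: "'a::metric_space set \<Rightarrow> ennreal"
  assumes f0: "f {} = 0" and mono: "\<And>A B. A \<subseteq> B \<Longrightarrow> f A \<le> f B"
    and UN: "\<And>A :: nat \<Rightarrow> 'a set. f (\<Union>i. A i) \<le> (\<Sum>i. f (A i))"
    and sep: "\<And>A B \<eta>. 0 < \<eta> \<Longrightarrow> (\<And>x y. x \<in> A \<Longrightarrow> y \<in> B \<Longrightarrow> \<eta> \<le> dist x y) \<Longrightarrow> f A + f B \<le> f (A \<union> B)"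
    and "closed C"
  shows "C \<in> lambda_system UNIV UNIV f"
proof -
  have Un: "f (A \<union> B) \<le> f A + f B" for A B
    by (rule outer_measure_Un_le[OF f0 UN])
  have main: "f (C \<inter> X) + f (X - C) \<le> f X" for X
  proof (cases "C = {} \<or> f X = top")
    case True
    then show ?thesis by (auto simp: f0)
  next
    case False
    then have ne: "C \<noteq> {}" and fin: "f X < top" by (auto simp: top.not_eq_extremum)
    define A where "A n = {x \<in> X. 1 / (real n + 1) \<le> infdist x C}" for n :: nat
    define D where "D n = A (Suc n) - A n" for n
    have mono_inv: "1 / (real n + 1) \<le> 1 / (real m + 1)" if "m \<le> n" for m n :: nat
      using that by (simp add: field_simps)
    have A_mono: "A m \<subseteq> A n" if "m \<le> n" for m n
      unfolding A_def using mono_inv[OF that] by auto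
    have near: "infdist x C \<le> infdist y C + dist x y" for x y
      using infdist_triangle by blast
    have sepD: "f (D m \<union> E) = f (D m) + f E" if "E \<subseteq> X - A (Suc (Suc m))" for E m
    proof (rule antisym[OF Un sep[of "1 / (real m + 2) - 1 / (real m + 3)"]])
      show "0 < 1 / (real m + 2) - 1 / (real m + 3)" by (simp add: frac_less2)
      fix x y assume "x \<in> D m" "y \<in> E"
      then have "1 / (real m + 2) \<le> infdist x C" "infdist y C < 1 / (real m + 3)"
        using that by (auto simp: D_def A_def add_ac)
      then show "1 / (real m + 2) - 1 / (real m + 3) \<le> dist x y"
        using near[of x y] by linarith
    qed
    have DX: "D n \<subseteq> X - A n" for n
      unfolding D_def by (auto simp: A_def)
    \<comment> \<open>Summing over the even or over the odd shells only, consecutive terms are at positive distance.\<close>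
    have par: "(\<Sum>k<N. f (D (2 * k + p))) \<le> f X" for N p
    proof -
      have "f X \<ge> f (\<Union>k\<in>{j..<N}. D (2 * k + p)) \<and>
          f (\<Union>k\<in>{j..<N}. D (2 * k + p)) \<ge> (\<Sum>k\<in>{j..<N}. f (D (2 * k + p)))" if "j \<le> N" for j
        using that
      proof (induction j rule: inc_induct)
        case base then show ?case by (simp add: f0)
      next
        case (step n)
        have iv: "{n..<N} = insert n {Suc n..<N}" using step by auto
        have sub: "(\<Union>k\<in>{Suc n..<N}. D (2 * k + p)) \<subseteq> X - A (Suc (Suc (2 * n + p)))"
        proof -
          have "D (2 * k + p) \<subseteq> X - A (Suc (Suc (2 * n + p)))" if "k \<in> {Suc n..<N}" for k
            using DX[of "2 * k + p"] A_mono[of "Suc (Suc (2 * n + p))" "2 * k + p"] that by auto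
          then show ?thesis by blast
        qed
        have eq: "f (\<Union>k\<in>{n..<N}. D (2 * k + p)) = f (D (2 * n + p)) + f (\<Union>k\<in>{Suc n..<N}. D (2 * k + p))"
          unfolding iv UN_insert by (rule sepD[OF sub])
        have "(\<Union>k\<in>{n..<N}. D (2 * k + p)) \<subseteq> X"
          using DX by blast
        then have "f (\<Union>k\<in>{n..<N}. D (2 * k + p)) \<le> f X" by (rule mono)
        moreover have "(\<Sum>k = n..<N. f (D (2 * k + p))) = f (D (2 * n + p)) + (\<Sum>k = Suc n..<N. f (D (2 * k + p)))"
          unfolding iv by simp
        ultimately show ?case
          unfolding eq using step.IH by (auto intro: add_left_mono)
      qed
      from this[of 0] show ?thesis
        by (auto simp: atLeast0LessThan intro: order_trans)
    qed
    define r where "r k = enn2real (f (D k))" for k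
    have finD: "f (D k) = ennreal (r k)" for k
      unfolding r_def using mono[of "D k" X] DX[of k] fin
      by (metis Diff_subset ennreal_enn2real order_le_less_trans order_trans)
    have r0: "0 \<le> r k" for k by (simp add: r_def)
    have "summable r"
    proof (rule bounded_imp_summable[OF r0])
      fix n
      have "ennreal (\<Sum>k\<le>n. r k) \<le> (\<Sum>k<2 * Suc n. f (D k))"
        using r0 by (simp add: finD del: mult_Suc_right) (intro ennreal_leI sum_mono2; auto)
      also have "\<dots> = (\<Sum>k<Suc n. f (D (2 * k + 0))) + (\<Sum>k<Suc n. f (D (2 * k + 1)))"
        by (induction n) (auto simp: ac_simps)
      also have "\<dots> \<le> f X + f X"
        by (intro add_mono par)
      also have "\<dots> = ennreal (enn2real (f X) + enn2real (f X))"
        using fin by (subst ennreal_plus) auto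
      finally show "(\<Sum>k\<le>n. r k) \<le> enn2real (f X) + enn2real (f X)"
        by (simp add: ennreal_le_iff)
    qed
    show ?thesis
    proof (rule ennreal_le_epsilon)
      fix e :: real assume "0 < e"
      obtain N where N: "(\<Sum>i. r (i + N)) < e"
        using suminf_exist_split[OF \<open>0 < e\<close> \<open>summable r\<close>] by (metis abs_less_iff order_refl real_norm_def)
      have "X - C \<subseteq> A N \<union> (\<Union>k. D (k + N))"
      proof
        fix x assume x: "x \<in> X - C"
        then have "0 < infdist x C"
          using \<open>closed C\<close> ne by (metis DiffD2 in_closed_iff_infdist_zero infdist_pos_not_in_closed)
        then obtain n where "inverse (real (Suc n)) < infdist x C"
          using reals_Archimedean by blast
        then have ex: "x \<in> A n" using x by (auto simp: A_def field_simps)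
        define m where "m = (LEAST n. x \<in> A n)"
        have m: "x \<in> A m" unfolding m_def by (rule LeastI[of _ n]) (rule ex)
        show "x \<in> A N \<union> (\<Union>k. D (k + N))"
        proof (cases "m \<le> N")
          case True then show ?thesis using A_mono m by blast
        next
          case False
          then obtain k where k: "m = Suc (k + N)"
            by (metis add.commute less_natE not_le)
          then have "x \<notin> A (k + N)"
            using not_less_Least[of "k + N" "\<lambda>n. x \<in> A n"] by (simp add: m_def)
          with m k show ?thesis by (auto simp: D_def)
        qed
      qed
      then have "f (X - C) \<le> f (A N) + f (\<Union>k. D (k + N))"
        by (meson Un mono order_trans)
      also have "f (\<Union>k. D (k + N)) \<le> (\<Sum>k. f (D (k + N)))"
        by (rule UN)
      also have "\<dots> = ennreal (\<Sum>k. r (k + N))"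
        unfolding finD using \<open>summable r\<close> r0 by (intro suminf_ennreal2) auto
      also have "\<dots> \<le> ennreal e" using N by (intro ennreal_leI) auto
      finally have 1: "f (X - C) \<le> f (A N) + ennreal e" by (simp add: add_left_mono)
      have "f (C \<inter> X) + f (A N) \<le> f (C \<inter> X \<union> A N)"
      proof (rule sep[of "1 / (real N + 1)"])
        fix x y assume "x \<in> C \<inter> X" "y \<in> A N"
        then show "1 / (real N + 1) \<le> dist x y"
          using near[of y x] by (auto simp: A_def dist_commute)
      qed simp
      also have "\<dots> \<le> f X" by (rule mono) (auto simp: A_def)
      finally have "f (C \<inter> X) + f (A N) \<le> f X" .
      with 1 show "f (C \<inter> X) + f (X - C) \<le> f X + ennreal e"
        by (smt (verit, ccfv_SIG) add.assoc add_left_mono add_right_mono order_trans)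
    qed
  qed
  have "f (C \<inter> X) + f ((UNIV - C) \<inter> X) = f X" for X
  proof (rule antisym)
    have "(UNIV - C) \<inter> X = X - C" by auto
    then show "f (C \<inter> X) + f ((UNIV - C) \<inter> X) \<le> f X" using main by simp
    have "f ((C \<inter> X) \<union> ((UNIV - C) \<inter> X)) \<le> f (C \<inter> X) + f ((UNIV - C) \<inter> X)"
      by (rule Un)
    moreover have "(C \<inter> X) \<union> ((UNIV - C) \<inter> X) = X" by auto
    ultimately show "f X \<le> f (C \<inter> X) + f ((UNIV - C) \<inter> X)" by simp
  qed
  then show ?thesis by (simp add: lambda_system_def)
qed

lemma sets_hausdorff_measure [simp, measurable_cong]: "sets (hausdorff_measure d) = sets borel"
  unfolding hausdorff_measure_def
  by (metis sets.sigma_sets_eq sets_measure_of space_borel top_greatest Pow_UNIV)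

lemma space_hausdorff_measure [simp]: "space (hausdorff_measure d) = UNIV"
  unfolding hausdorff_measure_def by (simp add: space_measure_of_conv)

text \<open>
  The measure was introduced by \<open>measure_of\<close>, which yields the given set function only if that function is
  countably additive on the Borel sets. This is what Caratheodory's criterion provides.
\<close>
lemma emeasure_hausdorff_measure:
  fixes S :: "'a::metric_space set"
  assumes "S \<in> sets borel"
  shows "emeasure (hausdorff_measure d) S = hausdorff_outer d S"
proof -
  let ?f = "hausdorff_outer d :: 'a set \<Rightarrow> ennreal"
  interpret sigma_algebra UNIV "UNIV :: 'a set set"
    using sigma_algebra_Pow[of "UNIV :: 'a set"] by simp
  have oms: "outer_measure_space UNIV ?f"
    unfolding outer_measure_space_def positive_def increasing_def countably_subadditive_def
    by (auto intro: hausdorff_outer_mono hausdorff_outer_UN_le)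
  have ms: "measure_space UNIV (lambda_system UNIV UNIV ?f) ?f"
    by (rule caratheodory_lemma[OF oms])
  have "sigma_algebra UNIV (lambda_system UNIV UNIV ?f)"
    using ms by (simp add: measure_space_def)
  moreover have "Collect closed \<subseteq> lambda_system UNIV UNIV ?f"
  proof
    fix C :: "'a set" assume "C \<in> Collect closed"
    then show "C \<in> lambda_system UNIV UNIV ?f"
      by (intro closed_in_lambda_system hausdorff_outer_separated hausdorff_outer_mono
          hausdorff_outer_UN_le hausdorff_outer_empty) auto
  qed
  ultimately have sub: "sets borel \<subseteq> lambda_system UNIV UNIV ?f"
    unfolding borel_eq_closed sets_measure_of_conv
    by (simp add: sigma_algebra.sigma_sets_subset)
  have "countably_additive (sets borel) ?f"
    using ms sub unfolding measure_space_def countably_additive_def by blast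
  moreover have "positive (sets borel) ?f"
    by (simp add: positive_def)
  ultimately show ?thesis
    using assms by (intro emeasure_measure_of[OF hausdorff_measure_def]) auto
qed

lemma diameter_image_le_lipschitz:
  assumes "C-lipschitz_on A f" "A \<noteq> {}" "A \<subseteq> B" "bounded B"
  shows "diameter (f ` A) \<le> C * diameter B"
proof -
  have "(SUP (x,y)\<in>f ` A \<times> f ` A. dist x y) \<le> C * diameter B"
  proof (rule cSUP_least)
    fix z assume "z \<in> f ` A \<times> f ` A"
    then obtain x y where xy: "x \<in> A" "y \<in> A" "z = (f x, f y)" by auto
    have "dist (f x) (f y) \<le> C * dist x y"
      using assms(1) xy(1,2) by (rule lipschitz_onD)
    also have "\<dots> \<le> C * diameter B"
      using xy assms lipschitz_on_nonneg[OF assms(1)]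
      by (intro mult_left_mono diameter_bounded_bound) auto
    finally show "(case z of (x, y) \<Rightarrow> dist x y) \<le> C * diameter B" by (simp add: xy(3))
  qed (use assms in auto)
  then show ?thesis using assms(2) by (simp add: diameter_def)
qed

text \<open>
  The images of the pieces \<open>U i \<inter> A\<close> of a cover cover \<open>f ` A\<close>, with all diameters scaled by at most
  \<open>C\<close>.
\<close>
lemma hausdorff_outer_lipschitz_image:
  assumes lip: "C-lipschitz_on A f" and "0 < C"
  shows "hausdorff_outer d (f ` A) \<le> ennreal (C ^ d) * hausdorff_outer d A"
proof (rule hausdorff_outer_le)
  fix \<delta> :: real assume "0 < \<delta>"
  have C0: "0 \<le> C" using \<open>0 < C\<close> by simp
  define \<delta>' where "\<delta>' = \<delta> / (C + 1)"
  have d': "0 < \<delta>'" "C * \<delta>' \<le> \<delta>" using C0 \<open>0 < \<delta>\<close> by (auto simp: \<delta>'_def field_simps)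
  have "hausdorff_premeasure d \<delta> (f ` A) \<le> (\<Sum>i. ennreal (C ^ d) * diam_cost d (U i))"
    if U: "U \<in> fine_covers \<delta>' A" for U
  proof -
    have bU: "bounded (U i)" "diameter (U i) \<le> \<delta>'" for i using U by (auto simp: fine_covers_def)
    have V: "(\<lambda>i. f ` (U i \<inter> A)) \<in> fine_covers \<delta> (f ` A)"
      unfolding fine_covers_def
    proof (intro CollectI conjI allI)
      show "f ` A \<subseteq> (\<Union>i. f ` (U i \<inter> A))" using U unfolding fine_covers_def by blast
      fix i
      show "bounded (f ` (U i \<inter> A))"
        unfolding bounded_two_points
      proof (intro exI ballI)
        fix x y assume "x \<in> f ` (U i \<inter> A)" "y \<in> f ` (U i \<inter> A)"
        then obtain u v where uv: "u \<in> U i" "v \<in> U i" "u \<in> A" "v \<in> A" "x = f u" "y = f v" by blast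
        have "dist x y \<le> C * dist u v" unfolding uv using uv(3,4) by (rule lipschitz_onD[OF lip])
        also have "\<dots> \<le> C * diameter (U i)"
          using uv bU C0 by (intro mult_left_mono diameter_bounded_bound) auto
        finally show "dist x y \<le> C * diameter (U i)" .
      qed
      show "diameter (f ` (U i \<inter> A)) \<le> \<delta>"
      proof (cases "U i \<inter> A = {}")
        case False
        have "diameter (f ` (U i \<inter> A)) \<le> C * diameter (U i)"
          by (rule diameter_image_le_lipschitz[OF lipschitz_on_subset[OF lip] False _ bU(1)]) auto
        also have "\<dots> \<le> C * \<delta>'" using bU C0 by (intro mult_left_mono) auto
        finally show ?thesis using d' by simp
      qed (use \<open>0 < \<delta>\<close> in simp)
    qed
    have "diam_cost d (f ` (U i \<inter> A)) \<le> ennreal (C ^ d) * diam_cost d (U i)" for i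
    proof (cases "U i \<inter> A = {}")
      case False
      have "diameter (f ` (U i \<inter> A)) \<le> C * diameter (U i)"
        by (rule diameter_image_le_lipschitz[OF lipschitz_on_subset[OF lip] False _ bU(1)]) auto
      moreover have "bounded (f ` (U i \<inter> A))" using V by (auto simp: fine_covers_def)
      ultimately have "(diameter (f ` (U i \<inter> A)) / 2) ^ d \<le> (C * (diameter (U i) / 2)) ^ d"
        using diameter_ge_0 by (intro power_mono) auto
      then have "unit_ball_vol (real d) * (diameter (f ` (U i \<inter> A)) / 2) ^ d
           \<le> C ^ d * (unit_ball_vol (real d) * (diameter (U i) / 2) ^ d)"
        using mult_left_mono[of "(diameter (f ` (U i \<inter> A)) / 2) ^ d" "(C * (diameter (U i) / 2)) ^ d" "unit_ball_vol (real d)"]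
        by (simp only: power_mult_distrib mult.assoc mult.left_commute[of "C ^ d"] unit_ball_vol_nonneg)
      then show ?thesis
        using False C0 bU diameter_ge_0 by (auto simp: diam_cost_def ennreal_mult'[symmetric] intro!: ennreal_leI)
    qed (simp add: diam_cost_def)
    then show ?thesis
      using hausdorff_premeasure_le[OF V] by (meson order_trans suminf_le summableI)
  qed
  note cover = this
  have Cd: "0 < C ^ d" using \<open>0 < C\<close> by simp
  have "hausdorff_premeasure d \<delta> (f ` A) \<le> ennreal (C ^ d) * hausdorff_premeasure d \<delta>' A"
  proof (cases "hausdorff_premeasure d \<delta>' A = top")
    case True
    have "ennreal (C ^ d) * top = top"
      by (subst ennreal_mult_top) (use \<open>0 < C\<close> in simp)
    then show ?thesis unfolding True by simp
  next
    case False
    show ?thesis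
    proof (rule ennreal_le_epsilon)
      fix e :: real assume "0 < e"
      then have e': "0 < e / C ^ d" using Cd by simp
      obtain U where U: "U \<in> fine_covers \<delta>' A"
        and le: "(\<Sum>i. diam_cost d (U i)) \<le> hausdorff_premeasure d \<delta>' A + ennreal (e / C ^ d)"
        by (rule hausdorff_premeasure_approx[OF _ e']) (use False in \<open>simp add: top.not_eq_extremum\<close>)
      have "hausdorff_premeasure d \<delta> (f ` A) \<le> ennreal (C ^ d) * (\<Sum>i. diam_cost d (U i))"
        using cover[OF U] by simp
      also have "\<dots> \<le> ennreal (C ^ d) * (hausdorff_premeasure d \<delta>' A + ennreal (e / C ^ d))"
        by (rule mult_left_mono[OF le]) simp
      also have "\<dots> = ennreal (C ^ d) * hausdorff_premeasure d \<delta>' A + ennreal e"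
        using \<open>0 < C\<close> \<open>0 < e\<close> by (simp add: distrib_left ennreal_mult'[symmetric])
      finally show "hausdorff_premeasure d \<delta> (f ` A) \<le> ennreal (C ^ d) * hausdorff_premeasure d \<delta>' A + ennreal e" .
    qed
  qed
  also have "\<dots> \<le> ennreal (C ^ d) * hausdorff_outer d A"
    using d' by (intro mult_left_mono hausdorff_premeasure_le_outer) auto
  finally show "hausdorff_premeasure d \<delta> (f ` A) \<le> ennreal (C ^ d) * hausdorff_outer d A" .
qed

section \<open>The Brunn--Minkowski inequality for finite unions of boxes\<close>

definition midpoint_set :: "'a::real_vector set \<Rightarrow> 'a set \<Rightarrow> 'a set" where
  "midpoint_set A B = (\<lambda>(x, y). (1/2) *\<^sub>R (x + y)) ` (A \<times> B)"

lemma midpoint_setI: "x \<in> A \<Longrightarrow> y \<in> B \<Longrightarrow> z = (1/2) *\<^sub>R (x + y) \<Longrightarrow> z \<in> midpoint_set A B"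
  unfolding midpoint_set_def by force

lemma midpoint_setE:
  assumes "z \<in> midpoint_set A B"
  obtains x y where "x \<in> A" "y \<in> B" "z = (1/2) *\<^sub>R (x + y)"
  using assms unfolding midpoint_set_def by auto

lemma midpoint_set_commute: "midpoint_set A B = midpoint_set B A"
  by (auto elim!: midpoint_setE intro!: midpoint_setI simp: add.commute)

lemma midpoint_set_mono: "A \<subseteq> A' \<Longrightarrow> B \<subseteq> B' \<Longrightarrow> midpoint_set A B \<subseteq> midpoint_set A' B'"
  unfolding midpoint_set_def by blast

lemma compact_midpoint_set:
  fixes A B :: "'a::real_normed_vector set"
  shows "compact A \<Longrightarrow> compact B \<Longrightarrow> compact (midpoint_set A B)"
  unfolding midpoint_set_def
  by (intro compact_continuous_image compact_Times) (auto intro!: continuous_intros simp: case_prod_beta)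

text \<open>
  Finite unions of boxes with disjoint interiors are the sets on which the Brunn--Minkowski inequality is
  proved by induction on the number of boxes.
\<close>
definition box_family :: "'a::euclidean_space set set \<Rightarrow> bool" where
  "box_family \<D> \<longleftrightarrow> finite \<D> \<and> \<D> \<noteq> {} \<and> (\<forall>K\<in>\<D>. \<exists>a b. K = cbox a b \<and> box a b \<noteq> {}) \<and>
     pairwise (\<lambda>K L. interior K \<inter> interior L = {}) \<D>"

text \<open>
  The pieces that a half space cuts from a family of boxes. Degenerate pieces are dropped, so that the
  number of boxes decreases when the half space misses the interior of a box.
\<close>
definition cut_family :: "'a::euclidean_space set set \<Rightarrow> 'a set \<Rightarrow> 'a set set" where
  "cut_family \<D> H = {K \<inter> H |K. K \<in> \<D> \<and> interior (K \<inter> H) \<noteq> {}}"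

lemma box_familyE:
  assumes "box_family \<D>" "K \<in> \<D>"
  obtains a b where "K = cbox a b" "box a b \<noteq> {}"
  using assms unfolding box_family_def by blast

lemma box_family_compact: "box_family \<D> \<Longrightarrow> compact (\<Union>\<D>)"
  unfolding box_family_def by (intro compact_Union) auto

lemma cbox_Int_halfspace:
  fixes a b :: "'a::euclidean_space"
  assumes "i \<in> Basis" "H = {x. x \<bullet> i \<le> c} \<or> H = {x. c \<le> x \<bullet> i}"
  shows "\<exists>u v. cbox a b \<inter> H = cbox u v"
  using assms interval_split[OF assms(1), of a b c] by metis

lemma cut_family:
  fixes \<D> :: "'a::euclidean_space set set"
  assumes D: "box_family \<D>" and i: "i \<in> Basis" and H: "H = {x. x \<bullet> i \<le> c} \<or> H = {x. c \<le> x \<bullet> i}"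
  shows "measure lebesgue (\<Union>(cut_family \<D> H)) = measure lebesgue (\<Union>\<D> \<inter> H)"
    and "cut_family \<D> H \<noteq> {} \<Longrightarrow> box_family (cut_family \<D> H)"
    and "card (cut_family \<D> H) \<le> card \<D>"
    and "L \<in> \<D> \<Longrightarrow> interior (L \<inter> H) = {} \<Longrightarrow> card (cut_family \<D> H) < card \<D>"
proof -
  have fin: "finite \<D>" using D by (simp add: box_family_def)
  have cutD: "cut_family \<D> H = (\<lambda>K. K \<inter> H) ` {K\<in>\<D>. interior (K \<inter> H) \<noteq> {}}"
    by (auto simp: cut_family_def)
  have box: "\<exists>u v. K \<inter> H = cbox u v" if "K \<in> \<D>" for K
    using that D cbox_Int_halfspace[OF i H] by (auto simp: box_family_def)
  have neg: "negligible (K \<inter> H)" if "K \<in> \<D>" "interior (K \<inter> H) = {}" for K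
    using box[OF that(1)] that(2) negligible_convex_interior[of "K \<inter> H"] by auto
  have "negligible (\<Union>((\<lambda>K. K \<inter> H) ` {K\<in>\<D>. interior (K \<inter> H) = {}}))"
    using fin neg by (intro negligible_Union) auto
  moreover have "\<Union>\<D> \<inter> H = \<Union>(cut_family \<D> H) \<union> \<Union>((\<lambda>K. K \<inter> H) ` {K\<in>\<D>. interior (K \<inter> H) = {}})"
    by (auto simp: cutD)
  moreover have "\<Union>(cut_family \<D> H) \<in> sets lebesgue"
    unfolding cutD using fin box by (intro sets.finite_Union) (auto, metis lborelD borel_compact sets_completionI_sets sets_lborel compact_cbox)
  ultimately show "measure lebesgue (\<Union>(cut_family \<D> H)) = measure lebesgue (\<Union>\<D> \<inter> H)"
    by (simp only: measure_Un_null_set flip: negligible_iff_null_sets)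
  show "box_family (cut_family \<D> H)" if "cut_family \<D> H \<noteq> {}"
    unfolding box_family_def
  proof (intro conjI ballI that)
    show "finite (cut_family \<D> H)" using fin by (simp add: cutD)
    show "\<exists>a b. K = cbox a b \<and> box a b \<noteq> {}" if K: "K \<in> cut_family \<D> H" for K
    proof -
      obtain L where "L \<in> \<D>" "K = L \<inter> H" "interior K \<noteq> {}"
        using K unfolding cutD by blast
      moreover then obtain u v where "K = cbox u v" using box by blast
      ultimately show ?thesis by (metis interior_cbox)
    qed
    show "pairwise (\<lambda>K L. interior K \<inter> interior L = {}) (cut_family \<D> H)"
      unfolding cutD
    proof (rule pairwise_imageI)
      fix K L assume "K \<in> {K \<in> \<D>. interior (K \<inter> H) \<noteq> {}}" "L \<in> {K \<in> \<D>. interior (K \<inter> H) \<noteq> {}}"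
        "K \<noteq> L"
      then have "interior K \<inter> interior L = {}"
        using D by (auto simp: box_family_def pairwise_def)
      then show "interior (K \<inter> H) \<inter> interior (L \<inter> H) = {}" by auto
    qed
  qed
  have "card (cut_family \<D> H) \<le> card {K\<in>\<D>. interior (K \<inter> H) \<noteq> {}}"
    unfolding cutD using fin by (intro card_image_le) auto
  moreover have "card {K\<in>\<D>. interior (K \<inter> H) \<noteq> {}} \<le> card \<D>"
    using fin by (intro card_mono) auto
  ultimately show "card (cut_family \<D> H) \<le> card \<D>" by simp
  show "card (cut_family \<D> H) < card \<D>" if "L \<in> \<D>" "interior (L \<inter> H) = {}"
  proof -
    have "card {K\<in>\<D>. interior (K \<inter> H) \<noteq> {}} < card \<D>"
      using fin that by (intro psubset_card_mono) auto
    with \<open>card (cut_family \<D> H) \<le> card {K\<in>\<D>. interior (K \<inter> H) \<noteq> {}}\<close> show ?thesis by simp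
  qed
qed

lemma closed_axis_halfspace:
  fixes i :: "'a::euclidean_space"
  shows "closed {x. x \<bullet> i \<le> c}" "closed {x. c \<le> x \<bullet> i}"
  using closed_halfspace_le[of i c] closed_halfspace_ge[of c i] by (simp_all add: inner_commute)

lemma measure_split_halfspace:
  fixes A B :: "'a::euclidean_space set"
  assumes "compact A" "compact B" and i: "i \<in> Basis"
    and "A \<subseteq> {x. x \<bullet> i \<le> c}" "B \<subseteq> {x. c \<le> x \<bullet> i}"
  shows "measure lebesgue (A \<union> B) = measure lebesgue A + measure lebesgue B"
proof -
  have "A \<inter> B \<subseteq> {x. i \<bullet> x = c}"
  proof
    fix x assume "x \<in> A \<inter> B"
    then have "x \<bullet> i \<le> c" "c \<le> x \<bullet> i" using assms(4,5) by blast+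
    then show "x \<in> {x. i \<bullet> x = c}" by (simp add: inner_commute)
  qed
  then have "negligible (A \<inter> B)"
    using i by (intro negligible_subset[OF negligible_hyperplane[of i c]]) auto
  then have "measure lebesgue (A \<inter> B) = 0" by (rule negligible_imp_measure0)
  then show ?thesis
    using measure_Un3[OF lmeasurable_compact[OF assms(1)] lmeasurable_compact[OF assms(2)]] by simp
qed

text \<open>
  The volume of \<open>A\<close> below the level \<open>c\<close> depends continuously on \<open>c\<close>, because slabs around a level are
  thin, and it runs from zero to the full volume.
\<close>
lemma halfspace_measure_IVT:
  fixes A :: "'a::euclidean_space set"
  assumes A: "compact A" and i: "i \<in> Basis" and th: "0 < \<theta>" "\<theta> < 1"
  obtains c where "measure lebesgue (A \<inter> {x. x \<bullet> i \<le> c}) = \<theta> * measure lebesgue A"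
proof -
  obtain a b where ab: "A \<subseteq> cbox a b"
    using compact_imp_bounded[OF A] bounded_subset_cbox_symmetric by blast
  define m where "m c = measure lebesgue (A \<inter> {x. x \<bullet> i \<le> c})" for c
  have lm: "A \<inter> S \<in> lmeasurable" if "closed S" for S
    using A that by (intro lmeasurable_compact compact_Int_closed)
  have mono: "m c \<le> m c'" if "c \<le> c'" for c c'
    unfolding m_def using that
    by (intro measure_mono_fmeasurable lm closed_axis_halfspace fmeasurableD) auto
  have cont: "isCont m c" for c
    unfolding isCont_def LIM_eq
  proof (intro allI impI)
    fix e :: real assume "0 < e"
    obtain d where d: "0 < d" "measure lborel (cbox a b \<inter> {x. \<bar>x \<bullet> i - c\<bar> \<le> d}) < e"
      using content_doublesplit[OF \<open>0 < e\<close> i] by blast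
    have slab: "closed {x :: 'a. \<bar>x \<bullet> i - c\<bar> \<le> d}"
      by (intro closed_Collect_le continuous_intros)
    have key: "m v \<le> m u + measure lborel (cbox a b \<inter> {x. \<bar>x \<bullet> i - c\<bar> \<le> d})"
      if "u \<le> v" "\<bar>u - c\<bar> \<le> d" "\<bar>v - c\<bar> \<le> d" for u v
    proof -
      have C: "compact (cbox a b \<inter> {x. \<bar>x \<bullet> i - c\<bar> \<le> d})" using slab by (intro compact_Int_closed) auto
      have "m v \<le> measure lebesgue ((A \<inter> {x. x \<bullet> i \<le> u}) \<union> (cbox a b \<inter> {x. \<bar>x \<bullet> i - c\<bar> \<le> d}))"
        unfolding m_def using that ab A C
        by (intro measure_mono_fmeasurable fmeasurable.Un lm lmeasurable_compact closed_axis_halfspace fmeasurableD)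
           (auto simp: abs_le_iff)
      also have "\<dots> \<le> m u + measure lebesgue (cbox a b \<inter> {x. \<bar>x \<bullet> i - c\<bar> \<le> d})"
        unfolding m_def
        by (intro measure_Un_le fmeasurableD lm closed_axis_halfspace lmeasurable_compact C)
      also have "measure lebesgue (cbox a b \<inter> {x. \<bar>x \<bullet> i - c\<bar> \<le> d}) = measure lborel (cbox a b \<inter> {x. \<bar>x \<bullet> i - c\<bar> \<le> d})"
        using C by (simp add: borel_compact)
      finally show ?thesis .
    qed
    show "\<exists>s>0. \<forall>x. x \<noteq> c \<and> norm (x - c) < s \<longrightarrow> norm (m x - m c) < e"
    proof (intro exI conjI allI impI)
      fix x assume "x \<noteq> c \<and> norm (x - c) < d"
      then show "norm (m x - m c) < e"
        using key[of x c] key[of c x] mono[of x c] mono[of c x] d by (cases "x \<le> c") auto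
    qed (fact d)
  qed
  have lo: "m (a \<bullet> i - 1) = 0"
  proof -
    have "A \<inter> {x. x \<bullet> i \<le> a \<bullet> i - 1} = {}"
      using ab i by (force simp: mem_box)
    then show ?thesis unfolding m_def by simp
  qed
  have hi: "m (max (a \<bullet> i) (b \<bullet> i)) = measure lebesgue A"
  proof -
    have "A \<inter> {x. x \<bullet> i \<le> max (a \<bullet> i) (b \<bullet> i)} = A"
      using ab i by (force simp: mem_box)
    then show ?thesis unfolding m_def by simp
  qed
  have "\<exists>c\<ge>a \<bullet> i - 1. c \<le> max (a \<bullet> i) (b \<bullet> i) \<and> m c = \<theta> * measure lebesgue A"
  proof (rule IVT[of m])
    show "\<theta> * measure lebesgue A \<le> m (max (a \<bullet> i) (b \<bullet> i))"
      unfolding hi using th by (intro mult_left_le_one_le) auto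
  qed (use th cont lo in auto)
  then show thesis using that unfolding m_def by blast
qed

text \<open>
  The midpoint set of two boxes contains the box whose edges are the means of the edges, so the claim is
  the inequality of the arithmetic and the geometric mean for each edge.
\<close>
lemma brunn_minkowski_box:
  fixes a b c d :: "'a::euclidean_space"
  assumes "box a b \<noteq> {}" "box c d \<noteq> {}"
  shows "measure lebesgue (cbox a b) * measure lebesgue (cbox c d)
    \<le> (measure lebesgue (midpoint_set (cbox a b) (cbox c d)))\<^sup>2"
proof -
  have ab: "a \<bullet> i < b \<bullet> i" and cd: "c \<bullet> i < d \<bullet> i" if "i \<in> Basis" for i
    using assms that by (auto simp: box_ne_empty)
  let ?u = "(1/2) *\<^sub>R (a + c)" and ?v = "(1/2) *\<^sub>R (b + d)"
  have uv: "?v \<bullet> i - ?u \<bullet> i = ((b \<bullet> i - a \<bullet> i) + (d \<bullet> i - c \<bullet> i)) / 2" for i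
    by (simp add: inner_add_left field_simps)
  have sub: "cbox ?u ?v \<subseteq> midpoint_set (cbox a b) (cbox c d)"
  proof
    fix x assume x: "x \<in> cbox ?u ?v"
    define t where "t i = (x \<bullet> i - ?u \<bullet> i) / (?v \<bullet> i - ?u \<bullet> i)" for i
    have pos: "0 < ?v \<bullet> i - ?u \<bullet> i" if "i \<in> Basis" for i
      using ab[OF that] cd[OF that] unfolding uv by simp
    have t: "0 \<le> t i \<and> t i \<le> 1" if "i \<in> Basis" for i
      using x pos[OF that] that unfolding t_def by (auto simp: mem_box divide_simps)
    have tx: "t i * (?v \<bullet> i - ?u \<bullet> i) = x \<bullet> i - ?u \<bullet> i" if "i \<in> Basis" for i
      using pos[OF that] by (simp add: t_def)
    define y where "y = (\<Sum>i\<in>Basis. (a \<bullet> i + t i * (b \<bullet> i - a \<bullet> i)) *\<^sub>R i)"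
    define z where "z = (\<Sum>i\<in>Basis. (c \<bullet> i + t i * (d \<bullet> i - c \<bullet> i)) *\<^sub>R i)"
    have lin: "p \<le> p + s * (q - p) \<and> p + s * (q - p) \<le> q" if "p \<le> q" "0 \<le> s \<and> s \<le> 1" for p q s :: real
      using that mult_left_le_one_le[of "q - p" s] by (auto simp: mult_nonneg_nonneg)
    have "y \<in> cbox a b" "z \<in> cbox c d"
      using lin[OF less_imp_le[OF ab] t] lin[OF less_imp_le[OF cd] t] by (auto simp: mem_box y_def z_def)
    moreover have "x = (1/2) *\<^sub>R (y + z)"
    proof (rule euclidean_eqI)
      fix i :: 'a assume i: "i \<in> Basis"
      show "x \<bullet> i = (1/2) *\<^sub>R (y + z) \<bullet> i"
      proof -
        have "y \<bullet> i = a \<bullet> i + t i * (b \<bullet> i - a \<bullet> i)" "z \<bullet> i = c \<bullet> i + t i * (d \<bullet> i - c \<bullet> i)"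
          unfolding y_def z_def using i by (simp_all add: inner_sum_left_Basis)
        then show ?thesis
          using tx[OF i] unfolding uv inner_scaleR_left inner_add_left by (simp add: field_simps)
      qed
    qed
    ultimately show "x \<in> midpoint_set (cbox a b) (cbox c d)" by (rule midpoint_setI)
  qed
  have uv_le: "?u \<bullet> i \<le> ?v \<bullet> i" if "i \<in> Basis" for i
    using ab[OF that] cd[OF that] by (simp add: inner_add_left)
  have "measure lebesgue (cbox a b) * measure lebesgue (cbox c d)
      = (\<Prod>i\<in>Basis. (b \<bullet> i - a \<bullet> i) * (d \<bullet> i - c \<bullet> i))"
    using ab cd by (simp add: content_cbox less_imp_le inner_diff_left prod.distrib)
  also have "\<dots> \<le> (\<Prod>i\<in>Basis. (?v \<bullet> i - ?u \<bullet> i)\<^sup>2)"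
  proof (rule prod_mono)
    fix i :: 'a assume i: "i \<in> Basis"
    have "0 \<le> ((b \<bullet> i - a \<bullet> i) - (d \<bullet> i - c \<bullet> i))\<^sup>2" by simp
    then have "(b \<bullet> i - a \<bullet> i) * (d \<bullet> i - c \<bullet> i) \<le> (((b \<bullet> i - a \<bullet> i) + (d \<bullet> i - c \<bullet> i)) / 2)\<^sup>2"
      by (simp add: power2_eq_square field_simps)
    then show "0 \<le> (b \<bullet> i - a \<bullet> i) * (d \<bullet> i - c \<bullet> i) \<and>
        (b \<bullet> i - a \<bullet> i) * (d \<bullet> i - c \<bullet> i) \<le> (?v \<bullet> i - ?u \<bullet> i)\<^sup>2"
      unfolding uv using ab[OF i] cd[OF i] by simp
  qed
  also have "\<dots> = (measure lebesgue (cbox ?u ?v))\<^sup>2"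
    using uv_le by (simp add: content_cbox inner_diff_left prod_power_distrib)
  also have "\<dots> \<le> (measure lebesgue (midpoint_set (cbox a b) (cbox c d)))\<^sup>2"
    by (intro power_mono measure_mono_fmeasurable sub lmeasurable_compact compact_midpoint_set) auto
  finally show ?thesis .
qed

lemma box_family_measure_pos:
  assumes "box_family \<D>" "K \<in> \<D>"
  shows "0 < measure lebesgue K" "measure lebesgue K \<le> measure lebesgue (\<Union>\<D>)"
proof -
  obtain a b where K: "K = cbox a b" "box a b \<noteq> {}"
    using box_familyE[OF assms] .
  then show "0 < measure lebesgue K"
    by (simp add: content_pos_lt_eq box_ne_empty)
  show "measure lebesgue K \<le> measure lebesgue (\<Union>\<D>)"
    using assms K by (intro measure_mono_fmeasurable lmeasurable_compact box_family_compact) auto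
qed

text \<open>
  The induction of Hadwiger and Ohmann. Two boxes of \<open>\<D>\<close> are separated by a coordinate hyperplane; cut
  \<open>\<Union>\<D>\<close> there, and cut \<open>\<Union>\<E>\<close> by a parallel hyperplane in the same volume ratio \<open>\<theta>\<close>. Each half of
  \<open>\<D>\<close> has fewer boxes, so the inequality holds for both pairs of halves, and the two midpoint sets lie on
  different sides of the middle hyperplane, so that their volumes add up.
\<close>
lemma brunn_minkowski_step:
  fixes \<D> \<E> :: "'a::euclidean_space set set"
  assumes D: "box_family \<D>" and E: "box_family \<E>" and two: "K \<in> \<D>" "L \<in> \<D>" "K \<noteq> L"
    and IH: "\<And>\<D>' \<E>' :: 'a set set. box_family \<D>' \<Longrightarrow> box_family \<E>' \<Longrightarrow> card \<D>' < card \<D> \<Longrightarrow> card \<E>' \<le> card \<E> \<Longrightarrow>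
      measure lebesgue (\<Union>\<D>') * measure lebesgue (\<Union>\<E>') \<le> (measure lebesgue (midpoint_set (\<Union>\<D>') (\<Union>\<E>')))\<^sup>2"
  shows "measure lebesgue (\<Union>\<D>) * measure lebesgue (\<Union>\<E>) \<le> (measure lebesgue (midpoint_set (\<Union>\<D>) (\<Union>\<E>)))\<^sup>2"
proof -
  obtain a b where K: "K = cbox a b" "box a b \<noteq> {}" using box_familyE[OF D two(1)] .
  obtain c d where L: "L = cbox c d" "box c d \<noteq> {}" using box_familyE[OF D two(2)] .
  have "box a b \<inter> box c d = {}"
    using D two K L by (force simp: box_family_def pairwise_def)
  then obtain i where i: "i \<in> Basis" and "b \<bullet> i \<le> c \<bullet> i \<or> d \<bullet> i \<le> a \<bullet> i"
    using K(2) L(2) unfolding disjoint_interval by (force simp: box_ne_empty)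
  then obtain P Q s where PQ: "P \<in> \<D>" "Q \<in> \<D>" "P \<subseteq> {x. x \<bullet> i \<le> s}" "Q \<subseteq> {x. s \<le> x \<bullet> i}"
  proof (elim disjE)
    assume "b \<bullet> i \<le> c \<bullet> i"
    then show ?thesis using that[of K L "b \<bullet> i"] K L two i by (force simp: mem_box)
  next
    assume "d \<bullet> i \<le> a \<bullet> i"
    then show ?thesis using that[of L K "d \<bullet> i"] K L two i by (force simp: mem_box)
  qed
  let ?A = "\<Union>\<D>" and ?B = "\<Union>\<E>"
  define H1 H2 where "H1 = {x::'a. x \<bullet> i \<le> s}" and "H2 = {x::'a. s \<le> x \<bullet> i}"
  let ?m = "measure lebesgue :: 'a set \<Rightarrow> real"
  have cA: "compact ?A" and cB: "compact ?B" using D E by (auto intro: box_family_compact)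
  have cl: "closed H1" "closed H2" by (auto simp: H1_def H2_def closed_axis_halfspace)
  have flat: "interior (H1 \<inter> H2) = {}"
  proof -
    have "H1 \<inter> H2 = {x. i \<bullet> x = s}" by (auto simp: H1_def H2_def inner_commute)
    then show ?thesis using i by (auto simp: nonzero_Basis interior_hyperplane)
  qed
  have intP: "interior (P \<inter> H2) = {}" and intQ: "interior (Q \<inter> H1) = {}"
    using flat PQ interior_mono[of "P \<inter> H2" "H1 \<inter> H2"] interior_mono[of "Q \<inter> H1" "H1 \<inter> H2"]
    by (auto simp: H1_def H2_def)
  have mA: "?m ?A = ?m (?A \<inter> H1) + ?m (?A \<inter> H2)"
  proof -
    have "?A = (?A \<inter> H1) \<union> (?A \<inter> H2)" by (auto simp: H1_def H2_def)
    then show ?thesis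
      using measure_split_halfspace[of "?A \<inter> H1" "?A \<inter> H2" i s] cA cl i
      by (metis H1_def H2_def compact_Int_closed inf_le2)
  qed
  have pos1: "0 < ?m (?A \<inter> H1)"
    using box_family_measure_pos(1)[OF D PQ(1)] cA cl PQ box_family_compact[OF D]
    by (intro less_le_trans[OF _ measure_mono_fmeasurable[of P "?A \<inter> H1"]])
       (use D PQ(1) in \<open>auto simp: H1_def box_family_def intro!: lmeasurable_compact compact_Int_closed\<close>)
  have pos2: "0 < ?m (?A \<inter> H2)"
    using box_family_measure_pos(1)[OF D PQ(2)] cA cl PQ box_family_compact[OF D]
    by (intro less_le_trans[OF _ measure_mono_fmeasurable[of Q "?A \<inter> H2"]])
       (use D PQ(2) in \<open>auto simp: H2_def box_family_def intro!: lmeasurable_compact compact_Int_closed\<close>)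
  define \<theta> where "\<theta> = ?m (?A \<inter> H1) / ?m ?A"
  have th: "0 < \<theta>" "\<theta> < 1" using pos1 pos2 mA by (auto simp: \<theta>_def)
  \<comment> \<open>The parallel cut of the second union in the same ratio.\<close>
  obtain t where t: "?m (?B \<inter> {x. x \<bullet> i \<le> t}) = \<theta> * ?m ?B"
    using halfspace_measure_IVT[OF cB i th] .
  define G1 G2 where "G1 = {x::'a. x \<bullet> i \<le> t}" and "G2 = {x::'a. t \<le> x \<bullet> i}"
  have clG: "closed G1" "closed G2" by (auto simp: G1_def G2_def closed_axis_halfspace)
  have mB: "?m ?B = ?m (?B \<inter> G1) + ?m (?B \<inter> G2)"
  proof -
    have "?B = (?B \<inter> G1) \<union> (?B \<inter> G2)" by (auto simp: G1_def G2_def)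
    then show ?thesis
      using measure_split_halfspace[of "?B \<inter> G1" "?B \<inter> G2" i t] cB clG i
      by (metis G1_def G2_def compact_Int_closed inf_le2)
  qed
  have posB: "0 < ?m ?B"
    using E box_family_measure_pos[OF E] by (auto simp: box_family_def) (meson less_le_trans)
  have A1: "?m (?A \<inter> H1) = \<theta> * ?m ?A" "?m (?A \<inter> H2) = (1 - \<theta>) * ?m ?A"
    using mA pos1 pos2 by (auto simp: \<theta>_def field_simps)
  have B1: "?m (?B \<inter> G1) = \<theta> * ?m ?B" "?m (?B \<inter> G2) = (1 - \<theta>) * ?m ?B"
    using t mB by (auto simp: G1_def algebra_simps)
  note cutA1 = cut_family[OF D i, of H1 s, OF disjI1[OF H1_def]]
  note cutA2 = cut_family[OF D i, of H2 s, OF disjI2[OF H2_def]]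
  note cutB1 = cut_family[OF E i, of G1 t, OF disjI1[OF G1_def]]
  note cutB2 = cut_family[OF E i, of G2 t, OF disjI2[OF G2_def]]
  have ne: "cut_family \<D> H1 \<noteq> {}" "cut_family \<D> H2 \<noteq> {}" "cut_family \<E> G1 \<noteq> {}" "cut_family \<E> G2 \<noteq> {}"
    using cutA1(1) cutA2(1) cutB1(1) cutB2(1) pos1 pos2 A1 B1 th posB by auto
  have ineq: "sqrt (?m ?A * ?m ?B) * r \<le> ?m (midpoint_set (?A \<inter> H) (?B \<inter> G))"
    if H: "box_family (cut_family \<D> H)" "box_family (cut_family \<E> G)" "card (cut_family \<D> H) < card \<D>"
      "card (cut_family \<E> G) \<le> card \<E>" "?m (\<Union>(cut_family \<D> H)) = r * ?m ?A"
      "?m (\<Union>(cut_family \<E> G)) = r * ?m ?B" "0 < r" "closed H" "closed G" for H G r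
  proof -
    have "(sqrt (?m ?A * ?m ?B) * r)\<^sup>2 = (r * ?m ?A) * (r * ?m ?B)"
      by (simp add: power_mult_distrib power2_eq_square)
    also have "\<dots> \<le> (?m (midpoint_set (\<Union>(cut_family \<D> H)) (\<Union>(cut_family \<E> G))))\<^sup>2"
      using IH[OF H(1-4)] H by simp
    finally have "sqrt (?m ?A * ?m ?B) * r \<le> ?m (midpoint_set (\<Union>(cut_family \<D> H)) (\<Union>(cut_family \<E> G)))"
      by (rule power2_le_imp_le) simp
    also have "\<dots> \<le> ?m (midpoint_set (?A \<inter> H) (?B \<inter> G))"
      using H cA cB D E
      by (intro measure_mono_fmeasurable midpoint_set_mono lmeasurable_compact fmeasurableD compact_midpoint_set
          box_family_compact compact_Int_closed) (auto simp: cut_family_def)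
    finally show ?thesis .
  qed
  let ?M1 = "midpoint_set (?A \<inter> H1) (?B \<inter> G1)" and ?M2 = "midpoint_set (?A \<inter> H2) (?B \<inter> G2)"
  have cM: "compact ?M1" "compact ?M2"
    using cA cB cl clG by (auto intro!: compact_midpoint_set compact_Int_closed)
  have e1: "sqrt (?m ?A * ?m ?B) * \<theta> \<le> ?m ?M1"
    by (rule ineq[OF cutA1(2)[OF ne(1)] cutB1(2)[OF ne(3)] cutA1(4)[OF PQ(2) intQ] cutB1(3) _ _ th(1) cl(1) clG(1)])
       (simp_all only: cutA1(1) cutB1(1) A1 B1)
  have e2: "sqrt (?m ?A * ?m ?B) * (1 - \<theta>) \<le> ?m ?M2"
    by (rule ineq[OF cutA2(2)[OF ne(2)] cutB2(2)[OF ne(4)] cutA2(4)[OF PQ(1) intP] cutB2(3) _ _ _ cl(2) clG(2)])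
       (use th in \<open>simp_all add: cutA2(1) cutB2(1) A1 B1\<close>)
  \<comment> \<open>The half spaces below and above the level \<open>(s + t) / 2\<close> separate the two midpoint sets.\<close>
  have "sqrt (?m ?A * ?m ?B) = sqrt (?m ?A * ?m ?B) * \<theta> + sqrt (?m ?A * ?m ?B) * (1 - \<theta>)"
    by (simp add: algebra_simps)
  also have "\<dots> \<le> ?m ?M1 + ?m ?M2"
    using e1 e2 by (rule add_mono)
  also have "\<dots> = ?m (?M1 \<union> ?M2)"
    by (rule measure_split_halfspace[OF cM i, of "(s + t) / 2", symmetric])
       (auto simp: H1_def H2_def G1_def G2_def inner_add_left elim!: midpoint_setE)
  also have "\<dots> \<le> ?m (midpoint_set ?A ?B)"
    using cM cA cB cl clG
    by (intro measure_mono_fmeasurable lmeasurable_compact fmeasurableD compact_midpoint_set compact_Un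
        Un_least midpoint_set_mono Int_lower1 compact_Int_closed)
  finally have "(sqrt (?m ?A * ?m ?B))\<^sup>2 \<le> (?m (midpoint_set ?A ?B))\<^sup>2"
    by (rule power_mono) simp
  then show ?thesis by simp
qed

lemma brunn_minkowski_box_family:
  fixes \<D> \<E> :: "'a::euclidean_space set set"
  assumes "box_family \<D>" "box_family \<E>"
  shows "measure lebesgue (\<Union>\<D>) * measure lebesgue (\<Union>\<E>) \<le> (measure lebesgue (midpoint_set (\<Union>\<D>) (\<Union>\<E>)))\<^sup>2"
  using assms
proof (induction "card \<D> + card \<E>" arbitrary: \<D> \<E> rule: less_induct)
  case less
  have *: "(\<exists>K. \<F> = {K}) \<or> (\<exists>K L. K \<in> \<F> \<and> L \<in> \<F> \<and> K \<noteq> L)" if "box_family \<F>" for \<F> :: "'a set set"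
    using that unfolding box_family_def by blast
  consider (1) "\<exists>K L. K \<in> \<D> \<and> L \<in> \<D> \<and> K \<noteq> L" | (2) "\<exists>K L. K \<in> \<E> \<and> L \<in> \<E> \<and> K \<noteq> L"
    | (3) "\<exists>K. \<D> = {K}" "\<exists>L. \<E> = {L}"
    using *[OF less.prems(1)] *[OF less.prems(2)] by argo
  then show ?case
  proof cases
    case 1
    then obtain K L where KL: "K \<in> \<D>" "L \<in> \<D>" "K \<noteq> L" by blast
    show ?thesis
      by (rule brunn_minkowski_step[OF less.prems KL]) (rule less.hyps; simp)
  next
    case 2
    then obtain K L where KL: "K \<in> \<E>" "L \<in> \<E>" "K \<noteq> L" by blast
    have "measure lebesgue (\<Union>\<E>) * measure lebesgue (\<Union>\<D>) \<le> (measure lebesgue (midpoint_set (\<Union>\<E>) (\<Union>\<D>)))\<^sup>2"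
      by (rule brunn_minkowski_step[OF less.prems(2,1) KL]) (rule less.hyps; simp)
    then show ?thesis by (simp add: mult.commute midpoint_set_commute)
  next
    case 3
    then obtain K L where 3: "\<D> = {K}" "\<E> = {L}" by blast
    obtain a b where "K = cbox a b" "box a b \<noteq> {}" using box_familyE[OF less.prems(1), of K] 3 by blast
    moreover obtain c d where "L = cbox c d" "box c d \<noteq> {}" using box_familyE[OF less.prems(2), of L] 3 by blast
    ultimately show ?thesis using brunn_minkowski_box 3 by simp
  qed
qed

section \<open>The isodiametric inequality\<close>

text \<open>
  The boxes of a fine tagged division that meet \<open>A\<close> cover it and stay close to it; dropping the
  degenerate boxes changes no volume.
\<close>
lemma box_family_approx:
  fixes A :: "'a::euclidean_space set"
  assumes A: "compact A" and pos: "0 < measure lebesgue A" and e: "0 < e"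
  obtains \<D> where "box_family \<D>" "measure lebesgue A \<le> measure lebesgue (\<Union>\<D>)"
    "\<And>y. y \<in> \<Union>\<D> \<Longrightarrow> \<exists>a\<in>A. dist y a < e"
proof -
  obtain a b where ab: "A \<subseteq> cbox a b"
    using compact_imp_bounded[OF A] bounded_subset_cbox_symmetric by blast
  have "gauge (\<lambda>x::'a. ball x (e/2))" using e by (auto simp: gauge_def)
  then obtain p where p: "p tagged_division_of (cbox a b)" "(\<lambda>x. ball x (e/2)) fine p"
    using fine_division_exists by blast
  note td = tagged_division_ofD[OF p(1)]
  define \<K> where "\<K> = {K \<in> snd ` p. K \<inter> A \<noteq> {}}"
  define \<D> where "\<D> = {K \<in> \<K>. interior K \<noteq> {}}"
  have finK: "finite \<K>" using td(1) by (simp add: \<K>_def)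
  have box: "\<exists>u v. K = cbox u v" if "K \<in> \<K>" for K
    using that td(4) by (force simp: \<K>_def)
  have cK: "compact K" if "K \<in> \<K>" for K
    using box[OF that] by auto
  have cD: "compact (\<Union>\<D>)" and cKK: "compact (\<Union>\<K>)"
    using finK cK by (auto intro!: compact_Union simp: \<D>_def)
  have AK: "A \<subseteq> \<Union>\<K>"
  proof
    fix x assume x: "x \<in> A"
    then have "x \<in> \<Union>{K. \<exists>x. (x, K) \<in> p}" using ab td(6) by blast
    then obtain y K where "(y, K) \<in> p" "x \<in> K" by blast
    with x show "x \<in> \<Union>\<K>" unfolding \<K>_def by force
  qed
  have "measure lebesgue A \<le> measure lebesgue (\<Union>\<K>)"
    using AK A cKK by (intro measure_mono_fmeasurable lmeasurable_compact fmeasurableD)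
  also have "\<Union>\<K> = \<Union>\<D> \<union> \<Union>(\<K> - \<D>)" by (auto simp: \<D>_def)
  also have "measure lebesgue (\<Union>\<D> \<union> \<Union>(\<K> - \<D>)) = measure lebesgue (\<Union>\<D>)"
  proof (rule measure_Un_null_set)
    show "\<Union>\<D> \<in> sets lebesgue" using lmeasurable_compact[OF cD] by (rule fmeasurableD)
    have "negligible K" if "K \<in> \<K> - \<D>" for K
      using that box[of K] negligible_convex_interior[of K] by (auto simp: \<D>_def)
    then have "negligible (\<Union>(\<K> - \<D>))" using finK by (intro negligible_Union) auto
    then show "\<Union>(\<K> - \<D>) \<in> null_sets lebesgue" by (simp add: negligible_iff_null_sets)
  qed
  finally have le: "measure lebesgue A \<le> measure lebesgue (\<Union>\<D>)" .
  have "box_family \<D>"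
    unfolding box_family_def
  proof (intro conjI ballI)
    show "finite \<D>" using finK by (simp add: \<D>_def)
    show "\<D> \<noteq> {}" using le pos by auto
    show "\<exists>a b. K = cbox a b \<and> box a b \<noteq> {}" if "K \<in> \<D>" for K
    proof -
      have "K \<in> \<K>" "interior K \<noteq> {}" using that by (auto simp: \<D>_def)
      then show ?thesis using box by (metis interior_cbox)
    qed
    show "pairwise (\<lambda>K L. interior K \<inter> interior L = {}) \<D>"
    proof (rule pairwiseI)
      fix K L assume KL: "K \<in> \<D>" "L \<in> \<D>" "K \<noteq> L"
      then obtain x y where "(x, K) \<in> p" "(y, L) \<in> p" by (auto simp: \<D>_def \<K>_def)
      then show "interior K \<inter> interior L = {}" using td(5) KL(3) by blast
    qed
  qed
  moreover have "\<exists>a\<in>A. dist y a < e" if y: "y \<in> \<Union>\<D>" for y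
  proof -
    obtain x K z where K: "(x, K) \<in> p" "y \<in> K" "z \<in> K" "z \<in> A"
      using y by (auto simp: \<D>_def \<K>_def)
    then have "K \<subseteq> ball x (e/2)" using p(2) by (auto simp: fine_def)
    then have "dist x y < e/2" "dist x z < e/2" using K by auto
    then have "dist y z < e" using dist_triangle_half_r by blast
    with K show ?thesis by blast
  qed
  ultimately show thesis using that le by blast
qed

lemma box_family_uminus:
  assumes "box_family \<D>"
  shows "box_family ((\<lambda>K. uminus ` K) ` \<D>)"
  unfolding box_family_def
proof (intro conjI ballI)
  show "finite ((\<lambda>K. uminus ` K) ` \<D>)" "(\<lambda>K. uminus ` K) ` \<D> \<noteq> {}"
    using assms by (auto simp: box_family_def)
  show "\<exists>a b. L = cbox a b \<and> box a b \<noteq> {}" if L: "L \<in> (\<lambda>K. uminus ` K) ` \<D>" for L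
  proof -
    obtain K where K: "K \<in> \<D>" "L = uminus ` K" using L by blast
    obtain a b where ab: "K = cbox a b" "box a b \<noteq> {}" using box_familyE[OF assms K(1)] .
    have "uminus ` cbox a b = cbox (-b) (-a)"
    proof (intro equalityI subsetI)
      fix x assume "x \<in> cbox (-b) (-a)"
      then have "-x \<in> cbox a b" by (force simp: mem_box)
      then show "x \<in> uminus ` cbox a b" by (metis image_eqI minus_minus)
    qed (auto simp: mem_box)
    moreover have "box (-b) (-a) \<noteq> {}" using ab(2) by (auto simp: box_ne_empty)
    ultimately show ?thesis using K ab by blast
  qed
  show "pairwise (\<lambda>K L. interior K \<inter> interior L = {}) ((\<lambda>K. uminus ` K) ` \<D>)"
  proof (rule pairwise_imageI)
    fix K L assume "K \<in> \<D>" "L \<in> \<D>" "K \<noteq> L"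
    then have "interior K \<inter> interior L = {}" using assms unfolding box_family_def pairwise_def by blast
    then show "interior (uminus ` K) \<inter> interior (uminus ` L) = {}"
      unfolding interior_negations by auto
  qed
qed

text \<open>
  Brunn--Minkowski for \<open>A\<close> and its reflection, which have the same volume. Box families approximating
  \<open>A\<close> have their midpoint sets inside a neighbourhood of the midpoint set of \<open>A\<close>, and the volumes of
  these closed neighbourhoods decrease to the volume of the compact midpoint set.
\<close>
lemma measure_le_midpoint_uminus:
  fixes A :: "'a::euclidean_space set"
  assumes A: "compact A"
  shows "measure lebesgue A \<le> measure lebesgue (midpoint_set A (uminus ` A))"
proof (cases "measure lebesgue A = 0")
  case False
  then have pos: "0 < measure lebesgue A" by (simp add: zero_less_measure_iff)
  then have ne: "A \<noteq> {}" by auto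
  let ?B = "midpoint_set A (uminus ` A)"
  define N where "N n = {x. infdist x ?B \<le> 1 / (real n + 1)}" for n :: nat
  have B: "compact ?B" using A by (intro compact_midpoint_set compact_negations)
  have B': "?B \<noteq> {}" using ne by (auto simp: midpoint_set_def)
  have cN: "compact (N n)" for n
    unfolding N_def by (rule compact_infdist_le[OF B' B]) simp
  have le: "measure lebesgue A \<le> measure lebesgue (N n)" for n
  proof -
    obtain \<D> where D: "box_family \<D>" "measure lebesgue A \<le> measure lebesgue (\<Union>\<D>)"
      "\<And>y. y \<in> \<Union>\<D> \<Longrightarrow> \<exists>a\<in>A. dist y a < 1 / (real n + 1)"
      by (rule box_family_approx[OF A pos, of "1 / (real n + 1)"]) (simp, blast)
    let ?E = "(\<lambda>K. uminus ` K) ` \<D>"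
    have U: "\<Union>?E = uminus ` (\<Union>\<D>)" by auto
    have "measure lebesgue (uminus ` (\<Union>\<D>)) = measure lebesgue (\<Union>\<D>)"
      using measure_lebesgue_affine[of "-1" 0 "\<Union>\<D>"] by simp
    then have "(measure lebesgue (\<Union>\<D>))\<^sup>2 \<le> (measure lebesgue (midpoint_set (\<Union>\<D>) (uminus ` (\<Union>\<D>))))\<^sup>2"
      using brunn_minkowski_box_family[OF D(1) box_family_uminus[OF D(1)]]
      unfolding U by (simp add: power2_eq_square)
    then have "measure lebesgue (\<Union>\<D>) \<le> measure lebesgue (midpoint_set (\<Union>\<D>) (uminus ` (\<Union>\<D>)))"
      by (rule power2_le_imp_le) simp
    also have "\<dots> \<le> measure lebesgue (N n)"
    proof (intro measure_mono_fmeasurable lmeasurable_compact fmeasurableD cN compact_midpoint_set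
        compact_negations box_family_compact D(1))
      show "midpoint_set (\<Union>\<D>) (uminus ` (\<Union>\<D>)) \<subseteq> N n"
      proof
        fix z assume "z \<in> midpoint_set (\<Union>\<D>) (uminus ` (\<Union>\<D>))"
        then obtain x w where "x \<in> \<Union>\<D>" "w \<in> uminus ` (\<Union>\<D>)" "z = (1/2) *\<^sub>R (x + w)"
          by (rule midpoint_setE)
        then obtain y where xy: "x \<in> \<Union>\<D>" "y \<in> \<Union>\<D>" "z = (1/2) *\<^sub>R (x + - y)"
          by blast
        obtain a b where ab: "a \<in> A" "b \<in> A" "dist x a < 1 / (real n + 1)" "dist y b < 1 / (real n + 1)"
          using D(3)[OF xy(1)] D(3)[OF xy(2)] by blast
        have m: "(1/2) *\<^sub>R (a + - b) \<in> ?B" by (rule midpoint_setI[of a A "-b"]) (use ab in auto)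
        have "z - (1/2) *\<^sub>R (a + - b) = (1/2) *\<^sub>R ((x - a) - (y - b))"
          unfolding xy(3) by (simp add: algebra_simps)
        then have "dist z ((1/2) *\<^sub>R (a + - b)) = (1/2) * norm ((x - a) - (y - b))"
          by (simp add: dist_norm)
        also have "\<dots> \<le> (1/2) * (norm (x - a) + norm (y - b))"
          by (intro mult_left_mono norm_triangle_ineq4) simp
        also have "\<dots> \<le> 1 / (real n + 1)" using ab by (simp add: dist_norm)
        finally show "z \<in> N n"
          unfolding N_def using infdist_le[OF m, of z] by simp
      qed
    qed
    finally show ?thesis using D(2) by simp
  qed
  have "(\<lambda>n. measure lebesgue (N n)) \<longlonglongrightarrow> measure lebesgue (\<Inter>n. N n)"
  proof (rule Lim_measure_decseq)
    show "range N \<subseteq> sets lebesgue" using lmeasurable_compact[OF cN] by auto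
    show "decseq N"
      unfolding decseq_def N_def by (force intro: order_trans simp: frac_le)
    show "emeasure lebesgue (N i) \<noteq> \<infinity>" for i using fmeasurableD2[OF lmeasurable_compact[OF cN[of i]]] by simp
  qed
  moreover have "(\<Inter>n. N n) = ?B"
  proof (intro equalityI subsetI)
    fix x assume x: "x \<in> (\<Inter>n. N n)"
    have "infdist x ?B \<le> 0"
    proof (rule field_le_epsilon)
      fix e :: real assume "0 < e"
      then obtain n where "inverse (real (Suc n)) < e" using reals_Archimedean by blast
      moreover have "infdist x ?B \<le> inverse (real (Suc n))"
        using x by (auto simp: N_def field_simps)
      ultimately show "infdist x ?B \<le> 0 + e" by simp
    qed
    then have "infdist x ?B = 0" using infdist_nonneg[of x ?B] by linarith
    then show "x \<in> ?B" using B B' in_closed_iff_infdist_zero compact_imp_closed by blast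
  qed (auto simp: N_def)
  ultimately have "(\<lambda>n. measure lebesgue (N n)) \<longlonglongrightarrow> measure lebesgue ?B" by simp
  then show ?thesis using le by (intro LIMSEQ_le_const) auto
qed simp

text \<open>
  Symmetrization: the midpoint set of \<open>U\<close> and \<open>- U\<close> has at least the volume of \<open>U\<close> and lies in the
  ball around 0 whose radius is half the diameter of \<open>U\<close>.
\<close>
lemma isodiametric_inequality:
  fixes U :: "'a::euclidean_space set"
  assumes U: "bounded U"
  shows "emeasure lborel (closure U) \<le> diam_cost DIM('a) U"
proof (cases "U = {}")
  case False
  let ?A = "closure U" and ?r = "diameter U / 2"
  have A: "compact ?A" using U by (simp add: compact_closure)
  have r: "0 \<le> ?r" using diameter_ge_0[OF U] by simp
  have "midpoint_set ?A (uminus ` ?A) \<subseteq> cball 0 ?r"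
  proof
    fix z assume "z \<in> midpoint_set ?A (uminus ` ?A)"
    then obtain x y where xy: "x \<in> ?A" "y \<in> ?A" "z = (1/2) *\<^sub>R (x + - y)"
      by (auto elim!: midpoint_setE)
    then have "dist x y \<le> diameter U"
      using diameter_bounded_bound[of ?A x y] U by (simp add: diameter_closure bounded_closure)
    then show "z \<in> cball 0 ?r" unfolding xy(3) by (simp add: dist_norm)
  qed
  then have "measure lebesgue (midpoint_set ?A (uminus ` ?A)) \<le> measure lebesgue (cball (0::'a) ?r)"
    using A by (intro measure_mono_fmeasurable lmeasurable_compact fmeasurableD compact_midpoint_set
        compact_negations) auto
  then have "measure lebesgue ?A \<le> measure lebesgue (cball (0::'a) ?r)"
    using measure_le_midpoint_uminus[OF A] by simp
  also have "\<dots> = unit_ball_vol DIM('a) * ?r ^ DIM('a)"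
    using content_cball[OF r, of "0::'a"] by simp
  finally have "measure lborel ?A \<le> unit_ball_vol DIM('a) * ?r ^ DIM('a)"
    by simp
  moreover have "emeasure lborel ?A = ennreal (measure lborel ?A)"
    using emeasure_compact_finite[OF A] by (simp add: emeasure_eq_ennreal_measure)
  ultimately show ?thesis using False by (simp add: diam_cost_def ennreal_leI)
qed simp

section \<open>Hausdorff measure in the full dimension\<close>

lemma lborel_le_hausdorff_premeasure:
  fixes V :: "'a::euclidean_space set"
  shows "emeasure lborel V \<le> hausdorff_premeasure DIM('a) \<delta> V"
proof (rule le_hausdorff_premeasure)
  fix U assume U: "U \<in> fine_covers \<delta> V"
  have "V \<subseteq> (\<Union>i. closure (U i))"
    using U closure_subset unfolding fine_covers_def by blast
  then have "emeasure lborel V \<le> emeasure lborel (\<Union>i. closure (U i))"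
    by (rule emeasure_mono) auto
  also have "\<dots> \<le> (\<Sum>i. emeasure lborel (closure (U i)))"
    by (rule emeasure_subadditive_countably) auto
  also have "\<dots> \<le> (\<Sum>i. diam_cost DIM('a) (U i))"
    using U by (intro suminf_le isodiametric_inequality) (auto simp: fine_covers_def)
  finally show "emeasure lborel V \<le> (\<Sum>i. diam_cost DIM('a) (U i))" .
qed

text \<open>
  Covering by balls that become disjoint when shrunk by the factor \<open>s\<close>. The two uses are \<open>s = 5\<close>, for
  the elementary Vitali lemma, and \<open>s = 1\<close>, for disjoint balls.
\<close>
lemma hausdorff_premeasure_le_disjoint_balls:
  fixes a :: "'i \<Rightarrow> 'a::euclidean_space"
  assumes C: "countable C" and disj: "pairwise (\<lambda>i j. disjnt (cball (a i) (r i)) (cball (a j) (r j))) C"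
    and O: "O' \<in> sets borel" "\<And>i. i \<in> C \<Longrightarrow> cball (a i) (r i) \<subseteq> O'"
    and r: "\<And>i. i \<in> C \<Longrightarrow> 0 < r i \<and> s * r i \<le> \<delta> / 2" and s: "1 \<le> s" and "0 < \<delta>"
    and S: "S \<subseteq> (\<Union>i\<in>C. cball (a i) (s * r i))"
  shows "hausdorff_premeasure DIM('a) \<delta> S \<le> ennreal (s ^ DIM('a)) * emeasure lborel O'"
proof -
  define I where "I = to_nat_on C ` C"
  define j where "j = from_nat_into C"
  have jC: "j k \<in> C" "to_nat_on C (j k) = k" if "k \<in> I" for k
    using that C by (auto simp: I_def j_def)
  define U where "U k = (if k \<in> I then cball (a (j k)) (s * r (j k)) else {})" for k
  define B where "B k = (if k \<in> I then cball (a (j k)) (r (j k)) else {})" for k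
  have pos: "0 \<le> s * r (j k)" if "k \<in> I" for k using r[OF jC(1)[OF that]] s by simp
  have diam: "diameter (U k) / 2 \<le> s * r (j k)" if "k \<in> I" for k
    unfolding U_def using that pos by simp
  have "U \<in> fine_covers \<delta> S"
    unfolding fine_covers_def
  proof (intro CollectI conjI allI)
    show "S \<subseteq> (\<Union>i. U i)"
    proof
      fix x assume "x \<in> S"
      then obtain i where i: "i \<in> C" "x \<in> cball (a i) (s * r i)" using S by blast
      then have "x \<in> U (to_nat_on C i)" using C by (simp add: U_def I_def j_def)
      then show "x \<in> (\<Union>i. U i)" by blast
    qed
    fix k show "bounded (U k)" by (simp add: U_def)
    show "diameter (U k) \<le> \<delta>"
    proof (cases "k \<in> I")
      case True
      then show ?thesis using diam[OF True] r[OF jC(1)[OF True]] by simp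
    qed (use \<open>0 < \<delta>\<close> in \<open>simp add: U_def\<close>)
  qed
  then have "hausdorff_premeasure DIM('a) \<delta> S \<le> (\<Sum>k. diam_cost DIM('a) (U k))"
    by (rule hausdorff_premeasure_le)
  also have "\<dots> \<le> (\<Sum>k. ennreal (s ^ DIM('a)) * emeasure lborel (B k))"
  proof (intro suminf_le)
    fix k
    show "diam_cost DIM('a) (U k) \<le> ennreal (s ^ DIM('a)) * emeasure lborel (B k)"
    proof (cases "k \<in> I")
      case True
      have r0: "0 < r (j k)" using r[OF jC(1)[OF True]] by simp
      have "unit_ball_vol DIM('a) * (diameter (U k) / 2) ^ DIM('a) \<le> unit_ball_vol DIM('a) * (s * r (j k)) ^ DIM('a)"
        using diam[OF True] by (intro mult_left_mono power_mono) (auto simp: U_def diameter_ge_0)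
      also have "\<dots> = s ^ DIM('a) * (unit_ball_vol DIM('a) * r (j k) ^ DIM('a))"
        by (simp add: power_mult_distrib)
      finally show ?thesis
        using True r0 s emeasure_cball[of "r (j k)" "a (j k)"]
        by (simp add: diam_cost_def B_def ennreal_mult'[symmetric] ennreal_leI)
    qed (simp add: U_def B_def diam_cost_def)
  qed auto
  also have "\<dots> = ennreal (s ^ DIM('a)) * (\<Sum>k. emeasure lborel (B k))"
    by simp
  also have "(\<Sum>k. emeasure lborel (B k)) = emeasure lborel (\<Union>k. B k)"
  proof (rule suminf_emeasure)
    show "range B \<subseteq> sets lborel" by (auto simp: B_def)
    show "disjoint_family B"
      unfolding disjoint_family_on_def
    proof (intro ballI impI)
      fix m n :: nat assume "m \<noteq> n"
      show "B m \<inter> B n = {}"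
      proof (cases "m \<in> I \<and> n \<in> I")
        case True
        then have "j m \<noteq> j n" using jC(2) \<open>m \<noteq> n\<close> by metis
        then show ?thesis using True disj jC(1) unfolding B_def pairwise_def disjnt_def by auto
      qed (auto simp: B_def)
    qed
  qed
  also have "emeasure lborel (\<Union>k. B k) \<le> emeasure lborel O'"
  proof (rule emeasure_mono)
    show "(\<Union>k. B k) \<subseteq> O'" using O(2)[OF jC(1)] by (intro UN_least) (simp add: B_def)
  qed (use O in simp)
  finally show ?thesis by (simp add: mult_left_mono)
qed

lemma hausdorff_premeasure_Un_le:
  assumes "0 < \<delta>"
  shows "hausdorff_premeasure d \<delta> (A \<union> B) \<le> hausdorff_premeasure d \<delta> A + hausdorff_premeasure d \<delta> B"
proof (rule outer_measure_Un_le[of "hausdorff_premeasure d \<delta>"])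
  show "hausdorff_premeasure d \<delta> {} = 0"
    using hausdorff_premeasure_le_outer[OF assms, of d "{}"] by simp
qed (rule hausdorff_premeasure_UN_le[OF assms])

lemma lmeasurable_outer_open:
  fixes S :: "'a::euclidean_space set"
  assumes S: "S \<in> lmeasurable" and "0 < e"
  obtains T where "open T" "S \<subseteq> T" "T \<in> lmeasurable" "measure lebesgue T < measure lebesgue S + e"
proof -
  obtain T where T: "open T" "S \<subseteq> T" "T - S \<in> lmeasurable" "emeasure lebesgue (T - S) < ennreal e"
    using sets_lebesgue_outer_open[OF fmeasurableD[OF S] \<open>0 < e\<close>] by blast
  have "measure lebesgue (T - S) < e"
    using T(3,4) \<open>0 < e\<close> by (simp add: emeasure_eq_measure2 ennreal_less_iff)
  moreover have "T = S \<union> (T - S)" using T(2) by blast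
  then have "T \<in> lmeasurable" "measure lebesgue T \<le> measure lebesgue S + measure lebesgue (T - S)"
    using S T(3) by (metis fmeasurable.Un, metis fmeasurableD measure_Un_le)
  ultimately show thesis using that T by fastforce
qed

text \<open>
  Vitali's lemma selects disjoint balls inside an open set of small volume such that their enlargements by
  the factor 5 cover \<open>N\<close>.
\<close>
lemma hausdorff_premeasure_negligible:
  fixes N :: "'a::euclidean_space set"
  assumes N: "negligible N" and d: "0 < \<delta>"
  shows "hausdorff_premeasure DIM('a) \<delta> N = 0"
proof -
  have "hausdorff_premeasure DIM('a) \<delta> N \<le> 0"
  proof (rule ennreal_le_epsilon)
    fix e :: real assume "0 < e"
    define e' where "e' = e / 5 ^ DIM('a)"
    have "0 < e'" using \<open>0 < e\<close> by (simp add: e'_def)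
    then obtain T where T: "open T" "N \<subseteq> T" "T \<in> lmeasurable" "measure lebesgue T < measure lebesgue N + e'"
      using lmeasurable_outer_open[OF negligible_imp_measurable[OF N]] by metis
    have "\<forall>x\<in>N. \<exists>r. 0 < r \<and> 5 * r \<le> \<delta> / 2 \<and> cball x r \<subseteq> T"
    proof
      fix x assume "x \<in> N"
      then obtain u where u: "0 < u" "cball x u \<subseteq> T" using T open_contains_cball by blast
      show "\<exists>r. 0 < r \<and> 5 * r \<le> \<delta> / 2 \<and> cball x r \<subseteq> T"
        by (rule exI[of _ "min u (\<delta> / 10)"]) (use u d in auto)
    qed
    then obtain r where r: "\<And>x. x \<in> N \<Longrightarrow> 0 < r x \<and> 5 * r x \<le> \<delta> / 2 \<and> cball x (r x) \<subseteq> T" by metis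
    obtain C where C: "countable C" "C \<subseteq> N"
      "pairwise (\<lambda>i j. disjnt (cball i (r i)) (cball j (r j))) C" "N \<subseteq> (\<Union>i\<in>C. cball i (5 * r i))"
      by (rule Vitali_covering_lemma_cballs[where S = N and K = N and a = "\<lambda>x. x" and r = r and B = \<delta>]) (use r d in force)+
    have "hausdorff_premeasure DIM('a) \<delta> N \<le> ennreal (5 ^ DIM('a)) * emeasure lborel T"
      by (rule hausdorff_premeasure_le_disjoint_balls[where a = "\<lambda>x. x", OF C(1,3)]) (use T r C d in auto)
    also have "emeasure lborel T \<le> ennreal e'"
    proof -
      have "emeasure lborel T = emeasure lebesgue T" using T(1) by simp
      also have "\<dots> = ennreal (measure lebesgue T)" using T(3) by (rule emeasure_eq_measure2)
      also have "\<dots> \<le> ennreal e'" using T(4) negligible_imp_measure0[OF N] by (intro ennreal_leI) simp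
      finally show ?thesis .
    qed
    finally have "hausdorff_premeasure DIM('a) \<delta> N \<le> ennreal (5 ^ DIM('a)) * ennreal e'"
      by (simp add: mult_left_mono)
    also have "\<dots> = ennreal e" using \<open>0 < e\<close> by (simp add: ennreal_mult'[symmetric] e'_def del: ennreal_numeral ennreal_power)
    finally show "hausdorff_premeasure DIM('a) \<delta> N \<le> 0 + ennreal e" by simp
  qed
  then show ?thesis by simp
qed

text \<open>
  The isodiametric inequality bounds the volume by the cost of any cover. Conversely, the Vitali covering
  theorem fills an open superset of almost the same volume with small disjoint balls that leave out only a
  null set of \<open>V\<close>, and for balls the cost is the volume.
\<close>
theorem hausdorff_outer_eq_lborel:
  fixes V :: "'a::euclidean_space set"
  assumes V: "V \<in> sets borel"
  shows "hausdorff_outer DIM('a) V = emeasure lborel V"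
proof (rule antisym)
  show "emeasure lborel V \<le> hausdorff_outer DIM('a) V"
    by (rule order_trans[OF lborel_le_hausdorff_premeasure[of V 1] hausdorff_premeasure_le_outer]) simp
  show "hausdorff_outer DIM('a) V \<le> emeasure lborel V"
  proof (rule hausdorff_outer_le, rule ennreal_le_epsilon)
    fix \<delta> e :: real assume d: "0 < \<delta>" and "emeasure lborel V < top" and e: "0 < e"
    then have Vm: "V \<in> lmeasurable" using V by (intro fmeasurableI) auto
    obtain T where T: "open T" "V \<subseteq> T" "T \<in> lmeasurable" "measure lebesgue T < measure lebesgue V + e"
      using lmeasurable_outer_open[OF Vm e] by metis
    define K where "K = {(x, r). x \<in> V \<and> 0 < r \<and> r \<le> \<delta> / 2 \<and> cball x r \<subseteq> T}"
    obtain C where C: "countable C" "C \<subseteq> K"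
      "pairwise (\<lambda>i j. disjnt (cball (fst i) (snd i)) (cball (fst j) (snd j))) C"
      "negligible (V - (\<Union>i\<in>C. cball (fst i) (snd i)))"
    proof (rule Vitali_covering_theorem_cballs[of K snd V fst])
      show "0 < snd i" if "i \<in> K" for i using that by (auto simp: K_def)
      fix x t assume "x \<in> V" "0 < (t::real)"
      then obtain u where u: "0 < u" "cball x u \<subseteq> T" using T open_contains_cball by blast
      define w where "w = min u (min (\<delta> / 2) (t / 2))"
      have "(x, w) \<in> K" using u d \<open>0 < t\<close> \<open>x \<in> V\<close> by (auto simp: K_def w_def)
      moreover have "w < t" using \<open>0 < t\<close> unfolding w_def by linarith
      moreover have "0 < w" using u d \<open>0 < t\<close> by (simp add: w_def)
      ultimately show "\<exists>i. i \<in> K \<and> x \<in> cball (fst i) (snd i) \<and> snd i < t"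
        by (intro exI[of _ "(x, w)"]) auto
    qed
    let ?W = "\<Union>i\<in>C. cball (fst i) (snd i)"
    have "hausdorff_premeasure DIM('a) \<delta> V \<le> hausdorff_premeasure DIM('a) \<delta> (?W \<union> (V - ?W))"
      by (rule hausdorff_premeasure_mono) auto
    also have "\<dots> \<le> hausdorff_premeasure DIM('a) \<delta> ?W + hausdorff_premeasure DIM('a) \<delta> (V - ?W)"
      by (rule hausdorff_premeasure_Un_le[OF d])
    also have "hausdorff_premeasure DIM('a) \<delta> (V - ?W) = 0"
      by (rule hausdorff_premeasure_negligible[OF C(4) d])
    also have "hausdorff_premeasure DIM('a) \<delta> ?W \<le> ennreal (1 ^ DIM('a)) * emeasure lborel T"
    proof (rule hausdorff_premeasure_le_disjoint_balls[OF C(1,3)])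
      fix i assume "i \<in> C"
      then have "i \<in> K" using C(2) by blast
      then show "cball (fst i) (snd i) \<subseteq> T" "0 < snd i \<and> 1 * snd i \<le> \<delta> / 2"
        by (auto simp: K_def simp del: subset_iff)
    qed (use T d in simp_all)
    also have "ennreal (1 ^ DIM('a)) * emeasure lborel T = emeasure lebesgue T" using T(1) by simp
    also have "\<dots> = ennreal (measure lebesgue T)" using T(3) by (rule emeasure_eq_measure2)
    also have "\<dots> \<le> ennreal (measure lebesgue V + e)" using T(4) by (intro ennreal_leI) simp
    also have "\<dots> = emeasure lborel V + ennreal e"
      using e V emeasure_eq_measure2[OF Vm] by (simp add: ennreal_plus)
    finally show "hausdorff_premeasure DIM('a) \<delta> V \<le> emeasure lborel V + ennreal e" by simp
  qed
qed

text \<open>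
  An isometry and its inverse are 1-Lipschitz and therefore preserve Hausdorff measure, which in the full
  dimension is Lebesgue measure.
\<close>
lemma emeasure_lborel_linear_isometry:
  fixes J :: "'a::euclidean_space \<Rightarrow> 'b::euclidean_space"
  assumes J: "linear J" "\<And>x. norm (J x) = norm x" and dim: "DIM('a) = DIM('b)" and A: "A \<in> sets borel"
  shows "emeasure lborel (J -` A) = emeasure lborel A"
proof -
  have inj: "inj J"
    unfolding linear_injective_0[OF J(1)] using J(2) by (metis norm_eq_zero)
  then have surj: "surj J"
    using linear_injective_imp_surjective[OF J(1)] dim by (simp add: dim_UNIV)
  have lip: "1-lipschitz_on S J" for S
    using J by (intro lipschitz_onI) (auto simp: dist_norm linear_diff[symmetric])
  have lip': "1-lipschitz_on S (inv J)" for S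
  proof (rule lipschitz_onI)
    fix x y
    have "norm (J (inv J x - inv J y)) = norm (x - y)"
      using J(1) surj by (simp add: linear_diff surj_f_inv_f)
    then show "dist (inv J x) (inv J y) \<le> 1 * dist x y" using J(2) by (simp add: dist_norm)
  qed simp
  have meas: "J -` A \<in> sets borel"
    using A J(1) by (intro measurable_sets_borel[of J borel] borel_measurable_continuous_onI
        linear_continuous_on linear_conv_bounded_linear[THEN iffD1])
  have im1: "J ` (J -` A) = A" by (rule surj_image_vimage_eq[OF surj])
  have im2: "inv J ` A = J -` A" using bij_vimage_eq_inv_image[OF bijI[OF inj surj], of A] by simp
  have "hausdorff_outer DIM('b) A \<le> hausdorff_outer DIM('a) (J -` A)"
    using hausdorff_outer_lipschitz_image[OF lip[of "J -` A"], of "DIM('b)"] unfolding im1 dim by simp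
  moreover have "hausdorff_outer DIM('a) (J -` A) \<le> hausdorff_outer DIM('b) A"
    using hausdorff_outer_lipschitz_image[OF lip'[of A], of "DIM('a)"] unfolding im2 dim by simp
  ultimately show ?thesis
    using hausdorff_outer_eq_lborel[OF A] hausdorff_outer_eq_lborel[OF meas] by simp
qed

section \<open>Gnomonic charts of spherical caps\<close>

definition unit_cone :: "'a::real_normed_vector set \<Rightarrow> 'a set" where
  "unit_cone E = {x. x \<noteq> 0 \<and> norm x \<le> 1 \<and> sgn x \<in> E}"

lemma borel_measurable_sgn [measurable]: "(sgn :: 'a::euclidean_space \<Rightarrow> 'a) \<in> borel_measurable borel"
  unfolding sgn_div_norm by measurable

lemma unit_cone_borel [measurable]:
  assumes [measurable]: "E \<in> sets borel"
  shows "unit_cone (E :: 'a::euclidean_space set) \<in> sets borel"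
  unfolding unit_cone_def by measurable

lemma emeasure_lborel_scaled_vimage:
  fixes V :: "'a::euclidean_space set"
  assumes V: "V \<in> sets borel" and t: "0 < t"
  shows "emeasure lborel {y. (1/t) *\<^sub>R y \<in> V} = ennreal (t ^ DIM('a)) * emeasure lborel V"
proof -
  have "{y. (1/t) *\<^sub>R y \<in> V} = (\<lambda>x. t *\<^sub>R x + 0) ` V"
  proof (intro equalityI subsetI)
    fix y assume "y \<in> {y. (1/t) *\<^sub>R y \<in> V}"
    then show "y \<in> (\<lambda>x. t *\<^sub>R x + 0) ` V"
      using t by (intro image_eqI[of _ _ "(1/t) *\<^sub>R y"]) auto
  qed (use t in auto)
  moreover have "{y. (1/t) *\<^sub>R y \<in> V} \<in> sets borel"
    using V by measurable
  ultimately show ?thesis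
    using emeasure_lebesgue_affine[of t 0 V] V t by simp
qed

lemma nn_integral_power_Ioc:
  "(\<integral>\<^sup>+t. ennreal (t ^ d) * indicator {0<..1} t \<partial>lborel) = ennreal (1 / (real d + 1))"
proof -
  have "((\<lambda>t::real. t ^ d) has_integral (1 ^ Suc d / real (Suc d) - 0 ^ Suc d / real (Suc d))) {0..1}"
    by (rule fundamental_theorem_of_calculus)
       (auto intro!: derivative_eq_intros simp: has_real_derivative_iff_has_vector_derivative[symmetric] simp del: power_Suc)
  then have int: "((\<lambda>t::real. t ^ d) has_integral (1 / (real d + 1))) {0..1}"
    by (simp add: add.commute)
  have "(\<integral>\<^sup>+t. ennreal (t ^ d) * indicator {0<..1} t \<partial>lborel) = (\<integral>\<^sup>+t. ennreal (t ^ d) * indicator {0..1} t \<partial>lborel)"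
  proof (rule nn_integral_cong_AE)
    have "AE t in lborel. t \<noteq> (0::real)" by (rule AE_lborel_singleton)
    then show "AE t in lborel. ennreal (t ^ d) * indicator {0<..1} t = ennreal (t ^ d) * indicator {0..1} t"
      by eventually_elim (auto simp: indicator_def)
  qed
  also have "\<dots> = (\<integral>\<^sup>+t. ennreal (indicator {0..1} t * t ^ d) \<partial>lborel)"
    by (rule nn_integral_cong) (auto simp: indicator_def)
  also have "\<dots> = ennreal (1 / (real d + 1))"
  proof (rule nn_integral_has_integral_lborel)
    show "((\<lambda>t. indicator {0..1} t * t ^ d) has_integral 1 / (real d + 1)) UNIV"
      using int unfolding has_integral_restrict_UNIV[of "{0..1}", symmetric]
      by (rule has_integral_eq[rotated]) (auto simp: indicator_def)
  qed (auto simp: indicator_def)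
  finally show ?thesis .
qed

text \<open>
  \<open>L\<close> embeds a Euclidean space isometrically as the hyperplane orthogonal to the unit vector \<open>e\<close>. Central
  projection of the affine hyperplane \<open>e + range L\<close> to the unit sphere is the chart \<open>proj\<close>.
\<close>
locale gnomonic =
  fixes L :: "'a::euclidean_space \<Rightarrow> 'b::euclidean_space" and e :: 'b
  assumes dim: "DIM('b) = Suc DIM('a)" and e: "norm e = 1"
    and L: "linear L" "\<And>y. norm (L y) = norm y" "\<And>y. L y \<bullet> e = 0"
begin

definition J :: "real \<times> 'a \<Rightarrow> 'b" where "J p = fst p *\<^sub>R e + L (snd p)"

lemma ee [simp]: "e \<bullet> e = 1"
  using e by (simp add: norm_eq_1)

lemma linear_J: "linear J"
  unfolding J_def by (intro linearI) (auto simp: linear_add[OF L(1)] linear_scale[OF L(1)] algebra_simps)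

lemma norm_J: "norm (J p) = norm p"
proof -
  have "(norm (J p))\<^sup>2 = (fst p)\<^sup>2 + (norm (L (snd p)))\<^sup>2"
    unfolding J_def power2_norm_eq_inner using L(3)[of "snd p"] L(3)[of "snd p", unfolded inner_commute[of "L (snd p)"]]
    by (simp add: inner_add_left inner_add_right power2_eq_square)
  also have "\<dots> = (norm p)\<^sup>2"
    using L(2) by (simp add: norm_prod_def)
  finally show ?thesis by (simp add: power2_eq_iff_nonneg)
qed

lemma J_inner: "J p \<bullet> e = fst p"
  by (simp add: J_def inner_add_left L(3))

lemma bij_J: "bij J"
proof -
  have "inj J"
    unfolding linear_injective_0[OF linear_J] using norm_J by (metis norm_eq_zero)
  then have "surj J"
    using linear_injective_imp_surjective[OF linear_J] dim by (simp add: dim_UNIV)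
  with \<open>inj J\<close> show ?thesis by (simp add: bij_def)
qed

lemma continuous_L: "continuous_on S L"
  using L(1) by (simp add: linear_continuous_on linear_conv_bounded_linear)

text \<open>
  The cone with apex 0 over the subset \<open>e + L ` V\<close> of the affine hyperplane, without its apex.
\<close>
definition flat_cone :: "'a set \<Rightarrow> 'b set" where
  "flat_cone V = J ` {p. 0 < fst p \<and> fst p \<le> 1 \<and> (1 / fst p) *\<^sub>R snd p \<in> V}"

lemma emeasure_flat_cone:
  assumes V[measurable]: "V \<in> sets borel"
  shows "flat_cone V \<in> sets borel"
    and "ennreal DIM('b) * emeasure lborel (flat_cone V) = emeasure lborel V"
proof -
  let ?P = "{p. 0 < fst p \<and> fst p \<le> 1 \<and> (1 / fst p) *\<^sub>R snd p \<in> V} :: (real \<times> 'a) set"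
  have P[measurable]: "?P \<in> sets borel"
  proof -
    have m: "(\<lambda>p :: real \<times> 'a. (1 / fst p) *\<^sub>R snd p) \<in> borel_measurable (borel \<Otimes>\<^sub>M borel)"
      by measurable
    have "{p \<in> space (borel \<Otimes>\<^sub>M borel). 0 < fst p \<and> fst p \<le> (1::real)} \<inter>
        ((\<lambda>p :: real \<times> 'a. (1 / fst p) *\<^sub>R snd p) -` V \<inter> space (borel \<Otimes>\<^sub>M borel)) \<in> sets (borel \<Otimes>\<^sub>M borel)"
      using measurable_sets[OF m V] by measurable
    also have "{p \<in> space (borel \<Otimes>\<^sub>M borel). 0 < fst p \<and> fst p \<le> (1::real)} \<inter>
        ((\<lambda>p :: real \<times> 'a. (1 / fst p) *\<^sub>R snd p) -` V \<inter> space (borel \<Otimes>\<^sub>M borel)) = ?P"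
      by (auto simp: space_pair_measure)
    finally have "?P \<in> sets (borel \<Otimes>\<^sub>M borel)" .
    then show ?thesis unfolding borel_prod .
  qed
  have contJ': "continuous_on UNIV (inv J)"
  proof -
    have "1-lipschitz_on UNIV (inv J)"
    proof (rule lipschitz_onI)
      fix x y
      have "J (inv J x - inv J y) = x - y"
        using bij_J by (simp add: linear_diff[OF linear_J] bij_is_surj surj_f_inv_f)
      then show "dist (inv J x) (inv J y) \<le> 1 * dist x y"
        using norm_J[of "inv J x - inv J y"] by (simp add: dist_norm)
    qed simp
    then show ?thesis by (rule lipschitz_on_continuous_on)
  qed
  have im: "flat_cone V = inv J -` ?P"
    unfolding flat_cone_def by (simp only: bij_vimage_eq_inv_image[OF bij_imp_bij_inv[OF bij_J]] inv_inv_eq[OF bij_J])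
  show fb: "flat_cone V \<in> sets borel"
    unfolding im by (intro measurable_sets_borel[OF borel_measurable_continuous_onI[OF contJ'] P])
  have "emeasure lborel (flat_cone V) = emeasure lborel (J -` flat_cone V)"
    using norm_J dim by (intro emeasure_lborel_linear_isometry[symmetric] linear_J fb) auto
  also have "J -` flat_cone V = ?P"
    unfolding flat_cone_def using bij_J by (simp add: bij_def inj_vimage_image_eq)
  also have "emeasure lborel ?P = emeasure (lborel \<Otimes>\<^sub>M lborel) ?P"
    by (simp add: lborel_prod)
  \<comment> \<open>The slice at height \<open>t\<close> is \<open>V\<close> scaled by \<open>t\<close>.\<close>
  also have "\<dots> = (\<integral>\<^sup>+t. emeasure lborel (Pair t -` ?P) \<partial>lborel)"
    by (rule lborel.emeasure_pair_measure_alt)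
       (simp only: sets_pair_measure_cong[OF sets_lborel sets_lborel] borel_prod P)
  also have "\<dots> = (\<integral>\<^sup>+t. ennreal (t ^ DIM('a)) * indicator {0<..1} t * emeasure lborel V \<partial>lborel)"
  proof (rule nn_integral_cong)
    fix t :: real
    show "emeasure lborel (Pair t -` ?P) = ennreal (t ^ DIM('a)) * indicator {0<..1} t * emeasure lborel V"
    proof (cases "0 < t \<and> t \<le> 1")
      case True
      then have "Pair t -` ?P = {y. (1/t) *\<^sub>R y \<in> V}" by auto
      then show ?thesis using True emeasure_lborel_scaled_vimage[OF V, of t] by simp
    next
      case False
      then have "Pair t -` ?P = {}" by auto
      then show ?thesis using False by (auto simp: indicator_def)
    qed
  qed
  also have "\<dots> = (\<integral>\<^sup>+t. ennreal (t ^ DIM('a)) * indicator {0<..1} t \<partial>lborel) * emeasure lborel V"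
    by (rule nn_integral_multc) measurable
  finally have "emeasure lborel (flat_cone V) = ennreal (1 / (real DIM('a) + 1)) * emeasure lborel V"
    by (simp only: nn_integral_power_Ioc)
  moreover have "ennreal DIM('b) * ennreal (1 / (real DIM('a) + 1)) = 1"
  proof -
    have "ennreal DIM('b) * ennreal (1 / (real DIM('a) + 1)) = ennreal (real DIM('b) * (1 / (real DIM('a) + 1)))"
      by (rule ennreal_mult'[symmetric]) simp
    also have "real DIM('b) * (1 / (real DIM('a) + 1)) = 1" using dim by simp
    finally show ?thesis by simp
  qed
  ultimately show "ennreal DIM('b) * emeasure lborel (flat_cone V) = emeasure lborel V"
    by (simp add: mult.assoc[symmetric])
qed

definition proj :: "'a \<Rightarrow> 'b" where "proj y = sgn (e + L y)"

lemma one_le_norm: "1 \<le> norm (e + L y)"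
proof -
  have "1 = (e + L y) \<bullet> e" by (simp add: inner_add_left L(3))
  also have "\<dots> \<le> norm (e + L y) * norm e" by (rule norm_cauchy_schwarz)
  finally show ?thesis using e by simp
qed

lemma eL_eq: "e + L y = (1 / (proj y \<bullet> e)) *\<^sub>R proj y" "0 < proj y \<bullet> e"
proof -
  have n: "0 < norm (e + L y)" using one_le_norm[of y] by linarith
  have "proj y \<bullet> e = 1 / norm (e + L y)"
    by (simp add: proj_def sgn_div_norm inner_add_left L(3) field_simps)
  then show "e + L y = (1 / (proj y \<bullet> e)) *\<^sub>R proj y" "0 < proj y \<bullet> e"
    using n by (auto simp: proj_def sgn_div_norm)
qed

lemma norm_proj: "norm (proj y) = 1"
  using one_le_norm[of y] by (auto simp: proj_def norm_sgn)

lemma continuous_proj: "continuous_on UNIV proj"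
  unfolding proj_def sgn_div_norm using one_le_norm
  by (intro continuous_intros continuous_L) (metis norm_zero not_one_le_zero)

text \<open>
  With \<open>a = norm a * p\<close> and \<open>b = norm b * q\<close> one has \<open>norm (a - b)^2 = (norm a - norm b)^2 + norm a *
  norm b * norm (p - q)^2\<close>, and both norms are at least 1.
\<close>
lemma proj_lipschitz: "1-lipschitz_on S proj"
proof (rule lipschitz_onI)
  fix y z
  let ?a = "e + L y" and ?b = "e + L z"
  have ab: "1 \<le> norm ?a" "1 \<le> norm ?b" by (rule one_le_norm)+
  define p where "p = proj y" define q where "q = proj z"
  have pq: "?a = norm ?a *\<^sub>R p" "?b = norm ?b *\<^sub>R q" "p \<bullet> p = 1" "q \<bullet> q = 1"
  proof -
    have "?a \<noteq> 0" "?b \<noteq> 0" using ab by auto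
    then show "?a = norm ?a *\<^sub>R p" "?b = norm ?b *\<^sub>R q"
      by (simp_all add: p_def q_def proj_def sgn_div_norm)
    show "p \<bullet> p = 1" "q \<bullet> q = 1"
      using norm_proj by (simp_all add: p_def q_def flip: norm_eq_1)
  qed
  have pq1: "p \<bullet> q \<le> 1" using norm_cauchy_schwarz[of p q] pq(3,4) by (simp add: norm_eq_sqrt_inner)
  have "(norm (?a - ?b))\<^sup>2 = (norm (norm ?a *\<^sub>R p - norm ?b *\<^sub>R q))\<^sup>2" using pq by metis
  also have "\<dots> = (norm ?a)\<^sup>2 + (norm ?b)\<^sup>2 - 2 * (norm ?a * norm ?b) * (p \<bullet> q)"
    unfolding power2_norm_eq_inner[of "_ - _"] using pq(3,4)
    by (simp add: inner_diff_left inner_diff_right inner_commute[of q p] power2_eq_square algebra_simps)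
  also have "\<dots> = (norm ?a - norm ?b)\<^sup>2 + (norm ?a * norm ?b) * (2 - 2 * (p \<bullet> q))"
    by (simp add: power2_eq_square algebra_simps)
  also have "\<dots> \<ge> 1 * (2 - 2 * (p \<bullet> q))"
  proof -
    have "1 * 1 \<le> norm ?a * norm ?b" using ab by (intro mult_mono) auto
    then have "1 * (2 - 2 * (p \<bullet> q)) \<le> (norm ?a * norm ?b) * (2 - 2 * (p \<bullet> q))"
      using pq1 by (intro mult_right_mono) auto
    then show ?thesis using zero_le_power2[of "norm ?a - norm ?b"] by linarith
  qed
  finally have "2 - 2 * (p \<bullet> q) \<le> (norm (?a - ?b))\<^sup>2" by simp
  moreover have "(norm (p - q))\<^sup>2 = 2 - 2 * (p \<bullet> q)"
    unfolding power2_norm_eq_inner using pq(3,4) by (simp add: inner_diff_left inner_diff_right inner_commute[of q p])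
  ultimately have "norm (p - q) \<le> norm (?a - ?b)" by (metis norm_ge_zero power2_le_imp_le)
  also have "?a - ?b = L (y - z)" by (simp add: linear_diff[OF L(1)])
  finally show "dist (proj y) (proj z) \<le> 1 * dist y z"
    by (simp add: dist_norm p_def q_def L(2))
qed simp

text \<open>
  On the cap where \<open>\<xi> \<bullet> e > c\<close> the chart is 1-Lipschitz and its inverse is Lipschitz with a constant that
  tends to 1 as \<open>c\<close> tends to 1, so the Hausdorff measure of \<open>E\<close> is close to the Lebesgue measure of
  its preimage \<open>V\<close>. The latter is the dimension times the volume of the flat cone over \<open>V\<close>, which
  contains the cone over \<open>E\<close> and is contained in it after scaling by \<open>c\<close>.
\<close>
lemma cap_bounds_gnomonic:
  assumes c: "0 < c" "c < 1" and E: "E \<in> sets borel" "E \<subseteq> {\<xi>. norm \<xi> = 1 \<and> c < \<xi> \<bullet> e}"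
  shows "ennreal (c ^ DIM('b)) * hausdorff_outer DIM('a) E \<le> ennreal DIM('b) * emeasure lborel (unit_cone E)"
    and "ennreal DIM('b) * emeasure lborel (unit_cone E)
      \<le> ennreal ((1 / c + sqrt (2 - 2 * c) / c\<^sup>2) ^ DIM('a)) * hausdorff_outer DIM('a) E"
proof -
  define V where "V = proj -` E"
  have V: "V \<in> sets borel"
    unfolding V_def by (intro measurable_sets_borel[OF borel_measurable_continuous_onI[OF continuous_proj] E(1)])
  have Jproj: "sgn (J (t, y)) = proj ((1/t) *\<^sub>R y)" if "0 < t" for t y
  proof -
    have "J (t, y) = t *\<^sub>R (e + L ((1/t) *\<^sub>R y))"
      using that by (simp add: J_def linear_scale[OF L(1)] scaleR_add_right)
    then show ?thesis using that by (simp add: proj_def sgn_scaleR)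
  qed
  have EV: "E = proj ` V"
  proof (intro equalityI subsetI)
    fix \<xi> assume xi: "\<xi> \<in> E"
    then have n: "norm \<xi> = 1" "0 < \<xi> \<bullet> e" using E(2) c by auto
    obtain t y where ty: "\<xi> = J (t, y)" using bij_J by (metis bij_pointE surj_pair)
    then have "0 < t" using n J_inner[of "(t, y)"] by simp
    moreover have "sgn \<xi> = \<xi>" using n by (simp add: sgn_div_norm)
    ultimately have "\<xi> = proj ((1/t) *\<^sub>R y)" using Jproj[of t y] ty by simp
    then show "\<xi> \<in> proj ` V" using xi by (auto simp: V_def)
  qed (auto simp: V_def)
  have sub1: "unit_cone E \<subseteq> flat_cone V"
  proof
    fix x assume x: "x \<in> unit_cone E"
    then have nx: "0 < norm x" "norm x \<le> 1" "sgn x \<in> E" by (auto simp: unit_cone_def)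
    obtain t y where ty: "x = J (t, y)" using bij_J by (metis bij_pointE surj_pair)
    have "0 < sgn x \<bullet> e" using nx E(2) c by auto
    then have "0 < x \<bullet> e" using nx by (simp add: sgn_div_norm zero_less_mult_iff)
    then have t0: "0 < t" using J_inner[of "(t, y)"] ty by simp
    have "x \<bullet> e \<le> norm x * norm e" by (rule norm_cauchy_schwarz)
    then have "t \<le> 1" using J_inner[of "(t, y)"] ty nx e by simp
    moreover have "(1/t) *\<^sub>R y \<in> V" using Jproj[OF t0, of y] nx(3) ty by (simp add: V_def)
    ultimately show "x \<in> flat_cone V" unfolding flat_cone_def using t0 ty by force
  qed
  have sub2: "(\<lambda>x. c *\<^sub>R x + 0) ` flat_cone V \<subseteq> unit_cone E"
  proof
    fix z assume "z \<in> (\<lambda>x. c *\<^sub>R x + 0) ` flat_cone V"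
    then obtain t y where ty: "0 < t" "t \<le> 1" "(1/t) *\<^sub>R y \<in> V" "z = c *\<^sub>R J (t, y)"
      by (auto simp: flat_cone_def)
    let ?x = "J (t, y)"
    have inE: "sgn ?x \<in> E" using Jproj[OF ty(1), of y] ty(3) by (simp add: V_def)
    have x0: "?x \<noteq> 0" using J_inner[of "(t, y)"] ty(1) by auto
    have "c < sgn ?x \<bullet> e" using inE E(2) by auto
    also have "\<dots> = t / norm ?x" using J_inner[of "(t, y)"] by (simp add: sgn_div_norm divide_inverse mult.commute)
    finally have "c * norm ?x < t" using x0 by (simp add: field_simps)
    then have "norm z \<le> 1" using ty c by simp
    moreover have "sgn z = sgn ?x" using ty(4) c by (simp add: sgn_scaleR)
    ultimately show "z \<in> unit_cone E" using inE x0 ty(4) c by (simp add: unit_cone_def)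
  qed
  note flat = emeasure_flat_cone[OF V]
  have V1: "ennreal DIM('b) * emeasure lborel (unit_cone E) \<le> emeasure lborel V"
    unfolding flat(2)[symmetric] by (intro mult_left_mono emeasure_mono sub1) (use flat(1) in auto)
  have "ennreal (c ^ DIM('b)) * emeasure lborel (flat_cone V) = emeasure lebesgue ((\<lambda>x. c *\<^sub>R x + 0) ` flat_cone V)"
    using emeasure_lebesgue_affine[of c 0 "flat_cone V"] flat(1) c by simp
  also have "\<dots> \<le> emeasure lebesgue (unit_cone E)"
    using unit_cone_borel[OF E(1)] by (intro emeasure_mono sub2) auto
  also have "\<dots> = emeasure lborel (unit_cone E)" using unit_cone_borel[OF E(1)] by simp
  finally have "ennreal DIM('b) * (ennreal (c ^ DIM('b)) * emeasure lborel (flat_cone V)) \<le> ennreal DIM('b) * emeasure lborel (unit_cone E)"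
    by (rule mult_left_mono) simp
  then have V2: "ennreal (c ^ DIM('b)) * emeasure lborel V \<le> ennreal DIM('b) * emeasure lborel (unit_cone E)"
    unfolding flat(2)[symmetric] by (simp only: mult.left_commute)
  have "hausdorff_outer DIM('a) E \<le> emeasure lborel V"
    using hausdorff_outer_lipschitz_image[OF proj_lipschitz[of V], of "DIM('a)"] hausdorff_outer_eq_lborel[OF V]
    by (simp add: EV[symmetric])
  then have "ennreal (c ^ DIM('b)) * hausdorff_outer DIM('a) E \<le> ennreal (c ^ DIM('b)) * emeasure lborel V"
    by (rule mult_left_mono) simp
  with V2 show "ennreal (c ^ DIM('b)) * hausdorff_outer DIM('a) E \<le> ennreal DIM('b) * emeasure lborel (unit_cone E)"
    by (rule order_trans[rotated])
  let ?C = "1 / c + sqrt (2 - 2 * c) / c\<^sup>2"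
  have C0: "0 < ?C" using c by (intro add_pos_nonneg) auto
  \<comment> \<open>Two points of the hyperplane differ by the difference of their projections scaled by \<open>1 / a\<close> and by the
    change of the scaling; the latter is small since \<open>\<xi> - \<eta>\<close> is orthogonal to \<open>\<xi> + \<eta>\<close>, which is nearly
    parallel to \<open>e\<close>.\<close>
  have bilip: "dist y z \<le> ?C * dist (proj y) (proj z)" if "y \<in> V" "z \<in> V" for y z
  proof -
    define \<xi> where "\<xi> = proj y"
    define \<eta> where "\<eta> = proj z"
    define a where "a = \<xi> \<bullet> e"
    define b where "b = \<eta> \<bullet> e"
    have ab: "c < a" "c < b" using that E(2) by (auto simp: a_def b_def \<xi>_def \<eta>_def V_def)
    have n: "\<xi> \<bullet> \<xi> = 1" "\<eta> \<bullet> \<eta> = 1" using norm_proj by (simp_all add: \<xi>_def \<eta>_def norm_eq_1)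
    have "L (y - z) = (1 / a) *\<^sub>R \<xi> - (1 / b) *\<^sub>R \<eta>"
      using eL_eq(1)[of y] eL_eq(1)[of z] linear_diff[OF L(1), of y z]
      by (simp add: a_def b_def \<xi>_def \<eta>_def) (metis add_diff_cancel_left)
    also have "\<dots> = (1 / a) *\<^sub>R (\<xi> - \<eta>) + ((b - a) / (a * b)) *\<^sub>R \<eta>"
    proof -
      have "(b - a) / (a * b) = 1 / a - 1 / b" using ab c by (simp add: field_simps)
      then show ?thesis by (simp only: scaleR_diff_right scaleR_diff_left) simp
    qed
    finally have eq: "L (y - z) = (1 / a) *\<^sub>R (\<xi> - \<eta>) + ((b - a) / (a * b)) *\<^sub>R \<eta>" .
    have nn: "norm \<eta> = 1" using norm_proj by (simp add: \<eta>_def)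
    have "norm (y - z) = norm (L (y - z))" by (simp only: L(2))
    also have "\<dots> \<le> norm ((1 / a) *\<^sub>R (\<xi> - \<eta>)) + norm (((b - a) / (a * b)) *\<^sub>R \<eta>)"
      unfolding eq by (rule norm_triangle_ineq)
    also have "\<dots> = (1 / a) * norm (\<xi> - \<eta>) + \<bar>b - a\<bar> / (a * b)"
      using ab c by (simp add: nn abs_mult)
    finally have bound: "norm (y - z) \<le> (1 / a) * norm (\<xi> - \<eta>) + \<bar>b - a\<bar> / (a * b)" .
    have ba: "\<bar>b - a\<bar> \<le> sqrt (2 - 2 * c) * norm (\<xi> - \<eta>)"
    proof -
      have orth: "(\<xi> - \<eta>) \<bullet> (\<xi> + \<eta>) = 0"
        using n by (simp add: inner_diff_left inner_add_right inner_commute[of \<eta> \<xi>])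
      have half: "norm (e - (1/2) *\<^sub>R (\<xi> + \<eta>)) \<le> sqrt (2 - 2 * c)"
      proof -
        have d: "norm (e - \<zeta>) \<le> sqrt (2 - 2 * c)" if "\<zeta> \<bullet> \<zeta> = 1" "c < \<zeta> \<bullet> e" for \<zeta>
        proof (rule real_le_rsqrt)
          show "(norm (e - \<zeta>))\<^sup>2 \<le> 2 - 2 * c"
            unfolding power2_norm_eq_inner using that by (simp add: inner_diff_left inner_diff_right inner_commute[of e \<zeta>])
        qed
        have "e - (1/2) *\<^sub>R (\<xi> + \<eta>) = (1/2) *\<^sub>R ((e - \<xi>) + (e - \<eta>))"
        proof -
          have "(e - \<xi>) + (e - \<eta>) = (e + e) - (\<xi> + \<eta>)" by simp
          then show ?thesis by (simp only: scaleR_right_diff_distrib scaleR_half_double)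
        qed
        then have "norm (e - (1/2) *\<^sub>R (\<xi> + \<eta>)) = (1/2) * norm ((e - \<xi>) + (e - \<eta>))"
          by simp
        also have "\<dots> \<le> (1/2) * (norm (e - \<xi>) + norm (e - \<eta>))"
          by (intro mult_left_mono norm_triangle_ineq) simp
        also have "\<dots> \<le> sqrt (2 - 2 * c)"
          using d[of \<xi>] d[of \<eta>] n ab by (simp add: a_def b_def)
        finally show ?thesis .
      qed
      have "\<bar>b - a\<bar> = \<bar>(\<xi> - \<eta>) \<bullet> e\<bar>" by (simp add: a_def b_def inner_diff_left abs_minus_commute)
      also have "(\<xi> - \<eta>) \<bullet> e = (\<xi> - \<eta>) \<bullet> (e - (1/2) *\<^sub>R (\<xi> + \<eta>))"
        using orth by (simp add: inner_diff_right[of "\<xi> - \<eta>" e])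
      also have "\<bar>\<dots>\<bar> \<le> norm (\<xi> - \<eta>) * norm (e - (1/2) *\<^sub>R (\<xi> + \<eta>))"
        by (rule Cauchy_Schwarz_ineq2)
      also have "\<dots> \<le> norm (\<xi> - \<eta>) * sqrt (2 - 2 * c)"
        by (intro mult_left_mono half) simp
      finally show ?thesis by (simp add: mult.commute)
    qed
    have "(1 / a) * norm (\<xi> - \<eta>) \<le> (1 / c) * norm (\<xi> - \<eta>)"
      using ab c by (intro mult_right_mono frac_le) auto
    moreover have "\<bar>b - a\<bar> / (a * b) \<le> (sqrt (2 - 2 * c) * norm (\<xi> - \<eta>)) / c\<^sup>2"
    proof (rule frac_le[OF _ ba])
      show "c\<^sup>2 \<le> a * b" unfolding power2_eq_square using ab c by (intro mult_mono) auto
    qed (use c in auto)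
    ultimately have "norm (y - z) \<le> (1 / c) * norm (\<xi> - \<eta>) + (sqrt (2 - 2 * c) * norm (\<xi> - \<eta>)) / c\<^sup>2"
      using bound by linarith
    also have "\<dots> = ?C * norm (\<xi> - \<eta>)" by (simp add: algebra_simps)
    finally show ?thesis by (simp add: dist_norm \<xi>_def \<eta>_def)
  qed
  define \<rho> where "\<rho> = inv_into V proj"
  have inj: "inj_on proj V"
    using bilip by (intro inj_onI) (metis dist_self mult_zero_right dist_le_zero_iff)
  have \<rho>: "\<rho> ` E = V" unfolding EV \<rho>_def by (rule inv_into_image_cancel[OF inj]) simp
  have "?C-lipschitz_on E \<rho>"
  proof (rule lipschitz_onI)
    fix \<xi> \<eta> assume "\<xi> \<in> E" "\<eta> \<in> E"
    then have "\<rho> \<xi> \<in> V" "\<rho> \<eta> \<in> V" "proj (\<rho> \<xi>) = \<xi>" "proj (\<rho> \<eta>) = \<eta>"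
      unfolding \<rho>_def EV by (auto intro: inv_into_into f_inv_into_f)
    then show "dist (\<rho> \<xi>) (\<rho> \<eta>) \<le> ?C * dist \<xi> \<eta>" using bilip by metis
  qed (use C0 in simp)
  from hausdorff_outer_lipschitz_image[OF this C0, of "DIM('a)"]
  have "emeasure lborel V \<le> ennreal (?C ^ DIM('a)) * hausdorff_outer DIM('a) E"
    unfolding \<rho> by (simp only: hausdorff_outer_eq_lborel[OF V])
  with V1 show "ennreal DIM('b) * emeasure lborel (unit_cone E) \<le> ennreal (?C ^ DIM('a)) * hausdorff_outer DIM('a) E"
    by (rule order_trans)
qed

end

section \<open>Hausdorff measure on the sphere as cone volume\<close>

text \<open>
  An index type with one element less, so that the chart of the sphere in \<open>real^'n\<close> has a Euclidean space
  as its domain. A type cannot be empty, hence the case distinction for a single index; dimension one is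
  treated separately.
\<close>
typedef ('n::finite) pred_index = "{i::'n. CARD('n) = 1 \<or> i \<noteq> (SOME j. True)}"
proof (cases "CARD('n) = 1")
  case False
  then have "UNIV \<noteq> {SOME j :: 'n. True}"
    by (metis card_1_singleton_iff card.empty One_nat_def is_singletonI is_singleton_altdef)
  then show ?thesis by auto
qed auto

instance pred_index :: (finite) finite
proof
  have "finite (Rep_pred_index ` (UNIV :: 'a pred_index set))" by simp
  then show "finite (UNIV :: 'a pred_index set)"
    by (rule finite_imageD) (simp add: Rep_pred_index_inject inj_on_def)
qed

lemma CARD_pred_index:
  assumes "CARD('n::finite) \<noteq> 1"
  shows "CARD('n) = Suc CARD('n pred_index)"
proof -
  have "CARD('n pred_index) = card {i::'n. CARD('n) = 1 \<or> i \<noteq> (SOME j. True)}"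
    by (rule type_definition.card[OF type_definition_pred_index])
  also have "{i::'n. CARD('n) = 1 \<or> i \<noteq> (SOME j. True)} = UNIV - {SOME j. True}"
    using assms by auto
  also have "card \<dots> = CARD('n) - 1" by simp
  finally show ?thesis using zero_less_card_finite[where 'a = 'n] by simp
qed

lemma exists_gnomonic:
  fixes e :: "'b::euclidean_space"
  assumes "DIM('b) = Suc DIM('a)" "norm e = 1"
  obtains L :: "'a::euclidean_space \<Rightarrow> 'b" where "gnomonic L e"
proof -
  have e0: "e \<noteq> 0" using assms(2) by auto
  obtain L :: "'a \<Rightarrow> 'b" where L: "linear L" "L \<in> UNIV \<rightarrow> {x. e \<bullet> x = 0}" "\<And>x. x \<in> UNIV \<Longrightarrow> norm (L x) = norm x"
  proof (rule isometry_subset_subspace[of "UNIV :: 'a set" "{x. e \<bullet> x = 0}"])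
    show "subspace {x. e \<bullet> x = 0}" by (rule subspace_hyperplane)
    show "dim (UNIV :: 'a set) \<le> dim {x. e \<bullet> x = 0}"
      using dim_hyperplane[OF e0] assms(1) by simp
  qed auto
  then have "gnomonic L e"
    using assms by (auto simp: gnomonic_def inner_commute)
  then show thesis by (rule that)
qed

lemma hausdorff_outer_0_singleton: "hausdorff_outer 0 {e} = 1"
proof (rule antisym)
  show "hausdorff_outer 0 {e} \<le> 1"
  proof (rule hausdorff_outer_le)
    fix \<delta> :: real assume "0 < \<delta>"
    let ?U = "\<lambda>i::nat. if i = 0 then {e} else {}"
    have "?U \<in> fine_covers \<delta> {e}" using \<open>0 < \<delta>\<close> by (auto simp: fine_covers_def)
    then have "hausdorff_premeasure 0 \<delta> {e} \<le> (\<Sum>i. diam_cost 0 (?U i))"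
      by (rule hausdorff_premeasure_le)
    also have "\<dots> = (\<Sum>i\<in>{0::nat}. diam_cost 0 (?U i))"
      by (rule suminf_finite) (auto simp: diam_cost_def)
    also have "\<dots> = 1" by (simp add: diam_cost_def)
    finally show "hausdorff_premeasure 0 \<delta> {e} \<le> 1" .
  qed
  have "1 \<le> hausdorff_premeasure 0 1 {e}"
  proof (rule le_hausdorff_premeasure)
    fix U assume "U \<in> fine_covers 1 {e}"
    then obtain i where "e \<in> U i" by (auto simp: fine_covers_def)
    then have "1 = diam_cost 0 (U i)" by (auto simp: diam_cost_def)
    also have "\<dots> \<le> (\<Sum>i. diam_cost 0 (U i))"
      using sum_le_suminf[of "\<lambda>i. diam_cost 0 (U i)" "{i}"] by simp
    finally show "1 \<le> (\<Sum>i. diam_cost 0 (U i))" .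
  qed
  also have "\<dots> \<le> hausdorff_outer 0 {e}" by (rule hausdorff_premeasure_le_outer) simp
  finally show "1 \<le> hausdorff_outer 0 {e}" .
qed

text \<open>
  On the line a cap is a single point, whose counting measure is the length of the half-open segment from
  0 to it.
\<close>
lemma cap_eq_dim1:
  fixes e :: "'b::euclidean_space"
  assumes dim: "DIM('b) = 1" and e: "norm e = 1" and c: "0 < c"
    and E: "E \<subseteq> {\<xi>. norm \<xi> = 1 \<and> c < \<xi> \<bullet> e}"
  shows "hausdorff_outer 0 E = emeasure lborel (unit_cone E)"
proof -
  have lin: "linear (\<lambda>t::real. t *\<^sub>R e)" by (simp add: linear_scaleR_left)
  have ee: "e \<bullet> e = 1" using e by (simp add: norm_eq_1)
  have inj: "inj (\<lambda>t::real. t *\<^sub>R e)" using e by (intro injI) auto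
  have surj: "surj (\<lambda>t::real. t *\<^sub>R e)"
    using linear_injective_imp_surjective[OF lin inj] dim by (simp add: dim_UNIV)
  have "E \<subseteq> {e}"
  proof
    fix \<xi> assume xi: "\<xi> \<in> E"
    obtain t where t: "\<xi> = t *\<^sub>R e" using surj by (metis surjD)
    then have "\<bar>t\<bar> = 1" "c < t" using xi E e ee by auto
    then show "\<xi> \<in> {e}" using t c by simp
  qed
  then consider "E = {}" | "E = {e}" by blast
  then show ?thesis
  proof cases
    case 1
    then show ?thesis by (simp add: unit_cone_def)
  next
    case 2
    have m: "unit_cone E \<in> sets borel" unfolding 2 by (rule unit_cone_borel) simp
    have "emeasure lborel (unit_cone E) = emeasure lborel ((\<lambda>t::real. t *\<^sub>R e) -` unit_cone E)"
      using e dim by (intro emeasure_lborel_linear_isometry[symmetric] lin m) auto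
    also have "(\<lambda>t::real. t *\<^sub>R e) -` unit_cone E = {0<..1}"
    proof (intro equalityI subsetI)
      fix t :: real assume "t \<in> (\<lambda>t::real. t *\<^sub>R e) -` unit_cone E"
      then have "t \<noteq> 0" "\<bar>t\<bar> \<le> 1" "sgn (t *\<^sub>R e) = e"
        using e 2 by (auto simp: unit_cone_def)
      moreover have "sgn e = e" using e by (simp add: sgn_div_norm)
      ultimately have "sgn t *\<^sub>R e = 1 *\<^sub>R e" by (simp add: sgn_scaleR)
      then have "sgn t = 1" using inj by (metis injD)
      then have "0 < t" by (simp add: sgn_if split: if_splits)
      then show "t \<in> {0<..1}" using \<open>\<bar>t\<bar> \<le> 1\<close> by simp
    next
      fix t :: real assume "t \<in> {0<..1}"
      moreover have "sgn e = e" using e by (simp add: sgn_div_norm)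
      moreover have "e \<noteq> 0" using e by auto
      ultimately show "t \<in> (\<lambda>t::real. t *\<^sub>R e) -` unit_cone E"
        using e 2 by (auto simp: unit_cone_def sgn_scaleR)
    qed
    finally show ?thesis by (simp add: 2 hausdorff_outer_0_singleton)
  qed
qed

text \<open>
  A Lipschitz constant of the inverse chart on the cap \<open>\<xi> \<bullet> e > c\<close>.
\<close>
definition cap_const :: "real \<Rightarrow> real" where "cap_const c = 1 / c + sqrt (2 - 2 * c) / c\<^sup>2"

definition between_caps :: "nat \<Rightarrow> real \<Rightarrow> ennreal \<Rightarrow> ennreal \<Rightarrow> bool" where
  "between_caps n c h k \<longleftrightarrow> ennreal (c ^ n) * h \<le> k \<and> k \<le> ennreal (cap_const c ^ (n - 1)) * h"

lemma between_caps_add: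
  "between_caps n c h k \<Longrightarrow> between_caps n c h' k' \<Longrightarrow> between_caps n c (h + h') (k + k')"
  unfolding between_caps_def by (auto simp: distrib_left intro: add_mono)

lemma cap_bounds:
  fixes e :: "real^'n"
  assumes c: "0 < c" "c < 1" and e: "norm e = 1" and E: "E \<in> sets borel" "E \<subseteq> {\<xi>. norm \<xi> = 1 \<and> c < \<xi> \<bullet> e}"
  shows "between_caps CARD('n) c (hausdorff_outer (CARD('n) - 1) E) (ennreal CARD('n) * emeasure lborel (unit_cone E))"
proof (cases "CARD('n) = 1")
  case True
  have "ennreal c * emeasure lborel (unit_cone E) \<le> 1 * emeasure lborel (unit_cone E)"
    using c by (intro mult_right_mono) (auto simp: ennreal_le_1)
  then show ?thesis
    using cap_eq_dim1[OF _ e c(1) E(2)] True by (simp add: between_caps_def)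
next
  case False
  have dim: "DIM(real^'n) = Suc DIM(real^'n pred_index)" using CARD_pred_index[OF False] by simp
  obtain L :: "real^'n pred_index \<Rightarrow> real^'n" where "gnomonic L e"
    using exists_gnomonic[OF dim e] .
  then interpret gnomonic L e .
  have d: "DIM(real^'n pred_index) = CARD('n) - 1" "DIM(real^'n) = CARD('n)" using dim by simp_all
  show ?thesis
    using cap_bounds_gnomonic[OF c E] unfolding d between_caps_def cap_const_def by blast
qed

lemma sphere_bounds_finite_caps:
  fixes T :: "(real^'n) set"
  assumes c: "0 < c" "c < 1" and "finite T" "\<And>e. e \<in> T \<Longrightarrow> norm e = 1"
    and E: "E \<in> sets borel" "E \<subseteq> (\<Union>e\<in>T. {\<xi>. norm \<xi> = 1 \<and> c < \<xi> \<bullet> e})"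
  shows "between_caps CARD('n) c (hausdorff_outer (CARD('n) - 1) E) (ennreal CARD('n) * emeasure lborel (unit_cone E))"
  using assms(3-)
proof (induction T arbitrary: E rule: finite_induct)
  case empty
  then have "E = {}" by auto
  then show ?case by (simp add: between_caps_def unit_cone_def)
next
  case (insert e T)
  let ?C = "{\<xi> :: real^'n. norm \<xi> = 1 \<and> c < \<xi> \<bullet> e}"
  have C: "?C \<in> sets borel"
  proof -
    have "?C = sphere 0 1 \<inter> {\<xi>. c < \<xi> \<bullet> e}" by auto
    moreover have "open {\<xi>. c < \<xi> \<bullet> e}" using open_halfspace_gt[of c e] by (simp add: inner_commute)
    ultimately show ?thesis by (simp add: borel_closed borel_open)
  qed
  let ?A = "E \<inter> ?C" and ?B = "E - ?C"
  have AB: "?A \<in> sets borel" "?B \<in> sets borel" using C insert.prems(2) by auto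
  have 1: "between_caps CARD('n) c (hausdorff_outer (CARD('n) - 1) ?A) (ennreal CARD('n) * emeasure lborel (unit_cone ?A))"
    by (rule cap_bounds[OF c _ AB(1)]) (use insert.prems(1) in auto)
  have 2: "between_caps CARD('n) c (hausdorff_outer (CARD('n) - 1) ?B) (ennreal CARD('n) * emeasure lborel (unit_cone ?B))"
    by (rule insert.IH[OF _ AB(2)]) (use insert.prems in auto)
  have un: "?A \<union> ?B = E" "?A \<inter> ?B = {}" by auto
  have "hausdorff_outer (CARD('n) - 1) ?A + hausdorff_outer (CARD('n) - 1) ?B = hausdorff_outer (CARD('n) - 1) E"
    using plus_emeasure[of ?A "hausdorff_measure (CARD('n) - 1)" ?B] AB un insert.prems(2)
    by (simp add: emeasure_hausdorff_measure)
  moreover have "emeasure lborel (unit_cone ?A) + emeasure lborel (unit_cone ?B) = emeasure lborel (unit_cone E)"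
  proof -
    have "unit_cone ?A \<union> unit_cone ?B = unit_cone E" "unit_cone ?A \<inter> unit_cone ?B = {}"
      by (auto simp: unit_cone_def)
    then show ?thesis
      using plus_emeasure[of "unit_cone ?A" lborel "unit_cone ?B"] unit_cone_borel[OF AB(1)] unit_cone_borel[OF AB(2)]
      by simp
  qed
  ultimately show ?case
    using between_caps_add[OF 1 2] by (simp add: distrib_left[symmetric])
qed

text \<open>
  Finitely many caps of the same aperture cover the compact sphere, and both sides are additive, so the
  bounds for caps carry over to \<open>E\<close> with the same constants. These tend to 1 when the caps shrink.
\<close>
theorem hausdorff_outer_sphere:
  fixes E :: "(real^'n) set"
  assumes E: "E \<in> sets borel" "E \<subseteq> sphere 0 1"
  shows "hausdorff_outer (CARD('n) - 1) E = ennreal CARD('n) * emeasure lborel (unit_cone E)"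
proof -
  define h where "h = hausdorff_outer (CARD('n) - 1) E"
  define k where "k = ennreal CARD('n) * emeasure lborel (unit_cone E)"
  have bounds: "between_caps CARD('n) c h k" if c: "0 < c" "c < 1" for c
  proof -
    have op: "open {\<xi> :: real^'n. c < \<xi> \<bullet> e}" for e
      using open_halfspace_gt[of c e] by (simp add: inner_commute)
    have "sphere (0 :: real^'n) 1 \<subseteq> (\<Union>e\<in>sphere 0 1. {\<xi>. c < \<xi> \<bullet> e})"
      using c by (auto simp: norm_eq_1)
    then obtain T where T: "T \<subseteq> sphere (0 :: real^'n) 1" "finite T" "sphere 0 1 \<subseteq> (\<Union>e\<in>T. {\<xi>. c < \<xi> \<bullet> e})"
      using compactE_image[OF compact_sphere, of "sphere 0 1" "\<lambda>e. {\<xi>. c < \<xi> \<bullet> e}" 0 1] op by metis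
    show ?thesis unfolding h_def k_def
    proof (rule sphere_bounds_finite_caps[OF c T(2)])
      show "norm e = 1" if "e \<in> T" for e using T(1) that by auto
      show "E \<subseteq> (\<Union>e\<in>T. {\<xi>. norm \<xi> = 1 \<and> c < \<xi> \<bullet> e})" using T(3) E(2) by fastforce
    qed (rule E)
  qed
  have kfin: "k < top"
  proof -
    have "emeasure lborel (unit_cone E) \<le> emeasure lborel (cball (0 :: real^'n) 1)"
      by (rule emeasure_mono) (auto simp: unit_cone_def)
    also have "\<dots> < top" using emeasure_lborel_cball_finite by simp
    finally show ?thesis unfolding k_def by (simp add: ennreal_mult_less_top)
  qed
  \<comment> \<open>The limit of the bounds only makes sense for finite values; the lower bound for \<open>c = 1/2\<close> gives finiteness.\<close>
  have hfin: "h < top"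
  proof (rule ccontr)
    assume "\<not> h < top"
    then have "h = top" by (metis less_top)
    then have "ennreal ((1/2) ^ CARD('n)) * h = top" by (simp add: ennreal_mult_top)
    moreover have "ennreal ((1/2) ^ CARD('n)) * h \<le> k" using bounds[of "1/2"] by (simp add: between_caps_def)
    ultimately show False using kfin by (simp add: top_unique)
  qed
  define h' where "h' = enn2real h"
  define k' where "k' = enn2real k"
  have hk: "h = ennreal h'" "k = ennreal k'" "0 \<le> h'" "0 \<le> k'"
    using hfin kfin by (auto simp: h'_def k'_def)
  have cap0: "0 \<le> cap_const c" if "0 < c" "c < 1" for c
    using that by (simp add: cap_const_def)
  have ev: "\<forall>\<^sub>F c in at_left 1. c ^ CARD('n) * h' \<le> k' \<and> k' \<le> cap_const c ^ (CARD('n) - 1) * h'"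
  proof -
    have "\<forall>\<^sub>F c::real in at_left 1. 0 < c \<and> c < 1"
      by (rule eventually_at_leftI[of 0]) auto
    then show ?thesis
    proof eventually_elim
      case (elim c)
      have "ennreal (c ^ CARD('n) * h') \<le> ennreal k'" "ennreal k' \<le> ennreal (cap_const c ^ (CARD('n) - 1) * h')"
        using bounds[of c] elim hk cap0[of c] by (simp_all add: between_caps_def ennreal_mult')
      then show ?case
        using hk elim cap0[of c] by (simp add: ennreal_le_iff)
    qed
  qed
  have "((\<lambda>c::real. c ^ CARD('n) * h') \<longlongrightarrow> 1 ^ CARD('n) * h') (at_left 1)"
    by (intro tendsto_intros)
  then have le1: "1 ^ CARD('n) * h' \<le> k'"
    by (rule tendsto_upperbound) (use ev in \<open>auto elim: eventually_mono\<close>)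
  have "((\<lambda>c. cap_const c ^ (CARD('n) - 1) * h') \<longlongrightarrow> (1 / 1 + sqrt (2 - 2 * 1) / 1\<^sup>2) ^ (CARD('n) - 1) * h') (at_left 1)"
    unfolding cap_const_def by (intro tendsto_intros) auto
  then have "k' \<le> (1 / 1 + sqrt (2 - 2 * 1) / 1\<^sup>2) ^ (CARD('n) - 1) * h'"
    by (rule tendsto_lowerbound) (use ev in \<open>auto elim: eventually_mono\<close>)
  with le1 have "h' = k'" by simp
  then show ?thesis using hk by (simp add: h_def k_def)
qed

section \<open>Polar coordinates\<close>

definition sphere_measure :: "(real^'n) measure" where
  "sphere_measure = density (hausdorff_measure (CARD('n) - 1)) (indicator (sphere 0 1))"

lemma sets_sphere_measure [simp, measurable_cong]: "sets (sphere_measure :: (real^'n) measure) = sets borel"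
  by (simp add: sphere_measure_def)

lemma space_sphere_measure [simp]: "space (sphere_measure :: (real^'n) measure) = UNIV"
  by (simp add: sphere_measure_def)

lemma emeasure_sphere_measure:
  fixes A :: "(real^'n) set"
  assumes A: "A \<in> sets borel"
  shows "emeasure sphere_measure A = ennreal CARD('n) * emeasure lborel (unit_cone A)"
proof -
  have S: "sphere 0 1 \<in> sets (borel :: (real^'n) measure)" by (simp add: borel_closed)
  have "emeasure sphere_measure A = (\<integral>\<^sup>+\<xi>. indicator (sphere 0 1) \<xi> * indicator A \<xi> \<partial>hausdorff_measure (CARD('n) - 1))"
    unfolding sphere_measure_def using A S by (intro emeasure_density borel_measurable_indicator) simp_all
  also have "\<dots> = (\<integral>\<^sup>+\<xi>. indicator (sphere 0 1 \<inter> A) \<xi> \<partial>hausdorff_measure (CARD('n) - 1))"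
    by (rule nn_integral_cong) (auto simp: indicator_def)
  also have "\<dots> = emeasure (hausdorff_measure (CARD('n) - 1)) (sphere 0 1 \<inter> A)"
    using A S by (intro nn_integral_indicator) auto
  also have "\<dots> = hausdorff_outer (CARD('n) - 1) (sphere 0 1 \<inter> A)"
    using A S by (intro emeasure_hausdorff_measure) auto
  also have "\<dots> = ennreal CARD('n) * emeasure lborel (unit_cone (sphere 0 1 \<inter> A))"
    using A S by (intro hausdorff_outer_sphere) auto
  also have "unit_cone (sphere 0 1 \<inter> A) = unit_cone A"
    by (auto simp: unit_cone_def norm_sgn)
  finally show ?thesis .
qed

lemma finite_measure_sphere_measure: "finite_measure (sphere_measure :: (real^'n) measure)"
proof (rule finite_measureI)
  have "emeasure lborel (unit_cone (UNIV :: (real^'n) set)) \<le> emeasure lborel (cball (0 :: real^'n) 1)"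
    by (rule emeasure_mono) (auto simp: unit_cone_def)
  also have "\<dots> < top" using emeasure_lborel_cball_finite by simp
  finally show "emeasure (sphere_measure :: (real^'n) measure) (space sphere_measure) \<noteq> \<infinity>"
    by (simp add: emeasure_sphere_measure ennreal_mult_eq_top_iff)
qed

text \<open>
  The density of Lebesgue measure in the variable \<open>u\<close> when the radius is written as \<open>1 + \<rho> u\<close>.
\<close>
definition shell_weight :: "nat \<Rightarrow> real \<Rightarrow> real \<Rightarrow> real" where
  "shell_weight n \<rho> u = (if 0 < 1 + \<rho> * u then \<rho> * (1 + \<rho> * u) ^ (n - 1) else 0)"

lemma borel_measurable_shell_weight [measurable]: "shell_weight n \<rho> \<in> borel_measurable borel"
  unfolding shell_weight_def by measurable

lemma nn_integral_shell_weight: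
  assumes n: "0 < n" and \<rho>: "0 < \<rho>"
  shows "(\<integral>\<^sup>+u. ennreal (shell_weight n \<rho> u) * indicator {..b} u \<partial>lborel)
    = ennreal ((if 0 < 1 + \<rho> * b then (1 + \<rho> * b) ^ n else 0) / real n)"
proof (cases "0 < 1 + \<rho> * b")
  case False
  have "ennreal (shell_weight n \<rho> u) * indicator {..b} u = 0" for u
  proof (cases "u \<le> b")
    case True
    then have "\<rho> * u \<le> \<rho> * b" using \<rho> by simp
    then show ?thesis using False by (simp add: shell_weight_def)
  qed simp
  then have "(\<integral>\<^sup>+u. ennreal (shell_weight n \<rho> u) * indicator {..b} u \<partial>lborel) = (\<integral>\<^sup>+u. 0 \<partial>(lborel :: real measure))"
    by (intro nn_integral_cong)
  then show ?thesis using False by simp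
next
  case True
  let ?a = "- 1 / \<rho>"
  have ab: "?a \<le> b" using True \<rho> by (simp add: field_simps)
  have "((\<lambda>u. \<rho> * (1 + \<rho> * u) ^ (n - 1)) has_integral ((1 + \<rho> * b) ^ n / real n - (1 + \<rho> * ?a) ^ n / real n)) {?a..b}"
  proof (rule fundamental_theorem_of_calculus[OF ab])
    fix x assume "x \<in> {?a..b}"
    show "((\<lambda>u. (1 + \<rho> * u) ^ n / real n) has_vector_derivative \<rho> * (1 + \<rho> * x) ^ (n - 1)) (at x within {?a..b})"
      unfolding has_real_derivative_iff_has_vector_derivative[symmetric]
      using n by (auto intro!: derivative_eq_intros)
  qed
  then have int: "((\<lambda>u. \<rho> * (1 + \<rho> * u) ^ (n - 1)) has_integral ((1 + \<rho> * b) ^ n / real n)) {?a..b}"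
    using n \<rho> by (simp add: zero_power)
  have "(\<integral>\<^sup>+u. ennreal (shell_weight n \<rho> u) * indicator {..b} u \<partial>lborel)
      = (\<integral>\<^sup>+u. ennreal (indicator {?a..b} u * (\<rho> * (1 + \<rho> * u) ^ (n - 1))) \<partial>lborel)"
  proof (rule nn_integral_cong_AE)
    have "AE u in lborel. u \<noteq> ?a" by (rule AE_lborel_singleton)
    then show "AE u in lborel. ennreal (shell_weight n \<rho> u) * indicator {..b} u
        = ennreal (indicator {?a..b} u * (\<rho> * (1 + \<rho> * u) ^ (n - 1)))"
    proof eventually_elim
      case (elim u)
      have "0 < 1 + \<rho> * u \<longleftrightarrow> ?a < u" using \<rho> by (simp add: field_simps, linarith)
      then show ?case using elim by (auto simp: indicator_def shell_weight_def)
    qed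
  qed
  also have "\<dots> = ennreal ((1 + \<rho> * b) ^ n / real n)"
  proof (rule nn_integral_has_integral_lborel)
    show "((\<lambda>u. indicator {?a..b} u * (\<rho> * (1 + \<rho> * u) ^ (n - 1))) has_integral (1 + \<rho> * b) ^ n / real n) UNIV"
      using int unfolding has_integral_restrict_UNIV[of "{?a..b}", symmetric]
      by (rule has_integral_eq[rotated]) (auto simp: indicator_def)
    have "0 \<le> 1 + \<rho> * x" if "?a \<le> x" for x
    proof -
      have "\<rho> * ?a \<le> \<rho> * x" using that \<rho> by (intro mult_left_mono) auto
      then show ?thesis using \<rho> by simp
    qed
    then show "0 \<le> indicator {?a..b} x * (\<rho> * (1 + \<rho> * x) ^ (n - 1))" for x
      using \<rho> by (auto simp: indicator_def)
  qed measurable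
  finally show ?thesis using True by simp
qed

text \<open>
  The set is the cone over \<open>A\<close>, scaled to the radius \<open>1 + \<rho> b\<close>, up to the origin.
\<close>
lemma emeasure_shell:
  fixes A :: "(real^'n) set"
  assumes A: "A \<in> sets borel" and \<rho>: "0 < \<rho>"
  shows "emeasure lborel {x. sgn x \<in> A \<and> (norm x - 1) / \<rho> \<le> b}
    = emeasure sphere_measure A * ennreal ((if 0 < 1 + \<rho> * b then (1 + \<rho> * b) ^ CARD('n) else 0) / real CARD('n))"
proof -
  let ?R = "1 + \<rho> * b"
  have le: "(norm x - 1) / \<rho> \<le> b \<longleftrightarrow> norm x \<le> ?R" for x :: "real^'n"
    using \<rho> by (auto simp: field_simps)
  have AE0: "AE x in lborel. x \<noteq> (0 :: real^'n)" by (rule AE_lborel_singleton)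
  have m: "{x. sgn x \<in> A \<and> (norm x - 1) / \<rho> \<le> b} \<in> sets lborel"
    using A by measurable
  show ?thesis
  proof (cases "0 < ?R")
    case False
    have "emeasure lborel {x. sgn x \<in> A \<and> (norm x - 1) / \<rho> \<le> b} = emeasure lborel ({} :: (real^'n) set)"
    proof (rule emeasure_eq_AE)
      show "AE x in lborel. x \<in> {x. sgn x \<in> A \<and> (norm x - 1) / \<rho> \<le> b} \<longleftrightarrow> x \<in> {}"
        using AE0
      proof eventually_elim
        case (elim x)
        then have "0 < norm x" by simp
        with False have "\<not> norm x \<le> ?R" by linarith
        then show ?case unfolding le by blast
      qed
    qed (use m in auto)
    then show ?thesis using False by simp
  next
    case True
    have "emeasure lborel {x. sgn x \<in> A \<and> (norm x - 1) / \<rho> \<le> b} = emeasure lborel {y. (1/?R) *\<^sub>R y \<in> unit_cone A}"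
    proof (rule emeasure_eq_AE)
      show "AE x in lborel. x \<in> {x. sgn x \<in> A \<and> (norm x - 1) / \<rho> \<le> b} \<longleftrightarrow> x \<in> {y. (1/?R) *\<^sub>R y \<in> unit_cone A}"
        using AE0
      proof eventually_elim
        case (elim x)
        have "norm ((1/?R) *\<^sub>R x) \<le> 1 \<longleftrightarrow> norm x \<le> ?R" using True by (simp add: field_simps)
        moreover have "sgn ((1/?R) *\<^sub>R x) = sgn x" using True by (simp add: sgn_scaleR)
        moreover have "(1/?R) *\<^sub>R x \<noteq> 0" using elim True by simp
        ultimately show ?case unfolding unit_cone_def le by auto
      qed
    qed (use m unit_cone_borel[OF A] in measurable)
    also have "\<dots> = ennreal (?R ^ CARD('n)) * emeasure lborel (unit_cone A)"
      using emeasure_lborel_scaled_vimage[OF unit_cone_borel[OF A] True] by simp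
    also have "\<dots> = emeasure sphere_measure A * ennreal (?R ^ CARD('n) / real CARD('n))"
    proof -
      have "ennreal CARD('n) * ennreal (?R ^ CARD('n) / real CARD('n)) = ennreal (real CARD('n) * (?R ^ CARD('n) / real CARD('n)))"
        by (rule ennreal_mult'[symmetric]) simp
      then have "ennreal CARD('n) * ennreal (?R ^ CARD('n) / real CARD('n)) = ennreal (?R ^ CARD('n))" by simp
      then show ?thesis
        unfolding emeasure_sphere_measure[OF A] by (metis mult.assoc mult.commute)
    qed
    finally show ?thesis using True by simp
  qed
qed

lemma emeasure_shell_density:
  assumes "0 < n" "0 < \<rho>"
  shows "emeasure (density lborel (\<lambda>u. ennreal (shell_weight n \<rho> u))) {..b}
    = ennreal ((if 0 < 1 + \<rho> * b then (1 + \<rho> * b) ^ n else 0) / real n)"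
  using nn_integral_shell_weight[OF assms, of b] by (subst emeasure_density) auto

lemma sigma_finite_shell:
  assumes "0 < \<rho>" "0 < n"
  shows "sigma_finite_measure (density lborel (\<lambda>u. ennreal (shell_weight n \<rho> u)))"
proof (rule sigma_finite_measure.intro, intro exI[of _ "range (\<lambda>i::nat. {..real i})"] conjI)
  show "\<Union> (range (\<lambda>i::nat. {..real i})) = space (density lborel (\<lambda>u. ennreal (shell_weight n \<rho> u)))"
    using real_arch_simple by auto
  show "\<forall>a\<in>range (\<lambda>i::nat. {..real i}). emeasure (density lborel (\<lambda>u. ennreal (shell_weight n \<rho> u))) a \<noteq> \<infinity>"
    using assms by (simp add: emeasure_shell_density)
qed auto

text \<open>
  A product measure is determined by its values on rectangles. For a fixed spherical set \<open>A\<close> both sides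
  are measures in the radial variable, and these agree on the intervals \<open>{..b}\<close> by \<open>emeasure_shell\<close>.
\<close>
theorem polar_coordinates:
  assumes \<rho>: "0 < \<rho>"
  shows "distr lborel (borel \<Otimes>\<^sub>M borel) (\<lambda>x :: real^'n. (sgn x, (norm x - 1) / \<rho>))
    = sphere_measure \<Otimes>\<^sub>M density lborel (\<lambda>u. ennreal (shell_weight CARD('n) \<rho> u))"
    (is "?N = ?S \<Otimes>\<^sub>M ?W")
proof (rule pair_measure_eqI[symmetric])
  interpret S: finite_measure "sphere_measure :: (real^'n) measure" by (rule finite_measure_sphere_measure)
  show "sigma_finite_measure ?S" ..
  have card: "0 < CARD('n)" by simp
  have Wb: "emeasure ?W {..b} = ennreal ((if 0 < 1 + \<rho> * b then (1 + \<rho> * b) ^ CARD('n) else 0) / real CARD('n))" for b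
    by (rule emeasure_shell_density[OF card \<rho>])
  have Un: "(\<Union>i::nat. {..real i}) = UNIV" using real_arch_simple by auto
  show "sigma_finite_measure ?W" by (rule sigma_finite_shell[OF \<rho> card])
  have meas: "(\<lambda>x :: real^'n. (sgn x, (norm x - 1) / \<rho>)) \<in> lborel \<rightarrow>\<^sub>M borel \<Otimes>\<^sub>M borel" by measurable
  show "sets (?S \<Otimes>\<^sub>M ?W) = sets ?N" by (simp cong: sets_pair_measure_cong)
  fix A :: "(real^'n) set" and B :: "real set" assume "A \<in> sets ?S" "B \<in> sets ?W"
  then have A: "A \<in> sets borel" and B: "B \<in> sets borel" by auto
  let ?X = "\<lambda>B. {x. sgn x \<in> A \<and> (norm x - 1) / \<rho> \<in> B}"
  have N: "emeasure ?N (A \<times> B) = emeasure lborel (?X B)" if "B \<in> sets borel" for B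
  proof -
    have "(\<lambda>x :: real^'n. (sgn x, (norm x - 1) / \<rho>)) -` (A \<times> B) \<inter> space lborel = ?X B" by auto
    then show ?thesis using A that by (subst emeasure_distr[OF meas]) auto
  qed
  define \<mu> where "\<mu> = distr (density lborel (indicator {x :: real^'n. sgn x \<in> A})) borel (\<lambda>x. (norm x - 1) / \<rho>)"
  define \<nu> where "\<nu> = scale_measure (emeasure ?S A) ?W"
  have mA: "{x :: real^'n. sgn x \<in> A} \<in> sets borel" using A by measurable
  have mu: "emeasure \<mu> B = emeasure lborel (?X B)" if B: "B \<in> sets borel" for B
  proof -
    have m2: "?X B \<in> sets borel" using A B by measurable
    have "emeasure \<mu> B = emeasure (density lborel (indicator {x :: real^'n. sgn x \<in> A})) {x. (norm x - 1) / \<rho> \<in> B}"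
      unfolding \<mu>_def using B by (subst emeasure_distr) (auto simp: vimage_def)
    also have "\<dots> = (\<integral>\<^sup>+x. indicator {x. sgn x \<in> A} x * indicator {x. (norm x - 1) / \<rho> \<in> B} x \<partial>lborel)"
      using mA B by (intro emeasure_density) auto
    also have "\<dots> = (\<integral>\<^sup>+x. indicator (?X B) x \<partial>lborel)"
      by (rule nn_integral_cong) (auto simp: indicator_def)
    also have "\<dots> = emeasure lborel (?X B)" using m2 by (intro nn_integral_indicator) auto
    finally show ?thesis .
  qed
  have bs: "sets (borel :: real measure) = sigma_sets UNIV (range (\<lambda>b::real. {..b}))"
    by (subst borel_eq_atMost) (rule sets_measure_of, simp)
  have "\<mu> = \<nu>"
  proof (rule measure_eqI_generator_eq[of "range (\<lambda>b::real. {..b})" UNIV \<mu> \<nu> "\<lambda>i. {..real i}"])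
    show "Int_stable (range (\<lambda>b::real. {..b}))" by (auto simp: Int_stable_def)
    show "emeasure \<mu> X = emeasure \<nu> X" if range: "X \<in> range (\<lambda>b::real. {..b})" for X
    proof -
      obtain b where X: "X = {..b}" using range by auto
      have "emeasure \<mu> X = emeasure lborel {x. sgn x \<in> A \<and> (norm x - 1) / \<rho> \<le> b}"
        unfolding X by (subst mu) auto
      also have "\<dots> = emeasure \<nu> X"
        unfolding X \<nu>_def using emeasure_shell[OF A \<rho>, of b] by (simp add: Wb)
      finally show ?thesis .
    qed
    show "sets \<mu> = sigma_sets UNIV (range (\<lambda>b::real. {..b}))" "sets \<nu> = sigma_sets UNIV (range (\<lambda>b::real. {..b}))"
      unfolding \<mu>_def \<nu>_def by (simp_all add: bs)
    show "emeasure \<mu> {..real i} \<noteq> \<infinity>" for i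
    proof -
      have "emeasure \<mu> {..real i} = emeasure ?S A * ennreal ((if 0 < 1 + \<rho> * real i then (1 + \<rho> * real i) ^ CARD('n) else 0) / real CARD('n))"
        using emeasure_shell[OF A \<rho>, of "real i"] by (subst mu) auto
      then show ?thesis using S.emeasure_finite[of A] by (simp add: ennreal_mult_eq_top_iff)
    qed
  qed (use Un in auto)
  then have "emeasure \<mu> B = emeasure \<nu> B" by simp
  then show "emeasure ?S A * emeasure ?W B = emeasure ?N (A \<times> B)"
    using N[OF B] mu[OF B] by (simp add: \<nu>_def)
qed

lemma
  fixes \<Phi> :: "real^'n \<Rightarrow> real"
  assumes \<Phi>[measurable]: "\<Phi> \<in> borel_measurable borel" and \<rho>: "0 < \<rho>"
  defines "\<Psi> \<equiv> (\<lambda>p. shell_weight CARD('n) \<rho> (snd p) * \<Phi> ((1 + \<rho> * snd p) *\<^sub>R fst p))"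
  shows integrable_polar: "integrable lborel \<Phi> \<longleftrightarrow> integrable (sphere_measure \<Otimes>\<^sub>M lborel) \<Psi>"
    and integral_polar: "(\<integral>x. \<Phi> x \<partial>lborel) = (\<integral>p. \<Psi> p \<partial>(sphere_measure \<Otimes>\<^sub>M lborel))"
proof -
  interpret S: finite_measure "sphere_measure :: (real^'n) measure" by (rule finite_measure_sphere_measure)
  let ?w = "\<lambda>u. shell_weight CARD('n) \<rho> u" and ?g = "\<lambda>p :: (real^'n) \<times> real. \<Phi> ((1 + \<rho> * snd p) *\<^sub>R fst p)"
  have w0: "0 \<le> ?w u" for u using \<rho> by (simp add: shell_weight_def)
  have g[measurable]: "?g \<in> borel_measurable (borel \<Otimes>\<^sub>M borel)" by measurable
  have g': "?g \<in> borel_measurable (sphere_measure \<Otimes>\<^sub>M lborel)" 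
    using g by (simp cong: measurable_cong_sets sets_pair_measure_cong)
  have T: "(\<lambda>x :: real^'n. (sgn x, (norm x - 1) / \<rho>)) \<in> lborel \<rightarrow>\<^sub>M borel \<Otimes>\<^sub>M borel" by measurable
  \<comment> \<open>At the origin the radial variable is \<open>- 1 / \<rho>\<close>, so the factor \<open>1 + \<rho> u\<close> vanishes as it should.\<close>
  have comp: "?g (sgn x, (norm x - 1) / \<rho>) = \<Phi> x" for x
    using \<rho> by (cases "x = 0") (simp_all add: sgn_div_norm)
  have dens: "sphere_measure \<Otimes>\<^sub>M density lborel (\<lambda>u. ennreal (?w u))
      = density (sphere_measure \<Otimes>\<^sub>M lborel) (\<lambda>p :: (real^'n) \<times> real. ennreal (?w (snd p)))"
  proof -
    have "density sphere_measure (\<lambda>_. 1) \<Otimes>\<^sub>M density lborel (\<lambda>u. ennreal (?w u))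
      = density (sphere_measure \<Otimes>\<^sub>M lborel) (\<lambda>(x :: real^'n, y). 1 * ennreal (?w y))"
    proof (rule pair_measure_density)
      show "sigma_finite_measure (density lborel (\<lambda>u. ennreal (?w u)))"
        by (rule sigma_finite_shell[OF \<rho>]) simp
    qed (auto intro: lborel.sigma_finite_measure_axioms)
    then show ?thesis by (simp add: density_1 case_prod_beta')
  qed
  have wm: "(\<lambda>p :: (real^'n) \<times> real. ?w (snd p)) \<in> borel_measurable (sphere_measure \<Otimes>\<^sub>M lborel)" by measurable
  have "integrable lborel \<Phi> \<longleftrightarrow> integrable (distr lborel (borel \<Otimes>\<^sub>M borel) (\<lambda>x :: real^'n. (sgn x, (norm x - 1) / \<rho>))) ?g"
    by (subst integrable_distr_eq[OF T g]) (simp only: comp)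
  also have "\<dots> \<longleftrightarrow> integrable (density (sphere_measure \<Otimes>\<^sub>M lborel) (\<lambda>p :: (real^'n) \<times> real. ennreal (?w (snd p)))) ?g"
    unfolding polar_coordinates[OF \<rho>] dens ..
  also have "\<dots> \<longleftrightarrow> integrable (sphere_measure \<Otimes>\<^sub>M lborel) \<Psi>"
    unfolding \<Psi>_def by (subst integrable_density[OF g' wm]) (auto simp: w0)
  finally show "integrable lborel \<Phi> \<longleftrightarrow> integrable (sphere_measure \<Otimes>\<^sub>M lborel) \<Psi>" .
  have "(\<integral>x. \<Phi> x \<partial>lborel) = (\<integral>p. ?g p \<partial>distr lborel (borel \<Otimes>\<^sub>M borel) (\<lambda>x :: real^'n. (sgn x, (norm x - 1) / \<rho>)))"
    by (subst integral_distr[OF T g]) (simp only: comp)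
  also have "\<dots> = (\<integral>p. ?g p \<partial>density (sphere_measure \<Otimes>\<^sub>M lborel) (\<lambda>p :: (real^'n) \<times> real. ennreal (?w (snd p))))"
    unfolding polar_coordinates[OF \<rho>] dens ..
  also have "\<dots> = (\<integral>p. \<Psi> p \<partial>(sphere_measure \<Otimes>\<^sub>M lborel))"
    unfolding \<Psi>_def by (subst integral_density[OF g' wm]) (auto simp: w0)
  finally show "(\<integral>x. \<Phi> x \<partial>lborel) = (\<integral>p. \<Psi> p \<partial>(sphere_measure \<Otimes>\<^sub>M lborel))" .
qed

section \<open>Symmetric matrices\<close>

lemma linear_coefficient_zero:
  fixes a b :: real
  assumes "\<And>t. 2 * t * a + t\<^sup>2 * b \<le> 0"
  shows "a = 0"
proof (rule ccontr)
  assume a: "a \<noteq> 0"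
  define t where "t = a / (\<bar>b\<bar> + 1)"
  have b: "0 < \<bar>b\<bar> + 1" by simp
  have a_eq: "a = t * (\<bar>b\<bar> + 1)" using b by (simp add: t_def)
  have "2 * t * a + t\<^sup>2 * b = t\<^sup>2 * (2 * (\<bar>b\<bar> + 1) + b)"
    by (simp add: a_eq power2_eq_square algebra_simps)
  moreover have "0 < t\<^sup>2" using a b by (simp add: t_def)
  moreover have "0 < 2 * (\<bar>b\<bar> + 1) + b" by (cases "0 \<le> b") auto
  ultimately have "0 < 2 * t * a + t\<^sup>2 * b" by simp
  with assms[of t] show False by simp
qed

text \<open>
  A maximum of the quadratic form on the unit sphere of an invariant subspace is an eigenvector, since the
  first variation in every direction vanishes, and its orthogonal complement in the subspace is again
  invariant.
\<close>
lemma self_adjoint_orthonormal_eigenbasis: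
  fixes f :: "'a::euclidean_space \<Rightarrow> 'a"
  assumes f: "linear f" and sa: "\<And>x y. f x \<bullet> y = x \<bullet> f y"
  shows "subspace S \<Longrightarrow> f ` S \<subseteq> S \<Longrightarrow>
    \<exists>B. B \<subseteq> S \<and> pairwise orthogonal B \<and> (\<forall>b\<in>B. norm b = 1 \<and> (\<exists>c. f b = c *\<^sub>R b)) \<and> span B = S"
proof (induction "dim S" arbitrary: S rule: less_induct)
  case less
  show ?case
  proof (cases "S = {0}")
    case True
    then show ?thesis by (intro exI[of _ "{}"]) auto
  next
    case False
    then obtain x0 where x0: "x0 \<in> S" "x0 \<noteq> 0" using subspace_0[OF less.prems(1)] by blast
    have contf: "continuous_on UNIV f" using f by (simp add: linear_continuous_on linear_conv_bounded_linear)
    have "compact (S \<inter> sphere 0 1)"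
      using closed_subspace[OF less.prems(1)] by (simp add: closed_Int_compact)
    moreover have "(1 / norm x0) *\<^sub>R x0 \<in> S \<inter> sphere 0 1"
      using x0 subspace_scale[OF less.prems(1)] by simp
    moreover have "continuous_on (S \<inter> sphere 0 1) (\<lambda>x. x \<bullet> f x)"
      by (intro continuous_intros continuous_on_subset[OF contf]) auto
    ultimately obtain v where v: "v \<in> S \<inter> sphere 0 1" "\<And>x. x \<in> S \<inter> sphere 0 1 \<Longrightarrow> x \<bullet> f x \<le> v \<bullet> f v"
      using continuous_attains_sup[of "S \<inter> sphere 0 1" "\<lambda>x. x \<bullet> f x"] by blast
    define c where "c = v \<bullet> f v"
    have vS: "v \<in> S" and vv: "v \<bullet> v = 1" using v(1) by (auto simp: norm_eq_1)
    have homog: "x \<bullet> f x \<le> c * (x \<bullet> x)" if x: "x \<in> S" for x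
    proof (cases "x = 0")
      case False
      let ?y = "(1 / norm x) *\<^sub>R x"
      have y: "?y \<in> S \<inter> sphere 0 1" using x False subspace_scale[OF less.prems(1)] by simp
      have "?y \<bullet> f ?y \<le> c" unfolding c_def by (rule v(2)[OF y])
      then have "(x \<bullet> f x) / (norm x)\<^sup>2 \<le> c"
        by (simp add: linear_scale[OF f] power2_eq_square)
      then show ?thesis using False by (simp add: field_simps power2_norm_eq_inner)
    qed (simp add: linear_0[OF f])
    \<comment> \<open>The linear coefficient in \<open>t\<close> of the form along \<open>v + t w\<close> vanishes at a maximum.\<close>
    have orth: "w \<bullet> (f v - c *\<^sub>R v) = 0" if w: "w \<in> S" for w
    proof -
      have "w \<bullet> f v - c * (w \<bullet> v) = 0"
      proof (rule linear_coefficient_zero)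
        fix t :: real
        have "v + t *\<^sub>R w \<in> S" using w vS less.prems(1) by (simp add: subspace_add subspace_scale)
        then have "(v + t *\<^sub>R w) \<bullet> f (v + t *\<^sub>R w) \<le> c * ((v + t *\<^sub>R w) \<bullet> (v + t *\<^sub>R w))" by (rule homog)
        moreover have "v \<bullet> f w = w \<bullet> f v" using sa[of v w] by (simp add: inner_commute)
        ultimately show "2 * t * (w \<bullet> f v - c * (w \<bullet> v)) + t\<^sup>2 * (w \<bullet> f w - c * (w \<bullet> w)) \<le> 0"
          using vv c_def
          by (simp add: linear_add[OF f] linear_scale[OF f] inner_add_left inner_add_right inner_commute[of v w]
              power2_eq_square algebra_simps)
      qed
      then show ?thesis by (simp add: inner_diff_right)
    qed
    have "f v - c *\<^sub>R v \<in> S"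
      using vS less.prems by (intro subspace_diff subspace_scale) auto
    from orth[OF this] have ev: "f v = c *\<^sub>R v" by simp
    define S' where "S' = {x \<in> S. v \<bullet> x = 0}"
    have S': "subspace S'"
    proof -
      have "S' = S \<inter> {x. v \<bullet> x = 0}" by (auto simp: S'_def)
      then show ?thesis using subspace_inter[OF less.prems(1) subspace_hyperplane] by simp
    qed
    have inv: "f ` S' \<subseteq> S'"
    proof
      fix y assume "y \<in> f ` S'"
      then obtain x where x: "x \<in> S" "v \<bullet> x = 0" "y = f x" by (auto simp: S'_def)
      have "v \<bullet> f x = f v \<bullet> x" using sa[of v x] by simp
      then show "y \<in> S'" using x less.prems(2) by (auto simp: S'_def ev)
    qed
    have "dim S' < dim S"
    proof (rule dim_psubset)
      have "v \<notin> S'" using vv by (simp add: S'_def)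
      moreover have "S' \<subseteq> S" by (auto simp: S'_def)
      ultimately have "S' \<subset> S" using vS by blast
      then show "span S' \<subset> span S" using S' less.prems(1) by (simp add: span_eq_iff[THEN iffD2])
    qed
    from less.hyps[OF this S' inv] obtain B where B: "B \<subseteq> S'" "pairwise orthogonal B"
      "\<forall>b\<in>B. norm b = 1 \<and> (\<exists>c. f b = c *\<^sub>R b)" "span B = S'" by blast
    have "span (insert v B) = S"
    proof
      show "span (insert v B) \<subseteq> S"
        using B(1) vS less.prems(1) by (intro span_minimal) (auto simp: S'_def)
      show "S \<subseteq> span (insert v B)"
      proof
        fix x assume x: "x \<in> S"
        have "x - (v \<bullet> x) *\<^sub>R v \<in> S'"
          using x vS vv less.prems(1) by (simp add: S'_def subspace_diff subspace_scale inner_diff_right)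
        then have "x - (v \<bullet> x) *\<^sub>R v \<in> span (insert v B)" using B(4) span_mono[of B "insert v B"] by blast
        moreover have "(v \<bullet> x) *\<^sub>R v \<in> span (insert v B)" by (intro span_scale span_base) simp
        ultimately have "(x - (v \<bullet> x) *\<^sub>R v) + (v \<bullet> x) *\<^sub>R v \<in> span (insert v B)" by (rule span_add)
        then show "x \<in> span (insert v B)" by simp
      qed
    qed
    moreover have "pairwise orthogonal (insert v B)"
      using B(1,2) by (auto simp: pairwise_insert orthogonal_def S'_def inner_commute)
    moreover have "\<forall>b\<in>insert v B. norm b = 1 \<and> (\<exists>c. f b = c *\<^sub>R b)"
      using B(3) ev v(1) by auto
    moreover have "insert v B \<subseteq> S" using B(1) vS by (auto simp: S'_def)
    ultimately show ?thesis by blast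
  qed
qed

definition diagm :: "('n \<Rightarrow> real) \<Rightarrow> real^'n^'n" where
  "diagm d = (\<chi> i j. if i = j then d i else 0)"

lemma diagm_mult_vec: "diagm d *v x = (\<chi> i. d i * x $ i)"
  by (simp add: diagm_def matrix_vector_mult_def vec_eq_iff if_distrib[where f = "\<lambda>x. x * _"] cong: if_cong)

lemma diagm_mult: "diagm d ** diagm e = diagm (\<lambda>i. d i * e i)"
  by (simp add: diagm_def matrix_matrix_mult_def vec_eq_iff if_distrib[where f = "\<lambda>x. x * _"]
      if_distrib[where f = "\<lambda>x. _ * x"] cong: if_cong)

lemma diagm_1: "diagm (\<lambda>_. 1) = mat 1"
  by (simp add: diagm_def mat_def)

lemma transpose_diagm [simp]: "transpose (diagm d) = diagm d"
  by (auto simp: diagm_def transpose_def vec_eq_iff)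

lemma det_diagm: "det (diagm d) = (\<Prod>i\<in>UNIV. d i)"
  by (subst det_diagonal) (auto simp: diagm_def)

lemma trace_diagm: "trace (diagm d) = (\<Sum>i\<in>UNIV. d i)"
  by (simp add: trace_def diagm_def)

definition conj_diag :: "real^'n^'n \<Rightarrow> ('n \<Rightarrow> real) \<Rightarrow> real^'n^'n" where
  "conj_diag P d = P ** diagm d ** transpose P"

lemma conj_diag_nth: "conj_diag P d $ i $ j = (\<Sum>k\<in>UNIV. P $ i $ k * d k * P $ j $ k)"
  by (simp add: conj_diag_def matrix_matrix_mult_def diagm_def transpose_def
      if_distrib[where f = "\<lambda>x. _ * x"] cong: if_cong)

lemma Sym_inner: "A \<in> Sym \<Longrightarrow> (A *v x) \<bullet> y = x \<bullet> (A *v (y :: real^'n))"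
proof -
  assume "A \<in> Sym"
  then have "A *v x = x v* A" using transpose_matrix_vector[of A x] by (simp add: Sym_def)
  then show ?thesis by (simp add: dot_lmul_matrix)
qed

text \<open>
  The columns of \<open>P\<close> are the vectors of an orthonormal eigenbasis.
\<close>
theorem spectral_theorem:
  fixes A :: "real^'n^'n"
  assumes A: "A \<in> Sym"
  obtains P d where "orthogonal_matrix P" "A = conj_diag P d"
proof -
  have "\<exists>B. B \<subseteq> UNIV \<and> pairwise orthogonal B \<and> (\<forall>b\<in>B. norm b = 1 \<and> (\<exists>c. A *v b = c *\<^sub>R b)) \<and> span B = (UNIV :: (real^'n) set)"
    by (rule self_adjoint_orthonormal_eigenbasis) (auto simp: Sym_inner[OF A])
  then obtain B :: "(real^'n) set" where B: "pairwise orthogonal B" "\<forall>b\<in>B. norm b = 1 \<and> (\<exists>c. A *v b = c *\<^sub>R b)" "span B = UNIV"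
    by blast
  have ind: "independent B"
    using B(1,2) by (intro pairwise_orthogonal_independent) auto
  then have finB: "finite B" by (rule independent_imp_finite)
  have "card B = CARD('n)"
    using dim_eq_card_independent[OF ind] dim_span[of B] B(3) by (simp add: dim_UNIV)
  then obtain h where h: "bij_betw h (UNIV :: 'n set) B"
    using finite_same_card_bij[of "UNIV :: 'n set" B] finB by auto
  have hB: "h j \<in> B" for j using h by (auto simp: bij_betw_def)
  have hinj: "h i = h j \<longleftrightarrow> i = j" for i j using h by (auto simp: bij_betw_def inj_on_eq_iff)
  have "\<forall>j. \<exists>c. A *v h j = c *\<^sub>R h j" using B(2) hB by blast
  then obtain d where d: "\<And>j. A *v h j = d j *\<^sub>R h j" by (rule choice[THEN exE]) blast
  define P :: "real^'n^'n" where "P = (\<chi> i j. h j $ i)"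
  have col: "P *v axis j 1 = h j" for j
    unfolding matrix_vector_mult_basis column_def P_def by (simp add: vec_eq_iff)
  have orth: "h i \<bullet> h j = (if i = j then 1 else 0)" for i j
    using B(1,2) hB hinj[of i j] by (auto simp: pairwise_def orthogonal_def norm_eq_1)
  have "transpose P ** P = mat 1"
    using orth by (simp add: matrix_matrix_mult_def transpose_def mat_def vec_eq_iff P_def inner_vec_def)
  then have P: "orthogonal_matrix P" by (simp add: orthogonal_matrix)
  have "A ** P = P ** diagm d"
  proof -
    have "(A ** P) *v axis j 1 = (P ** diagm d) *v axis j 1" for j
    proof -
      have "diagm d *v axis j 1 = d j *\<^sub>R axis j 1"
        by (auto simp: diagm_mult_vec vec_eq_iff axis_def)
      then show ?thesis
        by (simp add: matrix_vector_mul_assoc[symmetric] col d matrix_vector_mult_scaleR)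
    qed
    then have "column j (A ** P) = column j (P ** diagm d)" for j
      by (simp add: matrix_vector_mult_basis)
    then show ?thesis by (simp add: column_def vec_eq_iff)
  qed
  moreover have "P ** transpose P = mat 1" using P by (simp add: orthogonal_matrix_def)
  ultimately have "A = conj_diag P d"
    unfolding conj_diag_def by (metis matrix_mul_assoc matrix_mul_rid)
  with P show thesis by (rule that)
qed

context
  fixes P :: "real^'n^'n"
  assumes P: "orthogonal_matrix P"
begin

lemma orthogonal_cancel: "P ** transpose P = mat 1" "transpose P ** P = mat 1"
  using P by (auto simp: orthogonal_matrix_def)

lemma conj_diag_Sym: "conj_diag P d \<in> Sym"
  by (simp add: Sym_def conj_diag_def matrix_transpose_mul matrix_mul_assoc)

lemma conj_diag_mult: "conj_diag P d ** conj_diag P e = conj_diag P (\<lambda>i. d i * e i)"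
proof -
  have "conj_diag P d ** conj_diag P e = P ** diagm d ** (transpose P ** P) ** diagm e ** transpose P"
    by (simp add: conj_diag_def matrix_mul_assoc)
  also have "\<dots> = P ** (diagm d ** diagm e) ** transpose P"
    by (simp only: orthogonal_cancel matrix_mul_rid matrix_mul_assoc)
  finally show ?thesis by (simp add: conj_diag_def diagm_mult)
qed

lemma conj_diag_1: "conj_diag P (\<lambda>_. 1) = mat 1"
  by (simp add: conj_diag_def diagm_1 orthogonal_cancel)

lemma det_conj_diag: "det (conj_diag P d) = (\<Prod>i\<in>UNIV. d i)"
proof -
  have "det P * det (transpose P) = 1" by (metis det_mul det_I orthogonal_cancel(1))
  then show ?thesis by (simp add: conj_diag_def det_mul det_diagm)
qed

lemma trace_conj_diag: "trace (conj_diag P d) = (\<Sum>i\<in>UNIV. d i)"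
proof -
  have "trace (conj_diag P d) = trace (transpose P ** (P ** diagm d))"
    unfolding conj_diag_def by (rule trace_mul_sym)
  also have "\<dots> = trace (diagm d)" by (simp add: matrix_mul_assoc orthogonal_cancel)
  finally show ?thesis by (simp add: trace_diagm)
qed

lemma conj_diag_quadratic: "x \<bullet> (conj_diag P d *v x) = (\<Sum>i\<in>UNIV. d i * ((transpose P *v x) $ i)\<^sup>2)"
proof -
  have "x \<bullet> (conj_diag P d *v x) = x \<bullet> (P *v (diagm d *v (transpose P *v x)))"
    by (simp only: conj_diag_def matrix_vector_mul_assoc matrix_mul_assoc)
  also have "\<dots> = (transpose P *v x) \<bullet> (diagm d *v (transpose P *v x))"
    by (simp add: dot_lmul_matrix)
  finally show ?thesis
    by (simp add: diagm_mult_vec inner_vec_def power2_eq_square algebra_simps)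
qed

lemma conj_diag_Sym_pos: "conj_diag P d \<in> Sym_pos \<longleftrightarrow> (\<forall>i. 0 < d i)"
proof
  assume L: "conj_diag P d \<in> Sym_pos"
  show "\<forall>i. 0 < d i"
  proof
    fix i
    let ?x = "P *v axis i 1"
    have t: "transpose P *v ?x = axis i 1"
      by (simp only: matrix_vector_mul_assoc orthogonal_cancel matrix_vector_mul_lid)
    have "?x \<noteq> 0"
    proof
      assume "?x = 0"
      then have "transpose P *v ?x = transpose P *v 0" by (simp only:)
      then have "axis i 1 = (0 :: real^'n)" unfolding t by simp
      then show False by (simp add: axis_eq_0_iff)
    qed
    then have "0 < ?x \<bullet> (conj_diag P d *v ?x)" using L by (simp add: Sym_pos_def)
    also have "\<dots> = d i"
      unfolding conj_diag_quadratic t by (simp add: axis_def if_distrib[where f = "\<lambda>x. _ * x"]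
          if_distrib[where f = "\<lambda>x. x\<^sup>2"] cong: if_cong)
    finally show "0 < d i" .
  qed
next
  assume R: "\<forall>i. 0 < d i"
  show "conj_diag P d \<in> Sym_pos"
    unfolding Sym_pos_def
  proof (intro CollectI conjI allI impI conj_diag_Sym)
    fix x :: "real^'n" assume x: "x \<noteq> 0"
    have "transpose P *v x \<noteq> 0"
    proof
      assume "transpose P *v x = 0"
      then have "P *v (transpose P *v x) = P *v 0" by (simp only:)
      then show False using x
        by (simp add: matrix_vector_mul_assoc orthogonal_cancel del: transpose_matrix_vector)
    qed
    then obtain i where i: "(transpose P *v x) $ i \<noteq> 0" by (auto simp: vec_eq_iff)
    have "0 < (\<Sum>i\<in>UNIV. d i * ((transpose P *v x) $ i)\<^sup>2)"
      by (rule sum_pos2[of _ i]) (use R i in \<open>auto simp: less_imp_le\<close>)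
    then show "0 < x \<bullet> (conj_diag P d *v x)" by (simp add: conj_diag_quadratic)
  qed
qed

end

lemma Sym_pos_spectral:
  fixes A :: "real^'n^'n"
  assumes "A \<in> Sym_pos"
  obtains P d where "orthogonal_matrix P" "A = conj_diag P d" "\<forall>i. 0 < d i"
proof -
  have "A \<in> Sym" using assms by (simp add: Sym_pos_def)
  then obtain P d where Pd: "orthogonal_matrix P" "A = conj_diag P d" by (rule spectral_theorem)
  then have "\<forall>i. 0 < d i" using conj_diag_Sym_pos[OF Pd(1)] assms by simp
  with Pd show thesis using that by blast
qed

lemma Sym_pos_det_pos:
  assumes "A \<in> Sym_pos" shows "0 < det A"
proof -
  obtain P d where Pd': "orthogonal_matrix P" "A = conj_diag P d" "\<forall>i. 0 < d i"
    using Sym_pos_spectral[OF assms] .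
  note Pd = Pd'(1,2) Pd'(3)[rule_format]
  have d0: "d i \<noteq> 0" for i using Pd(3)[of i] by simp
  show ?thesis unfolding Pd(2) det_conj_diag[OF Pd(1)] by (intro prod_pos) (simp add: Pd(3))
qed

text \<open>
  Apply \<open>ln d \<le> d - 1\<close> to the eigenvalues; equality holds only for \<open>d = 1\<close>. This turns the nonlinear
  constraint on the determinant into a linear one on the trace.
\<close>
lemma trace_ge_of_det_ge_1:
  fixes X :: "real^'n^'n"
  assumes X: "X \<in> Sym_pos" and det: "1 \<le> det X"
  shows "real CARD('n) \<le> trace X" and "trace X = real CARD('n) \<Longrightarrow> X = mat 1"
proof -
  obtain P d where Pd': "orthogonal_matrix P" "X = conj_diag P d" "\<forall>i. 0 < d i"
    using Sym_pos_spectral[OF X] .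
  note Pd = Pd'(1,2) Pd'(3)[rule_format]
  have d0: "d i \<noteq> 0" for i using Pd(3)[of i] by simp
  have ln_le: "ln (d i) \<le> d i - 1" for i using ln_le_minus_one[OF Pd(3)] .
  have "0 \<le> ln (\<Prod>i\<in>UNIV. d i)" using det det_conj_diag[OF Pd(1), of d] Pd(2) by simp
  also have "\<dots> = (\<Sum>i\<in>UNIV. ln (d i))" by (intro ln_prod) (auto simp: Pd(3) d0)
  finally have ln0: "0 \<le> (\<Sum>i\<in>UNIV. ln (d i))" .
  have tr: "(\<Sum>i\<in>UNIV. d i - 1) = trace X - real CARD('n)"
    using trace_conj_diag[OF Pd(1), of d] Pd(2) by (simp add: sum_subtractf)
  have "(\<Sum>i\<in>UNIV. ln (d i)) \<le> (\<Sum>i\<in>UNIV. d i - 1)" by (intro sum_mono ln_le)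
  with ln0 tr show "real CARD('n) \<le> trace X" by simp
  assume eq: "trace X = real CARD('n)"
  have "(\<Sum>i\<in>UNIV. (d i - 1) - ln (d i)) = 0"
  proof (rule antisym)
    show "(\<Sum>i\<in>UNIV. (d i - 1) - ln (d i)) \<le> 0"
      using eq tr ln0 unfolding sum_subtractf[of "\<lambda>i. d i - 1"] by simp
  qed (intro sum_nonneg, use ln_le in simp)
  then have "\<forall>i\<in>UNIV. (d i - 1) - ln (d i) = 0"
    by (subst (asm) sum_nonneg_eq_0_iff) (use ln_le in auto)
  then have "d i = 1" for i using ln_eq_minus_one[OF Pd(3)[of i]] by simp
  then have "d = (\<lambda>_. 1)" by auto
  then show "X = mat 1" using Pd conj_diag_1 by simp
qed

lemma Sym_pos_congruence:
  fixes A Q :: "real^'n^'n"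
  assumes A: "A \<in> Sym_pos" and Q: "Q \<in> Sym" "det Q \<noteq> 0"
  shows "Q ** A ** Q \<in> Sym_pos"
  unfolding Sym_pos_def
proof (intro CollectI conjI allI impI)
  have "transpose A = A" "transpose Q = Q" using A Q(1) unfolding Sym_pos_def Sym_def by blast+
  then show "Q ** A ** Q \<in> Sym"
    by (simp only: Sym_def mem_Collect_eq matrix_transpose_mul matrix_mul_assoc)
  fix x :: "real^'n" assume x: "x \<noteq> 0"
  have "Q *v x \<noteq> 0"
  proof
    assume Qx: "Q *v x = 0"
    obtain R where "R ** Q = mat 1" using Q(2) invertible_det_nz[of Q] by (auto simp: invertible_def)
    then have "x = R *v (Q *v x)" by (simp only: matrix_vector_mul_assoc matrix_vector_mul_lid)
    then show False using x Qx by simp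
  qed
  then have "0 < (Q *v x) \<bullet> (A *v (Q *v x))" using A by (simp add: Sym_pos_def)
  also have "\<dots> = x \<bullet> ((Q ** A ** Q) *v x)"
    by (simp only: Sym_inner[OF Q(1)] matrix_vector_mul_assoc matrix_mul_assoc)
  finally show "0 < x \<bullet> ((Q ** A ** Q) *v x)" .
qed

lemma Sym_pos_midpoint: "A \<in> Sym_pos \<Longrightarrow> B \<in> Sym_pos \<Longrightarrow> (1/2) *\<^sub>R (A + B) \<in> Sym_pos"
  unfolding Sym_pos_def Sym_def
  by (auto simp: transpose_def vec_eq_iff matrix_vector_mult_add_rdistrib scaleR_matrix_vector_assoc[symmetric]
      inner_add_right intro!: add_pos_pos)

lemma matrix_add_right: "(B + C) ** A = B ** A + C ** (A :: real^'n^'n)"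
  by (simp add: matrix_matrix_mult_def vec_eq_iff sum.distrib distrib_right)

lemma matrix_scaleR_left: "(c *\<^sub>R B) ** A = c *\<^sub>R (B ** (A :: real^'n^'n))"
  by (simp add: matrix_matrix_mult_def vec_eq_iff sum_distrib_left mult.assoc)

lemma matrix_scaleR_right: "B ** (c *\<^sub>R A) = c *\<^sub>R (B ** (A :: real^'n^'n))"
  by (simp add: matrix_matrix_mult_def vec_eq_iff sum_distrib_left mult.left_commute)

text \<open>
  Strict concavity of the determinant without roots: conjugation with the inverse square root \<open>Q\<close> of the
  midpoint makes the midpoint the identity. If its determinant were at most 1, the conjugated matrices
  would have determinant at least 1 and, on average, trace \<open>n\<close>, so both would be the identity.
\<close>
lemma det_midpoint_gt_1:
  fixes A B :: "real^'n^'n"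
  assumes A: "A \<in> Sym_pos" "det A = 1" and B: "B \<in> Sym_pos" "det B = 1" and "A \<noteq> B"
  shows "1 < det ((1/2) *\<^sub>R (A + B))"
proof (rule ccontr)
  let ?C = "(1/2) *\<^sub>R (A + B)"
  assume "\<not> 1 < det ?C"
  then have detC: "det ?C \<le> 1" by simp
  have C: "?C \<in> Sym_pos" by (rule Sym_pos_midpoint[OF A(1) B(1)])
  obtain P d where Pd': "orthogonal_matrix P" "?C = conj_diag P d" "\<forall>i. 0 < d i"
    using Sym_pos_spectral[OF C] .
  note Pd = Pd'(1,2) Pd'(3)[rule_format]
  have d0: "d i \<noteq> 0" for i using Pd(3)[of i] by simp
  define Q where "Q = conj_diag P (\<lambda>i. 1 / sqrt (d i))"
  have QS: "Q \<in> Sym" unfolding Q_def by (rule conj_diag_Sym[OF Pd(1)])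
  have detQ: "det Q = (\<Prod>i\<in>UNIV. 1 / sqrt (d i))" unfolding Q_def by (rule det_conj_diag[OF Pd(1)])
  have Q0: "0 < det Q" unfolding detQ by (intro prod_pos) (simp add: Pd(3))
  have "(\<lambda>i. 1 / sqrt (d i) * d i * (1 / sqrt (d i))) = (\<lambda>_. 1)"
  proof
    fix i
    show "1 / sqrt (d i) * d i * (1 / sqrt (d i)) = 1"
      using Pd(3)[of i] by simp
  qed
  then have QCQ: "Q ** ?C ** Q = mat 1"
    unfolding Q_def Pd(2) conj_diag_mult[OF Pd(1)] by (simp add: conj_diag_1[OF Pd(1)])
  have sum: "Q ** A ** Q + Q ** B ** Q = 2 *\<^sub>R mat 1"
  proof -
    have "Q ** A ** Q + Q ** B ** Q = 2 *\<^sub>R (Q ** ?C ** Q)"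
      by (simp add: matrix_add_ldistrib matrix_add_right matrix_scaleR_left matrix_scaleR_right)
    then show ?thesis by (simp only: QCQ)
  qed
  have "det (Q ** ?C ** Q) = 1" unfolding QCQ by (rule det_I)
  then have "det Q * det ?C * det Q = 1" by (simp only: det_mul)
  then have "1 \<le> det Q * det Q"
  proof -
    assume 1: "det Q * det ?C * det Q = 1"
    have "det Q * det Q * det ?C \<le> det Q * det Q * 1"
      using detC Q0 by (intro mult_left_mono) auto
    with 1 show ?thesis by (simp add: mult.commute mult.left_commute)
  qed
  then have det: "1 \<le> det (Q ** A ** Q)" "1 \<le> det (Q ** B ** Q)"
    using A(2) B(2) by (simp_all add: det_mul)
  have XY: "Q ** A ** Q \<in> Sym_pos" "Q ** B ** Q \<in> Sym_pos"
    using Sym_pos_congruence[OF _ QS] A B Q0 by auto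
  have "trace (Q ** A ** Q) + trace (Q ** B ** Q) = 2 * real CARD('n)"
    using arg_cong[OF sum, of trace] by (simp add: trace_def mat_def sum.distrib mult.commute)
  then have "trace (Q ** A ** Q) = real CARD('n)" "trace (Q ** B ** Q) = real CARD('n)"
    using trace_ge_of_det_ge_1(1)[OF XY(1) det(1)] trace_ge_of_det_ge_1(1)[OF XY(2) det(2)] by auto
  then have eq: "Q ** A ** Q = mat 1" "Q ** B ** Q = mat 1"
    using trace_ge_of_det_ge_1(2)[OF XY(1) det(1)] trace_ge_of_det_ge_1(2)[OF XY(2) det(2)] by auto
  obtain R where R: "R ** Q = mat 1" "Q ** R = mat 1"
    using Q0 invertible_det_nz[of Q] by (auto simp: invertible_def)
  have rec: "X = R ** (Q ** X ** Q) ** R" for X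
  proof -
    have "R ** (Q ** X ** Q) ** R = (R ** Q) ** X ** (Q ** R)" by (simp add: matrix_mul_assoc)
    then show ?thesis by (simp add: R)
  qed
  have "A = R ** mat 1 ** R" using rec[of A] by (simp only: eq)
  moreover have "B = R ** mat 1 ** R" using rec[of B] by (simp only: eq)
  ultimately show False using \<open>A \<noteq> B\<close> by simp
qed

text \<open>
  The curve is the matrix exponential \<open>exp (t M)\<close>, written in an eigenbasis of \<open>M\<close>; trace zero makes its
  determinant one.
\<close>
lemma unimodular_curve:
  fixes M :: "real^'n^'n"
  assumes M: "M \<in> Sym_zero"
  obtains A :: "real \<Rightarrow> real^'n^'n" where "\<And>t. A t \<in> Sym_pos \<inter> SL"
    "((\<lambda>t. (1/t) *\<^sub>R (A t - mat 1)) \<longlongrightarrow> M) (at 0)"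
proof -
  have "M \<in> Sym" using M by (simp add: Sym_zero_def)
  then obtain P d where Pd: "orthogonal_matrix P" "M = conj_diag P d" by (rule spectral_theorem)
  define A where "A t = conj_diag P (\<lambda>i. exp (t * d i))" for t
  have sum0: "(\<Sum>i\<in>UNIV. d i) = 0"
    using M trace_conj_diag[OF Pd(1), of d] Pd(2) by (simp add: Sym_zero_def)
  have "A t \<in> Sym_pos \<inter> SL" for t
  proof -
    have "(\<Prod>i\<in>UNIV. exp (t * d i)) = exp (t * (\<Sum>i\<in>UNIV. d i))"
      by (simp add: exp_sum sum_distrib_left)
    then have "det (A t) = 1" unfolding A_def det_conj_diag[OF Pd(1)] by (simp add: sum0)
    then show ?thesis using conj_diag_Sym_pos[OF Pd(1)] by (simp add: A_def SL_def)
  qed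
  moreover have "((\<lambda>t. (1/t) *\<^sub>R (A t - mat 1)) \<longlongrightarrow> M) (at 0)"
  proof -
    have eq: "(1/t) *\<^sub>R (A t - mat 1) = conj_diag P (\<lambda>i. (exp (t * d i) - 1) / t)" for t
      unfolding A_def conj_diag_1[OF Pd(1), symmetric]
      by (simp add: vec_eq_iff conj_diag_nth sum_subtractf[symmetric] sum_divide_distrib algebra_simps diff_divide_distrib)
    have lim: "((\<lambda>t. (exp (t * c) - 1) / t) \<longlongrightarrow> c) (at 0)" for c :: real
    proof -
      have "((\<lambda>t. exp (t * c)) has_real_derivative c) (at 0)"
        by (auto intro!: derivative_eq_intros)
      then show ?thesis by (simp add: has_field_derivative_iff)
    qed
    have "((\<lambda>t. conj_diag P (\<lambda>i. (exp (t * d i) - 1) / t)) \<longlongrightarrow> conj_diag P d) (at 0)"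
      by (intro vec_tendstoI) (unfold conj_diag_nth, intro tendsto_sum tendsto_mult tendsto_const lim)
    then show ?thesis unfolding eq Pd(2) .
  qed
  ultimately show thesis by (rule that)
qed

section \<open>Linear change of variables for positive definite matrices\<close>

lemma distr_lborel_linear_isometry:
  fixes J :: "'a::euclidean_space \<Rightarrow> 'a"
  assumes J: "linear J" "\<And>x. norm (J x) = norm x"
  shows "distr lborel borel J = lborel"
proof (rule measure_eqI)
  have m: "J \<in> borel_measurable borel"
    using J(1) by (intro borel_measurable_continuous_onI linear_continuous_on) (simp add: linear_conv_bounded_linear)
  fix A assume "A \<in> sets (distr lborel borel J)"
  then have A: "A \<in> sets borel" by simp
  show "emeasure (distr lborel borel J) A = emeasure lborel A"
    using emeasure_lborel_linear_isometry[OF J _ A] m A by (simp add: emeasure_distr)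
qed simp

lemma norm_orthogonal_matrix:
  fixes P :: "real^'n^'n"
  assumes "orthogonal_matrix P"
  shows "norm (P *v x) = norm x"
  using assms orthogonal_transformation_matrix[of "(*v) P"] by (simp add: orthogonal_transformation)

text \<open>
  The affine change of variables with independent scaling of the standard basis vectors.
\<close>
lemma lborel_diagm:
  fixes d :: "'n::finite \<Rightarrow> real"
  assumes d: "\<And>i. 0 < d i"
  shows "lborel = density (distr lborel borel (\<lambda>x :: real^'n. diagm d *v x)) (\<lambda>_. ennreal (\<Prod>i\<in>UNIV. d i))"
proof -
  define c where "c b = (\<Sum>i\<in>UNIV. d i * b $ i)" for b :: "real^'n"
  have c: "c (axis i 1) = d i" for i
    by (simp add: c_def axis_def if_distrib[where f = "\<lambda>x. _ * x"] cong: if_cong)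
  have Basis: "(Basis :: (real^'n) set) = range (\<lambda>i. axis i 1)"
    by (auto simp: Basis_vec_def)
  have inj: "inj (\<lambda>i :: 'n. axis i (1::real))" by (auto simp: inj_def axis_eq_axis)
  have T: "0 + (\<Sum>b\<in>Basis. (c b * (x \<bullet> b)) *\<^sub>R b) = diagm d *v x" for x :: "real^'n"
  proof -
    have "(\<Sum>b\<in>Basis. (c b * (x \<bullet> b)) *\<^sub>R b) = (\<Sum>i\<in>UNIV. (d i * x $ i) *\<^sub>R axis i 1)"
      unfolding Basis using inj by (simp add: sum.reindex c inner_axis)
    also have "\<dots> = diagm d *v x"
      by (simp add: diagm_mult_vec vec_eq_iff axis_def if_distrib[where f = "\<lambda>x. _ * x"] cong: if_cong)
    finally show ?thesis by simp
  qed
  have pr: "(\<Prod>j\<in>Basis. \<bar>c j\<bar>) = (\<Prod>i\<in>UNIV. d i)"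
    unfolding Basis using inj d by (simp add: prod.reindex c less_imp_le)
  have "lborel = density (distr lborel borel (\<lambda>x. 0 + (\<Sum>j\<in>Basis. (c j * (x \<bullet> j)) *\<^sub>R j))) (\<lambda>_. (\<Prod>j\<in>Basis. \<bar>c j\<bar>))"
  proof (rule lborel_affine_euclidean)
    fix j :: "real^'n" assume "j \<in> Basis"
    then obtain i where "j = axis i 1" unfolding Basis by blast
    then show "c j \<noteq> 0" using c[of i] d[of i] by simp
  qed
  then show ?thesis unfolding T pr .
qed

lemma
  fixes h :: "real^'n \<Rightarrow> real" and A :: "real^'n^'n"
  assumes A: "A \<in> Sym_pos" and h: "h \<in> borel_measurable borel"
  shows integrable_lborel_Sym_pos: "integrable lborel h \<longleftrightarrow> integrable lborel (\<lambda>x. h (A *v x + v))"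
    and integral_lborel_Sym_pos: "(\<integral>x. h x \<partial>lborel) = det A * (\<integral>x. h (A *v x + v) \<partial>lborel)"
proof -
  obtain P d where Pd': "orthogonal_matrix P" "A = conj_diag P d" "\<forall>i. 0 < d i"
    using Sym_pos_spectral[OF A] .
  define \<delta> where "\<delta> = (\<Prod>i\<in>UNIV. d i)"
  have \<delta>: "0 < \<delta>" unfolding \<delta>_def by (intro prod_pos) (simp add: Pd'(3))
  have det: "det A = \<delta>" unfolding Pd'(2) \<delta>_def by (rule det_conj_diag[OF Pd'(1)])
  have orthT: "orthogonal_matrix (transpose P)" using Pd'(1) by (simp add: orthogonal_matrix_def)
  have mat_meas: "(\<lambda>x. B *v x) \<in> borel_measurable borel" for B :: "real^'n^'n"
    by (intro borel_measurable_continuous_onI linear_continuous_on) (simp add: linear_conv_bounded_linear[symmetric])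
  have iso: "distr lborel borel (\<lambda>x. B *v x) = lborel" if "orthogonal_matrix B" for B :: "real^'n^'n"
    by (rule distr_lborel_linear_isometry) (simp_all add: norm_orthogonal_matrix[OF that])
  have trans: "distr lborel borel (\<lambda>x. v + x) = lborel" by (rule lborel_distr_plus)
  let ?h1 = "\<lambda>x. h (v + x)"
  let ?h2 = "\<lambda>x. ?h1 (P *v x)"
  let ?h3 = "\<lambda>x. ?h2 (diagm d *v x)"
  have h1: "?h1 \<in> borel_measurable borel" using h by measurable
  have h2: "?h2 \<in> borel_measurable borel" using measurable_compose[OF mat_meas h1] .
  have h3: "?h3 \<in> borel_measurable borel" using measurable_compose[OF mat_meas h2] .
  have eq: "?h3 (transpose P *v x) = h (A *v x + v)" for x
    unfolding Pd'(2) conj_diag_def by (simp add: matrix_vector_mul_assoc matrix_mul_assoc add.commute del: transpose_matrix_vector)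
  have vm: "(\<lambda>x. v + x) \<in> lborel \<rightarrow>\<^sub>M borel" by measurable
  have dd: "lborel = density (distr lborel borel (\<lambda>x :: real^'n. diagm d *v x)) (\<lambda>_. ennreal \<delta>)"
    unfolding \<delta>_def by (rule lborel_diagm) (use Pd'(3) in blast)
  have i1: "integrable lborel h \<longleftrightarrow> integrable lborel ?h1" "(\<integral>x. h x \<partial>lborel) = (\<integral>x. ?h1 x \<partial>lborel)"
    using integrable_distr_eq[OF vm h] integral_distr[OF vm h] unfolding trans by simp_all
  have mat_meas': "(\<lambda>x. B *v x) \<in> lborel \<rightarrow>\<^sub>M borel" for B :: "real^'n^'n"
    using mat_meas by simp
  have i2: "integrable lborel ?h1 \<longleftrightarrow> integrable lborel ?h2" "(\<integral>x. ?h1 x \<partial>lborel) = (\<integral>x. ?h2 x \<partial>lborel)"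
    using integrable_distr_eq[OF mat_meas'[of P] h1] integral_distr[OF mat_meas'[of P] h1] unfolding iso[OF Pd'(1)] by simp_all
  have i3: "integrable lborel ?h2 \<longleftrightarrow> integrable lborel ?h3" "(\<integral>x. ?h2 x \<partial>lborel) = \<delta> * (\<integral>x. ?h3 x \<partial>lborel)"
  proof -
    let ?D = "distr lborel borel (\<lambda>x :: real^'n. diagm d *v x)"
    have h2': "?h2 \<in> borel_measurable ?D" using h2 by simp
    have "integrable lborel ?h2 \<longleftrightarrow> integrable (density ?D (\<lambda>_. ennreal \<delta>)) ?h2" using dd by simp
    also have "\<dots> \<longleftrightarrow> integrable ?D (\<lambda>x. \<delta> *\<^sub>R ?h2 x)" using \<delta> by (intro integrable_density h2') auto
    also have "\<dots> \<longleftrightarrow> integrable ?D ?h2" using \<delta> by simp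
    also have "\<dots> \<longleftrightarrow> integrable lborel ?h3" by (rule integrable_distr_eq[OF mat_meas' h2])
    finally show "integrable lborel ?h2 \<longleftrightarrow> integrable lborel ?h3" .
    have "(\<integral>x. ?h2 x \<partial>lborel) = (\<integral>x. ?h2 x \<partial>density ?D (\<lambda>_. ennreal \<delta>))" using dd by simp
    also have "\<dots> = (\<integral>x. \<delta> *\<^sub>R ?h2 x \<partial>?D)" using \<delta> by (intro integral_density h2') auto
    also have "\<dots> = \<delta> * (\<integral>x. ?h2 x \<partial>?D)" by simp
    also have "(\<integral>x. ?h2 x \<partial>?D) = (\<integral>x. ?h3 x \<partial>lborel)" by (rule integral_distr[OF mat_meas' h2])
    finally show "(\<integral>x. ?h2 x \<partial>lborel) = \<delta> * (\<integral>x. ?h3 x \<partial>lborel)" .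
  qed
  have i4: "integrable lborel ?h3 \<longleftrightarrow> integrable lborel (\<lambda>x. h (A *v x + v))" "(\<integral>x. ?h3 x \<partial>lborel) = (\<integral>x. h (A *v x + v) \<partial>lborel)"
    using integrable_distr_eq[OF mat_meas'[of "transpose P"] h3] integral_distr[OF mat_meas'[of "transpose P"] h3]
    unfolding iso[OF orthT] eq by simp_all
  show "integrable lborel h \<longleftrightarrow> integrable lborel (\<lambda>x. h (A *v x + v))" using i1 i2 i3 i4 by simp
  show "(\<integral>x. h x \<partial>lborel) = det A * (\<integral>x. h (A *v x + v) \<partial>lborel)" using i1 i2 i3 i4 det by simp
qed

section \<open>The gauge of a convex body inside the unit ball\<close>

locale unit_ball_body =
  fixes K :: "(real^'n) set"
  assumes cpt: "compact K" and cvx: "convex K" and sub: "K \<subseteq> cball 0 1" and zero: "0 \<in> interior K"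
begin

abbreviation N :: "real^'n \<Rightarrow> real" where "N \<equiv> body_gauge K"

lemma scale_in: "x \<in> K \<Longrightarrow> 0 \<le> t \<Longrightarrow> t \<le> 1 \<Longrightarrow> t *\<^sub>R x \<in> K"
  using convexD[OF cvx, of x 0 t "1 - t"] zero interior_subset by fastforce

lemma gauge_set_iff: "0 < c \<Longrightarrow> x \<in> (*\<^sub>R) c ` K \<longleftrightarrow> (1 / c) *\<^sub>R x \<in> K"
  by (auto simp: image_iff intro!: bexI[of _ "(1 / c) *\<^sub>R x"])

lemma bdd: "bdd_below {c. 0 < c \<and> x \<in> (*\<^sub>R) c ` K}"
  by (rule bdd_belowI[of _ 0]) auto

lemma inner_radius: obtains \<rho> where "0 < \<rho>" "cball 0 \<rho> \<subseteq> K"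
  using zero mem_interior_cball by blast

lemma gauge_le: "0 < c \<Longrightarrow> (1 / c) *\<^sub>R x \<in> K \<Longrightarrow> N x \<le> c"
  unfolding body_gauge_def by (rule cInf_lower[OF _ bdd]) (simp add: gauge_set_iff)

lemma gauge_ne: "{c. 0 < c \<and> x \<in> (*\<^sub>R) c ` K} \<noteq> {}"
proof -
  obtain \<rho> where r: "0 < \<rho>" "cball 0 \<rho> \<subseteq> K" by (rule inner_radius)
  define c where "c = norm x / \<rho> + 1"
  have c0: "0 < c" unfolding c_def using r(1) by (intro add_nonneg_pos) auto
  have "norm ((1 / c) *\<^sub>R x) \<le> \<rho>"
  proof -
    have "norm x \<le> \<rho> * c" using r(1) by (simp add: c_def field_simps)
    then show ?thesis using c0 by (simp add: field_simps)
  qed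
  then have "(1 / c) *\<^sub>R x \<in> K" using r(2) by auto
  then show ?thesis using gauge_set_iff[OF c0, of x] c0 by blast
qed

lemma gauge_approx:
  assumes "N x < c"
  obtains c' where "0 < c'" "c' < c" "(1 / c') *\<^sub>R x \<in> K"
proof -
  obtain c' where "c' \<in> {c. 0 < c \<and> x \<in> (*\<^sub>R) c ` K}" "c' < c"
    using cInf_lessD[OF gauge_ne, of x c] assms by (auto simp: body_gauge_def)
  then show thesis using that gauge_set_iff by auto
qed

lemma gauge_less_imp: "N x < c \<Longrightarrow> (1 / c) *\<^sub>R x \<in> K"
proof (erule gauge_approx)
  fix c' assume c: "0 < c'" "c' < c" "(1 / c') *\<^sub>R x \<in> K"
  have "(c' / c) *\<^sub>R ((1 / c') *\<^sub>R x) \<in> K" by (rule scale_in[OF c(3)]) (use c in auto)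
  moreover have "(c' / c) * (1 / c') = 1 / c" using c by simp
  ultimately show "(1 / c) *\<^sub>R x \<in> K" by (simp only: scaleR_scaleR)
qed

lemma norm_le_gauge: "norm x \<le> N x"
  unfolding body_gauge_def
proof (rule cInf_greatest[OF gauge_ne])
  fix c assume "c \<in> {c. 0 < c \<and> x \<in> (*\<^sub>R) c ` K}"
  then have c: "0 < c" "(1 / c) *\<^sub>R x \<in> K" using gauge_set_iff by auto
  then have "norm ((1 / c) *\<^sub>R x) \<le> 1" using sub by auto
  then show "norm x \<le> c" using c by simp
qed

lemma gauge_nonneg: "0 \<le> N x"
  using norm_le_gauge[of x] norm_ge_zero[of x] by linarith

lemma gauge_scale:
  assumes t: "0 < t"
  shows "N (t *\<^sub>R x) = t * N x"
proof -
  have le: "N (s *\<^sub>R y) \<le> s * N y" if s: "0 < s" for s y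
  proof (rule field_le_epsilon)
    fix e :: real assume e: "0 < e"
    have pos: "0 < N y + e / s" using gauge_nonneg[of y] e s by (intro add_nonneg_pos) auto
    have "(1 / (N y + e / s)) *\<^sub>R y \<in> K" by (rule gauge_less_imp) (use e s in simp)
    then have "(1 / (s * (N y + e / s))) *\<^sub>R (s *\<^sub>R y) \<in> K" using s by simp
    then have "N (s *\<^sub>R y) \<le> s * (N y + e / s)" using pos s by (intro gauge_le) auto
    then show "N (s *\<^sub>R y) \<le> s * N y + e" using s by (simp add: distrib_left)
  qed
  have "N x \<le> (1 / t) * N (t *\<^sub>R x)" using le[of "1 / t" "t *\<^sub>R x"] t by simp
  then have "t * N x \<le> N (t *\<^sub>R x)" using t by (simp add: field_simps)
  with le[OF t, of x] show ?thesis by simp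
qed

lemma gauge_triangle: "N (x + y) \<le> N x + N y"
proof (rule field_le_epsilon)
  fix e :: real assume e: "0 < e"
  define a where "a = N x + e / 2"
  define b where "b = N y + e / 2"
  have ab: "0 < a" "0 < b" unfolding a_def b_def using gauge_nonneg[of x] gauge_nonneg[of y] e by auto
  have x: "(1 / a) *\<^sub>R x \<in> K" by (rule gauge_less_imp) (use e in \<open>simp add: a_def\<close>)
  have y: "(1 / b) *\<^sub>R y \<in> K" by (rule gauge_less_imp) (use e in \<open>simp add: b_def\<close>)
  have "(a / (a + b)) *\<^sub>R ((1 / a) *\<^sub>R x) + (b / (a + b)) *\<^sub>R ((1 / b) *\<^sub>R y) \<in> K"
    using ab by (intro convexD[OF cvx x y]) (auto simp: add_divide_distrib[symmetric])
  then have "(1 / (a + b)) *\<^sub>R (x + y) \<in> K" using ab by (simp add: scaleR_add_right)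
  then have "N (x + y) \<le> a + b" using ab by (intro gauge_le) auto
  then show "N (x + y) \<le> N x + N y + e" by (simp add: a_def b_def)
qed

lemma continuous_gauge: "continuous_on UNIV N"
proof -
  obtain \<rho> where r: "0 < \<rho>" "cball 0 \<rho> \<subseteq> K" by (rule inner_radius)
  have bd: "N x \<le> (1 / \<rho>) * norm x" for x
  proof (cases "x = 0")
    case True
    have "N 0 \<le> e" if "0 < e" for e
      by (rule gauge_le) (use that zero interior_subset in auto)
    then have "N 0 \<le> 0" by (meson dense not_le)
    then show ?thesis using True by simp
  next
    case False
    have "(1 / (norm x / \<rho>)) *\<^sub>R x \<in> cball 0 \<rho>" using False r(1) by simp
    then have "N x \<le> norm x / \<rho>" using r False by (intro gauge_le) auto
    then show ?thesis by simp
  qed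
  have one: "N x - N y \<le> (1 / \<rho>) * norm (x - y)" for x y
    using gauge_triangle[of y "x - y"] bd[of "x - y"] by simp
  have "(1 / \<rho>)-lipschitz_on UNIV N"
  proof (rule lipschitz_onI)
    fix x y
    show "dist (N x) (N y) \<le> 1 / \<rho> * dist x y"
      using one[of x y] one[of y x] by (simp add: dist_norm norm_minus_commute abs_le_iff)
  qed (use r in simp)
  then show ?thesis by (rule lipschitz_on_continuous_on)
qed

lemma gauge_borel [measurable]: "N \<in> borel_measurable borel"
  by (rule borel_measurable_continuous_onI[OF continuous_gauge])

lemma gauge_le_1_iff: "N x \<le> 1 \<longleftrightarrow> x \<in> K"
proof
  assume "x \<in> K"
  then show "N x \<le> 1" by (intro gauge_le) auto
next
  assume "N x \<le> 1"
  have "(1 / (1 + inverse (real (Suc n)))) *\<^sub>R x \<in> K" for n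
  proof (rule gauge_less_imp)
    have "0 < inverse (real (Suc n))" by simp
    with \<open>N x \<le> 1\<close> show "N x < 1 + inverse (real (Suc n))" by linarith
  qed
  moreover have "(\<lambda>n. (1 / (1 + inverse (real (Suc n)))) *\<^sub>R x) \<longlonglongrightarrow> (1 / (1 + 0)) *\<^sub>R x"
    by (intro tendsto_intros LIMSEQ_inverse_real_of_nat) simp
  ultimately have "(1 / (1 + 0)) *\<^sub>R x \<in> K"
    using closed_sequentially[OF compact_imp_closed[OF cpt],
        of "\<lambda>n. (1 / (1 + inverse (real (Suc n)))) *\<^sub>R x" "(1 / (1 + 0)) *\<^sub>R x"] by blast
  then show "x \<in> K" by simp
qed

text \<open>
  A point of the unit sphere is no interior point of a subset of the unit ball.
\<close>
lemma contact_iff: "norm \<xi> = 1 \<Longrightarrow> \<xi> \<in> frontier K \<longleftrightarrow> \<xi> \<in> K"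
proof -
  assume n: "norm \<xi> = 1"
  have "interior K \<subseteq> ball 0 1" using interior_mono[OF sub] by simp
  then have "\<xi> \<notin> interior K" using n by auto
  then show ?thesis using compact_imp_closed[OF cpt] by (simp add: frontier_def)
qed

lemma contact_gauge: "norm \<xi> = 1 \<Longrightarrow> \<xi> \<in> frontier K \<Longrightarrow> N \<xi> = 1"
  using contact_iff gauge_le_1_iff[of \<xi>] norm_le_gauge[of \<xi>] by simp

lemma noncontact_gauge: "norm \<xi> = 1 \<Longrightarrow> \<xi> \<notin> frontier K \<Longrightarrow> 1 < N \<xi>"
  using contact_iff gauge_le_1_iff[of \<xi>] by (simp add: not_le[symmetric])

end

section \<open>The shell limit\<close>

lemma norm_matrix_vector_le:
  fixes M :: "real^'n^'m"
  shows "norm (M *v x) \<le> norm M * norm x"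
proof -
  have "norm (M *v x) = L2_set (\<lambda>i. \<bar>M $ i \<bullet> x\<bar>) UNIV"
    by (simp add: norm_vec_def matrix_vector_mul_component)
  also have "\<dots> \<le> L2_set (\<lambda>i. norm (M $ i) * norm x) UNIV"
    by (rule L2_set_mono) (auto intro: Cauchy_Schwarz_ineq2)
  also have "\<dots> = norm M * norm x"
    by (simp add: norm_vec_def L2_set_left_distrib)
  finally show ?thesis .
qed

lemma tendsto_matrix_vector_mult:
  fixes M :: "'a \<Rightarrow> real^'n^'m"
  assumes "(M \<longlongrightarrow> M') F" "(x \<longlongrightarrow> x') F"
  shows "((\<lambda>j. M j *v x j) \<longlongrightarrow> M' *v x') F"
  unfolding matrix_vector_mult_def
  by (intro vec_tendstoI) (simp, intro tendsto_sum tendsto_mult tendsto_vec_nth assms)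

text \<open>
  The derivative of the norm at \<open>\<xi>\<close>, along directions that vary with the step.
\<close>
lemma tendsto_norm_increment:
  fixes \<xi> :: "'a::real_inner"
  assumes \<xi>: "norm \<xi> = 1" and \<rho>: "\<And>j. 0 < \<rho> j" "\<rho> \<longlonglongrightarrow> (0::real)" and y: "y \<longlonglongrightarrow> y'"
  shows "(\<lambda>j. (norm (\<xi> + \<rho> j *\<^sub>R y j) - 1) / \<rho> j) \<longlonglongrightarrow> \<xi> \<bullet> y'"
proof -
  have eq: "(norm (\<xi> + \<rho> j *\<^sub>R y j) - 1) / \<rho> j
      = (2 * (\<xi> \<bullet> y j) + \<rho> j * (y j \<bullet> y j)) / (norm (\<xi> + \<rho> j *\<^sub>R y j) + 1)" for j
  proof -
    let ?a = "norm (\<xi> + \<rho> j *\<^sub>R y j)"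
    have pos: "0 < ?a + 1" by (simp add: add_nonneg_pos)
    have "(?a - 1) * (?a + 1) = ?a\<^sup>2 - 1" by (simp add: power2_eq_square algebra_simps)
    also have "?a\<^sup>2 = \<xi> \<bullet> \<xi> + 2 * \<rho> j * (\<xi> \<bullet> y j) + \<rho> j * \<rho> j * (y j \<bullet> y j)"
      unfolding power2_norm_eq_inner by (simp add: inner_add_left inner_add_right inner_commute[of "y j" \<xi>] distrib_left)
    also have "\<xi> \<bullet> \<xi> = 1" using \<xi> by (simp add: norm_eq_1)
    finally have "(?a - 1) * (?a + 1) = \<rho> j * (2 * (\<xi> \<bullet> y j) + \<rho> j * (y j \<bullet> y j))"
      by (simp add: algebra_simps)
    then show ?thesis using pos \<rho>(1)[of j] by (simp add: frac_eq_eq mult.commute)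
  qed
  have "(\<lambda>j. (2 * (\<xi> \<bullet> y j) + \<rho> j * (y j \<bullet> y j)) / (norm (\<xi> + \<rho> j *\<^sub>R y j) + 1))
      \<longlonglongrightarrow> (2 * (\<xi> \<bullet> y') + 0 * (y' \<bullet> y')) / (norm (\<xi> + 0 *\<^sub>R y') + 1)"
    using \<xi> by (intro tendsto_intros \<rho>(2) y) simp
  then show ?thesis unfolding eq using \<xi> by simp
qed

lemma AE_sphere_measure: "AE \<xi> in (sphere_measure :: (real^'n) measure). norm \<xi> = 1"
proof -
  have m: "indicator (sphere 0 1) \<in> borel_measurable (hausdorff_measure (CARD('n) - 1) :: (real^'n) measure)"
    by (intro borel_measurable_indicator) (simp add: borel_closed)
  show ?thesis
    unfolding sphere_measure_def by (subst AE_density[OF m]) (auto simp: indicator_def)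
qed

text \<open>
  The properties of \<open>f\<close> that the limit theorem uses. They are shared by its derivative, to which the
  theorem is applied as well; this is why \<open>k\<close> may be discontinuous.
\<close>
locale profile =
  fixes k g :: "real \<Rightarrow> real"
  assumes k_mono: "mono k" and k_nonneg: "\<And>x. 0 \<le> k x" and k_0: "\<And>x. x < -1 \<Longrightarrow> k x = 0"
    and g_cont: "continuous_on UNIV g" and g_01: "\<And>x. 0 \<le> g x \<and> g x \<le> 1" and g_0: "\<And>x. 1 \<le> x \<Longrightarrow> g x = 0"
begin

lemma k_borel [measurable]: "k \<in> borel_measurable borel"
  by (rule borel_measurable_mono[OF k_mono])

lemma g_borel [measurable]: "g \<in> borel_measurable borel"
  by (rule borel_measurable_continuous_onI[OF g_cont])

end

text \<open>
  The weight \<open>\<psi>\<close> is constant for the functional itself and carries the test function for the measures.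
\<close>
locale shell_limit = unit_ball_body K + profile k g for K :: "(real^'n) set" and k g +
  fixes \<psi> :: "real^'n \<Rightarrow> real"
  assumes \<psi>_cont: "continuous_on UNIV \<psi>"
begin

text \<open>
  The integrand of the functional at \<open>r = 1 - \<rho>\<close>, \<open>A = Id + \<rho> M\<close> and translation \<open>\<rho> v\<close>, with the
  additional weight.
\<close>
definition integrand :: "real \<Rightarrow> real^'n^'n \<Rightarrow> real^'n \<Rightarrow> real^'n \<Rightarrow> real" where
  "integrand \<rho> M v x = (let y = (mat 1 + \<rho> *\<^sub>R M) *v x + \<rho> *\<^sub>R v in
     1 / \<rho> * (k ((norm y - 1) / \<rho>) * \<psi> y * g ((N x - 1) / \<rho>)))"

definition limit_integrand :: "real^'n^'n \<Rightarrow> real^'n \<Rightarrow> (real^'n) \<times> real \<Rightarrow> real" where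
  "limit_integrand M v p = indicator (frontier K) (fst p) * \<psi> (fst p) *
     (k (snd p + fst p \<bullet> (M *v fst p + v)) * g (snd p))"

lemma \<psi>_borel [measurable]: "\<psi> \<in> borel_measurable borel"
  by (rule borel_measurable_continuous_onI[OF \<psi>_cont])

lemma matrix_borel [measurable]: "(\<lambda>x. (B :: real^'n^'n) *v x) \<in> borel_measurable borel"
  by (intro borel_measurable_continuous_onI linear_continuous_on) (simp add: linear_conv_bounded_linear[symmetric])

lemma integrand_borel [measurable]: "integrand \<rho> M v \<in> borel_measurable borel"
  unfolding integrand_def Let_def by measurable

text \<open>
  The integrand in polar coordinates, including the density of the radial variable.
\<close>
definition shell_integrand :: "real \<Rightarrow> real^'n^'n \<Rightarrow> real^'n \<Rightarrow> (real^'n) \<times> real \<Rightarrow> real" where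
  "shell_integrand \<rho> M v p = shell_weight CARD('n) \<rho> (snd p) * integrand \<rho> M v ((1 + \<rho> * snd p) *\<^sub>R fst p)"

lemma shell_integrand_eq:
  assumes \<rho>: "0 < \<rho>" and s: "0 < 1 + \<rho> * u"
  shows "shell_integrand \<rho> M v (\<xi>, u) =
    (let y = \<xi> + \<rho> *\<^sub>R (u *\<^sub>R \<xi> + (1 + \<rho> * u) *\<^sub>R (M *v \<xi>) + v) in
     (1 + \<rho> * u) ^ (CARD('n) - 1) * (k ((norm y - 1) / \<rho>) * \<psi> y * g (((1 + \<rho> * u) * N \<xi> - 1) / \<rho>)))"
proof -
  have "(mat 1 + \<rho> *\<^sub>R M) *v ((1 + \<rho> * u) *\<^sub>R \<xi>) + \<rho> *\<^sub>R v
      = (1 + \<rho> * u) *\<^sub>R \<xi> + \<rho> *\<^sub>R ((1 + \<rho> * u) *\<^sub>R (M *v \<xi>)) + \<rho> *\<^sub>R v"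
    by (simp add: matrix_vector_mult_add_rdistrib matrix_vector_mult_scaleR scaleR_matrix_vector_assoc[symmetric])
       (simp add: algebra_simps)
  also have "\<dots> = \<xi> + \<rho> *\<^sub>R (u *\<^sub>R \<xi> + (1 + \<rho> * u) *\<^sub>R (M *v \<xi>) + v)"
    by (simp add: algebra_simps)
  finally show ?thesis
    using assms by (simp add: shell_integrand_def integrand_def shell_weight_def Let_def gauge_scale[OF s])
qed

text \<open>
  The supports of \<open>k\<close> and \<open>g\<close> confine \<open>u\<close>: since the gauge dominates the norm, \<open>g\<close> forces \<open>u < 1\<close>,
  and \<open>k\<close> forces \<open>u\<close> above \<open>- 1 - 2 R\<close>, because \<open>M\<close> and \<open>v\<close> move a point of norm at most 2 by at most
  \<open>2 R\<close> units of \<open>\<rho>\<close>.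
\<close>
lemma shell_integrand_bound:
  assumes \<rho>: "0 < \<rho>" "\<rho> \<le> 1" and R: "norm M + norm v \<le> R" and \<xi>: "norm \<xi> = 1"
    and \<Psi>: "\<And>y. norm y \<le> 2 + 2 * R \<Longrightarrow> \<bar>\<psi> y\<bar> \<le> \<Psi>"
  shows "\<bar>shell_integrand \<rho> M v (\<xi>, u)\<bar> \<le> 2 ^ (CARD('n) - 1) * (k (1 + 2 * R) * \<Psi>) * indicator {-1 - 2 * R..1} u"
proof -
  have R0: "0 \<le> R" using R norm_ge_zero[of M] norm_ge_zero[of v] by linarith
  have Psi0: "0 \<le> \<Psi>" using \<Psi>[of 0] R0 abs_ge_zero[of "\<psi> 0"] by auto
  show ?thesis
  proof (cases "0 < 1 + \<rho> * u")
    case False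
    then have "shell_integrand \<rho> M v (\<xi>, u) = 0" by (simp add: shell_integrand_def shell_weight_def)
    then show ?thesis using Psi0 k_nonneg by simp
  next
    case s: True
    define y where "y = \<xi> + \<rho> *\<^sub>R (u *\<^sub>R \<xi> + (1 + \<rho> * u) *\<^sub>R (M *v \<xi>) + v)"
    have eq: "shell_integrand \<rho> M v (\<xi>, u) = (1 + \<rho> * u) ^ (CARD('n) - 1) * (k ((norm y - 1) / \<rho>) * \<psi> y * g (((1 + \<rho> * u) * N \<xi> - 1) / \<rho>))"
      using shell_integrand_eq[OF \<rho>(1) s] by (simp add: y_def Let_def)
    show ?thesis
    proof (cases "shell_integrand \<rho> M v (\<xi>, u) = 0")
      case True
      then show ?thesis using Psi0 k_nonneg by simp
    next
      case nz: False
      then have knz: "k ((norm y - 1) / \<rho>) \<noteq> 0" and gnz: "g (((1 + \<rho> * u) * N \<xi> - 1) / \<rho>) \<noteq> 0"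
        unfolding eq by auto
      have "((1 + \<rho> * u) * N \<xi> - 1) / \<rho> < 1" using g_0 gnz by (meson not_le)
      then have lt: "(1 + \<rho> * u) * N \<xi> < 1 + \<rho>" using \<rho> by (simp add: field_simps)
      have "(1 + \<rho> * u) * 1 \<le> (1 + \<rho> * u) * N \<xi>"
        using norm_le_gauge[of \<xi>] \<xi> s by (intro mult_left_mono) auto
      from le_less_trans[OF this lt] have s1: "1 + \<rho> * u < 1 + \<rho>" by simp
      then have u1: "u < 1" using \<rho> by simp
      have s2: "1 + \<rho> * u \<le> 2" using s1 \<rho> by linarith
      have y2: "y = (1 + \<rho> * u) *\<^sub>R \<xi> + \<rho> *\<^sub>R ((1 + \<rho> * u) *\<^sub>R (M *v \<xi>) + v)"
        by (simp add: y_def algebra_simps)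
      have "norm ((1 + \<rho> * u) *\<^sub>R (M *v \<xi>) + v) \<le> norm ((1 + \<rho> * u) *\<^sub>R (M *v \<xi>)) + norm v"
        by (rule norm_triangle_ineq)
      also have "\<dots> \<le> 2 * norm M + norm v"
      proof -
        have "norm (M *v \<xi>) \<le> norm M" using norm_matrix_vector_le[of M \<xi>] \<xi> by simp
        then have "(1 + \<rho> * u) * norm (M *v \<xi>) \<le> 2 * norm M" using s s2 by (intro mult_mono) auto
        then show ?thesis using s by simp
      qed
      also have "\<dots> \<le> 2 * R" using R norm_ge_zero[of v] by linarith
      finally have z: "norm ((1 + \<rho> * u) *\<^sub>R (M *v \<xi>) + v) \<le> 2 * R" .
      have "norm y \<le> norm ((1 + \<rho> * u) *\<^sub>R \<xi>) + norm (\<rho> *\<^sub>R ((1 + \<rho> * u) *\<^sub>R (M *v \<xi>) + v))"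
        unfolding y2 by (rule norm_triangle_ineq)
      also have "\<dots> \<le> (1 + \<rho> * u) + \<rho> * (2 * R)"
        using s \<xi> \<rho> z by (intro add_mono) (auto intro: mult_left_mono)
      finally have ny: "norm y \<le> (1 + \<rho> * u) + \<rho> * (2 * R)" .
      have "\<rho> * (2 * R) \<le> 1 * (2 * R)" using \<rho> R0 by (intro mult_right_mono) auto
      then have ny2: "norm y \<le> 2 + 2 * R" using ny s2 by linarith
      have "norm y - 1 \<le> (u + 2 * R) * \<rho>" using ny by (simp add: algebra_simps)
      then have arg: "(norm y - 1) / \<rho> \<le> u + 2 * R" using \<rho>(1) by (simp add: pos_divide_le_eq)
      have "-1 \<le> (norm y - 1) / \<rho>" using k_0 knz by (meson not_le)
      then have u2: "-1 - 2 * R \<le> u" using arg by linarith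
      have "\<bar>shell_integrand \<rho> M v (\<xi>, u)\<bar>
          = (1 + \<rho> * u) ^ (CARD('n) - 1) * (k ((norm y - 1) / \<rho>) * \<bar>\<psi> y\<bar> * g (((1 + \<rho> * u) * N \<xi> - 1) / \<rho>))"
        unfolding eq using s k_nonneg g_01 by (simp add: abs_mult)
      also have "\<dots> \<le> 2 ^ (CARD('n) - 1) * (k (1 + 2 * R) * \<Psi> * 1)"
      proof (intro mult_mono power_mono mult_nonneg_nonneg)
        show "k ((norm y - 1) / \<rho>) \<le> k (1 + 2 * R)" using arg u1 by (intro monoD[OF k_mono]) simp
        show "\<bar>\<psi> y\<bar> \<le> \<Psi>" by (rule \<Psi>[OF ny2])
      qed (use s s2 k_nonneg g_01 Psi0 in auto)
      finally show ?thesis using u1 u2 by simp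
    qed
  qed
qed

text \<open>
  At a contact point the gauge is 1 and the argument of \<open>g\<close> is exactly \<open>u\<close>; at any other point of the
  sphere the gauge exceeds 1 and the argument tends to infinity, where \<open>g\<close> vanishes. The argument of \<open>k\<close>
  is a difference quotient of the norm.
\<close>
lemma shell_integrand_tendsto:
  assumes \<rho>: "\<And>j. 0 < \<rho> j" "\<rho> \<longlonglongrightarrow> 0" and M: "M \<longlonglongrightarrow> M'" and v: "v \<longlonglongrightarrow> v'" and \<xi>: "norm \<xi> = 1"
    and cont: "isCont k (u + \<xi> \<bullet> (M' *v \<xi> + v'))"
  shows "(\<lambda>j. shell_integrand (\<rho> j) (M j) (v j) (\<xi>, u)) \<longlonglongrightarrow> limit_integrand M' v' (\<xi>, u)"
proof -
  define w where "w j = u *\<^sub>R \<xi> + (1 + \<rho> j * u) *\<^sub>R (M j *v \<xi>) + v j" for j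
  have w: "w \<longlonglongrightarrow> u *\<^sub>R \<xi> + (1 + 0 * u) *\<^sub>R (M' *v \<xi>) + v'"
    unfolding w_def by (intro tendsto_intros \<rho>(2) v tendsto_matrix_vector_mult M)
  define y where "y j = \<xi> + \<rho> j *\<^sub>R w j" for j
  have y: "y \<longlonglongrightarrow> \<xi> + 0 *\<^sub>R (u *\<^sub>R \<xi> + (1 + 0 * u) *\<^sub>R (M' *v \<xi>) + v')"
    unfolding y_def by (intro tendsto_intros \<rho>(2) w)
  then have y': "y \<longlonglongrightarrow> \<xi>" by simp
  have "(\<lambda>j. (norm (y j) - 1) / \<rho> j) \<longlonglongrightarrow> \<xi> \<bullet> (u *\<^sub>R \<xi> + (1 + 0 * u) *\<^sub>R (M' *v \<xi>) + v')"
    unfolding y_def by (rule tendsto_norm_increment[OF \<xi> \<rho> w])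
  moreover have "\<xi> \<bullet> (u *\<^sub>R \<xi> + (1 + 0 * u) *\<^sub>R (M' *v \<xi>) + v') = u + \<xi> \<bullet> (M' *v \<xi> + v')"
    using \<xi> by (simp add: inner_add_right norm_eq_1)
  ultimately have arg: "(\<lambda>j. (norm (y j) - 1) / \<rho> j) \<longlonglongrightarrow> u + \<xi> \<bullet> (M' *v \<xi> + v')" by simp
  have kl: "(\<lambda>j. k ((norm (y j) - 1) / \<rho> j)) \<longlonglongrightarrow> k (u + \<xi> \<bullet> (M' *v \<xi> + v'))"
    by (rule isCont_tendsto_compose[OF cont arg])
  have "isCont \<psi> \<xi>" using \<psi>_cont by (simp add: continuous_on_eq_continuous_at)
  then have \<psi>l: "(\<lambda>j. \<psi> (y j)) \<longlonglongrightarrow> \<psi> \<xi>" by (rule isCont_tendsto_compose[OF _ y'])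
  have sl: "(\<lambda>j. 1 + \<rho> j * u) \<longlonglongrightarrow> 1 + 0 * u" by (intro tendsto_intros \<rho>(2))
  then have ev: "\<forall>\<^sub>F j in sequentially. 0 < 1 + \<rho> j * u" by (rule order_tendstoD) simp
  have gl: "(\<lambda>j. g (((1 + \<rho> j * u) * N \<xi> - 1) / \<rho> j)) \<longlonglongrightarrow> indicator (frontier K) \<xi> * g u"
  proof (cases "\<xi> \<in> frontier K")
    case True
    have "((1 + \<rho> j * u) * N \<xi> - 1) / \<rho> j = u" for j
      using contact_gauge[OF \<xi> True] \<rho>(1)[of j] by simp
    then show ?thesis using True by simp
  next
    case False
    have N1: "1 < N \<xi>" by (rule noncontact_gauge[OF \<xi> False])
    have "(\<lambda>j. (1 + \<rho> j * u) * N \<xi> - \<rho> j) \<longlonglongrightarrow> (1 + 0 * u) * N \<xi> - 0" by (intro tendsto_intros \<rho>(2))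
    then have "\<forall>\<^sub>F j in sequentially. 1 < (1 + \<rho> j * u) * N \<xi> - \<rho> j"
      by (rule order_tendstoD) (use N1 in simp)
    then have "\<forall>\<^sub>F j in sequentially. g (((1 + \<rho> j * u) * N \<xi> - 1) / \<rho> j) = 0"
    proof eventually_elim
      case (elim j)
      then have "1 \<le> ((1 + \<rho> j * u) * N \<xi> - 1) / \<rho> j" using \<rho>(1)[of j] by (simp add: le_divide_eq)
      then show ?case by (rule g_0)
    qed
    then show ?thesis using False by (simp add: tendsto_eventually)
  qed
  have "(\<lambda>j. (1 + \<rho> j * u) ^ (CARD('n) - 1) * (k ((norm (y j) - 1) / \<rho> j) * \<psi> (y j) * g (((1 + \<rho> j * u) * N \<xi> - 1) / \<rho> j)))
      \<longlonglongrightarrow> (1 + 0 * u) ^ (CARD('n) - 1) * (k (u + \<xi> \<bullet> (M' *v \<xi> + v')) * \<psi> \<xi> * (indicator (frontier K) \<xi> * g u))"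
    by (intro tendsto_mult tendsto_power sl kl \<psi>l gl)
  moreover have "\<forall>\<^sub>F j in sequentially. (1 + \<rho> j * u) ^ (CARD('n) - 1) * (k ((norm (y j) - 1) / \<rho> j) * \<psi> (y j) * g (((1 + \<rho> j * u) * N \<xi> - 1) / \<rho> j))
      = shell_integrand (\<rho> j) (M j) (v j) (\<xi>, u)"
    using ev by eventually_elim (simp add: shell_integrand_eq[OF \<rho>(1)] Let_def y_def w_def)
  ultimately have "(\<lambda>j. shell_integrand (\<rho> j) (M j) (v j) (\<xi>, u))
      \<longlonglongrightarrow> (1 + 0 * u) ^ (CARD('n) - 1) * (k (u + \<xi> \<bullet> (M' *v \<xi> + v')) * \<psi> \<xi> * (indicator (frontier K) \<xi> * g u))"
    by (rule Lim_transform_eventually)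
  then show ?thesis by (simp add: limit_integrand_def mult_ac)
qed

text \<open>
  Dominated convergence in polar coordinates. The monotone function \<open>k\<close> has only countably many
  discontinuities, so for each \<open>\<xi>\<close> the pointwise limit holds for almost every \<open>u\<close>.
\<close>
theorem shell_limit_sequence:
  assumes \<rho>: "\<And>j. 0 < \<rho> j" "\<rho> \<longlonglongrightarrow> 0" and M: "M \<longlonglongrightarrow> M'" and v: "v \<longlonglongrightarrow> v'"
  shows "integrable (sphere_measure \<Otimes>\<^sub>M lborel) (limit_integrand M' v')"
    and "\<forall>\<^sub>F j in sequentially. integrable lborel (integrand (\<rho> j) (M j) (v j))"
    and "(\<lambda>j. \<integral>x. integrand (\<rho> j) (M j) (v j) x \<partial>lborel)
      \<longlonglongrightarrow> (\<integral>p. limit_integrand M' v' p \<partial>(sphere_measure \<Otimes>\<^sub>M lborel))"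
proof -
  interpret S: finite_measure "sphere_measure :: (real^'n) measure" by (rule finite_measure_sphere_measure)
  interpret SL: pair_sigma_finite "sphere_measure :: (real^'n) measure" "lborel :: real measure" ..
  let ?P = "(sphere_measure :: (real^'n) measure) \<Otimes>\<^sub>M (lborel :: real measure)"
  have sets_P: "sets ?P = sets (borel \<Otimes>\<^sub>M borel)" by (intro sets_pair_measure_cong) auto
  have "Bseq (\<lambda>j. norm (M j) + norm (v j))"
    by (rule convergent_imp_Bseq) (use M v in \<open>auto intro!: convergentI tendsto_intros\<close>)
  then obtain R where R: "0 < R" "\<And>j. norm (norm (M j) + norm (v j)) \<le> R"
    unfolding Bseq_def by blast
  have R': "norm (M j) + norm (v j) \<le> R" for j using R(2)[of j] by simp
  have "compact (\<psi> ` cball 0 (2 + 2 * R))"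
    by (intro compact_continuous_image continuous_on_subset[OF \<psi>_cont]) auto
  then obtain \<Psi> where \<Psi>: "\<And>y. y \<in> \<psi> ` cball 0 (2 + 2 * R) \<Longrightarrow> norm y \<le> \<Psi>"
    using compact_imp_bounded bounded_iff by metis
  have \<Psi>': "\<bar>\<psi> y\<bar> \<le> \<Psi>" if "norm y \<le> 2 + 2 * R" for y
    using \<Psi>[of "\<psi> y"] that by auto
  define w :: "(real^'n) \<times> real \<Rightarrow> real" where
    "w p = 2 ^ (CARD('n) - 1) * (k (1 + 2 * R) * \<Psi>) * indicator {-1 - 2 * R..1} (snd p)" for p
  have w_int: "integrable ?P w"
  proof -
    have "integrable ?P (\<lambda>p. indicator (UNIV \<times> {-1 - 2 * R..1}) p :: real)"
    proof (rule integrable_real_indicator)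
      show "UNIV \<times> {-1 - 2 * R..1} \<in> sets ?P"
        by (intro pair_measureI) auto
      have "emeasure ?P (UNIV \<times> {-1 - 2 * R..1}) = emeasure sphere_measure (UNIV :: (real^'n) set) * emeasure lborel {-1 - 2 * R..1}"
        by (rule lborel.emeasure_pair_measure_Times) auto
      also have "\<dots> < \<infinity>"
      proof -
        have "emeasure (sphere_measure :: (real^'n) measure) UNIV < top"
          using S.emeasure_finite[of UNIV] by (simp add: less_top[symmetric])
        then show ?thesis using R(1) by (simp add: ennreal_mult_less_top)
      qed
      finally show "emeasure ?P (UNIV \<times> {-1 - 2 * R..1}) < \<infinity>" .
    qed
    then have "integrable ?P (\<lambda>p. 2 ^ (CARD('n) - 1) * (k (1 + 2 * R) * \<Psi>) * indicator (UNIV \<times> {-1 - 2 * R..1}) p)"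
      by (rule integrable_mult_right)
    moreover have "(\<lambda>p. 2 ^ (CARD('n) - 1) * (k (1 + 2 * R) * \<Psi>) * indicator (UNIV \<times> {-1 - 2 * R..1}) p) = w"
      by (auto simp: w_def fun_eq_iff indicator_def)
    ultimately show ?thesis by (simp only:)
  qed
  define t where "t j = shell_integrand (\<rho> j) (M j) (v j)" for j
  have mP: "f \<in> borel_measurable ?P" if "f \<in> borel_measurable (borel \<Otimes>\<^sub>M borel)" for f :: "(real^'n) \<times> real \<Rightarrow> real"
    using that measurable_cong_sets[OF sets_P refl] by blast
  have arg_m: "(\<lambda>p :: (real^'n) \<times> real. snd p + fst p \<bullet> (M' *v fst p + v')) \<in> borel_measurable (borel \<Otimes>\<^sub>M borel)"
    by measurable
  have lim_m: "limit_integrand M' v' \<in> borel_measurable ?P"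
  proof (rule mP)
    have fK: "(\<lambda>p :: (real^'n) \<times> real. indicator (frontier K) (fst p) :: real) \<in> borel_measurable (borel \<Otimes>\<^sub>M borel)"
      by (rule measurable_compose[OF measurable_fst borel_measurable_indicator]) (simp add: borel_closed)
    show "limit_integrand M' v' \<in> borel_measurable (borel \<Otimes>\<^sub>M borel)"
      unfolding limit_integrand_def using fK arg_m by measurable
  qed
  have t_m: "t j \<in> borel_measurable ?P" for j
    unfolding t_def shell_integrand_def by (rule mP) measurable
  \<comment> \<open>Fubini needs the set of good pairs to be measurable.\<close>
  have norm_m: "{p \<in> space ?P. norm (fst p) = 1 \<and> isCont k (snd p + fst p \<bullet> (M' *v fst p + v'))} \<in> sets ?P"
  proof -
    have c: "{x. \<not> isCont k x} \<in> sets borel"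
      by (rule sets.countable[OF _ mono_ctble_discont[OF k_mono]]) simp
    have A1: "{p \<in> space (borel \<Otimes>\<^sub>M borel). norm (fst p :: real^'n) = 1} \<in> sets ((borel :: (real^'n) measure) \<Otimes>\<^sub>M (borel :: real measure))"
      by measurable
    note A2 = measurable_sets[OF arg_m borel_comp[OF c]]
    have "{p \<in> space (borel \<Otimes>\<^sub>M borel). norm (fst p :: real^'n) = 1} \<inter>
        ((\<lambda>p :: (real^'n) \<times> real. snd p + fst p \<bullet> (M' *v fst p + v')) -` (- {x. \<not> isCont k x}) \<inter> space (borel \<Otimes>\<^sub>M borel))
        \<in> sets (borel \<Otimes>\<^sub>M borel)"
      by (rule sets.Int[OF A1 A2])
    also have "{p \<in> space (borel \<Otimes>\<^sub>M borel). norm (fst p :: real^'n) = 1} \<inter>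
        ((\<lambda>p :: (real^'n) \<times> real. snd p + fst p \<bullet> (M' *v fst p + v')) -` (- {x. \<not> isCont k x}) \<inter> space (borel \<Otimes>\<^sub>M borel))
        = {p \<in> space ?P. norm (fst p) = 1 \<and> isCont k (snd p + fst p \<bullet> (M' *v fst p + v'))}"
      by (auto simp: space_pair_measure)
    finally show ?thesis using sets_P by simp
  qed
  have AE: "AE p in ?P. norm (fst p) = 1 \<and> isCont k (snd p + fst p \<bullet> (M' *v fst p + v'))"
  proof (rule SL.AE_pair_measure[OF norm_m])
    show "AE \<xi> in sphere_measure. AE u in lborel. norm (fst (\<xi>, u)) = 1 \<and>
        isCont k (snd (\<xi>, u) + fst (\<xi>, u) \<bullet> (M' *v fst (\<xi>, u) + v'))"
      using AE_sphere_measure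
    proof eventually_elim
      case (elim \<xi>)
      let ?a = "\<xi> \<bullet> (M' *v \<xi> + v')"
      have "countable ((\<lambda>x. x - ?a) ` {x. \<not> isCont k x})"
        using mono_ctble_discont[OF k_mono] by (rule countable_image)
      then have null: "(\<lambda>x. x - ?a) ` {x. \<not> isCont k x} \<in> null_sets lborel" by (rule countable_imp_null_set_lborel)
      show ?case
      proof (rule AE_I'[OF null], rule subsetI)
        fix u assume "u \<in> {u \<in> space lborel. \<not> (norm (fst (\<xi>, u)) = 1 \<and> isCont k (snd (\<xi>, u) + fst (\<xi>, u) \<bullet> (M' *v fst (\<xi>, u) + v')))}"
        then have "\<not> isCont k (u + ?a)" using elim by simp
        then show "u \<in> (\<lambda>x. x - ?a) ` {x. \<not> isCont k x}" by (intro image_eqI[of _ _ "u + ?a"]) auto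
      qed
    qed
  qed
  have lim_AE: "AE p in ?P. (\<lambda>j. t j p) \<longlonglongrightarrow> limit_integrand M' v' p"
    using AE
  proof eventually_elim
    case (elim p)
    then show ?case
      using shell_integrand_tendsto[OF \<rho> M v, where \<xi> = "fst p" and u = "snd p"] by (simp add: t_def)
  qed
  have "\<forall>\<^sub>F j in sequentially. \<rho> j < 1" by (rule order_tendstoD[OF \<rho>(2)]) simp
  then obtain J where J: "\<And>j. J \<le> j \<Longrightarrow> \<rho> j \<le> 1" unfolding eventually_sequentially by (meson less_imp_le)
  have bound: "AE p in ?P. norm (t j p) \<le> w p" if "J \<le> j" for j
    using AE
  proof eventually_elim
    case (elim p)
    then show ?case
      using shell_integrand_bound[OF \<rho>(1) J[OF that] R' _ \<Psi>', where \<xi> = "fst p" and u = "snd p"] by (simp add: t_def w_def)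
  qed
  have lim_AE': "AE p in ?P. (\<lambda>j. t (j + J) p) \<longlonglongrightarrow> limit_integrand M' v' p"
    using lim_AE by eventually_elim (rule LIMSEQ_ignore_initial_segment)
  have bound': "AE p in ?P. norm (t (j + J) p) \<le> w p" for j by (rule bound) simp
  show "integrable ?P (limit_integrand M' v')"
    by (rule integrable_dominated_convergence[OF lim_m t_m w_int lim_AE' bound'])
  have int_t: "integrable ?P (t j)" if "J \<le> j" for j
  proof (rule Bochner_Integration.integrable_bound[OF w_int t_m])
    show "AE p in ?P. norm (t j p) \<le> norm (w p)"
      using bound[OF that] by eventually_elim (metis abs_ge_self order_trans real_norm_def)
  qed
  have t_eq: "t j = (\<lambda>p. shell_weight CARD('n) (\<rho> j) (snd p) * integrand (\<rho> j) (M j) (v j) ((1 + \<rho> j * snd p) *\<^sub>R fst p))" for j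
    by (simp add: t_def shell_integrand_def fun_eq_iff)
  have pol: "integrable lborel (integrand (\<rho> j) (M j) (v j)) \<longleftrightarrow> integrable ?P (t j)"
    "(\<integral>x. integrand (\<rho> j) (M j) (v j) x \<partial>lborel) = (\<integral>p. t j p \<partial>?P)" for j
    unfolding t_eq by (rule integrable_polar[OF integrand_borel \<rho>(1)], rule integral_polar[OF integrand_borel \<rho>(1)])
  show "\<forall>\<^sub>F j in sequentially. integrable lborel (integrand (\<rho> j) (M j) (v j))"
    unfolding pol(1) eventually_sequentially using int_t by blast
  have "(\<lambda>j. \<integral>p. t (j + J) p \<partial>?P) \<longlonglongrightarrow> (\<integral>p. limit_integrand M' v' p \<partial>?P)"
    by (rule integral_dominated_convergence[OF lim_m t_m w_int lim_AE' bound'])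
  then show "(\<lambda>j. \<integral>x. integrand (\<rho> j) (M j) (v j) x \<partial>lborel) \<longlonglongrightarrow> (\<integral>p. limit_integrand M' v' p \<partial>?P)"
    unfolding pol(2) by (rule LIMSEQ_offset)
qed

end

section \<open>Slopes of the convex profile\<close>

lemma locally_lipschitz_continuous:
  assumes "locally_lipschitz h"
  shows "continuous_on UNIV h"
proof -
  have "isCont h x" for x
  proof -
    obtain u C where u: "0 < u" "C-lipschitz_on (cball x u) h"
      using assms unfolding locally_lipschitz_def by blast
    have "continuous_on (ball x u) h"
      by (rule continuous_on_subset[OF lipschitz_on_continuous_on[OF u(2)]]) auto
    then show ?thesis using u(1) by (simp add: continuous_on_eq_continuous_at)
  qed
  then show ?thesis by (simp add: continuous_on_eq_continuous_at)
qed

text \<open>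
  The right derivative of a convex function, defined everywhere. It is a monotone representative of the
  derivative and can therefore play the role of \<open>k\<close> in the limit theorem.
\<close>
definition right_slope :: "(real \<Rightarrow> real) \<Rightarrow> real \<Rightarrow> real" where
  "right_slope f x = Inf ((\<lambda>t. (f x - f t) / (x - t)) ` {x<..})"

context
  fixes f :: "real \<Rightarrow> real"
  assumes cvx: "convex_on UNIV f"
begin

lemma right_slope_subgradient: "f x + right_slope f x * (y - x) \<le> f y"
  using convex_le_Inf_differential[OF cvx, of x y] by (simp add: right_slope_def)

lemma right_slope_bounds:
  assumes "x < y"
  shows "right_slope f x \<le> (f y - f x) / (y - x)" "(f y - f x) / (y - x) \<le> right_slope f y"
proof -
  show "right_slope f x \<le> (f y - f x) / (y - x)"
    using right_slope_subgradient[of x y] assms by (simp add: le_divide_eq)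
  have "f y - f x \<le> right_slope f y * (y - x)"
    using right_slope_subgradient[of y x] by (simp add: algebra_simps)
  then show "(f y - f x) / (y - x) \<le> right_slope f y" using assms by (simp add: divide_le_eq)
qed

lemma right_slope_mono: "mono (right_slope f)"
proof (rule monoI)
  fix x y :: real assume "x \<le> y"
  then show "right_slope f x \<le> right_slope f y"
    using right_slope_bounds[of x y] by (cases "x = y") (auto intro: order_trans)
qed

text \<open>
  Difference quotients of \<open>f\<close> at \<open>x\<close> lie between values of the slope at points close to \<open>x\<close>.
\<close>
lemma right_slope_deriv:
  assumes cont: "isCont (right_slope f) x"
  shows "(f has_real_derivative right_slope f x) (at x)"
proof -
  let ?k = "right_slope f"
  have "((\<lambda>h. ?k (x + h)) \<longlongrightarrow> ?k x) (at 0)" using cont by (simp add: isCont_iff)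
  then have lim: "((\<lambda>h. ?k (x + h) - ?k x) \<longlongrightarrow> 0) (at 0)" by (simp add: LIM_zero_iff)
  have "((\<lambda>h. (f (x + h) - f x) / h - ?k x) \<longlongrightarrow> 0) (at 0)"
  proof (rule tendsto_0_le[OF lim, of _ 1])
    show "\<forall>\<^sub>F h in at 0. norm ((f (x + h) - f x) / h - ?k x) \<le> norm (?k (x + h) - ?k x) * 1"
      unfolding eventually_at_filter
    proof (intro always_eventually allI impI)
      fix h :: real assume h: "h \<noteq> 0"
      show "norm ((f (x + h) - f x) / h - ?k x) \<le> norm (?k (x + h) - ?k x) * 1"
      proof (cases "0 < h")
        case True
        then show ?thesis using right_slope_bounds[of x "x + h"] by simp
      next
        case False
        then have "x + h < x" using h by simp
        moreover have "(f x - f (x + h)) / (x - (x + h)) = (f (x + h) - f x) / h"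
          using h by (simp add: divide_simps)
        ultimately have "?k (x + h) \<le> (f (x + h) - f x) / h" "(f (x + h) - f x) / h \<le> ?k x"
          using right_slope_bounds[of "x + h" x] by simp_all
        then show ?thesis by simp
      qed
    qed
  qed
  then show ?thesis by (simp add: DERIV_def LIM_zero_iff)
qed

end

lemma integrable_bounded_support:
  fixes h :: "real \<Rightarrow> real"
  assumes h: "h \<in> borel_measurable borel" and bound: "\<And>u. \<bar>h u\<bar> \<le> B * indicator {a..b} u"
  shows "integrable lborel h"
proof (rule Bochner_Integration.integrable_bound)
  show "integrable lborel (\<lambda>u. B * indicator {a..b} u :: real)"
    by (intro integrable_mult_right integrable_real_indicator) (auto simp: emeasure_lborel_Icc_eq)
  show "AE u in lborel. norm (h u) \<le> norm (B * indicator {a..b} u)"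
    using bound by (intro AE_I2) (metis abs_ge_self order_trans real_norm_def)
qed (use h in simp)

context profile
begin

text \<open>
  This is \<open>F_conv k g\<close> after the substitution \<open>t = u + x\<close>, which frees \<open>g\<close> from the variable \<open>x\<close>.
\<close>
definition conv :: "real \<Rightarrow> real" where "conv x = (\<integral>u. k (u + x) * g u \<partial>lborel)"

lemma integrable_conv: "integrable lborel (\<lambda>u. k (u + x) * g u)"
proof (rule integrable_bounded_support[of _ "k (1 + x)" "-1 - x" 1])
  fix u
  show "\<bar>k (u + x) * g u\<bar> \<le> k (1 + x) * indicator {-1 - x..1} u"
  proof (cases "-1 - x \<le> u \<and> u \<le> 1")
    case True
    then have "k (u + x) \<le> k (1 + x)" by (intro monoD[OF k_mono]) simp
    then have "k (u + x) * g u \<le> k (1 + x) * 1" using k_nonneg g_01 by (intro mult_mono) auto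
    then show ?thesis using True k_nonneg[of "u + x"] g_01[of u] by (simp add: abs_mult)
  next
    case False
    then have z: "k (u + x) * g u = 0" using k_0[of "u + x"] g_0[of u] by (cases "1 \<le> u") auto
    show ?thesis unfolding z using k_nonneg[of "1 + x"] by simp
  qed
qed measurable

lemma conv_mono: "mono conv"
  unfolding conv_def
  by (intro monoI integral_mono integrable_conv mult_right_mono monoD[OF k_mono]) (auto simp: g_01)

lemma conv_nonneg: "0 \<le> conv x"
  unfolding conv_def by (intro integral_nonneg_AE AE_I2) (simp add: k_nonneg g_01)

lemma conv_borel [measurable]: "conv \<in> borel_measurable borel"
  by (rule borel_measurable_mono[OF conv_mono])

end

locale profile_data =
  fixes f g :: "real \<Rightarrow> real"
  assumes lf: "locally_lipschitz f" and cvx_f: "convex_on UNIV f"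
    and f0: "\<And>x. x \<le> -1 \<Longrightarrow> f x = 0" and f_strict: "strict_mono_on {-1..} f"
    and lg: "locally_lipschitz g" and anti: "antimono g"
    and g1: "\<And>x. x \<le> -1 \<Longrightarrow> g x = 1" and gpos: "\<And>x. -1 < x \<Longrightarrow> x < 1 \<Longrightarrow> 0 < g x"
    and g0: "\<And>x. 1 \<le> x \<Longrightarrow> g x = 0"
begin

lemma f_less: "x < y \<Longrightarrow> -1 < y \<Longrightarrow> f x < f y"
proof (cases "-1 \<le> x")
  case True
  then show "x < y \<Longrightarrow> -1 < y \<Longrightarrow> f x < f y" using strict_mono_onD[OF f_strict, of x y] by simp
next
  case False
  then show "x < y \<Longrightarrow> -1 < y \<Longrightarrow> f x < f y"
    using strict_mono_onD[OF f_strict, of "-1" y] f0[of "-1"] f0[of x] by simp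
qed

lemma f_mono: "mono f"
proof (rule monoI)
  fix x y :: real assume "x \<le> y"
  then show "f x \<le> f y"
    using f_less[of x y] f0[of x] f0[of y] by (cases "x = y"; cases "-1 < y") auto
qed

lemma f_nonneg: "0 \<le> f x"
  using monoD[OF f_mono, of "min x (-1)" x] f0[of "min x (-1)"] by simp

lemma g_bounds: "0 \<le> g x \<and> g x \<le> 1"
  using antimonoD[OF anti, of x "max x 1"] g0[of "max x 1"] antimonoD[OF anti, of "min x (-1)" x] g1[of "min x (-1)"]
  by simp

sublocale profile f g
  using f_mono f_nonneg f0 locally_lipschitz_continuous[OF lg] g_bounds g0 by unfold_locales auto

abbreviation k :: "real \<Rightarrow> real" where "k \<equiv> right_slope f"

lemma right_slope_nonneg: "0 \<le> k x"
proof -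
  have "0 \<le> (f x - f (x - 1)) / (x - (x - 1))" using monoD[OF f_mono, of "x - 1" x] by simp
  also have "\<dots> \<le> k x" by (rule right_slope_bounds(2)[OF cvx_f]) simp
  finally show ?thesis .
qed

lemma right_slope_zero: "x < -1 \<Longrightarrow> k x = 0"
  using right_slope_bounds(1)[OF cvx_f, of x "-1"] f0[of x] f0[of "-1"] right_slope_nonneg[of x] by simp

sublocale slope: profile k g
  using right_slope_mono[OF cvx_f] right_slope_nonneg right_slope_zero g_cont g_bounds g0 by unfold_locales auto

lemma F_eq: "F_conv f g = conv"
proof
  fix x
  show "F_conv f g x = conv x"
    unfolding F_conv_def conv_def using lborel_integral_real_affine[of 1 "\<lambda>t. f t * g (t - x)" x]
    by (simp add: add.commute)
qed

text \<open>
  On a common interval of \<open>u\<close> the function \<open>g\<close> is positive and \<open>u + y\<close> exceeds -1, so the integrand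
  increases strictly there.
\<close>
lemma conv_less:
  assumes "x < y" "-2 < y"
  shows "conv x < conv y"
proof (rule ccontr)
  assume "\<not> conv x < conv y"
  then have eq: "conv y - conv x = 0" using monoD[OF conv_mono, of x y] assms by simp
  let ?h = "\<lambda>u. f (u + y) * g u - f (u + x) * g u"
  have int: "integrable lborel ?h" by (intro Bochner_Integration.integrable_diff integrable_conv)
  have nn: "0 \<le> ?h u" for u
    using mult_right_mono[OF monoD[OF f_mono, of "u + x" "u + y"], of "g u"] assms g_bounds by simp
  have "(\<integral>u. ?h u \<partial>lborel) = 0"
    using eq unfolding conv_def by (subst Bochner_Integration.integral_diff) (auto intro: integrable_conv)
  then have AE0: "AE u in lborel. ?h u = 0"
    using integral_nonneg_eq_0_iff_AE[OF int] nn by simp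
  define a where "a = max (-1) (-1 - y)"
  have a: "a < 1" using assms by (simp add: a_def)
  have "AE u in lborel. u \<notin> {a<..<1}"
    using AE0
  proof eventually_elim
    case (elim u)
    show ?case
    proof
      assume u: "u \<in> {a<..<1}"
      then have "0 < g u" by (intro gpos) (auto simp: a_def)
      moreover have "f (u + x) < f (u + y)" using u assms by (intro f_less) (auto simp: a_def)
      ultimately have "f (u + x) * g u < f (u + y) * g u" by simp
      then show False using elim by simp
    qed
  qed
  then have "emeasure lborel {a<..<1} = 0"
    by (subst (asm) AE_iff_measurable[of "{a<..<1}"]) auto
  then show False using a by simp
qed

text \<open>
  Differentiation under the integral sign. The difference quotients of \<open>f\<close> are dominated by its slope one
  unit further to the right and converge wherever the slope is continuous.
\<close>
lemma conv_has_derivative: "(conv has_real_derivative slope.conv x) (at x)"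
  unfolding DERIV_def tendsto_at_iff_sequentially
proof (intro allI impI)
  fix X :: "nat \<Rightarrow> real" assume X0: "\<forall>i. X i \<in> UNIV - {0}" and X: "X \<longlonglongrightarrow> 0"
  define q where "q i u = (f (u + (x + X i)) * g u - f (u + x) * g u) / X i" for i u
  have q_eq: "q i u = (f ((u + x) + X i) - f (u + x)) / X i * g u" for i u
    by (simp add: q_def diff_divide_distrib left_diff_distrib add.assoc)
  have int: "integrable lborel (q i)" for i
    unfolding q_def by (intro integrable_divide Bochner_Integration.integrable_diff integrable_conv)
  have eq: "((\<lambda>h. (conv (x + h) - conv x) / h) \<circ> X) i = (\<integral>u. q i u \<partial>lborel)" for i
    unfolding q_def conv_def comp_def
    by (simp add: Bochner_Integration.integral_diff integrable_conv)
  have "\<forall>\<^sub>F i in sequentially. \<bar>X i\<bar> < 1"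
    using tendsto_rabs_zero[OF X] by (rule order_tendstoD) simp
  then obtain J where J: "\<And>i. J \<le> i \<Longrightarrow> \<bar>X i\<bar> < 1" unfolding eventually_sequentially by blast
  have bound: "\<bar>q i u\<bar> \<le> k (u + (x + 1)) * g u" if "J \<le> i" for i u
  proof -
    have X1: "\<bar>X i\<bar> < 1" "X i \<noteq> 0" using J[OF that] X0 by auto
    let ?z = "u + x"
    have "0 \<le> (f (?z + X i) - f ?z) / X i \<and> (f (?z + X i) - f ?z) / X i \<le> k (?z + 1)"
    proof (cases "0 < X i")
      case True
      have "0 \<le> f (?z + X i) - f ?z" using True monoD[OF f_mono, of ?z "?z + X i"] by simp
      moreover have "(f (?z + X i) - f ?z) / X i \<le> k (?z + X i)"
        using right_slope_bounds(2)[OF cvx_f, of ?z "?z + X i"] True by simp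
      moreover have "k (?z + X i) \<le> k (?z + 1)" using X1 by (intro monoD[OF slope.k_mono]) simp
      ultimately show ?thesis using True by simp
    next
      case False
      then have neg: "X i < 0" using X1 by simp
      have "(f ?z - f (?z + X i)) / (?z - (?z + X i)) = (f (?z + X i) - f ?z) / X i"
        using X1(2) by (simp add: divide_simps)
      then have "(f (?z + X i) - f ?z) / X i \<le> k ?z"
        using right_slope_bounds(2)[OF cvx_f, of "?z + X i" ?z] neg by simp
      moreover have "k ?z \<le> k (?z + 1)" by (intro monoD[OF slope.k_mono]) simp
      moreover have "f (?z + X i) - f ?z \<le> 0" using neg monoD[OF f_mono, of "?z + X i" ?z] by simp
      ultimately show ?thesis using neg by (simp add: divide_nonpos_neg)
    qed
    then have "0 \<le> (f (?z + X i) - f ?z) / X i * g u" "(f (?z + X i) - f ?z) / X i * g u \<le> k (?z + 1) * g u"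
      using g_bounds[of u] by (blast intro: mult_nonneg_nonneg mult_right_mono)+
    then show ?thesis
      unfolding q_eq by (simp only: abs_of_nonneg add.assoc)
  qed
  have ctble: "countable ((\<lambda>z. z - x) ` {z. \<not> isCont k z})"
    using mono_ctble_discont[OF slope.k_mono] by (rule countable_image)
  have AE: "AE u in lborel. isCont k (u + x)"
  proof (rule AE_I'[OF countable_imp_null_set_lborel[OF ctble]], rule subsetI)
    fix u assume "u \<in> {u \<in> space lborel. \<not> isCont k (u + x)}"
    then show "u \<in> (\<lambda>z. z - x) ` {z. \<not> isCont k z}" by (intro image_eqI[of _ _ "u + x"]) auto
  qed
  have lim: "AE u in lborel. (\<lambda>i. q (i + J) u) \<longlonglongrightarrow> k (u + x) * g u"
    using AE
  proof eventually_elim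
    case (elim u)
    have "((\<lambda>h. (f ((u + x) + h) - f (u + x)) / h) \<longlongrightarrow> k (u + x)) (at 0)"
      using right_slope_deriv[OF cvx_f elim] by (simp add: DERIV_def)
    then have "((\<lambda>h. (f ((u + x) + h) - f (u + x)) / h) \<circ> X) \<longlonglongrightarrow> k (u + x)"
      using X0 X unfolding tendsto_at_iff_sequentially by blast
    then have "(\<lambda>i. (f ((u + x) + X i) - f (u + x)) / X i * g u) \<longlonglongrightarrow> k (u + x) * g u"
      unfolding comp_def by (intro tendsto_mult tendsto_const)
    then show ?case unfolding q_eq by (rule LIMSEQ_ignore_initial_segment)
  qed
  have "(\<lambda>i. \<integral>u. q (i + J) u \<partial>lborel) \<longlonglongrightarrow> (\<integral>u. k (u + x) * g u \<partial>lborel)"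
  proof (rule integral_dominated_convergence)
    show "AE u in lborel. norm (q (i + J) u) \<le> k (u + (x + 1)) * g u" for i
      using bound[of "i + J"] by simp
  qed (use lim int slope.integrable_conv borel_measurable_integrable in auto)
  then have "(\<lambda>i. \<integral>u. q i u \<partial>lborel) \<longlonglongrightarrow> slope.conv x"
    unfolding slope.conv_def by (rule LIMSEQ_offset)
  then show "((\<lambda>h. (conv (x + h) - conv x) / h) \<circ> X) \<longlonglongrightarrow> slope.conv x"
    by (subst tendsto_cong[of _ "\<lambda>i. \<integral>u. q i u \<partial>lborel"]) (simp_all add: eq[symmetric])
qed

lemma deriv_F: "deriv (F_conv f g) = slope.conv"
  unfolding F_eq using DERIV_imp_deriv[OF conv_has_derivative] by auto

end

context shell_limit
begin

lemma
  assumes "integrable (sphere_measure \<Otimes>\<^sub>M lborel) (limit_integrand M v)"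
  shows integral_limit_integrand: "(\<integral>p. limit_integrand M v p \<partial>(sphere_measure \<Otimes>\<^sub>M lborel))
      = (\<integral>\<xi>. indicator (frontier K) \<xi> * \<psi> \<xi> * conv (\<xi> \<bullet> (M *v \<xi> + v)) \<partial>sphere_measure)"
    and integrable_limit_section: "integrable sphere_measure (\<lambda>\<xi>. indicator (frontier K) \<xi> * \<psi> \<xi> * conv (\<xi> \<bullet> (M *v \<xi> + v)))"
proof -
  interpret S: finite_measure "sphere_measure :: (real^'n) measure" by (rule finite_measure_sphere_measure)
  interpret SL: pair_sigma_finite "sphere_measure :: (real^'n) measure" "lborel :: real measure" ..
  have eq: "(\<integral>u. limit_integrand M v (\<xi>, u) \<partial>lborel) = indicator (frontier K) \<xi> * \<psi> \<xi> * conv (\<xi> \<bullet> (M *v \<xi> + v))" for \<xi>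
    by (simp add: limit_integrand_def conv_def)
  show "(\<integral>p. limit_integrand M v p \<partial>(sphere_measure \<Otimes>\<^sub>M lborel))
      = (\<integral>\<xi>. indicator (frontier K) \<xi> * \<psi> \<xi> * conv (\<xi> \<bullet> (M *v \<xi> + v)) \<partial>sphere_measure)"
    using SL.integral_fst'[OF assms] by (simp only: eq)
  show "integrable sphere_measure (\<lambda>\<xi>. indicator (frontier K) \<xi> * \<psi> \<xi> * conv (\<xi> \<bullet> (M *v \<xi> + v)))"
    using SL.integrable_fst'[OF assms] by (simp only: eq)
qed

end

section \<open>Integrals over the contact set\<close>

lemma contact_measure_eq: "contact_measure K = density sphere_measure (\<lambda>\<xi> :: real^'n. ennreal (indicator (frontier K) \<xi>))"
proof -
  have m: "indicator A \<in> borel_measurable (hausdorff_measure (CARD('n) - 1) :: (real^'n) measure)" if "closed A" for A :: "(real^'n) set"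
    using that by (intro borel_measurable_indicator) (simp add: borel_closed)
  have "density sphere_measure (indicator (frontier K)) = density (hausdorff_measure (CARD('n) - 1)) (\<lambda>\<xi> :: real^'n. indicator (sphere 0 1) \<xi> * indicator (frontier K) \<xi>)"
    unfolding sphere_measure_def by (rule density_density_eq) (rule m, simp)+
  also have "(\<lambda>\<xi> :: real^'n. indicator (sphere 0 1) \<xi> * indicator (frontier K) \<xi> :: ennreal) = indicator (sphere 0 1 \<inter> frontier K)"
    by (simp add: fun_eq_iff indicator_inter_arith)
  finally show ?thesis by (simp add: contact_measure_def ennreal_indicator)
qed

lemma sets_contact_measure [simp, measurable_cong]: "sets (contact_measure (K :: (real^'n) set)) = sets borel"
  by (simp add: contact_measure_eq)

lemma
  fixes h :: "real^'n \<Rightarrow> real"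
  assumes h: "h \<in> borel_measurable borel"
  shows integral_contact_measure: "(\<integral>\<xi>. h \<xi> \<partial>contact_measure K) = (\<integral>\<xi>. indicator (frontier K) \<xi> * h \<xi> \<partial>sphere_measure)"
    and integrable_contact_measure: "integrable (contact_measure K) h \<longleftrightarrow> integrable sphere_measure (\<lambda>\<xi>. indicator (frontier K) \<xi> * h \<xi>)"
proof -
  have m: "indicator (frontier K) \<in> borel_measurable (sphere_measure :: (real^'n) measure)"
    by (intro borel_measurable_indicator) (simp add: borel_closed)
  have h': "h \<in> borel_measurable sphere_measure"
    using h by (simp cong: measurable_cong_sets)
  show "(\<integral>\<xi>. h \<xi> \<partial>contact_measure K) = (\<integral>\<xi>. indicator (frontier K) \<xi> * h \<xi> \<partial>sphere_measure)"
    unfolding contact_measure_eq by (subst integral_density[OF h' m]) auto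
  show "integrable (contact_measure K) h \<longleftrightarrow> integrable sphere_measure (\<lambda>\<xi>. indicator (frontier K) \<xi> * h \<xi>)"
    unfolding contact_measure_eq by (subst integrable_density[OF h' m]) auto
qed

lemma borel_measurable_quadratic [measurable]:
  "(\<lambda>\<xi> :: real^'n. \<xi> \<bullet> (M *v \<xi> + v)) \<in> borel_measurable borel"
  by (intro borel_measurable_continuous_onI continuous_intros linear_continuous_on)
     (simp add: linear_conv_bounded_linear[symmetric])

lemma (in profile_data) I_one_eq:
  "I_one f g K (M, v) = (\<integral>\<xi>. indicator (frontier K) \<xi> * conv (\<xi> \<bullet> (M *v \<xi> + v)) \<partial>(sphere_measure :: (real^'n) measure))"
proof -
  let ?F = "\<lambda>\<xi> :: real^'n. conv (\<xi> \<bullet> (M *v \<xi> + v))"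
  have C: "sphere 0 1 \<inter> frontier K \<in> sets borel" by (intro borel_closed closed_Int) auto
  have Cm: "(\<lambda>\<xi> :: real^'n. indicator (sphere 0 1 \<inter> frontier K) \<xi> :: real) \<in> borel_measurable borel"
    by (rule borel_measurable_indicator[OF C])
  have Fm: "?F \<in> borel_measurable borel"
    by (rule measurable_compose[OF borel_measurable_quadratic conv_borel])
  have "I_one f g K (M, v) = (\<integral>\<xi>. indicator (sphere 0 1 \<inter> frontier K) \<xi> * ?F \<xi> \<partial>contact_measure K)"
    by (simp add: I_one_def set_lebesgue_integral_def F_eq)
  also have "\<dots> = (\<integral>\<xi>. indicator (frontier K) \<xi> * (indicator (sphere 0 1 \<inter> frontier K) \<xi> * ?F \<xi>) \<partial>sphere_measure)"
    by (intro integral_contact_measure borel_measurable_times Cm Fm)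
  also have "\<dots> = (\<integral>\<xi>. indicator (frontier K) \<xi> * ?F \<xi> \<partial>sphere_measure)"
  proof (rule integral_cong_AE)
    have fm: "(\<lambda>\<xi> :: real^'n. indicator (frontier K) \<xi> :: real) \<in> borel_measurable borel"
      by (intro borel_measurable_indicator) (simp add: borel_closed)
    show "(\<lambda>\<xi>. indicator (frontier K) \<xi> * (indicator (sphere 0 1 \<inter> frontier K) \<xi> * ?F \<xi>)) \<in> borel_measurable sphere_measure"
      "(\<lambda>\<xi>. indicator (frontier K) \<xi> * ?F \<xi>) \<in> borel_measurable sphere_measure"
      unfolding measurable_cong_sets[OF sets_sphere_measure refl]
      by (intro borel_measurable_times fm Cm Fm)+
    show "AE \<xi> in sphere_measure. indicator (frontier K) \<xi> * (indicator (sphere 0 1 \<inter> frontier K) \<xi> * ?F \<xi>) = indicator (frontier K) \<xi> * ?F \<xi>"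
      using AE_sphere_measure by eventually_elim (auto simp: indicator_def)
  qed
  finally show ?thesis .
qed

section \<open>The minimum of the limit functional\<close>

lemma unique_min_onD:
  assumes "unique_min_on S \<phi> p"
  shows "p \<in> S" "q \<in> S \<Longrightarrow> \<phi> p \<le> \<phi> q" "q \<in> S \<Longrightarrow> \<phi> q \<le> \<phi> p \<Longrightarrow> q = p"
proof -
  have min: "is_arg_min \<phi> (\<lambda>q. q \<in> S) p" and uniq: "\<And>q. is_arg_min \<phi> (\<lambda>q. q \<in> S) q \<Longrightarrow> q = p"
    using assms by (auto simp: unique_min_on_def)
  show "p \<in> S" using min by (simp add: is_arg_min_def)
  show le: "\<phi> p \<le> \<phi> q" if "q \<in> S" for q
    using min that by (force simp: is_arg_min_def not_less[symmetric])
  show "q = p" if q: "q \<in> S" "\<phi> q \<le> \<phi> p"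
  proof (rule uniq)
    show "is_arg_min \<phi> (\<lambda>q. q \<in> S) q"
      unfolding is_arg_min_def using q le by (meson not_less order_trans)
  qed
qed

lemma unique_min_onI:
  assumes "p \<in> S" "\<And>q. q \<in> S \<Longrightarrow> \<phi> p \<le> \<phi> q" "\<And>q. q \<in> S \<Longrightarrow> \<phi> q \<le> \<phi> p \<Longrightarrow> q = p"
  shows "unique_min_on S \<phi> p"
  unfolding unique_min_on_def
proof (intro conjI allI impI)
  show "is_arg_min \<phi> (\<lambda>q. q \<in> S) p"
    unfolding is_arg_min_def using assms(1,2) by (meson not_less)
  fix q assume "is_arg_min \<phi> (\<lambda>q. q \<in> S) q"
  then show "q = p" unfolding is_arg_min_def using assms(1,3) by (meson not_less)
qed

lemma unique_min_on_unique: "unique_min_on S \<phi> p \<Longrightarrow> unique_min_on S \<phi> q \<Longrightarrow> p = q"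
  by (metis unique_min_on_def)

lemma trace_mat_1: "trace (mat 1 :: real^'n^'n) = real CARD('n)"
  by (simp add: trace_def mat_def)

lemma trace_linear [simp]:
  "trace (A + B :: real^'n^'n) = trace A + trace B" "trace (c *\<^sub>R A :: real^'n^'n) = c * trace A"
  "trace (A - B :: real^'n^'n) = trace A - trace B"
  by (simp_all add: trace_def sum.distrib sum_distrib_left sum_subtractf)

lemma Sym_linear:
  "A \<in> Sym \<Longrightarrow> B \<in> Sym \<Longrightarrow> A + B \<in> Sym" "A \<in> Sym \<Longrightarrow> c *\<^sub>R A \<in> Sym" "A \<in> Sym \<Longrightarrow> B \<in> Sym \<Longrightarrow> A - B \<in> Sym" "mat 1 \<in> Sym"
  by (auto simp: Sym_def transpose_def vec_eq_iff mat_def)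

lemma Sym_pos_scale: "A \<in> Sym_pos \<Longrightarrow> 0 < c \<Longrightarrow> c *\<^sub>R A \<in> Sym_pos"
  by (auto simp: Sym_pos_def Sym_linear(2) scaleR_matrix_vector_assoc[symmetric])

context profile_data
begin

definition contact_fn :: "(real^'n) set \<Rightarrow> real^'n^'n \<Rightarrow> real^'n \<Rightarrow> real^'n \<Rightarrow> real" where
  "contact_fn K M v \<xi> = indicator (frontier K) \<xi> * conv (\<xi> \<bullet> (M *v \<xi> + v))"

lemma contact_fn_nonneg: "0 \<le> contact_fn K M v \<xi>"
  by (simp add: contact_fn_def conv_nonneg)

lemma contact_fn_integrable: "integrable (sphere_measure :: (real^'n) measure) (contact_fn K M v)"
proof -
  interpret S: finite_measure "sphere_measure :: (real^'n) measure" by (rule finite_measure_sphere_measure)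
  have fm: "(\<lambda>\<xi> :: real^'n. indicator (frontier K) \<xi> :: real) \<in> borel_measurable borel"
    by (intro borel_measurable_indicator) (simp add: borel_closed)
  have Fm: "(\<lambda>\<xi> :: real^'n. conv (\<xi> \<bullet> (M *v \<xi> + v))) \<in> borel_measurable borel"
    by (rule measurable_compose[OF borel_measurable_quadratic conv_borel])
  show ?thesis
  proof (rule S.integrable_const_bound[where B = "conv (norm M + norm v)"])
    show "AE \<xi> in sphere_measure. norm (contact_fn K M v \<xi>) \<le> conv (norm M + norm v)"
      using AE_sphere_measure
    proof eventually_elim
      case (elim \<xi>)
      have "\<xi> \<bullet> (M *v \<xi> + v) \<le> norm \<xi> * norm (M *v \<xi> + v)" by (rule norm_cauchy_schwarz)
      also have "\<dots> \<le> norm (M *v \<xi>) + norm v" using norm_triangle_ineq[of "M *v \<xi>" v] elim by simp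
      also have "\<dots> \<le> norm M + norm v" using norm_matrix_vector_le[of M \<xi>] elim by simp
      finally have "conv (\<xi> \<bullet> (M *v \<xi> + v)) \<le> conv (norm M + norm v)" by (rule monoD[OF conv_mono])
      then show ?case
        using conv_nonneg[of "norm M + norm v"] conv_nonneg[of "\<xi> \<bullet> (M *v \<xi> + v)"]
        by (auto simp: contact_fn_def indicator_def)
    qed
    show "contact_fn K M v \<in> borel_measurable sphere_measure"
      unfolding measurable_cong_sets[OF sets_sphere_measure refl] contact_fn_def
      by (intro borel_measurable_times fm Fm)
  qed
qed

lemma I_one_contact_fn: "I_one f g K (M, v) = (\<integral>\<xi>. contact_fn K M v \<xi> \<partial>(sphere_measure :: (real^'n) measure))"
  by (simp add: I_one_eq contact_fn_def)

text \<open>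
  The convolution is monotone, so the functional only grows when the contact points move outwards, and it
  stays equal only if almost no contact value changes.
\<close>
lemma I_one_mono:
  fixes K :: "(real^'n) set"
  assumes "\<And>\<xi>. norm \<xi> = 1 \<Longrightarrow> \<xi> \<in> frontier K \<Longrightarrow> \<xi> \<bullet> (M *v \<xi> + v) \<le> \<xi> \<bullet> (M' *v \<xi> + v')"
  shows "I_one f g K (M, v) \<le> I_one f g K (M', v')"
    and "I_one f g K (M', v') \<le> I_one f g K (M, v) \<Longrightarrow>
      AE \<xi> in sphere_measure. norm \<xi> = 1 \<and> (\<xi> \<in> frontier K \<longrightarrow> conv (\<xi> \<bullet> (M *v \<xi> + v)) = conv (\<xi> \<bullet> (M' *v \<xi> + v')))"
proof -
  have le: "AE \<xi> in sphere_measure. contact_fn K M v \<xi> \<le> contact_fn K M' v' \<xi>"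
    using AE_sphere_measure
  proof eventually_elim
    case (elim \<xi>)
    then show ?case using monoD[OF conv_mono assms, of \<xi>] by (auto simp: contact_fn_def indicator_def)
  qed
  show "I_one f g K (M, v) \<le> I_one f g K (M', v')"
    unfolding I_one_contact_fn by (rule integral_mono_AE[OF contact_fn_integrable contact_fn_integrable le])
  assume ge: "I_one f g K (M', v') \<le> I_one f g K (M, v)"
  let ?d = "\<lambda>\<xi>. contact_fn K M' v' \<xi> - contact_fn K M v \<xi>"
  have int: "integrable sphere_measure ?d" by (intro Bochner_Integration.integrable_diff contact_fn_integrable)
  have nn: "AE \<xi> in sphere_measure. 0 \<le> ?d \<xi>" using le by eventually_elim simp
  have "(\<integral>\<xi>. ?d \<xi> \<partial>sphere_measure) = I_one f g K (M', v') - I_one f g K (M, v)"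
    unfolding I_one_contact_fn by (rule Bochner_Integration.integral_diff[OF contact_fn_integrable contact_fn_integrable])
  also have "\<dots> \<le> 0" using ge by simp
  finally have "(\<integral>\<xi>. ?d \<xi> \<partial>sphere_measure) = 0" using integral_nonneg_AE[OF nn] by linarith
  then have "AE \<xi> in sphere_measure. ?d \<xi> = 0" using integral_nonneg_eq_0_iff_AE[OF int nn] by simp
  then show "AE \<xi> in sphere_measure. norm \<xi> = 1 \<and> (\<xi> \<in> frontier K \<longrightarrow> conv (\<xi> \<bullet> (M *v \<xi> + v)) = conv (\<xi> \<bullet> (M' *v \<xi> + v')))"
    using AE_sphere_measure by eventually_elim (auto simp: contact_fn_def)
qed

lemma I_one_zeroI:
  fixes K :: "(real^'n) set"
  assumes "AE \<xi> in sphere_measure. \<xi> \<in> frontier K \<longrightarrow> conv (\<xi> \<bullet> (M *v \<xi> + v)) = 0"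
  shows "I_one f g K (M, v) = 0"
proof -
  have "AE \<xi> in sphere_measure. contact_fn K M v \<xi> = 0"
    using assms by eventually_elim (auto simp: contact_fn_def)
  then show ?thesis unfolding I_one_contact_fn by (rule integral_eq_zero_AE)
qed

lemma I_one_nonneg: "0 \<le> I_one f g K (M, v)"
  unfolding I_one_contact_fn by (intro integral_nonneg_AE AE_I2 contact_fn_nonneg)

text \<open>
  The supports of the translated \<open>f\<close> and of \<open>g\<close> are separated.
\<close>
lemma conv_eq_0: "x \<le> -2 \<Longrightarrow> conv x = 0"
proof -
  assume x: "x \<le> -2"
  have "f (u + x) * g u = 0" for u
    using f0[of "u + x"] g0[of u] x by (cases "u \<le> 1") auto
  then have "(\<lambda>u. f (u + x) * g u) = (\<lambda>_. 0)" by (rule ext)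
  then show "conv x = 0" unfolding conv_def by simp
qed

lemma conv_0_pos: "0 < conv 0"
  using conv_less[of "-3" 0] conv_eq_0[of "-3"] by simp

text \<open>
  If 0 were not an interior point, all contact points would lie in a half space \<open>a \<bullet> x \<ge> 0\<close>, and
  translating by \<open>- a\<close> would move them inwards, giving a second minimum.
\<close>
lemma zero_in_interior:
  fixes K :: "(real^'n) set"
  assumes K: "compact K" "convex K" "interior K \<noteq> {}"
    and min: "unique_min_on (Sym_zero \<times> UNIV) (I_one f g K) (M0, w0)"
  shows "0 \<in> interior K"
proof (rule ccontr)
  assume "0 \<notin> interior K"
  then obtain a where a: "a \<noteq> 0" "\<forall>x\<in>interior K. 0 \<le> a \<bullet> x"
    using separating_hyperplane_set_0[OF convex_interior[OF K(2)]] by blast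
  have "closure (interior K) \<subseteq> {x. 0 \<le> a \<bullet> x}"
    using a(2) by (intro closure_minimal) (auto intro: closed_halfspace_ge)
  then have "K \<subseteq> {x. 0 \<le> a \<bullet> x}"
    using convex_closure_interior[OF K(2,3)] K(1) by (simp add: compact_imp_closed)
  moreover have "frontier K \<subseteq> K" using K(1) by (simp add: compact_imp_closed frontier_subset_closed)
  ultimately have pos: "0 \<le> a \<bullet> \<xi>" if "\<xi> \<in> frontier K" for \<xi> using that by blast
  have "I_one f g K (M0, w0 - a) \<le> I_one f g K (M0, w0)"
    by (rule I_one_mono(1)) (use pos in \<open>simp add: inner_diff_right inner_add_right inner_commute[of _ a]\<close>)
  moreover have "(M0, w0 - a) \<in> Sym_zero \<times> UNIV" using unique_min_onD(1)[OF min] by simp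
  ultimately have "(M0, w0 - a) = (M0, w0)" using unique_min_onD(3)[OF min] by blast
  then show False using a(1) by simp
qed

end

locale contact_minimum = unit_ball_body K + profile_data f g for K :: "(real^'n) set" and f g +
  fixes M0 :: "real^'n^'n" and w0 :: "real^'n"
  assumes min: "unique_min_on (Sym_zero \<times> UNIV) (I_one f g K) (M0, w0)"
begin

lemma M0: "M0 \<in> Sym" "trace M0 = 0"
  using unique_min_onD(1)[OF min] by (auto simp: Sym_zero_def)

text \<open>
  If the minimal value were zero, almost all contact values would be negative, and doubling \<open>(M0, w0)\<close>
  would keep the value zero. Uniqueness leaves only \<open>(M0, w0) = 0\<close>; but the convolution is positive at 0,
  so the contact set is a null set and every point is a minimum.
\<close>
lemma I_one_min_pos: "0 < I_one f g K (M0, w0)"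
proof (rule ccontr)
  assume "\<not> 0 < I_one f g K (M0, w0)"
  then have I0: "I_one f g K (M0, w0) = 0" using I_one_nonneg[of K M0 w0] by simp
  have "(\<integral>\<xi>. contact_fn K M0 w0 \<xi> \<partial>sphere_measure) = 0" using I0 by (simp add: I_one_contact_fn)
  moreover have "(\<integral>\<xi>. contact_fn K M0 w0 \<xi> \<partial>sphere_measure) = 0 \<longleftrightarrow> (AE \<xi> in sphere_measure. contact_fn K M0 w0 \<xi> = 0)"
    by (rule integral_nonneg_eq_0_iff_AE[OF contact_fn_integrable AE_I2[OF contact_fn_nonneg]])
  ultimately have AE0: "AE \<xi> in sphere_measure. contact_fn K M0 w0 \<xi> = 0" by simp
  have zero: "I_one f g K (M, v) = 0" if "AE \<xi> in sphere_measure. \<xi> \<in> frontier K \<longrightarrow> conv (\<xi> \<bullet> (M *v \<xi> + v)) = 0" for M v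
    by (rule I_one_zeroI[OF that])
  have "I_one f g K (2 *\<^sub>R M0, 2 *\<^sub>R w0) = 0"
  proof (rule zero)
    show "AE \<xi> in sphere_measure. \<xi> \<in> frontier K \<longrightarrow> conv (\<xi> \<bullet> (2 *\<^sub>R M0 *v \<xi> + 2 *\<^sub>R w0)) = 0"
      using AE0
    proof eventually_elim
      case (elim \<xi>)
      show ?case
      proof
        assume "\<xi> \<in> frontier K"
        then have c0: "conv (\<xi> \<bullet> (M0 *v \<xi> + w0)) = 0" using elim by (simp add: contact_fn_def)
        have neg: "\<xi> \<bullet> (M0 *v \<xi> + w0) < 0"
        proof (rule ccontr)
          assume "\<not> \<xi> \<bullet> (M0 *v \<xi> + w0) < 0"
          then have "conv 0 \<le> conv (\<xi> \<bullet> (M0 *v \<xi> + w0))" by (intro monoD[OF conv_mono]) simp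
          then show False using conv_0_pos c0 by simp
        qed
        have "\<xi> \<bullet> (2 *\<^sub>R M0 *v \<xi> + 2 *\<^sub>R w0) = 2 * (\<xi> \<bullet> (M0 *v \<xi> + w0))"
          by (simp add: scaleR_matrix_vector_assoc[symmetric] inner_add_right)
        also have "\<dots> \<le> \<xi> \<bullet> (M0 *v \<xi> + w0)" using neg by simp
        finally have "conv (\<xi> \<bullet> (2 *\<^sub>R M0 *v \<xi> + 2 *\<^sub>R w0)) \<le> 0"
          using monoD[OF conv_mono] c0 by metis
        then show "conv (\<xi> \<bullet> (2 *\<^sub>R M0 *v \<xi> + 2 *\<^sub>R w0)) = 0"
          using conv_nonneg by (metis antisym)
      qed
    qed
  qed
  moreover have "(2 *\<^sub>R M0, 2 *\<^sub>R w0) \<in> Sym_zero \<times> UNIV"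
    using M0 by (simp add: Sym_zero_def Sym_linear)
  ultimately have "(2 *\<^sub>R M0, 2 *\<^sub>R w0) = (M0, w0)" by (intro unique_min_onD(3)[OF min]) (simp_all only: I0)
  then have p0: "M0 = 0" "w0 = 0"
    by (auto simp: scaleR_2)
  have "I_one f g K (0, axis undefined 1) = 0"
  proof (rule zero)
    show "AE \<xi> in sphere_measure. \<xi> \<in> frontier K \<longrightarrow> conv (\<xi> \<bullet> (0 *v \<xi> + axis undefined 1)) = 0"
      using AE0 by eventually_elim (use conv_0_pos p0 in \<open>auto simp: contact_fn_def\<close>)
  qed
  moreover have "(0 :: real^'n^'n, axis undefined 1 :: real^'n) \<in> Sym_zero \<times> UNIV"
    using M0 p0 by (simp add: Sym_zero_def)
  ultimately have "(0, axis undefined 1) = (M0, w0)" by (intro unique_min_onD(3)[OF min]) (simp_all only: I0)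
  then show False using p0 by (simp add: axis_eq_0_iff)
qed

text \<open>
  Subtracting the multiple \<open>\<tau>\<close> of the identity that makes the trace zero lowers every contact value by
  \<open>\<tau>\<close>, so the value of the functional does not increase. If \<open>\<tau> > 0\<close> and the value stayed the same, the
  contact values would almost everywhere lie below the support of the convolution and the minimal value
  would be zero.
\<close>
lemma min_half_space:
  assumes M: "M \<in> Sym" "0 \<le> trace M" and le: "I_one f g K (M, v) \<le> I_one f g K (M0, w0)"
  shows "(M, v) = (M0, w0)"
proof -
  define \<tau> where "\<tau> = trace M / real CARD('n)"
  have \<tau>: "0 \<le> \<tau>" using M(2) by (simp add: \<tau>_def)
  define M' where "M' = M - \<tau> *\<^sub>R mat 1"
  have M': "M' \<in> Sym_zero"
    using M by (simp add: M'_def Sym_zero_def Sym_linear trace_mat_1 \<tau>_def)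
  have a: "\<xi> \<bullet> (M' *v \<xi> + v) = \<xi> \<bullet> (M *v \<xi> + v) - \<tau>" if "norm \<xi> = 1" for \<xi>
    using that by (simp add: M'_def matrix_vector_mult_diff_rdistrib scaleR_matrix_vector_assoc[symmetric]
        inner_add_right inner_diff_right norm_eq_1)
  have le1: "I_one f g K (M', v) \<le> I_one f g K (M, v)"
    by (rule I_one_mono(1)) (use a \<tau> in simp)
  have "(M', v) \<in> Sym_zero \<times> UNIV" using M' by simp
  then have eq: "(M', v) = (M0, w0)" by (rule unique_min_onD(3)[OF min _ order_trans[OF le1 le]])
  show ?thesis
  proof (cases "\<tau> = 0")
    case True
    then show ?thesis using eq by (simp add: M'_def)
  next
    case False
    then have \<tau>0: "0 < \<tau>" using \<tau> by simp
    have "AE \<xi> in sphere_measure. norm \<xi> = 1 \<and> (\<xi> \<in> frontier K \<longrightarrow> conv (\<xi> \<bullet> (M' *v \<xi> + v)) = conv (\<xi> \<bullet> (M *v \<xi> + v)))"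
      by (rule I_one_mono(2)) (use a \<tau> le eq in auto)
    then have "AE \<xi> in sphere_measure. \<xi> \<in> frontier K \<longrightarrow> conv (\<xi> \<bullet> (M' *v \<xi> + v)) = 0"
    proof eventually_elim
      case (elim \<xi>)
      show ?case
      proof
        assume "\<xi> \<in> frontier K"
        have n: "norm \<xi> = 1" using elim by simp
        have c: "conv (\<xi> \<bullet> (M *v \<xi> + v) - \<tau>) = conv (\<xi> \<bullet> (M *v \<xi> + v))"
          using elim a[OF n] \<open>\<xi> \<in> frontier K\<close> by simp
        have "\<xi> \<bullet> (M *v \<xi> + v) \<le> -2"
        proof (rule ccontr)
          assume "\<not> \<xi> \<bullet> (M *v \<xi> + v) \<le> -2"
          then show False using conv_less[of "\<xi> \<bullet> (M *v \<xi> + v) - \<tau>" "\<xi> \<bullet> (M *v \<xi> + v)"] \<tau>0 c by simp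
        qed
        then show "conv (\<xi> \<bullet> (M' *v \<xi> + v)) = 0" using a[OF n] \<tau> by (intro conv_eq_0) simp
      qed
    qed
    then have "I_one f g K (M', v) = 0" by (rule I_one_zeroI)
    then show ?thesis using eq I_one_min_pos by simp
  qed
qed

sublocale fshell: shell_limit K f g "\<lambda>_. 1"
  by unfold_locales auto

text \<open>
  The blown-up functional.
\<close>
definition \<Lambda> :: "real \<Rightarrow> (real^'n^'n) \<times> (real^'n) \<Rightarrow> real" where
  "\<Lambda> \<rho> p = L_fun f g K (1 - \<rho>) (mat 1 + \<rho> *\<^sub>R fst p, \<rho> *\<^sub>R snd p)"

lemma \<Lambda>_eq: "\<Lambda> \<rho> p = (\<integral>x. fshell.integrand \<rho> (fst p) (snd p) x \<partial>lborel)"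
  by (simp add: \<Lambda>_def L_fun_def fshell.integrand_def rescale_def Let_def)

lemma \<Lambda>_tendsto:
  assumes \<rho>: "\<And>j. 0 < \<rho> j" "\<rho> \<longlonglongrightarrow> 0" and p: "p \<longlonglongrightarrow> q"
  shows "(\<lambda>j. \<Lambda> (\<rho> j) (p j)) \<longlonglongrightarrow> I_one f g K q"
proof -
  note lim = fshell.shell_limit_sequence[OF \<rho> tendsto_fst[OF p] tendsto_snd[OF p]]
  have "(\<integral>p. fshell.limit_integrand (fst q) (snd q) p \<partial>(sphere_measure \<Otimes>\<^sub>M lborel)) = I_one f g K (fst q, snd q)"
    using fshell.integral_limit_integrand[OF lim(1)] I_one_eq[of K "fst q" "snd q"] by simp
  then show ?thesis using lim(3) by (simp add: \<Lambda>_eq)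
qed

text \<open>
  The integrand of \<open>L_fun\<close> in the original variables.
\<close>
definition G :: "real \<Rightarrow> (real^'n^'n) \<times> (real^'n) \<Rightarrow> real^'n \<Rightarrow> real" where
  "G r a x = rescale r f (norm (fst a *v x + snd a)) * rescale r g (N x)"

lemma L_fun_G: "L_fun f g K r a = 1 / (1 - r) * (\<integral>x. G r a x \<partial>lborel)"
  by (simp add: L_fun_def G_def case_prod_beta)

lemma f_cont: "continuous_on UNIV f"
  by (rule locally_lipschitz_continuous[OF lf])

lemma rescale_f_mono: "r < 1 \<Longrightarrow> s \<le> t \<Longrightarrow> rescale r f s \<le> rescale r f t"
  unfolding rescale_def by (intro monoD[OF f_mono] divide_right_mono) auto

lemma rescale_f_nonneg: "0 \<le> rescale r f s" and rescale_g_nonneg: "0 \<le> rescale r g s"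
  by (simp_all add: rescale_def f_nonneg g_bounds)

lemma rescale_f_pos_iff: "r < 1 \<Longrightarrow> 0 < rescale r f s \<longleftrightarrow> r < s"
proof -
  assume r: "r < 1"
  have "0 < f z \<longleftrightarrow> -1 < z" for z
    using f_less[of "-1" z] f0[of "-1"] f0[of z] by (cases "-1 < z") auto
  then show ?thesis using r by (simp add: rescale_def less_divide_eq)
qed

lemma rescale_f_less: "r < 1 \<Longrightarrow> s < t \<Longrightarrow> r < t \<Longrightarrow> rescale r f s < rescale r f t"
  unfolding rescale_def by (intro f_less) (auto simp: less_divide_eq divide_strict_right_mono)

lemma rescale_g_pos_iff: "r < 1 \<Longrightarrow> 0 < rescale r g s \<longleftrightarrow> s < 2 - r"
proof -
  assume r: "r < 1"
  have "0 < g z \<longleftrightarrow> z < 1" for z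
    using gpos[of z] g1[of z] g0[of z] by (cases "z \<le> -1"; cases "z < 1") auto
  then show ?thesis using r by (simp add: rescale_def divide_less_eq algebra_simps)
qed

lemma G_nonneg: "0 \<le> G r a x"
  by (simp add: G_def rescale_f_nonneg rescale_g_nonneg)

lemma G_continuous: "continuous_on UNIV (G r a)"
proof -
  have "continuous_on UNIV (\<lambda>x. norm (fst a *v x + snd a))"
    by (intro continuous_intros linear_continuous_on) (simp add: linear_conv_bounded_linear[symmetric])
  then have 1: "continuous_on UNIV (\<lambda>x. f ((norm (fst a *v x + snd a) - 1) / (1 - r)))"
    by (intro continuous_on_compose2[OF f_cont]) (auto intro!: continuous_intros simp: divide_inverse)
  have 2: "continuous_on UNIV (\<lambda>x. g ((N x - 1) / (1 - r)))"
    by (intro continuous_on_compose2[OF g_cont]) (auto intro!: continuous_intros continuous_gauge simp: divide_inverse)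
  show ?thesis unfolding G_def rescale_def by (intro continuous_on_mult 1 2)
qed

lemma G_integrable:
  assumes r: "0 < r" "r < 1"
  shows "integrable lborel (G r a)"
proof -
  let ?B = "rescale r f (norm (fst a) * 2 + norm (snd a))"
  have bound: "\<bar>G r a x\<bar> \<le> ?B * indicator (cball 0 2) x" for x
  proof (cases "rescale r g (N x) = 0")
    case True
    then show ?thesis using rescale_f_nonneg by (simp add: G_def)
  next
    case False
    then have "N x < 2 - r" using rescale_g_pos_iff[OF r(2)] rescale_g_nonneg[of r "N x"] by (metis order_le_less)
    then have x: "norm x \<le> 2" using norm_le_gauge[of x] r by linarith
    have "norm (fst a *v x + snd a) \<le> norm (fst a *v x) + norm (snd a)" by (rule norm_triangle_ineq)
    also have "\<dots> \<le> norm (fst a) * 2 + norm (snd a)"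
      using norm_matrix_vector_le[of "fst a" x] mult_left_mono[OF x, of "norm (fst a)"] by simp
    finally have "rescale r f (norm (fst a *v x + snd a)) \<le> ?B" by (rule rescale_f_mono[OF r(2)])
    moreover have "rescale r g (N x) \<le> 1" using g_bounds by (simp add: rescale_def)
    ultimately have "G r a x \<le> ?B * 1"
      unfolding G_def using rescale_f_nonneg rescale_g_nonneg by (intro mult_mono) auto
    then show ?thesis using x G_nonneg[of r a x] by simp
  qed
  show ?thesis
  proof (rule Bochner_Integration.integrable_bound)
    have "emeasure lborel (cball (0 :: real^'n) 2) < \<infinity>" using emeasure_lborel_cball_finite by simp
    then show "integrable lborel (\<lambda>x :: real^'n. ?B * indicator (cball 0 2) x :: real)"
      by (intro integrable_mult_right integrable_real_indicator) auto
    show "AE x in lborel. norm (G r a x) \<le> norm (?B * indicator (cball 0 2) x)"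
      using bound by (intro AE_I2) (metis abs_ge_self order_trans real_norm_def)
    show "G r a \<in> borel_measurable lborel" using borel_measurable_continuous_onI[OF G_continuous] by simp
  qed
qed

text \<open>
  A monotone convex function of the norm of an affine function is convex.
\<close>
lemma G_convex:
  assumes r: "r < 1" and t: "0 \<le> t" "t \<le> 1"
  shows "G r ((1 - t) *\<^sub>R a + t *\<^sub>R b) x \<le> (1 - t) * G r a x + t * G r b x"
proof -
  let ?n = "\<lambda>a. norm (fst a *v x + snd a)"
  have "fst ((1 - t) *\<^sub>R a + t *\<^sub>R b) *v x + snd ((1 - t) *\<^sub>R a + t *\<^sub>R b)
      = (1 - t) *\<^sub>R (fst a *v x + snd a) + t *\<^sub>R (fst b *v x + snd b)"
    by (simp add: matrix_vector_mult_add_rdistrib scaleR_matrix_vector_assoc[symmetric] algebra_simps)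
  then have "?n ((1 - t) *\<^sub>R a + t *\<^sub>R b) \<le> (1 - t) * ?n a + t * ?n b"
    using norm_triangle_ineq[of "(1 - t) *\<^sub>R (fst a *v x + snd a)" "t *\<^sub>R (fst b *v x + snd b)"] t by simp
  then have "rescale r f (?n ((1 - t) *\<^sub>R a + t *\<^sub>R b)) \<le> rescale r f ((1 - t) * ?n a + t * ?n b)"
    by (rule rescale_f_mono[OF r])
  also have "\<dots> = f ((1 - t) *\<^sub>R ((?n a - 1) / (1 - r)) + t *\<^sub>R ((?n b - 1) / (1 - r)))"
  proof -
    have "((1 - t) * p + t * q - 1) / (1 - r) = (1 - t) * ((p - 1) / (1 - r)) + t * ((q - 1) / (1 - r))" for p q :: real
    proof -
      have "(1 - t) * p + t * q - 1 = (1 - t) * (p - 1) + t * (q - 1)" by (simp add: algebra_simps)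
      then show ?thesis by (simp only: add_divide_distrib times_divide_eq_right)
    qed
    then show ?thesis by (simp add: rescale_def)
  qed
  also have "\<dots> \<le> (1 - t) * rescale r f (?n a) + t * rescale r f (?n b)"
    unfolding rescale_def using t by (intro convex_onD[OF cvx_f]) auto
  finally have "rescale r f (?n ((1 - t) *\<^sub>R a + t *\<^sub>R b)) * rescale r g (N x)
      \<le> ((1 - t) * rescale r f (?n a) + t * rescale r f (?n b)) * rescale r g (N x)"
    by (rule mult_right_mono) (rule rescale_g_nonneg)
  then show ?thesis by (simp add: G_def algebra_simps)
qed

lemma L_convex:
  assumes r: "0 < r" "r < 1"
  shows "convex_on UNIV (L_fun f g K r)"
proof (rule convex_onI)
  fix t :: real and a b :: "(real^'n^'n) \<times> (real^'n)"
  assume t: "0 < t" "t < 1"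
  have "(\<integral>x. G r ((1 - t) *\<^sub>R a + t *\<^sub>R b) x \<partial>lborel) \<le> (\<integral>x. (1 - t) * G r a x + t * G r b x \<partial>lborel)"
    using t by (intro integral_mono G_convex Bochner_Integration.integrable_add integrable_mult_right G_integrable r) auto
  also have "\<dots> = (1 - t) * (\<integral>x. G r a x \<partial>lborel) + t * (\<integral>x. G r b x \<partial>lborel)"
    by (simp add: G_integrable[OF r] Bochner_Integration.integral_add)
  finally have "1 / (1 - r) * (\<integral>x. G r ((1 - t) *\<^sub>R a + t *\<^sub>R b) x \<partial>lborel)
      \<le> 1 / (1 - r) * ((1 - t) * (\<integral>x. G r a x \<partial>lborel) + t * (\<integral>x. G r b x \<partial>lborel))"
    using r by (intro mult_left_mono) auto
  then show "L_fun f g K r ((1 - t) *\<^sub>R a + t *\<^sub>R b) \<le> (1 - t) * L_fun f g K r a + t * L_fun f g K r b"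
    unfolding L_fun_G by (simp add: algebra_simps add_divide_distrib diff_divide_distrib)
qed simp

end

section \<open>Localisation of the minimizers\<close>

context contact_minimum
begin

abbreviation p0 :: "(real^'n^'n) \<times> (real^'n)" where "p0 \<equiv> (M0, w0)"

definition half_space :: "((real^'n^'n) \<times> (real^'n)) set" where
  "half_space = {p. fst p \<in> Sym \<and> 0 \<le> trace (fst p)}"

lemma closed_Sym: "closed (Sym :: (real^'n^'n) set)"
proof -
  have "Sym = {A :: real^'n^'n. \<forall>i j. A $ i $ j = A $ j $ i}"
    by (auto simp: Sym_def transpose_def vec_eq_iff)
  also have "closed \<dots>"
    by (intro closed_Collect_all closed_Collect_eq continuous_intros)
  finally show ?thesis .
qed

lemma continuous_on_trace: "continuous_on S (trace :: real^'n^'n \<Rightarrow> real)"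
  unfolding trace_def by (intro continuous_intros)

lemma continuous_on_det: "continuous_on S (det :: real^'n^'n \<Rightarrow> real)"
  unfolding det_def by (intro continuous_intros)

lemma closed_half_space: "closed half_space"
proof -
  have eq: "half_space = (fst -` Sym) \<inter> (fst -` {A. 0 \<le> trace A})"
    by (auto simp: half_space_def)
  have "closed {A :: real^'n^'n. 0 \<le> trace A}"
    by (intro closed_Collect_le continuous_on_trace continuous_intros)
  then show ?thesis
    unfolding eq by (intro closed_Int closed_vimage_fst closed_Sym)
qed

lemma \<Lambda>_convex:
  assumes \<rho>: "0 < \<rho>" "\<rho> < 1"
  shows "convex_on UNIV (\<Lambda> \<rho>)"
proof (rule convex_onI)
  fix t :: real and p q :: "(real^'n^'n) \<times> (real^'n)"
  assume t: "0 < t" "t < 1"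
  let ?T = "\<lambda>p. (mat 1 + \<rho> *\<^sub>R fst p, \<rho> *\<^sub>R snd p)"
  have "?T ((1 - t) *\<^sub>R p + t *\<^sub>R q) = (1 - t) *\<^sub>R ?T p + t *\<^sub>R ?T q"
    by (simp add: scaleR_add_right algebra_simps)
  then show "\<Lambda> \<rho> ((1 - t) *\<^sub>R p + t *\<^sub>R q) \<le> (1 - t) * \<Lambda> \<rho> p + t * \<Lambda> \<rho> q"
    unfolding \<Lambda>_def using convex_onD[OF L_convex[of "1 - \<rho>"], of t "?T p" "?T q"] \<rho> t by simp
qed simp

text \<open>
  A sequence violating the claim would give \<open>I_one f g K p0 \<le> 0\<close> in the limit.
\<close>
lemma positive_near_minimum:
  "\<exists>\<delta>>0. \<forall>\<rho> p. 0 < \<rho> \<longrightarrow> \<rho> < \<delta> \<longrightarrow> dist p p0 < \<delta> \<longrightarrow> 0 < \<Lambda> \<rho> p"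
proof (rule ccontr)
  assume "\<not> ?thesis"
  then have "\<forall>\<delta>>0. \<exists>\<rho> p. 0 < \<rho> \<and> \<rho> < \<delta> \<and> dist p p0 < \<delta> \<and> \<Lambda> \<rho> p \<le> 0" by (meson not_less)
  then have "\<forall>n::nat. \<exists>\<rho> p. 0 < \<rho> \<and> \<rho> < inverse (real (Suc n)) \<and> dist p p0 < inverse (real (Suc n)) \<and> \<Lambda> \<rho> p \<le> 0"
    by simp
  then obtain \<rho> p where *: "\<And>n. 0 < \<rho> n" "\<And>n. \<rho> n < inverse (real (Suc n))"
    "\<And>n. dist (p n) p0 < inverse (real (Suc n))" "\<And>n. \<Lambda> (\<rho> n) (p n) \<le> 0"
    by metis
  have "\<rho> \<longlonglongrightarrow> 0"
    by (rule tendsto_sandwich[OF _ _ tendsto_const LIMSEQ_inverse_real_of_nat])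
       (use *(1,2) in \<open>auto intro!: always_eventually less_imp_le\<close>)
  moreover have "(\<lambda>n. dist (p n) p0) \<longlonglongrightarrow> 0"
    by (rule tendsto_sandwich[OF _ _ tendsto_const LIMSEQ_inverse_real_of_nat])
       (use *(3) in \<open>auto intro!: always_eventually less_imp_le\<close>)
  then have "p \<longlonglongrightarrow> p0" by (subst tendsto_dist_iff)
  ultimately have "(\<lambda>n. \<Lambda> (\<rho> n) (p n)) \<longlonglongrightarrow> I_one f g K p0" by (intro \<Lambda>_tendsto *(1))
  then have "I_one f g K p0 \<le> 0" by (rule LIMSEQ_le_const2) (use *(4) in auto)
  then show False using I_one_min_pos by simp
qed

text \<open>
  Suppose that for arbitrarily small \<open>\<rho>\<close> a point \<open>p\<close> at distance at least \<open>\<epsilon>\<close> is as good as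
  \<open>q \<rho>\<close>. By convexity the point \<open>p'\<close> on the segment from \<open>p0\<close> to \<open>p\<close> at distance exactly \<open>\<epsilon>\<close> is
  not worse than the worse of \<open>p0\<close> and \<open>q \<rho>\<close>. These points stay in a compact set, and a limit of them
  contradicts the uniqueness of the minimum on the half space.
\<close>
lemma localisation:
  assumes q: "(q \<longlongrightarrow> p0) (at_right 0)" and \<epsilon>: "0 < \<epsilon>"
  shows "\<exists>\<delta>>0. \<forall>\<rho> p. 0 < \<rho> \<longrightarrow> \<rho> < \<delta> \<longrightarrow> p \<in> half_space \<longrightarrow> \<epsilon> \<le> dist p p0 \<longrightarrow> \<Lambda> \<rho> (q \<rho>) < \<Lambda> \<rho> p"
proof (rule ccontr)
  assume "\<not> ?thesis"
  then have "\<forall>\<delta>>0. \<exists>\<rho> p. 0 < \<rho> \<and> \<rho> < \<delta> \<and> p \<in> half_space \<and> \<epsilon> \<le> dist p p0 \<and> \<Lambda> \<rho> p \<le> \<Lambda> \<rho> (q \<rho>)"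
    by (meson not_less)
  then have "\<forall>n::nat. \<exists>\<rho> p. 0 < \<rho> \<and> \<rho> < inverse (real (Suc n)) \<and> p \<in> half_space \<and> \<epsilon> \<le> dist p p0 \<and> \<Lambda> \<rho> p \<le> \<Lambda> \<rho> (q \<rho>)"
    by simp
  then obtain \<rho> p where *: "\<And>n. 0 < \<rho> n" "\<And>n. \<rho> n < inverse (real (Suc n))"
    "\<And>n. p n \<in> half_space" "\<And>n. \<epsilon> \<le> dist (p n) p0" "\<And>n. \<Lambda> (\<rho> n) (p n) \<le> \<Lambda> (\<rho> n) (q (\<rho> n))"
    by metis
  have \<rho>0: "\<rho> \<longlonglongrightarrow> 0"
    by (rule tendsto_sandwich[OF _ _ tendsto_const LIMSEQ_inverse_real_of_nat])
       (use *(1,2) in \<open>auto intro!: always_eventually less_imp_le\<close>)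
  have \<rho>1: "\<rho> n < 1" for n
  proof -
    have "inverse (real (Suc n)) \<le> 1" by (simp add: inverse_le_1_iff)
    then show ?thesis using *(2)[of n] by linarith
  qed
  have q\<rho>: "(\<lambda>n. q (\<rho> n)) \<longlonglongrightarrow> p0"
    by (rule filterlim_compose[OF q]) (use \<rho>0 *(1) in \<open>auto simp: filterlim_at less_imp_neq[symmetric] intro!: always_eventually\<close>)
  define t where "t n = \<epsilon> / dist (p n) p0" for n
  have d0: "0 < dist (p n) p0" for n using *(4)[of n] \<epsilon> by linarith
  have t: "0 < t n" "t n \<le> 1" for n using *(4)[of n] \<epsilon> d0[of n] by (auto simp: t_def divide_le_eq)
  define p' where "p' n = (1 - t n) *\<^sub>R p0 + t n *\<^sub>R p n" for n
  have p'_dist: "dist (p' n) p0 = \<epsilon>" for n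
  proof -
    have "p' n - p0 = t n *\<^sub>R (p n - p0)"
      unfolding p'_def by (simp add: scaleR_diff_left scaleR_diff_right)
    then have "dist (p' n) p0 = t n * dist (p n) p0" using t(1)[of n] by (simp add: dist_norm)
    then show ?thesis using d0[of n] by (simp add: t_def)
  qed
  have p'_half: "p' n \<in> half_space" for n
  proof -
    have "0 \<le> trace (fst (p' n))" using *(3)[of n] M0(2) t(1)[of n] by (simp add: p'_def half_space_def)
    moreover have "fst (p' n) \<in> Sym" using *(3)[of n] M0(1) by (simp add: p'_def half_space_def Sym_linear)
    ultimately show ?thesis by (simp add: half_space_def)
  qed
  have \<Lambda>p': "\<Lambda> (\<rho> n) (p' n) \<le> max (\<Lambda> (\<rho> n) p0) (\<Lambda> (\<rho> n) (q (\<rho> n)))" for n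
  proof -
    let ?m = "max (\<Lambda> (\<rho> n) p0) (\<Lambda> (\<rho> n) (q (\<rho> n)))"
    have "\<Lambda> (\<rho> n) (p' n) \<le> (1 - t n) * \<Lambda> (\<rho> n) p0 + t n * \<Lambda> (\<rho> n) (p n)"
      unfolding p'_def using t[of n] by (intro convex_onD[OF \<Lambda>_convex[OF *(1) \<rho>1]]) auto
    also have "\<dots> \<le> (1 - t n) * ?m + t n * ?m"
      using t[of n] *(5)[of n] by (intro add_mono mult_left_mono) auto
    also have "\<dots> = ?m" by (simp add: algebra_simps)
    finally show ?thesis .
  qed
  have "compact (cball p0 \<epsilon>)" by simp
  moreover have "\<forall>n. p' n \<in> cball p0 \<epsilon>" using p'_dist by (simp add: dist_commute)
  ultimately obtain l r where l: "strict_mono r" "(p' \<circ> r) \<longlonglongrightarrow> l"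
    unfolding compact_def by blast
  have sub: "(x \<circ> r) \<longlonglongrightarrow> y" if "x \<longlonglongrightarrow> y" for x and y :: "'z::topological_space"
    using that l(1) by (rule LIMSEQ_subseq_LIMSEQ)
  have "l \<in> half_space"
    using closed_sequentially[OF closed_half_space, of "p' \<circ> r" l] p'_half l(2) by simp
  have "(\<lambda>n. dist ((p' \<circ> r) n) p0) \<longlonglongrightarrow> dist l p0" by (intro tendsto_dist l(2) tendsto_const)
  then have dl: "dist l p0 = \<epsilon>" using p'_dist by (simp add: LIMSEQ_const_iff)
  have \<rho>r: "(\<rho> \<circ> r) \<longlonglongrightarrow> 0" by (rule sub[OF \<rho>0])
  have lim1: "(\<lambda>n. \<Lambda> ((\<rho> \<circ> r) n) ((p' \<circ> r) n)) \<longlonglongrightarrow> I_one f g K l"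
    by (rule \<Lambda>_tendsto[OF _ \<rho>r l(2)]) (simp add: *(1))
  have lim2: "(\<lambda>n. \<Lambda> ((\<rho> \<circ> r) n) p0) \<longlonglongrightarrow> I_one f g K p0"
    by (rule \<Lambda>_tendsto[OF _ \<rho>r tendsto_const]) (simp add: *(1))
  have lim3: "(\<lambda>n. \<Lambda> ((\<rho> \<circ> r) n) (((\<lambda>n. q (\<rho> n)) \<circ> r) n)) \<longlonglongrightarrow> I_one f g K p0"
    by (rule \<Lambda>_tendsto[OF _ \<rho>r sub[OF q\<rho>]]) (simp add: *(1))
  have "I_one f g K l \<le> max (I_one f g K p0) (I_one f g K p0)"
    by (rule LIMSEQ_le[OF lim1 tendsto_max[OF lim2 lim3]]) (use \<Lambda>p' in auto)
  then have "I_one f g K (fst l, snd l) \<le> I_one f g K (M0, w0)" by simp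
  then have "(fst l, snd l) = p0"
    by (intro min_half_space) (use \<open>l \<in> half_space\<close> in \<open>auto simp: half_space_def\<close>)
  then show False using dl \<epsilon> by simp
qed

lemma G_scale_le:
  assumes r: "r < 1" and t: "0 < t" "t \<le> 1"
  shows "G r (t *\<^sub>R a) x \<le> G r a x"
proof -
  have "fst (t *\<^sub>R a) *v x + snd (t *\<^sub>R a) = t *\<^sub>R (fst a *v x + snd a)"
    by (simp add: scaleR_matrix_vector_assoc[symmetric] scaleR_add_right)
  then have "norm (fst (t *\<^sub>R a) *v x + snd (t *\<^sub>R a)) \<le> norm (fst a *v x + snd a)"
    using t by (simp add: mult_left_le_one_le)
  then show ?thesis unfolding G_def by (intro mult_right_mono rescale_f_mono[OF r] rescale_g_nonneg)
qed

text \<open>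
  Scaling down strictly decreases the integrand wherever it is positive, and it is positive on a set of
  positive measure.
\<close>
lemma L_scale_less:
  assumes r: "0 < r" "r < 1" and t: "0 < t" "t < 1" and pos: "0 < L_fun f g K r a"
  shows "L_fun f g K r (t *\<^sub>R a) < L_fun f g K r a"
proof (rule ccontr)
  assume "\<not> ?thesis"
  then have "(\<integral>x. G r a x \<partial>lborel) \<le> (\<integral>x. G r (t *\<^sub>R a) x \<partial>lborel)"
    unfolding L_fun_G using r by (simp add: not_less divide_le_cancel)
  moreover have "(\<integral>x. G r a x - G r (t *\<^sub>R a) x \<partial>lborel) = (\<integral>x. G r a x \<partial>lborel) - (\<integral>x. G r (t *\<^sub>R a) x \<partial>lborel)"
    by (rule Bochner_Integration.integral_diff[OF G_integrable[OF r] G_integrable[OF r]])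
  moreover have nn: "AE x in lborel. 0 \<le> G r a x - G r (t *\<^sub>R a) x"
    using G_scale_le[OF r(2) t(1)] t by (intro AE_I2) (simp add: less_imp_le)
  ultimately have "(\<integral>x. G r a x - G r (t *\<^sub>R a) x \<partial>lborel) = 0"
    using integral_nonneg_AE[OF nn] by simp
  then have "AE x in lborel. G r a x - G r (t *\<^sub>R a) x = 0"
    using integral_nonneg_eq_0_iff_AE[OF Bochner_Integration.integrable_diff[OF G_integrable[OF r] G_integrable[OF r]] nn] by simp
  then have "AE x in lborel. G r a x = 0"
  proof eventually_elim
    case (elim x)
    let ?s = "norm (fst a *v x + snd a)"
    show ?case
    proof (rule ccontr)
      assume nz: "G r a x \<noteq> 0"
      then have gp: "0 < rescale r g (N x)" and fp: "0 < rescale r f ?s"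
        using rescale_f_nonneg[of r ?s] rescale_g_nonneg[of r "N x"] by (auto simp: G_def order_le_less)
      have "r < ?s" using fp rescale_f_pos_iff[OF r(2)] by simp
      then have "0 < (1 - t) * ?s" using t r by (intro mult_pos_pos) linarith+
      then have "t * ?s < ?s" by (simp add: algebra_simps)
      then have "rescale r f (t * ?s) < rescale r f ?s" by (rule rescale_f_less[OF r(2) _ \<open>r < ?s\<close>])
      moreover have "fst (t *\<^sub>R a) *v x + snd (t *\<^sub>R a) = t *\<^sub>R (fst a *v x + snd a)"
        by (simp add: scaleR_matrix_vector_assoc[symmetric] scaleR_add_right)
      then have "norm (fst (t *\<^sub>R a) *v x + snd (t *\<^sub>R a)) = t * ?s" using t by simp
      ultimately have "G r (t *\<^sub>R a) x < G r a x" unfolding G_def using gp by simp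
      then show False using elim by simp
    qed
  qed
  then have "(\<integral>x. G r a x \<partial>lborel) = 0" by (rule integral_eq_zero_AE)
  then show False using pos by (simp add: L_fun_G)
qed

lemma L_scale_le:
  assumes r: "0 < r" "r < 1" and t: "0 < t" "t \<le> 1"
  shows "L_fun f g K r (t *\<^sub>R a) \<le> L_fun f g K r a"
  unfolding L_fun_G using r t
  by (intro mult_left_mono integral_mono G_integrable G_scale_le) auto

text \<open>
  If the value at the midpoint is not smaller, the convex integrands have equality in the midpoint inequality
  at every point. Choose a point \<open>x\<close> in the support of \<open>g\<close> with \<open>norm (A x + u) = r\<close>, where \<open>u\<close> is the
  midpoint of the translations. There the midpoint integrand vanishes, hence so do both others, which
  means that \<open>A x + v\<close> and \<open>A x + w\<close> lie in the ball of radius \<open>r\<close> while their midpoint is on its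
  boundary. The ball is strictly convex.
\<close>
lemma translation_unique:
  assumes r: "0 < r" "r < 1" and A: "L_fun f g K r (A, v) = m" "L_fun f g K r (A, w) = m"
    and mid: "m \<le> L_fun f g K r (A, (1/2) *\<^sub>R (v + w))" and m: "0 < m"
    and small: "norm v < r" "norm w < r"
  shows "v = w"
proof -
  let ?u = "(1/2) *\<^sub>R (v + w)"
  let ?h = "\<lambda>x. (1 - 1/2) * G r (A, v) x + 1/2 * G r (A, w) x - G r (A, ?u) x"
  have comb: "(A, ?u) = (1 - 1/2) *\<^sub>R (A, v) + (1/2) *\<^sub>R (A, w)"
    by (simp add: scaleR_add_right scaleR_half_double flip: scaleR_add_left)
  have nn: "0 \<le> ?h x" for x
    using G_convex[OF r(2), of "1/2" "(A, v)" "(A, w)" x] unfolding comb by simp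
  have int: "integrable lborel ?h"
    by (intro Bochner_Integration.integrable_diff Bochner_Integration.integrable_add integrable_mult_right G_integrable r)
  have "(\<integral>x. ?h x \<partial>lborel) = (1 - 1/2) * (\<integral>x. G r (A, v) x \<partial>lborel) + 1/2 * (\<integral>x. G r (A, w) x \<partial>lborel) - (\<integral>x. G r (A, ?u) x \<partial>lborel)"
    by (simp add: G_integrable[OF r] Bochner_Integration.integral_diff Bochner_Integration.integral_add)
  also have "\<dots> = (1 - r) * ((1 - 1/2) * L_fun f g K r (A, v) + 1/2 * L_fun f g K r (A, w) - L_fun f g K r (A, ?u))"
  proof -
    have c: "(\<integral>x. G r a x \<partial>lborel) = (1 - r) * L_fun f g K r a" for a using r by (simp add: L_fun_G)
    show ?thesis unfolding c by (simp add: algebra_simps diff_divide_distrib)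
  qed
  also have "\<dots> \<le> 0" using A mid r by (simp add: mult_le_0_iff)
  finally have "(\<integral>x. ?h x \<partial>lborel) = 0"
    using integral_nonneg_AE[OF AE_I2[OF nn], of lborel] by (rule antisym)
  then have "AE x in lborel. ?h x = 0"
    using integral_nonneg_eq_0_iff_AE[OF int] nn by simp
  have h0: "?h x = 0" for x
  proof (rule ccontr)
    assume "?h x \<noteq> 0"
    have cont: "continuous_on UNIV ?h" by (intro continuous_intros G_continuous)
    have op: "open {y. ?h y \<noteq> 0}"
      by (intro open_Collect_neq cont continuous_intros)
    have "{y. ?h y \<noteq> 0} \<in> null_sets lborel"
      using AE_iff_null_sets[of "{y. ?h y \<noteq> 0}" lborel] \<open>AE x in lborel. ?h x = 0\<close> op by (simp add: borel_open)
    then have "negligible {y. ?h y \<noteq> 0}" using negligible_iff_null_sets null_sets_completionI by blast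
    then show False using op \<open>?h x \<noteq> 0\<close> open_not_negligible by blast
  qed
  have "m \<le> L_fun f g K r (A, ?u)" by (rule mid)
  then have "(\<integral>x. G r (A, ?u) x \<partial>lborel) \<noteq> 0" using m by (auto simp: L_fun_G)
  then obtain x1 where x1: "G r (A, ?u) x1 \<noteq> 0" by (metis Bochner_Integration.integral_zero ext)
  then have gp: "0 < rescale r g (N x1)" and fp: "0 < rescale r f (norm (A *v x1 + ?u))"
    using rescale_f_nonneg[of r "norm (A *v x1 + ?u)"] rescale_g_nonneg[of r "N x1"] by (auto simp: G_def order_le_less)
  have N1: "N x1 < 2 - r" using gp rescale_g_pos_iff[OF r(2)] by simp
  have r1: "r < norm (A *v x1 + ?u)" using fp rescale_f_pos_iff[OF r(2)] by simp
  have u: "norm ?u \<le> r"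
  proof -
    have "norm ?u = (1/2) * norm (v + w)" by simp
    also have "\<dots> \<le> (1/2) * (norm v + norm w)" by (intro mult_left_mono norm_triangle_ineq) simp
    finally show ?thesis using small by simp
  qed
  \<comment> \<open>On the segment from 0 to a point where the midpoint integrand is positive, the norm passes through \<open>r\<close>;
    at 0 it is at most \<open>r\<close> because the translations are small.\<close>
  have "\<exists>s. 0 \<le> s \<and> s \<le> 1 \<and> norm (A *v (s *\<^sub>R x1) + ?u) = r"
  proof (rule IVT')
    show "norm (A *v (0 *\<^sub>R x1) + ?u) \<le> r" using u by simp
    show "r \<le> norm (A *v (1 *\<^sub>R x1) + ?u)" using r1 by simp
    show "continuous_on {0..1} (\<lambda>s. norm (A *v (s *\<^sub>R x1) + ?u))"
      unfolding matrix_vector_mult_scaleR by (intro continuous_intros)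
  qed simp
  then obtain s where s: "0 \<le> s" "s \<le> 1" "norm (A *v (s *\<^sub>R x1) + ?u) = r" by blast
  let ?x = "s *\<^sub>R x1"
  have Nx: "N ?x < 2 - r"
  proof (cases "s = 0")
    case True
    have "N 0 \<le> 1" using gauge_le_1_iff[of 0] zero interior_subset by blast
    then show ?thesis using True r by simp
  next
    case False
    then have "N ?x = s * N x1" using s by (intro gauge_scale) simp
    also have "\<dots> \<le> N x1" using s gauge_nonneg[of x1] by (simp add: mult_left_le_one_le)
    finally show ?thesis using N1 by simp
  qed
  then have gx: "0 < rescale r g (N ?x)" using rescale_g_pos_iff[OF r(2)] by simp
  have fu: "rescale r f (norm (A *v ?x + ?u)) = 0"
    using rescale_f_pos_iff[OF r(2), of r] rescale_f_nonneg[of r r] s(3) by simp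
  have "(1 - 1/2) * G r (A, v) ?x + 1/2 * G r (A, w) ?x = 0" using h0[of ?x] fu by (simp add: G_def)
  then have "G r (A, v) ?x = 0" "G r (A, w) ?x = 0"
    using G_nonneg[of r "(A, v)" ?x] G_nonneg[of r "(A, w)" ?x] by simp_all
  then have "\<not> 0 < rescale r f (norm (A *v ?x + v))" "\<not> 0 < rescale r f (norm (A *v ?x + w))"
    using gx by (auto simp: G_def)
  then have le: "norm (A *v ?x + v) \<le> r" "norm (A *v ?x + w) \<le> r"
    using rescale_f_pos_iff[OF r(2)] by (auto simp: not_less)
  let ?a = "A *v ?x + v" and ?b = "A *v ?x + w"
  have "(1/2) *\<^sub>R (?a + ?b) = A *v ?x + ?u"
  proof -
    have "?a + ?b = (A *v ?x + A *v ?x) + (v + w)" by simp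
    then show ?thesis by (simp only: scaleR_add_right[of "1/2" "A *v ?x + A *v ?x"] scaleR_half_double)
  qed
  then have "norm ((1/2) *\<^sub>R (?a + ?b)) = r" using s(3) by simp
  then have sum: "norm (?a + ?b) = 2 * r" by simp
  have parallelogram: "(norm (a - b))\<^sup>2 = 2 * (norm a)\<^sup>2 + 2 * (norm b)\<^sup>2 - (norm (a + b))\<^sup>2" for a b :: "real^'n"
    unfolding power2_norm_eq_inner by (simp add: inner_add_left inner_add_right inner_diff_left inner_diff_right)
  have "(norm (?a - ?b))\<^sup>2 = 2 * (norm ?a)\<^sup>2 + 2 * (norm ?b)\<^sup>2 - (norm (?a + ?b))\<^sup>2"
    by (rule parallelogram)
  also have "\<dots> \<le> 2 * r\<^sup>2 + 2 * r\<^sup>2 - (2 * r)\<^sup>2"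
    unfolding sum using le by (intro diff_right_mono add_mono mult_left_mono power_mono) auto
  also have "\<dots> = 0" by (simp add: power2_eq_square)
  finally have "?a - ?b = 0" by simp
  then show ?thesis by simp
qed

end

section \<open>Existence, uniqueness and first-order behaviour of the minimizers\<close>

lemma det_scaleR: "det (c *\<^sub>R A :: real^'n^'n) = c ^ CARD('n) * det A"
proof -
  have "c *\<^sub>R A = (\<chi> i. c *s A $ i)" by (simp add: vec_eq_iff)
  then show ?thesis using det_rows_mul[of "\<lambda>_. c" "\<lambda>i. A $ i"] by (simp add: vec_lambda_eta)
qed

lemma Sym_pos_near_identity:
  fixes M :: "real^'n^'n"
  assumes M: "M \<in> Sym" and \<rho>: "0 \<le> \<rho>" "\<rho> * norm M < 1"
  shows "mat 1 + \<rho> *\<^sub>R M \<in> Sym_pos"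
proof -
  have "0 < x \<bullet> ((mat 1 + \<rho> *\<^sub>R M) *v x)" if x: "x \<noteq> 0" for x
  proof -
    have "\<bar>x \<bullet> (M *v x)\<bar> \<le> norm x * norm (M *v x)" by (rule Cauchy_Schwarz_ineq2)
    also have "\<dots> \<le> norm x * (norm M * norm x)" by (intro mult_left_mono norm_matrix_vector_le) simp
    finally have "\<rho> * \<bar>x \<bullet> (M *v x)\<bar> \<le> \<rho> * (norm x * (norm M * norm x))" using \<rho>(1) by (rule mult_left_mono)
    also have "\<dots> = (\<rho> * norm M) * (norm x * norm x)" by (simp add: algebra_simps)
    also have "\<dots> < 1 * (norm x * norm x)" using \<rho>(2) x by (intro mult_strict_right_mono) auto
    finally have "\<rho> * \<bar>x \<bullet> (M *v x)\<bar> < x \<bullet> x" by (simp add: dot_square_norm power2_eq_square)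
    moreover have "- (\<rho> * \<bar>x \<bullet> (M *v x)\<bar>) \<le> \<rho> * (x \<bullet> (M *v x))"
      using \<rho>(1) mult_left_mono[of "- \<bar>x \<bullet> (M *v x)\<bar>" "x \<bullet> (M *v x)" \<rho>] by simp
    ultimately show ?thesis
      by (simp add: matrix_vector_mult_add_rdistrib scaleR_matrix_vector_assoc[symmetric] inner_add_right)
  qed
  then show ?thesis using M by (simp add: Sym_pos_def Sym_linear)
qed

context contact_minimum
begin

abbreviation feasible :: "((real^'n^'n) \<times> (real^'n)) set" where "feasible \<equiv> (Sym_pos \<inter> SL) \<times> UNIV"

text \<open>
  If the matrices differ, their midpoint has determinant greater than 1 and can be scaled down to
  determinant 1, which makes the functional strictly smaller than at the midpoint, where by convexity it is
  at most the minimum. Otherwise only the translations differ.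
\<close>
lemma minimizer_unique:
  assumes r: "0 < r" "r < 1" and ab: "a \<in> feasible" "b \<in> feasible"
    and le: "\<And>q. q \<in> feasible \<Longrightarrow> m \<le> L_fun f g K r q"
    and La: "L_fun f g K r a = m" and Lb: "L_fun f g K r b = m" and m: "0 < m"
    and small: "norm (snd a) < r" "norm (snd b) < r"
  shows "a = b"
proof -
  define C u where "C = (1/2) *\<^sub>R (fst a + fst b)" and "u = (1/2) *\<^sub>R (snd a + snd b)"
  have mid: "(C, u) = (1 - 1/2) *\<^sub>R a + (1/2) *\<^sub>R b"
    by (simp add: prod_eq_iff C_def u_def scaleR_add_right)
  have "L_fun f g K r (C, u) \<le> (1 - 1/2) * L_fun f g K r a + 1/2 * L_fun f g K r b"
    unfolding mid by (rule convex_onD[OF L_convex[OF r]]) auto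
  then have Lc: "L_fun f g K r (C, u) \<le> m" by (simp add: La Lb)
  have A: "fst a \<in> Sym_pos" "det (fst a) = 1" and B: "fst b \<in> Sym_pos" "det (fst b) = 1"
    using ab by (auto simp: SL_def)
  have fst_eq: "fst a = fst b"
  proof (rule ccontr)
    assume ne: "fst a \<noteq> fst b"
    have detC: "1 < det C" unfolding C_def by (rule det_midpoint_gt_1[OF A B ne])
    define t where "t = inverse (root CARD('n) (det C))"
    have root: "1 < root CARD('n) (det C)" using detC by simp
    then have t: "0 < t" "t < 1" by (simp_all add: t_def inverse_less_1_iff)
    have "det (t *\<^sub>R C) = 1"
    proof -
      have "root CARD('n) (det C) ^ CARD('n) = det C" using detC by (intro real_root_pow_pos2) auto
      then show ?thesis using detC by (simp add: det_scaleR t_def power_inverse)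
    qed
    moreover have "C \<in> Sym_pos" unfolding C_def by (rule Sym_pos_midpoint[OF A(1) B(1)])
    ultimately have feas: "t *\<^sub>R (C, u) \<in> feasible" using Sym_pos_scale[of C t] t by (simp add: SL_def)
    have le': "L_fun f g K r (t *\<^sub>R (C, u)) \<le> L_fun f g K r (C, u)"
      using t by (intro L_scale_le r) auto
    have "0 < L_fun f g K r (C, u)" using le[OF feas] le' m by linarith
    then have "L_fun f g K r (t *\<^sub>R (C, u)) < L_fun f g K r (C, u)" by (rule L_scale_less[OF r t])
    then show False using le[OF feas] Lc by linarith
  qed
  have C_eq: "C = fst a" unfolding C_def fst_eq by (simp flip: scaleR_add_left scaleR_2)
  have a_eq: "a = (fst a, snd a)" and b_eq: "b = (fst a, snd b)" by (simp_all add: fst_eq[symmetric] prod_eq_iff)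
  have "(C, u) \<in> feasible" using ab by (simp add: C_eq mem_Times_iff)
  then have "m \<le> L_fun f g K r (C, u)" by (rule le)
  then have "m \<le> L_fun f g K r (fst a, (1/2) *\<^sub>R (snd a + snd b))" by (simp only: C_eq u_def)
  then have "snd a = snd b"
    using La Lb a_eq b_eq by (intro translation_unique[OF r _ _ _ m small]) simp_all
  then show ?thesis using fst_eq by (simp add: prod_eq_iff)
qed

text \<open>
  Determinant one forces the trace to be at least \<open>n\<close>, so the blown-up constraint set lies in the half
  space.
\<close>
lemma feasible_blow_up:
  assumes \<rho>: "0 < \<rho>" and Av: "(A, v) \<in> feasible"
  defines "p \<equiv> ((1/\<rho>) *\<^sub>R (A - mat 1), (1/\<rho>) *\<^sub>R v)"
  shows "p \<in> half_space" "(mat 1 + \<rho> *\<^sub>R fst p, \<rho> *\<^sub>R snd p) = (A, v)"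
proof -
  have A: "A \<in> Sym_pos" "det A = 1" using Av by (auto simp: SL_def)
  have "real CARD('n) \<le> trace A" by (rule trace_ge_of_det_ge_1(1)[OF A(1)]) (simp add: A(2))
  then show "p \<in> half_space"
    using \<rho> A(1) by (simp add: p_def half_space_def Sym_pos_def Sym_linear trace_mat_1)
  show "(mat 1 + \<rho> *\<^sub>R fst p, \<rho> *\<^sub>R snd p) = (A, v)" using \<rho> by (simp add: p_def)
qed

text \<open>
  The curve \<open>q\<close> of feasible points is tangent to \<open>p0\<close>, so by \<open>localisation\<close> every feasible point whose
  blow-up is far from \<open>p0\<close> is worse than \<open>q \<rho>\<close>. It remains to minimize over the compact set \<open>Z\<close> of
  blown-up feasible points in a ball around \<open>p0\<close>.
\<close>
lemma minimizer_near_contact_minimum: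
  assumes \<epsilon>: "0 < \<epsilon>"
  shows "\<exists>\<delta>>0. \<forall>\<rho>. 0 < \<rho> \<longrightarrow> \<rho> < \<delta> \<longrightarrow>
    (\<exists>p. dist p p0 \<le> \<epsilon> \<and> unique_min_on feasible (L_fun f g K (1 - \<rho>)) (mat 1 + \<rho> *\<^sub>R fst p, \<rho> *\<^sub>R snd p))"
proof -
  obtain \<delta>\<^sub>P where \<delta>P: "0 < \<delta>\<^sub>P" "\<And>\<rho> p. 0 < \<rho> \<Longrightarrow> \<rho> < \<delta>\<^sub>P \<Longrightarrow> dist p p0 < \<delta>\<^sub>P \<Longrightarrow> 0 < \<Lambda> \<rho> p"
    using positive_near_minimum by auto
  define \<eta> where "\<eta> = min \<epsilon> (\<delta>\<^sub>P / 2)"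
  have \<eta>: "0 < \<eta>" "\<eta> \<le> \<epsilon>" "\<eta> < \<delta>\<^sub>P" using \<epsilon> \<delta>P(1) by (auto simp: \<eta>_def)
  have M0': "M0 \<in> Sym_zero" using M0 by (simp add: Sym_zero_def)
  obtain A where A: "\<And>t. A t \<in> Sym_pos \<inter> SL" "((\<lambda>t. (1/t) *\<^sub>R (A t - mat 1)) \<longlongrightarrow> M0) (at 0)"
    using unimodular_curve[OF M0'] by blast
  define q where "q \<rho> = ((1/\<rho>) *\<^sub>R (A \<rho> - mat 1), w0)" for \<rho>
  have q_lim: "(q \<longlongrightarrow> p0) (at_right 0)"
    unfolding q_def by (intro tendsto_Pair tendsto_const tendsto_mono[OF at_le A(2)]) simp
  obtain \<delta>\<^sub>L where \<delta>L: "0 < \<delta>\<^sub>L" "\<And>\<rho> p. 0 < \<rho> \<Longrightarrow> \<rho> < \<delta>\<^sub>L \<Longrightarrow> p \<in> half_space \<Longrightarrow> \<eta> \<le> dist p p0 \<Longrightarrow> \<Lambda> \<rho> (q \<rho>) < \<Lambda> \<rho> p"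
    using localisation[OF q_lim \<eta>(1)] by auto
  obtain \<delta>\<^sub>q where \<delta>q: "0 < \<delta>\<^sub>q" "\<And>\<rho>. 0 < \<rho> \<Longrightarrow> \<rho> < \<delta>\<^sub>q \<Longrightarrow> dist (q \<rho>) p0 < \<eta>"
    using tendstoD[OF q_lim \<eta>(1)] unfolding eventually_at_right_field by (auto simp: field_simps)
  \<comment> \<open>\<open>B\<close> bounds both components in the ball; \<open>\<rho> B < 1/4\<close> makes \<open>Id + \<rho> M\<close> positive definite and the
    translations shorter than \<open>r\<close>.\<close>
  define B where "B = norm M0 + norm w0 + \<eta> + 1"
  have B: "1 \<le> B" using \<eta>(1) by (simp add: B_def)
  define \<delta> where "\<delta> = min (min \<delta>\<^sub>P \<delta>\<^sub>L) (min \<delta>\<^sub>q (1 / (4 * B)))"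
  have \<delta>: "0 < \<delta>" using \<delta>P(1) \<delta>L(1) \<delta>q(1) B by (simp add: \<delta>_def)
  have main: "\<exists>p. dist p p0 \<le> \<epsilon> \<and> unique_min_on feasible (L_fun f g K (1 - \<rho>)) (mat 1 + \<rho> *\<^sub>R fst p, \<rho> *\<^sub>R snd p)"
    if \<rho>0: "0 < \<rho>" and \<rho>\<delta>: "\<rho> < \<delta>" for \<rho>
  proof -
    have \<rho>P: "\<rho> < \<delta>\<^sub>P" and \<rho>L: "\<rho> < \<delta>\<^sub>L" and \<rho>q: "\<rho> < \<delta>\<^sub>q" and "\<rho> < 1 / (4 * B)" using \<rho>\<delta> by (simp_all add: \<delta>_def)
    then have \<rho>B: "\<rho> * B < 1/4" using B by (simp add: less_divide_eq field_simps)
    have "\<rho> * 1 \<le> \<rho> * B" using B \<rho>0 by (intro mult_left_mono) auto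
    then have \<rho>1: "\<rho> < 1/4" using \<rho>B by simp
    let ?r = "1 - \<rho>"
    have r: "0 < ?r" "?r < 1" using \<rho>0 \<rho>1 by auto
    let ?T = "\<lambda>p. (mat 1 + \<rho> *\<^sub>R fst p, \<rho> *\<^sub>R snd p) :: (real^'n^'n) \<times> (real^'n)"
    have near: "\<rho> * norm (fst p) < 1" "\<rho> * norm (snd p) < 1/4" if "dist p p0 \<le> \<eta>" for p
    proof -
      have "dist (fst p) (fst p0) \<le> \<eta>" "dist (snd p) (snd p0) \<le> \<eta>"
        using dist_fst_le[of p p0] dist_snd_le[of p p0] that by linarith+
      then have "norm (fst p - M0) \<le> \<eta>" "norm (snd p - w0) \<le> \<eta>" by (simp_all add: dist_norm)
      then have "norm (fst p) \<le> B" "norm (snd p) \<le> B"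
        using norm_triangle_sub[of "fst p" M0] norm_triangle_sub[of "snd p" w0] norm_ge_zero[of M0] norm_ge_zero[of w0]
        unfolding B_def by linarith+
      then have "\<rho> * norm (fst p) \<le> \<rho> * B" "\<rho> * norm (snd p) \<le> \<rho> * B" using \<rho>0 by (auto intro: mult_left_mono)
      then show "\<rho> * norm (fst p) < 1" "\<rho> * norm (snd p) < 1/4" using \<rho>B by linarith+
    qed
    define Z where "Z = cball p0 \<eta> \<inter> (fst -` (Sym \<inter> {M. det (mat 1 + \<rho> *\<^sub>R M) = 1}))"
    have "closed {M :: real^'n^'n. det (mat 1 + \<rho> *\<^sub>R M) = 1}"
      by (intro closed_Collect_eq continuous_on_compose2[OF continuous_on_det] continuous_intros) auto
    then have "compact Z"
      unfolding Z_def by (intro compact_Int_closed closed_vimage_fst closed_Int closed_Sym) auto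
    moreover have qZ: "q \<rho> \<in> Z"
    proof -
      have "A \<rho> \<in> Sym" "det (A \<rho>) = 1" using A(1)[of \<rho>] by (auto simp: Sym_pos_def SL_def)
      then show ?thesis using \<delta>q(2)[OF \<rho>0 \<rho>q] \<rho>0
        by (simp add: Z_def q_def Sym_linear dist_commute less_imp_le)
    qed
    moreover have "continuous_on Z (\<Lambda> \<rho>)"
      by (rule continuous_on_subset[OF convex_on_continuous[OF open_UNIV \<Lambda>_convex[OF \<rho>0]] subset_UNIV]) (use \<rho>1 in linarith)
    ultimately obtain p where p: "p \<in> Z" "\<And>z. z \<in> Z \<Longrightarrow> \<Lambda> \<rho> p \<le> \<Lambda> \<rho> z"
      using continuous_attains_inf[of Z "\<Lambda> \<rho>"] by blast
    have Z_feasible: "?T z \<in> feasible" if "z \<in> Z" for z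
    proof -
      have z: "dist z p0 \<le> \<eta>" "fst z \<in> Sym" "det (mat 1 + \<rho> *\<^sub>R fst z) = 1"
        using that by (simp_all add: Z_def dist_commute)
      have "mat 1 + \<rho> *\<^sub>R fst z \<in> Sym_pos"
        by (rule Sym_pos_near_identity[OF z(2) less_imp_le[OF \<rho>0] near(1)[OF z(1)]])
      then show ?thesis by (simp add: SL_def z(3))
    qed
    define b where "b a = ((1/\<rho>) *\<^sub>R (fst a - mat 1), (1/\<rho>) *\<^sub>R snd a)" for a :: "(real^'n^'n) \<times> (real^'n)"
    have b: "b a \<in> half_space" "?T (b a) = a" if "a \<in> feasible" for a
      using feasible_blow_up[OF \<rho>0, of "fst a" "snd a"] that by (simp_all add: b_def)
    have \<Lambda>b: "\<Lambda> \<rho> (b a) = L_fun f g K ?r a" if "a \<in> feasible" for a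
      unfolding \<Lambda>_def using b(2)[OF that] by simp
    have b_Z: "b a \<in> Z" if a: "a \<in> feasible" and "dist (b a) p0 < \<eta>" for a
    proof -
      have "mat 1 + \<rho> *\<^sub>R fst (b a) = fst a" using arg_cong[OF b(2)[OF a], of fst] by (simp only: fst_conv)
      moreover have "det (fst a) = 1" using a by (simp add: mem_Times_iff SL_def)
      moreover have "fst (b a) \<in> Sym" using b(1)[OF a] by (simp add: half_space_def)
      moreover have "b a \<in> cball p0 \<eta>" using that(2) by (simp add: dist_commute)
      ultimately show ?thesis by (simp only: Z_def Int_iff vimage_eq mem_Collect_eq)
    qed
    have far: "\<Lambda> \<rho> p < \<Lambda> \<rho> (b a)" if a: "a \<in> feasible" and d: "\<eta> \<le> dist (b a) p0" for a
      using \<delta>L(2)[OF \<rho>0 \<rho>L b(1)[OF a] d] p(2)[OF qZ] by linarith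
    have le: "\<Lambda> \<rho> p \<le> L_fun f g K ?r a" if a: "a \<in> feasible" for a
    proof (cases "\<eta> \<le> dist (b a) p0")
      case True
      then show ?thesis using far[OF a] \<Lambda>b[OF a] by linarith
    next
      case False
      then have "\<Lambda> \<rho> p \<le> \<Lambda> \<rho> (b a)" by (intro p(2) b_Z a) linarith
      then show ?thesis by (simp only: \<Lambda>b[OF a])
    qed
    have dp: "dist p p0 \<le> \<eta>" using p(1) by (simp add: Z_def dist_commute)
    have Tp: "?T p \<in> feasible" by (rule Z_feasible[OF p(1)])
    have Lp: "L_fun f g K ?r (?T p) = \<Lambda> \<rho> p" by (simp add: \<Lambda>_def)
    have "unique_min_on feasible (L_fun f g K ?r) (?T p)"
    proof (rule unique_min_onI)
      show "?T p \<in> feasible" by (rule Tp)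
      show "L_fun f g K ?r (?T p) \<le> L_fun f g K ?r a" if "a \<in> feasible" for a
        using le[OF that] by (simp only: Lp)
      fix a assume a: "a \<in> feasible" and La: "L_fun f g K ?r a \<le> L_fun f g K ?r (?T p)"
      have La': "L_fun f g K ?r a = \<Lambda> \<rho> p" using La le[OF a] by (simp only: Lp)
      have da: "dist (b a) p0 \<le> \<eta>" using far[OF a] La' \<Lambda>b[OF a] by linarith
      have "0 < \<Lambda> \<rho> p" using \<delta>P(2)[OF \<rho>0 \<rho>P] dp \<eta>(3) by simp
      moreover have "norm (snd a) < ?r"
      proof -
        have "\<rho> *\<^sub>R snd (b a) = snd a" using arg_cong[OF b(2)[OF a], of snd] by (simp only: snd_conv)
        then have "norm (snd a) = \<rho> * norm (snd (b a))" using \<rho>0 by (simp flip: \<open>\<rho> *\<^sub>R snd (b a) = snd a\<close>)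
        then show ?thesis using near(2)[OF da] \<rho>1 by linarith
      qed
      moreover have "norm (snd (?T p)) < ?r" using near(2)[OF dp] \<rho>0 \<rho>1 by simp
      ultimately show "a = ?T p" by (intro minimizer_unique[OF r a Tp le La' Lp])
    qed
    then show ?thesis using dp \<eta>(2) by (intro exI[of _ p]) simp
  qed
  show ?thesis using \<delta> main by blast
qed

lemma min_curve_quotient: "((\<lambda>\<rho>. (1/\<rho>) *\<^sub>R (min_curve f g K (1 - \<rho>) - (mat 1, 0))) \<longlongrightarrow> p0) (at_right 0)"
proof (rule tendstoI)
  fix e :: real assume "0 < e"
  then obtain \<delta> where \<delta>: "0 < \<delta>" and
    ex: "\<And>\<rho>. 0 < \<rho> \<Longrightarrow> \<rho> < \<delta> \<Longrightarrow> \<exists>p. dist p p0 \<le> e / 2 \<and>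
      unique_min_on feasible (L_fun f g K (1 - \<rho>)) (mat 1 + \<rho> *\<^sub>R fst p, \<rho> *\<^sub>R snd p)"
    using minimizer_near_contact_minimum[of "e / 2"] by auto
  have "dist ((1/\<rho>) *\<^sub>R (min_curve f g K (1 - \<rho>) - (mat 1, 0))) p0 < e" if \<rho>: "0 < \<rho>" "\<rho> < \<delta>" for \<rho>
  proof -
    obtain p where p: "dist p p0 \<le> e / 2"
      "unique_min_on feasible (L_fun f g K (1 - \<rho>)) (mat 1 + \<rho> *\<^sub>R fst p, \<rho> *\<^sub>R snd p)"
      using ex[OF \<rho>] by blast
    have "min_curve f g K (1 - \<rho>) = (mat 1 + \<rho> *\<^sub>R fst p, \<rho> *\<^sub>R snd p)"
      using \<rho>(1) unfolding min_curve_def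
      by (simp, intro the_equality p(2)) (rule unique_min_on_unique[OF _ p(2)])
    then have "(1/\<rho>) *\<^sub>R (min_curve f g K (1 - \<rho>) - (mat 1, 0)) = p"
      using \<rho>(1) by (simp add: prod_eq_iff)
    then show ?thesis using p(1) \<open>0 < e\<close> by simp
  qed
  then show "\<forall>\<^sub>F \<rho> in at_right 0. dist ((1/\<rho>) *\<^sub>R (min_curve f g K (1 - \<rho>) - (mat 1, 0))) p0 < e"
    using \<delta> unfolding eventually_at_right_field by (intro exI[of _ \<delta>]) auto
qed

theorem min_curve_derivative: "(min_curve f g K has_vector_derivative - (M0, w0)) (at 1 within {1/2<..1})"
proof -
  have q: "((\<lambda>r. (1 / (1 - r)) *\<^sub>R (min_curve f g K r - (mat 1, 0))) \<longlongrightarrow> p0) (at_left 1)"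
    using min_curve_quotient unfolding filterlim_at_left_to_right[of _ _ 1] filterlim_at_right_to_0[of _ _ "-1"]
    by simp
  have "at 1 within {1/2<..1} \<le> (at_left 1 :: real filter)"
    unfolding at_within_def by (intro inf_mono order_refl) (auto simp: principal_le_iff)
  then have q': "((\<lambda>r. (1 / (1 - r)) *\<^sub>R (min_curve f g K r - (mat 1, 0))) \<longlongrightarrow> p0) (at 1 within {1/2<..1})"
    using q by (rule tendsto_mono)
  have "((\<lambda>r. norm ((1 / (1 - r)) *\<^sub>R (min_curve f g K r - (mat 1, 0)) - p0)) \<longlongrightarrow> 0) (at 1 within {1/2<..1})"
    using q' by (intro tendsto_norm_zero LIM_zero)
  then have "((\<lambda>r. (1 / norm (r - 1)) *\<^sub>R (min_curve f g K r - (min_curve f g K 1 + (r - 1) *\<^sub>R - p0))) \<longlongrightarrow> 0) (at 1 within {1/2<..1})"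
  proof (rule tendsto_0_le[where K = 1], unfold eventually_at, intro exI[of _ 1] conjI ballI impI)
    fix r :: real assume r: "r \<in> {1/2<..1}" "r \<noteq> 1 \<and> dist r 1 < 1"
    then have r1: "r < 1" by auto
    have "(1 / norm (r - 1)) *\<^sub>R (min_curve f g K r - (min_curve f g K 1 + (r - 1) *\<^sub>R - p0))
        = (1 / (1 - r)) *\<^sub>R (min_curve f g K r - (mat 1, 0) - (1 - r) *\<^sub>R p0)"
      using r1 by (simp add: min_curve_def[of f g K 1] algebra_simps)
    also have "\<dots> = (1 / (1 - r)) *\<^sub>R (min_curve f g K r - (mat 1, 0)) - p0"
      using r1 by (simp add: scaleR_diff_right)
    finally show "norm ((1 / norm (r - 1)) *\<^sub>R (min_curve f g K r - (min_curve f g K 1 + (r - 1) *\<^sub>R - p0)))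
        \<le> norm (norm ((1 / (1 - r)) *\<^sub>R (min_curve f g K r - (mat 1, 0)) - p0)) * 1" by simp
  qed simp
  then show ?thesis
    unfolding has_vector_derivative_def has_derivative_within
    by (intro conjI bounded_linear_scaleR_left)
qed

end

section \<open>Weak convergence of the curve measures\<close>

context profile_data
begin

lemma countable_deriv_neq_right_slope: "countable {z. deriv f z \<noteq> k z}"
proof (rule countable_subset[OF _ mono_ctble_discont[OF right_slope_mono[OF cvx_f]]])
  show "{z. deriv f z \<noteq> k z} \<subseteq> {z. \<not> isCont k z}"
    using DERIV_imp_deriv[OF right_slope_deriv[OF cvx_f]] by auto
qed

lemma deriv_borel: "deriv f \<in> borel_measurable borel"
  by (rule measurable_discrete_difference[OF slope.k_borel countable_deriv_neq_right_slope]) auto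

text \<open>
  The derivative differs from the slope on a countable set, and the norm takes each single value on a
  sphere, which is a null set.
\<close>
lemma AE_rescale_deriv:
  assumes "r < 1"
  shows "AE x :: real^'n in lborel. rescale r (deriv f) (norm x) = rescale r k (norm x)"
proof -
  let ?C = "{z. deriv f z \<noteq> k z}"
  have "AE x :: real^'n in lborel. \<forall>z\<in>?C. (norm x - 1) / (1 - r) \<noteq> z"
  proof (rule AE_ball_countable'[OF _ countable_deriv_neq_right_slope])
    fix z
    have "sphere (0 :: real^'n) (1 + z * (1 - r)) \<in> null_sets lborel"
      using negligible_sphere[of "0 :: real^'n" "1 + z * (1 - r)"]
      by (simp add: negligible_iff_null_sets null_sets_completion_iff borel_closed)
    then have "AE x :: real^'n in lborel. x \<notin> sphere 0 (1 + z * (1 - r))" by (rule AE_not_in)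
    then show "AE x :: real^'n in lborel. (norm x - 1) / (1 - r) \<noteq> z"
      by eventually_elim (use assms in \<open>auto simp: divide_eq_eq\<close>)
  qed
  then show ?thesis by eventually_elim (auto simp: rescale_def)
qed

end

lemma det_at_identity_limit:
  assumes "(A \<longlongrightarrow> (mat 1 :: real^'n^'n)) F"
  shows "((\<lambda>x. det (A x)) \<longlongrightarrow> 1) F"
proof -
  have "continuous_on UNIV (det :: real^'n^'n \<Rightarrow> real)"
    unfolding det_def by (intro continuous_intros)
  from continuous_on_tendsto_compose[OF this assms] show ?thesis by simp
qed

context contact_minimum
begin

text \<open>
  Replacing the derivative by the monotone slope changes the density on a null set only, and makes it
  measurable and non-negative everywhere.
\<close>
lemma curve_measure_eq:
  assumes r: "r < 1"
  defines "D \<equiv> \<lambda>A v x. 1 / (1 - r) * (rescale r k (norm x) / norm x) * rescale r g (N (matrix_inv A *v (x - v)))"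
  shows "curve_measure f g K r A v = density lborel (\<lambda>x. ennreal (D A v x))"
    and "D A v \<in> borel_measurable borel" and "0 \<le> D A v x"
proof -
  have norm_m: "(\<lambda>x :: real^'n. (norm x - 1) / (1 - r)) \<in> borel_measurable borel"
    by (intro borel_measurable_divide borel_measurable_diff borel_measurable_norm) auto
  have "(\<lambda>x. matrix_inv A *v (x - v)) \<in> borel_measurable borel"
    by (intro borel_measurable_continuous_onI continuous_on_compose2[OF linear_continuous_on[of "\<lambda>x. matrix_inv A *v x" UNIV]] continuous_intros)
       (auto simp: linear_conv_bounded_linear[symmetric])
  then have "(\<lambda>x. N (matrix_inv A *v (x - v))) \<in> borel_measurable borel"
    by (rule measurable_compose[OF _ gauge_borel])
  then have "(\<lambda>x. (N (matrix_inv A *v (x - v)) - 1) / (1 - r)) \<in> borel_measurable borel"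
    by (intro borel_measurable_divide borel_measurable_diff) auto
  then have gm: "(\<lambda>x. rescale r g (N (matrix_inv A *v (x - v)))) \<in> borel_measurable borel"
    unfolding rescale_def by (rule measurable_compose[OF _ g_borel])
  have km: "(\<lambda>x :: real^'n. rescale r k (norm x)) \<in> borel_measurable borel"
    unfolding rescale_def by (rule measurable_compose[OF norm_m slope.k_borel])
  have dm: "(\<lambda>x :: real^'n. rescale r (deriv f) (norm x)) \<in> borel_measurable borel"
    unfolding rescale_def by (rule measurable_compose[OF norm_m deriv_borel])
  have m: "(\<lambda>x :: real^'n. 1 / (1 - r) * (h x / norm x) * rescale r g (N (matrix_inv A *v (x - v)))) \<in> borel_measurable borel"
    if "h \<in> borel_measurable borel" for h
    by (intro borel_measurable_times borel_measurable_divide that gm borel_measurable_norm) auto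
  show "D A v \<in> borel_measurable borel" unfolding D_def by (rule m[OF km])
  show "0 \<le> D A v x"
    unfolding D_def rescale_def using r slope.k_nonneg g_01 by (intro mult_nonneg_nonneg divide_nonneg_nonneg) auto
  show "curve_measure f g K r A v = density lborel (\<lambda>x. ennreal (D A v x))"
    unfolding curve_measure_def
  proof (rule density_cong)
    show "AE x in lborel. ennreal (1 / (1 - r) * (rescale r (deriv f) (norm x) / norm x) * rescale r g (N (matrix_inv A *v (x - v)))) = ennreal (D A v x)"
      using AE_rescale_deriv[OF r] by eventually_elim (simp add: D_def)
    show "(\<lambda>x. ennreal (1 / (1 - r) * (rescale r (deriv f) (norm x) / norm x) * rescale r g (N (matrix_inv A *v (x - v))))) \<in> borel_measurable lborel"
      using m[OF dm] by simp
    show "(\<lambda>x. ennreal (D A v x)) \<in> borel_measurable lborel" unfolding D_def using m[OF km] by simp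
  qed
qed

lemma limit_measure_integral:
  assumes \<phi>: "\<phi> \<in> borel_measurable borel"
  shows "(\<integral>\<xi>. \<phi> \<xi> \<partial>limit_measure f g K M w) = (\<integral>\<xi>. indicator (frontier K) \<xi> * \<phi> \<xi> * slope.conv (\<xi> \<bullet> (M *v \<xi> + w)) \<partial>sphere_measure)"
    and "integrable (limit_measure f g K M w) \<phi> \<longleftrightarrow> integrable sphere_measure (\<lambda>\<xi>. indicator (frontier K) \<xi> * \<phi> \<xi> * slope.conv (\<xi> \<bullet> (M *v \<xi> + w)))"
proof -
  let ?h = "\<lambda>\<xi> :: real^'n. slope.conv (\<xi> \<bullet> (M *v \<xi> + w))"
  have hm: "?h \<in> borel_measurable borel" by (rule measurable_compose[OF borel_measurable_quadratic slope.conv_borel])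
  have hm': "?h \<in> borel_measurable (contact_measure K)" and \<phi>m: "\<phi> \<in> borel_measurable (contact_measure K)"
    using hm \<phi> by (simp_all cong: measurable_cong_sets)
  have lm: "limit_measure f g K M w = density (contact_measure K) (\<lambda>\<xi>. ennreal (?h \<xi>))"
    by (simp add: limit_measure_def deriv_F)
  have prod_m: "(\<lambda>\<xi>. ?h \<xi> * \<phi> \<xi>) \<in> borel_measurable borel" by (rule borel_measurable_times[OF hm \<phi>])
  have nn: "AE \<xi> in contact_measure K. 0 \<le> ?h \<xi>" by (rule AE_I2) (rule slope.conv_nonneg)
  show "(\<integral>\<xi>. \<phi> \<xi> \<partial>limit_measure f g K M w) = (\<integral>\<xi>. indicator (frontier K) \<xi> * \<phi> \<xi> * ?h \<xi> \<partial>sphere_measure)"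
    unfolding lm integral_density[OF \<phi>m hm' nn] using integral_contact_measure[OF prod_m, of K] by (simp add: mult_ac)
  show "integrable (limit_measure f g K M w) \<phi> \<longleftrightarrow> integrable sphere_measure (\<lambda>\<xi>. indicator (frontier K) \<xi> * \<phi> \<xi> * ?h \<xi>)"
    unfolding lm integrable_density[OF \<phi>m hm' nn] using integrable_contact_measure[OF prod_m, of K] by (simp add: mult_ac)
qed

context
  fixes \<phi> :: "real^'n \<Rightarrow> real"
  assumes \<phi>: "continuous_on UNIV \<phi>"
begin

text \<open>
  The factor \<open>1 / norm\<close> of the density belongs to the weight. Cutting it off below \<open>1/2\<close> makes the weight
  continuous and is harmless, since the slope vanishes at such points when \<open>r \<ge> 1/2\<close>.
\<close>
definition radial_weight :: "real^'n \<Rightarrow> real" where "radial_weight y = \<phi> y / max (norm y) (1/2)"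

lemma shell_limit_radial_weight: "shell_limit K k g radial_weight"
proof (unfold_locales)
  show "continuous_on UNIV radial_weight"
    unfolding radial_weight_def by (intro continuous_intros \<phi>) auto
qed

interpretation weighted: shell_limit K k g radial_weight by (rule shell_limit_radial_weight)

lemma \<phi>_borel: "\<phi> \<in> borel_measurable borel"
  by (rule borel_measurable_continuous_onI[OF \<phi>])

text \<open>
  The substitution \<open>x = A y + v\<close> produces the integrand of the limit theorem; its Jacobian \<open>det A\<close> tends
  to 1 along the curve.
\<close>
lemma curve_measure_integral:
  fixes A :: "real^'n^'n" and v :: "real^'n"
  assumes r: "1/2 \<le> r" "r < 1" and A: "A \<in> Sym_pos"
  defines "M \<equiv> (1 / (1 - r)) *\<^sub>R (A - mat 1)" and "V \<equiv> (1 / (1 - r)) *\<^sub>R v"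
  shows "(\<integral>x. \<phi> x \<partial>curve_measure f g K r A v) = det A * (\<integral>x. weighted.integrand (1 - r) M V x \<partial>lborel)"
    and "integrable (curve_measure f g K r A v) \<phi> \<longleftrightarrow> integrable lborel (weighted.integrand (1 - r) M V)"
proof -
  let ?D = "\<lambda>x. 1 / (1 - r) * (rescale r k (norm x) / norm x) * rescale r g (N (matrix_inv A *v (x - v)))"
  note cm = curve_measure_eq[OF r(2), where A = A and v = v]
  have Dm: "?D \<in> borel_measurable lborel" using cm(2) by simp
  have \<phi>m: "\<phi> \<in> borel_measurable lborel" using \<phi>_borel by simp
  have nn: "AE x in lborel. 0 \<le> ?D x" by (rule AE_I2) (rule cm(3))
  have hm: "(\<lambda>x. ?D x *\<^sub>R \<phi> x) \<in> borel_measurable borel"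
    by (intro borel_measurable_scaleR cm(2) \<phi>_borel)
  have "invertible A" using Sym_pos_det_pos[OF A] by (simp add: invertible_det_nz)
  then have "\<exists>A'. A ** A' = mat 1 \<and> A' ** A = mat 1" by (simp only: invertible_def)
  from someI_ex[OF this] have inv: "matrix_inv A ** A = mat 1" unfolding matrix_inv_def by (rule conjunct2)
  have eq: "?D (A *v x + v) *\<^sub>R \<phi> (A *v x + v) = weighted.integrand (1 - r) M V x" for x
  proof -
    let ?y = "A *v x + v"
    have y: "(mat 1 + (1 - r) *\<^sub>R M) *v x + (1 - r) *\<^sub>R V = ?y" using r by (simp add: M_def V_def)
    have x: "matrix_inv A *v (?y - v) = x" by (simp add: matrix_vector_mul_assoc inv)
    have weight: "k ((norm ?y - 1) / (1 - r)) / norm ?y * \<phi> ?y = k ((norm ?y - 1) / (1 - r)) * radial_weight ?y"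
    proof (cases "k ((norm ?y - 1) / (1 - r)) = 0")
      case False
      then have "-1 \<le> (norm ?y - 1) / (1 - r)" using right_slope_zero by force
      then have "1/2 \<le> norm ?y" using r by (simp add: le_divide_eq)
      then show ?thesis by (simp add: radial_weight_def max_def)
    qed simp
    have "?D ?y *\<^sub>R \<phi> ?y = 1 / (1 - r) * (k ((norm ?y - 1) / (1 - r)) / norm ?y * \<phi> ?y * g ((N x - 1) / (1 - r)))"
      unfolding x by (simp add: rescale_def)
    also have "\<dots> = weighted.integrand (1 - r) M V x"
      unfolding weight weighted.integrand_def Let_def y by simp
    finally show ?thesis .
  qed
  show "(\<integral>x. \<phi> x \<partial>curve_measure f g K r A v) = det A * (\<integral>x. weighted.integrand (1 - r) M V x \<partial>lborel)"
    unfolding cm(1) integral_density[OF \<phi>m Dm nn] integral_lborel_Sym_pos[OF A hm, of v] eq ..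
  show "integrable (curve_measure f g K r A v) \<phi> \<longleftrightarrow> integrable lborel (weighted.integrand (1 - r) M V)"
    unfolding cm(1) integrable_density[OF \<phi>m Dm nn] integrable_lborel_Sym_pos[OF A hm, of v] eq ..
qed

lemma weighted_limit:
  shows "(\<integral>\<xi>. \<phi> \<xi> \<partial>limit_measure f g K M w) = (\<integral>p. weighted.limit_integrand M w p \<partial>(sphere_measure \<Otimes>\<^sub>M lborel))"
    and "integrable (limit_measure f g K M w) \<phi>"
proof -
  have int: "integrable (sphere_measure \<Otimes>\<^sub>M lborel) (weighted.limit_integrand M w)"
    by (rule weighted.shell_limit_sequence(1)[OF _ LIMSEQ_inverse_real_of_nat tendsto_const tendsto_const]) simp
  have C: "indicator (frontier K) \<in> borel_measurable (borel :: (real^'n) measure)"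
    by (intro borel_measurable_indicator) (simp add: borel_closed)
  have Fm: "(\<lambda>\<xi> :: real^'n. slope.conv (\<xi> \<bullet> (M *v \<xi> + w))) \<in> borel_measurable borel"
    by (rule measurable_compose[OF borel_measurable_quadratic slope.conv_borel])
  have m: "(\<lambda>\<xi> :: real^'n. indicator (frontier K) \<xi> * h \<xi> * slope.conv (\<xi> \<bullet> (M *v \<xi> + w))) \<in> borel_measurable sphere_measure"
    if "h \<in> borel_measurable borel" for h
    unfolding measurable_cong_sets[OF sets_sphere_measure refl] by (intro borel_measurable_times C Fm that)
  have ae: "AE \<xi> in sphere_measure. indicator (frontier K) \<xi> * \<phi> \<xi> * slope.conv (\<xi> \<bullet> (M *v \<xi> + w))
      = indicator (frontier K) \<xi> * radial_weight \<xi> * slope.conv (\<xi> \<bullet> (M *v \<xi> + w))"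
    using AE_sphere_measure by eventually_elim (simp add: radial_weight_def)
  note wm = weighted.\<psi>_borel
  show "(\<integral>\<xi>. \<phi> \<xi> \<partial>limit_measure f g K M w) = (\<integral>p. weighted.limit_integrand M w p \<partial>(sphere_measure \<Otimes>\<^sub>M lborel))"
    unfolding limit_measure_integral(1)[OF \<phi>_borel] weighted.integral_limit_integrand[OF int]
    by (rule integral_cong_AE[OF m[OF \<phi>_borel] m[OF wm] ae])
  show "integrable (limit_measure f g K M w) \<phi>"
    unfolding limit_measure_integral(2)[OF \<phi>_borel] integrable_cong_AE[OF m[OF \<phi>_borel] m[OF wm] ae]
    by (rule weighted.integrable_limit_section[OF int])
qed

text \<open>
  Along a sequence \<open>r\<close> tending to 1 from the left this is the limit theorem for the slope with the radial
  weight.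
\<close>
lemma curve_measure_limit:
  assumes pos: "\<forall>\<^sub>F r in at_left 1. A r \<in> Sym_pos"
    and lim: "((\<lambda>r. (1 / (1 - r)) *\<^sub>R ((A r, v r) - (mat 1, 0))) \<longlongrightarrow> p0) (at_left 1)"
  shows "\<forall>\<^sub>F r in at_left 1. integrable (curve_measure f g K r (A r) (v r)) \<phi>"
    and "((\<lambda>r. \<integral>x. \<phi> x \<partial>curve_measure f g K r (A r) (v r)) \<longlongrightarrow> (\<integral>x. \<phi> x \<partial>limit_measure f g K M0 w0)) (at_left 1)"
proof -
  have seq: "(\<forall>\<^sub>F j in sequentially. integrable (curve_measure f g K (X j) (A (X j)) (v (X j))) \<phi>) \<and>
      (\<lambda>j. \<integral>x. \<phi> x \<partial>curve_measure f g K (X j) (A (X j)) (v (X j))) \<longlonglongrightarrow> (\<integral>x. \<phi> x \<partial>limit_measure f g K M0 w0)"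
    if X: "\<And>j. X j < 1" "X \<longlonglongrightarrow> 1" for X
  proof -
    have X': "filterlim X (at_left 1) sequentially"
    proof -
      have "X j \<in> {..<1} \<and> X j \<noteq> 1" for j using X(1)[of j] by simp
      then show ?thesis unfolding filterlim_at using X(2) by simp
    qed
    define M V where "M j = (1 / (1 - X j)) *\<^sub>R (A (X j) - mat 1)" and "V j = (1 / (1 - X j)) *\<^sub>R v (X j)" for j
    have "(\<lambda>j. (M j, V j)) \<longlonglongrightarrow> p0"
      using filterlim_compose[OF lim X'] by (simp add: M_def V_def)
    then have M: "M \<longlonglongrightarrow> M0" and V: "V \<longlonglongrightarrow> w0"
      using tendsto_fst[of "\<lambda>j. (M j, V j)" p0] tendsto_snd[of "\<lambda>j. (M j, V j)" p0] by simp_all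
    have \<rho>: "(\<lambda>j. 1 - X j) \<longlonglongrightarrow> 0" using tendsto_diff[OF tendsto_const X(2), of 1] by simp
    have \<rho>0: "0 < 1 - X j" for j using X(1)[of j] by simp
    note lims = weighted.shell_limit_sequence[OF \<rho>0 \<rho> M V]
    have "(\<lambda>j. mat 1 + (1 - X j) *\<^sub>R M j) \<longlonglongrightarrow> mat 1 + 0 *\<^sub>R M0" by (intro tendsto_intros \<rho> M)
    moreover have "mat 1 + (1 - X j) *\<^sub>R M j = A (X j)" for j using \<rho>0[of j] by (simp add: M_def)
    ultimately have "(\<lambda>j. A (X j)) \<longlonglongrightarrow> mat 1" by simp
    then have det: "(\<lambda>j. det (A (X j))) \<longlonglongrightarrow> 1" by (rule det_at_identity_limit)
    have half: "\<forall>\<^sub>F j in sequentially. 1/2 < X j" by (rule order_tendstoD(1)[OF X(2)]) simp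
    have posX: "\<forall>\<^sub>F j in sequentially. A (X j) \<in> Sym_pos" by (rule eventually_compose_filterlim[OF pos X'])
    have "\<forall>\<^sub>F j in sequentially. integrable (curve_measure f g K (X j) (A (X j)) (v (X j))) \<phi>"
      using half posX lims(2)
    proof eventually_elim
      case (elim j)
      then show ?case using curve_measure_integral(2)[of "X j" "A (X j)" "v (X j)"] X(1)[of j] by (simp add: M_def V_def)
    qed
    moreover have "\<forall>\<^sub>F j in sequentially. det (A (X j)) * (\<integral>x. weighted.integrand (1 - X j) (M j) (V j) x \<partial>lborel)
        = (\<integral>x. \<phi> x \<partial>curve_measure f g K (X j) (A (X j)) (v (X j)))"
      using half posX
    proof eventually_elim
      case (elim j)
      then show ?case using curve_measure_integral(1)[of "X j" "A (X j)" "v (X j)"] X(1)[of j] by (simp add: M_def V_def)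
    qed
    then have "(\<lambda>j. \<integral>x. \<phi> x \<partial>curve_measure f g K (X j) (A (X j)) (v (X j))) \<longlonglongrightarrow>
        1 * (\<integral>p. weighted.limit_integrand M0 w0 p \<partial>(sphere_measure \<Otimes>\<^sub>M lborel))"
      by (rule Lim_transform_eventually[OF tendsto_mult[OF det lims(3)]])
    ultimately show ?thesis by (simp add: weighted_limit(1))
  qed
  show "\<forall>\<^sub>F r in at_left 1. integrable (curve_measure f g K r (A r) (v r)) \<phi>"
  proof (rule sequentially_imp_eventually_within, intro allI impI)
    fix X :: "nat \<Rightarrow> real" assume "(\<forall>n. X n \<in> {..<1} \<and> X n \<noteq> 1) \<and> X \<longlonglongrightarrow> 1"
    then show "\<forall>\<^sub>F n in sequentially. integrable (curve_measure f g K (X n) (A (X n)) (v (X n))) \<phi>"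
      by (intro conjunct1[OF seq]) simp_all
  qed
  show "((\<lambda>r. \<integral>x. \<phi> x \<partial>curve_measure f g K r (A r) (v r)) \<longlongrightarrow> (\<integral>x. \<phi> x \<partial>limit_measure f g K M0 w0)) (at_left 1)"
    unfolding tendsto_at_iff_sequentially comp_def
  proof (intro allI impI)
    fix X :: "nat \<Rightarrow> real" assume "\<forall>i. X i \<in> {..<1} - {1}" "X \<longlonglongrightarrow> 1"
    then show "(\<lambda>j. \<integral>x. \<phi> x \<partial>curve_measure f g K (X j) (A (X j)) (v (X j))) \<longlonglongrightarrow> (\<integral>x. \<phi> x \<partial>limit_measure f g K M0 w0)"
      by (intro conjunct2[OF seq]) simp_all
  qed
qed

end

text \<open>
  The expansion of the curve to first order says that the blown-up curve converges to \<open>p0\<close>.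
\<close>
theorem curve_measure_weakly_converges:
  assumes pos: "\<forall>\<^sub>F r in at_left 1. A r \<in> Sym_pos"
    and o: "(\<lambda>r. norm ((A r, v r) - ((mat 1, 0) + (1 - r) *\<^sub>R p0))) \<in> o[at_left 1](\<lambda>r. 1 - r)"
  shows "weakly_converges (\<lambda>r. curve_measure f g K r (A r) (v r)) (limit_measure f g K M0 w0) (at_left 1)"
proof -
  have "((\<lambda>r. norm ((1 / (1 - r)) *\<^sub>R ((A r, v r) - (mat 1, 0)) - p0)) \<longlongrightarrow> 0) (at_left 1)"
  proof (rule Lim_transform_eventually[OF smalloD_tendsto[OF o]])
    have "norm ((A r, v r) - ((mat 1, 0) + (1 - r) *\<^sub>R p0)) / (1 - r)
        = norm ((1 / (1 - r)) *\<^sub>R ((A r, v r) - (mat 1, 0)) - p0)" if "r < 1" for r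
    proof -
      have "(1 / (1 - r)) *\<^sub>R ((A r, v r) - (mat 1, 0)) - p0 = (1 / (1 - r)) *\<^sub>R ((A r, v r) - (mat 1, 0) - (1 - r) *\<^sub>R p0)"
        using that by (simp add: scaleR_diff_right del: diff_Pair scaleR_Pair)
      also have "\<dots> = (1 / (1 - r)) *\<^sub>R ((A r, v r) - ((mat 1, 0) + (1 - r) *\<^sub>R p0))" by (simp only: diff_diff_eq)
      finally show ?thesis using that by (simp only: norm_scaleR) (simp del: diff_Pair scaleR_Pair add_Pair)
    qed
    then show "\<forall>\<^sub>F r in at_left 1. norm ((A r, v r) - ((mat 1, 0) + (1 - r) *\<^sub>R p0)) / (1 - r)
        = norm ((1 / (1 - r)) *\<^sub>R ((A r, v r) - (mat 1, 0)) - p0)"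
      by (intro eventually_at_leftI[of 0]) auto
  qed
  then have lim: "((\<lambda>r. (1 / (1 - r)) *\<^sub>R ((A r, v r) - (mat 1, 0))) \<longlongrightarrow> p0) (at_left 1)"
    by (rule LIM_zero_cancel[OF tendsto_norm_zero_cancel])
  show ?thesis
    unfolding weakly_converges_def
    using curve_measure_limit[OF _ pos lim] weighted_limit(2) by blast
qed

lemma linear_curve_Sym_pos: "\<forall>\<^sub>F r in at_left 1. mat 1 + (1 - r) *\<^sub>R M0 \<in> Sym_pos"
proof -
  have "((\<lambda>r. (1 - r) * norm M0) \<longlongrightarrow> (1 - 1) * norm M0) (at_left 1)" by (intro tendsto_intros)
  then have "\<forall>\<^sub>F r in at_left 1. (1 - r) * norm M0 < 1" by (rule order_tendstoD(2)) simp
  moreover have "\<forall>\<^sub>F r in at_left (1 :: real). r < 1" by (simp add: eventually_at_filter)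
  ultimately show ?thesis
    by eventually_elim (intro Sym_pos_near_identity[OF M0(1)], auto)
qed

end

section \<open>The derivative of the minimizers and the limit measure\<close>

theorem theorem9:
  fixes K :: "(real^'n) set"
    and f g :: "real \<Rightarrow> real"
    and M0 :: "real^'n^'n" and w0 :: "real^'n"
  assumes "convex_body K" and "loewner_position K"
    and "locally_lipschitz f" and "convex_on UNIV f"
    and "\<forall>x\<le>-1. f x = 0" and "strict_mono_on {-1..} f"
    and "locally_lipschitz g" and "antimono g"
    and "\<forall>x\<le>-1. g x = 1" and "\<forall>x\<in>{-1<..<1}. 0 < g x" and "\<forall>x\<ge>1. g x = 0"
    and "unique_min_on (Sym_zero \<times> UNIV) (I_one f g K) (M0, w0)"
  shows "(min_curve f g K has_vector_derivative - (M0, w0)) (at 1 within {1/2<..1}) \<and>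
    (\<forall>(Abar :: real \<Rightarrow> real^'n^'n) (vbar :: real \<Rightarrow> real^'n).
       (\<forall>\<^sub>F r in at_left 1. Abar r \<in> Sym_pos) \<and>
       (\<lambda>r. norm ((Abar r, vbar r) - ((mat 1, 0) + (1 - r) *\<^sub>R (M0, w0)))) \<in> o[at_left 1](\<lambda>r. 1 - r)
       \<longrightarrow> weakly_converges (\<lambda>r. curve_measure f g K r (Abar r) (vbar r))
             (limit_measure f g K M0 w0) (at_left 1)) \<and>
    weakly_converges (\<lambda>r. curve_measure f g K r (mat 1 + (1 - r) *\<^sub>R M0) ((1 - r) *\<^sub>R w0))
      (limit_measure f g K M0 w0) (at_left 1)"
proof -
  have body: "compact K" "convex K" "interior K \<noteq> {}" and ball: "K \<subseteq> cball 0 1"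
    using assms(1,2) by (simp_all add: convex_body_def loewner_position_def)
  interpret P: profile_data f g
  proof unfold_locales
    show "locally_lipschitz f" "convex_on UNIV f" "strict_mono_on {-1..} f" "locally_lipschitz g" "antimono g"
      by fact+
    show "x \<le> -1 \<Longrightarrow> f x = 0" "x \<le> -1 \<Longrightarrow> g x = 1" "-1 < x \<Longrightarrow> x < 1 \<Longrightarrow> 0 < g x" "1 \<le> x \<Longrightarrow> g x = 0" for x
      using assms(5,9,10,11) by simp_all
  qed
  interpret contact_minimum K f g M0 w0
    by unfold_locales (fact body ball P.zero_in_interior[OF body assms(12)] assms(12))+
  have "weakly_converges (\<lambda>r. curve_measure f g K r (mat 1 + (1 - r) *\<^sub>R M0) ((1 - r) *\<^sub>R w0))
      (limit_measure f g K M0 w0) (at_left 1)"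
    by (rule curve_measure_weakly_converges[OF linear_curve_Sym_pos]) simp
  then show ?thesis
    using min_curve_derivative curve_measure_weakly_converges by blast
qed

end
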